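(* Let $g$ be an asymptotically flat four-dimensional metric in the sense of Newman and Unti, with conformal factor $e^{2\tilde\varphi}$. For $i=1,2$ let $(Y_i,\tilde T_i,\tilde\omega_i)$ be a triple consisting of a conformal Killing vector $Y_i=Y_i^A\partial_A$ (i.e. $Y_i^\zeta=Y_i(\zeta)$, $Y_i^{\bar\zeta}=\bar Y_i(\bar\zeta)$), a function $\tilde T_i=\tilde T_i(\zeta,\bar\zeta)$ and an arbitrary function $\tilde\omega_i=\tilde\omega_i(u,\zeta,\bar\zeta)$. Let $\xi[Y_i,\tilde T_i,\tilde\omega_i;g]$ be the associated metric-dependent spacetime vector fields, and let $[\cdot,\cdot]_M$ be the modified Lie bracket (all defined in the context). Then the spacetime vectors realize the extended $\mathfrak{bms}_4$ algebra in the modified Lie bracket everywhere in the bulk (i.e. exactly in $r$, not only asymptotically): $$\Big[\xi[Y_1,\tilde T_1,\tilde\omega_1;g],\ \xi[Y_2,\tilde T_2,\tilde\omega_2;g]\Big]_M=\xi[\hat Y,\hat{\tilde T},\hat{\tilde\omega};g],$$ where $$\hat Y^A=Y_1^B\partial_BY_2^A-Y_2^B\partial_BY_1^A,$$ $$\hat{\tilde T}=Y_1^A\partial_A\tilde T_2-Y_2^A\partial_A\tilde T_1+\tfrac12\big(\tilde T_1\,\partial_AY_2^A-\tilde T_2\,\partial_AY_1^A\big),$$ $$\hat{\tilde\omega}=0 .$$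
   Context: **Coordinates and conventions.** Spacetime coordinates are $(u,r,x^A)$ with $x^A=(\zeta,\bar\zeta)$ complex conjugate (stereographic) coordinates, $A,B\in\{\zeta,\bar\zeta\}$; one works locally in $\zeta$, on a $u$-interval containing $0$, and for $r$ sufficiently large. Write $\partial=\partial_\zeta$, $\bar\partial=\partial_{\bar\zeta}$. Repeated indices are summed. All functions are smooth, and the stated asymptotic expansions as $r\to\infty$ (at fixed $u,\zeta,\bar\zeta$) may be differentiated term by term, the order of the remainders being preserved under $\partial_u,\partial_A$ and lowered by one power of $r$ under $\partial_r$. **Asymptotically flat metrics in the sense of Newman and Unti.** These are metrics of the form $$ds^2=W\,du^2-2\,dr\,du+g_{AB}(dx^A-V^Adu)(dx^B-V^Bdu),$$ equivalently with inverse metric components $g^{uu}=0$, $g^{ur}=-1$, $g^{uA}=0$, $g^{rr}=-W$, $g^{rA}=-V^A$, and $g^{AB}$ the inverse of $g_{AB}$, satisfying as $r\to\infty$ $$g_{AB}=r^2\bar\gamma_{AB}+rC_{AB}+o(r),\qquad \bar\gamma^{AB}C_{AB}=0,$$ $$V^A=O(r^{-2}),\qquad W=-2r\,\partial_u\tilde\varphi+\bar\Delta\tilde\varphi+O(r^{-1}),$$ where $\bar\gamma_{AB}dx^Adx^B=e^{2\tilde\varphi}d\zeta d\bar\zeta$ with $\tilde\varphi=\tilde\varphi(u,\zeta,\bar\zeta)$ a real function, and $C_{AB}=C_{AB}(u,\zeta,\bar\zeta)$. Here $\bar D_A$ and $\bar\Delta=4e^{-2\tilde\varphi}\partial\bar\partial$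 are the covariant derivative and the Laplacian of $\bar\gamma_{AB}$. **The vector fields $\xi[Y,\tilde T,\tilde\omega;g]$.** Let $Y^A$ be a conformal Killing vector of $\bar\gamma_{AB}$ independent of $u$ and $r$, i.e. $Y^\zeta=Y(\zeta)$ is holomorphic and $Y^{\bar\zeta}=\bar Y(\bar\zeta)$ is its complex conjugate (only local definedness is required). Let $\tilde T=\tilde T(\zeta,\bar\zeta)$ and $\tilde\omega=\tilde\omega(u,\zeta,\bar\zeta)$ be arbitrary. Set $$\psi=\bar D_AY^A=\partial Y+\bar\partial\bar Y+2Y\partial\tilde\varphi+2\bar Y\bar\partial\tilde\varphi,\qquad \tilde\psi=\psi-2\tilde\omega,$$ $$f=e^{\tilde\varphi}\Big[\tilde T+\tfrac12\int_0^u du'\,e^{-\tilde\varphi}\tilde\psi\Big]$$ (so that $\partial_uf=f\partial_u\tilde\varphi+\tfrac12\tilde\psi$ and $f|_{u=0}=e^{\tilde\varphi}|_{u=0}\tilde T$). Then $\xi=\xi[Y,\tilde T,\tilde\omega;g]$ is the vector field with components $$\xi^u=f,\qquad \xi^A=Y^A-\partial_Bf\int_r^\infty dr'\,g^{AB},\qquad \xi^r=-r\,\partial_uf+\tfrac12\bar\Delta f+\partial_Af\int_r^\infty dr'\,V^A .$$ These are infinitesimal transformations preserving the class of asymptotically flat metrics in the sense of Newman and Unti, up to the change $\delta\tilde\varphi=\tilde\omega$ of the conformal factor: $\mathcal L_\xi g^{uu}=\mathcal L_\xi g^{uA}=\mathcal L_\xi g^{ur}=0$ and $\mathcal L_\xi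 g^{AB}=-2\tilde\omega g^{AB}+O(r^{-3})$, together with the corresponding conditions on the remaining components. **Modified Lie bracket.** For metric-dependent vector fields $\xi_1,\xi_2$, $$[\xi_1,\xi_2]_M=[\xi_1,\xi_2]-\delta^g_{\xi_1}\xi_2+\delta^g_{\xi_2}\xi_1,$$ where $[\xi_1,\xi_2]$ is the ordinary Lie bracket of vector fields and $\delta^g_{\xi_1}\xi_2$ is the variation (first-order linearization) of $\xi_2=\xi[Y_2,\tilde T_2,\tilde\omega_2;g]$, with the parameters $Y_2^A,\tilde T_2,\tilde\omega_2$ held fixed, under the variation of the metric $\delta^g_{\xi_1}g_{\mu\nu}=\mathcal L_{\xi_1}g_{\mu\nu}$. In particular $\delta^g_{\xi_1}\tilde\varphi=\tilde\omega_1$, $\delta^g_{\xi_1}g^{AB}=\mathcal L_{\xi_1}g^{AB}$ and $\delta^g_{\xi_1}V^A=-\mathcal L_{\xi_1}g^{rA}$. **Extended $\mathfrak{bms}_4$ algebra.** This is the Lie algebra of triples $(Y,\tilde T,\tilde\omega)$, where $Y=Y^A\partial_A$ is a (locally defined) conformal Killing vector with $Y^\zeta=Y(\zeta)$ and $Y^{\bar\zeta}=\bar Y(\bar\zeta)$, and $\tilde T=\tilde T(\zeta,\bar\zeta)$ and $\tilde\omega=\tilde\omega(u,\zeta,\bar\zeta)$ are arbitrary functions, with bracket $[(Y_1,\tilde T_1,\tilde\omega_1),(Y_2,\tilde T_2,\tilde\omega_2)]=(\hat Y,\hat{\tilde T},\hat{\tilde\omega})$, where $\hat Y^A=Y_1^B\partial_BY_2^A-Y_2^B\partial_BY_1^A$,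 $\hat{\tilde T}=Y_1^A\partial_A\tilde T_2-Y_2^A\partial_A\tilde T_1+\tfrac12(\tilde T_1\,\partial_AY_2^A-\tilde T_2\,\partial_AY_1^A)$ and $\hat{\tilde\omega}=0$. It is the direct sum of the abelian algebra of infinitesimal conformal rescalings $\tilde\omega$ with $\mathfrak{bms}_4$, the semi-direct sum of conformal Killing vectors of the Riemann sphere with the abelian ideal of supertranslations $\tilde T$. In the formulas, $\partial_AY^A=\partial Y+\bar\partial\bar Y$ in the coordinates $\zeta,\bar\zeta$.
   Formalization: The remainders in the expansions as r→∞ are required to be bounded locally uniformly in (u,ζ,ζ̄), with all derivatives, not merely at fixed u,ζ,ζ̄; with only pointwise bounds the radial integrals in ξ need not be differentiable, so the bracket would be undefined. *)

theory Defs
  imports "HOL-Analysis.Analysis"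
begin

section \<open>Coordinates and fields\<close>

text \<open>Indices A, B run over \<zeta> and its conjugate; spacetime indices over u, r and the x^A.\<close>

datatype ang = Zeta | Zetabar

datatype coord = Cu | Cr | Cx ang

lemma UNIV_ang: "(UNIV :: ang set) = {Zeta, Zetabar}"
  using ang.exhaust by auto

instance ang :: finite
  by standard (simp add: UNIV_ang)

lemma UNIV_coord: "(UNIV :: coord set) = {Cu, Cr, Cx Zeta, Cx Zetabar}"
proof -
  have "x \<in> {Cu, Cr, Cx Zeta, Cx Zetabar}" for x
  proof (cases x)
    case (Cx A)
    then show ?thesis by (cases A) simp_all
  qed simp_all
  then show ?thesis by blast
qed

instance coord :: finite
  by standard (simp add: UNIV_coord)

fun conj_ang :: "ang \<Rightarrow> ang" where
  "conj_ang Zeta = Zetabar"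
| "conj_ang Zetabar = Zeta"

text \<open>
  A spacetime scalar is a function of (u, r, \<zeta>), with \<zeta> complex; it need not be holomorphic in \<zeta>.
  Tensors are given by their components in the coordinates (u, r, \<zeta>, conjugate of \<zeta>), which are
  complex; a real tensor is one whose components are conjugated when the indices are.
\<close>

type_synonym scalar = "real \<Rightarrow> real \<Rightarrow> complex \<Rightarrow> complex"
type_synonym vfield = "coord \<Rightarrow> scalar"
type_synonym metric = "coord \<Rightarrow> coord \<Rightarrow> scalar"

text \<open>The Wirtinger derivatives with respect to \<zeta> and its conjugate.\<close>

definition dang :: "ang \<Rightarrow> (complex \<Rightarrow> complex) \<Rightarrow> complex \<Rightarrow> complex" where
  "dang A h z =
    (let D = frechet_derivative h (at z) in
     case A of Zeta \<Rightarrow> (D 1 - \<i> * D \<i>) / 2 | Zetabar \<Rightarrow> (D 1 + \<i> * D \<i>) / 2)"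

definition pd :: "coord \<Rightarrow> scalar \<Rightarrow> scalar" where
  "pd \<mu> F = (\<lambda>u r z.
    case \<mu> of
      Cu \<Rightarrow> vector_derivative (\<lambda>v. F v r z) (at u)
    | Cr \<Rightarrow> vector_derivative (\<lambda>s. F u s z) (at r)
    | Cx A \<Rightarrow> dang A (F u r) z)"

text \<open>
  All iterated directional derivatives are differentiable. For an open set S in a
  finite-dimensional space this is C^\<infinity>.
\<close>

definition smooth_on :: "'a::real_normed_vector set \<Rightarrow> ('a \<Rightarrow> 'b::real_normed_vector) \<Rightarrow> bool" where
  "smooth_on S f \<longleftrightarrow>
    (\<forall>vs. \<forall>x\<in>S. foldr (\<lambda>v h y. frechet_derivative h (at y) v) vs f differentiable (at x))"


section \<open>Asymptotically flat metrics in the sense of Newman and Unti\<close>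

text \<open>
  Remainders O(r^k) and o(r^k) as r tends to \<infinity>: locally uniform in (u, \<zeta>), with the order preserved
  by derivatives along u and x^A and lowered by one by each derivative along r.
\<close>

definition asymp_O :: "real set \<Rightarrow> complex set \<Rightarrow> int \<Rightarrow> scalar \<Rightarrow> bool" where
  "asymp_O I \<Omega> k F \<longleftrightarrow>
    (\<forall>ds K. compact K \<and> K \<subseteq> I \<times> \<Omega> \<longrightarrow>
      (\<exists>c. \<forall>\<^sub>F r in at_top. \<forall>(u, z)\<in>K.
        cmod (foldr pd ds F u r z) \<le> c * r powi (k - int (count_list ds Cr))))"

definition asymp_o :: "real set \<Rightarrow> complex set \<Rightarrow> int \<Rightarrow> scalar \<Rightarrow> bool" where
  "asymp_o I \<Omega> k F \<longleftrightarrow>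
    (\<forall>ds K. compact K \<and> K \<subseteq> I \<times> \<Omega> \<longrightarrow>
      (\<forall>c>0. \<forall>\<^sub>F r in at_top. \<forall>(u, z)\<in>K.
        cmod (foldr pd ds F u r z) \<le> c * r powi (k - int (count_list ds Cr))))"

text \<open>
  The metric e^(2 \<phi>) d\<zeta> d\<zeta>' (\<zeta>' the conjugate of \<zeta>) on the 2-surfaces; the line element contains each
  off-diagonal component twice, whence the factor 1/2.
\<close>

definition gbar :: "(real \<Rightarrow> complex \<Rightarrow> real) \<Rightarrow> ang \<Rightarrow> ang \<Rightarrow> real \<Rightarrow> complex \<Rightarrow> complex" where
  "gbar \<phi> A B u z = (if A = B then 0 else of_real (exp (2 * \<phi> u z) / 2))"

definition gbar_inv :: "(real \<Rightarrow> complex \<Rightarrow> real) \<Rightarrow> ang \<Rightarrow> ang \<Rightarrow> real \<Rightarrow> complex \<Rightarrow> complex" where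
  "gbar_inv \<phi> A B u z = (if A = B then 0 else of_real (2 * exp (- 2 * \<phi> u z)))"

definition laplace_bar :: "(real \<Rightarrow> complex \<Rightarrow> real) \<Rightarrow> (real \<Rightarrow> complex \<Rightarrow> complex) \<Rightarrow> real \<Rightarrow> complex \<Rightarrow> complex" where
  "laplace_bar \<phi> h u z = of_real (4 * exp (- 2 * \<phi> u z)) * dang Zeta (dang Zetabar (h u)) z"

text \<open>
  The spacetime region is u \<in> I, r > r0, \<zeta> \<in> \<Omega>. The conditions on the components of g spell out
  W du^2 - 2 dr du + g_AB (dx^A - V^A du) (dx^B - V^B du).
\<close>

definition newman_unti ::
    "real set \<Rightarrow> real \<Rightarrow> complex set \<Rightarrow> (real \<Rightarrow> complex \<Rightarrow> real) \<Rightarrow> metric \<Rightarrow> bool" where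
  "newman_unti I r0 \<Omega> \<phi> g \<longleftrightarrow>
    smooth_on (I \<times> \<Omega>) (\<lambda>(u, z). \<phi> u z) \<and>
    (\<exists>(W :: scalar) (V :: ang \<Rightarrow> scalar) (C :: ang \<Rightarrow> ang \<Rightarrow> real \<Rightarrow> complex \<Rightarrow> complex).
      smooth_on (I \<times> {r0<..} \<times> \<Omega>) (\<lambda>(u, r, z). W u r z) \<and>
      (\<forall>A. smooth_on (I \<times> {r0<..} \<times> \<Omega>) (\<lambda>(u, r, z). V A u r z)) \<and>
      (\<forall>A B. smooth_on (I \<times> {r0<..} \<times> \<Omega>) (\<lambda>(u, r, z). g (Cx A) (Cx B) u r z)) \<and>
      (\<forall>A B. smooth_on (I \<times> \<Omega>) (\<lambda>(u, z). C A B u z)) \<and>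
      (\<forall>u\<in>I. \<forall>r>r0. \<forall>z\<in>\<Omega>.
        g Cu Cu u r z = W u r z
          + (\<Sum>A\<in>UNIV. \<Sum>B\<in>UNIV. g (Cx A) (Cx B) u r z * V A u r z * V B u r z) \<and>
        g Cu Cr u r z = -1 \<and> g Cr Cu u r z = -1 \<and> g Cr Cr u r z = 0 \<and>
        (\<forall>A. g Cr (Cx A) u r z = 0 \<and> g (Cx A) Cr u r z = 0 \<and>
             g Cu (Cx A) u r z = - (\<Sum>B\<in>UNIV. g (Cx A) (Cx B) u r z * V B u r z) \<and>
             g (Cx A) Cu u r z = - (\<Sum>B\<in>UNIV. g (Cx A) (Cx B) u r z * V B u r z)) \<and>
        (\<forall>A B. g (Cx A) (Cx B) u r z = g (Cx B) (Cx A) u r z) \<and>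
        invertible (\<chi> A B. g (Cx A) (Cx B) u r z) \<and>
        cnj (W u r z) = W u r z \<and>
        (\<forall>A. cnj (V A u r z) = V (conj_ang A) u r z) \<and>
        (\<forall>A B. cnj (g (Cx A) (Cx B) u r z) = g (Cx (conj_ang A)) (Cx (conj_ang B)) u r z)) \<and>
      (\<forall>u\<in>I. \<forall>z\<in>\<Omega>. (\<Sum>A\<in>UNIV. \<Sum>B\<in>UNIV. gbar_inv \<phi> A B u z * C A B u z) = 0) \<and>
      (\<forall>A B. asymp_o I \<Omega> 1
        (\<lambda>u r z. g (Cx A) (Cx B) u r z - (of_real (r^2) * gbar \<phi> A B u z + of_real r * C A B u z))) \<and>
      (\<forall>A. asymp_O I \<Omega> (-2) (V A)) \<and>
      asymp_O I \<Omega> (-1) (\<lambda>u r z. W u r z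
        - (of_real (- 2 * r * vector_derivative (\<lambda>v. \<phi> v z) (at u))
           + laplace_bar \<phi> (\<lambda>u z. of_real (\<phi> u z)) u z)))"

definition metric_inv :: "metric \<Rightarrow> metric" where
  "metric_inv g \<mu> \<nu> u r z = matrix_inv (\<chi> \<alpha> \<beta>. g \<alpha> \<beta> u r z) $ \<mu> $ \<nu>"

text \<open>
  The conformal factor \<phi> as a functional of the metric, read off from the coefficient of r^2 in
  the angular part; it is the \<phi> of \<open>newman_unti\<close> by \<open>newman_unti_conf_factor\<close> below.
\<close>

definition conf_factor :: "metric \<Rightarrow> real \<Rightarrow> complex \<Rightarrow> real" where
  "conf_factor g u z =
    ln (2 * Re (Lim at_top (\<lambda>r. g (Cx Zeta) (Cx Zetabar) u r z / of_real (r^2)))) / 2"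

lemma newman_unti_conf_factor:
  assumes "newman_unti I r0 \<Omega> \<phi> g" "u \<in> I" "z \<in> \<Omega>"
  shows "conf_factor g u z = \<phi> u z"
proof -
  obtain C :: "ang \<Rightarrow> ang \<Rightarrow> real \<Rightarrow> complex \<Rightarrow> complex" where
    C: "asymp_o I \<Omega> 1 (\<lambda>u r z. g (Cx Zeta) (Cx Zetabar) u r z
          - (of_real (r^2) * gbar \<phi> Zeta Zetabar u z + of_real r * C Zeta Zetabar u z))"
    using assms(1) unfolding newman_unti_def by blast
  let ?G = "\<lambda>r. g (Cx Zeta) (Cx Zetabar) u r z"
  let ?c = "C Zeta Zetabar u z" and ?b = "gbar \<phi> Zeta Zetabar u z"
  have ev: "\<forall>\<^sub>F r in at_top. cmod (?G r - (of_real (r^2) * ?b + of_real r * ?c)) \<le> r"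
    using C[unfolded asymp_o_def, rule_format, of "{(u, z)}" 1 "[]"] assms(2,3) by simp
  have "((\<lambda>r. ?G r / of_real (r^2) - ?b) \<longlongrightarrow> 0) at_top"
  proof (rule Lim_null_comparison)
    show "\<forall>\<^sub>F r in at_top. cmod (?G r / of_real (r^2) - ?b) \<le> (1 + cmod ?c) / r"
      using ev eventually_gt_at_top[of 0]
    proof eventually_elim
      case (elim r)
      have "?G r / of_real (r^2) - ?b =
          (?G r - (of_real (r^2) * ?b + of_real r * ?c) + of_real r * ?c) / of_real (r^2)"
        using elim(2) by (simp add: field_simps)
      also have "cmod \<dots> \<le> (r + r * cmod ?c) / r^2"
        using elim by (simp only: norm_divide norm_of_real)
          (intro divide_mono order.trans[OF norm_triangle_ineq] add_mono,
           auto simp: norm_mult)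
      also have "\<dots> = (1 + cmod ?c) / r"
        using elim(2) by (simp add: field_simps power2_eq_square)
      finally show ?case .
    qed
    show "((\<lambda>r. (1 + cmod ?c) / r) \<longlongrightarrow> 0) at_top"
      by (rule tendsto_divide_0[OF tendsto_const])
         (simp add: filterlim_at_top_imp_at_infinity filterlim_ident)
  qed
  then have "((\<lambda>r. ?G r / of_real (r^2)) \<longlongrightarrow> ?b) at_top"
    by (simp add: LIM_zero_iff)
  then have "Lim at_top (\<lambda>r. ?G r / of_real (r^2)) = ?b"
    by (intro tendsto_Lim) auto
  then have "conf_factor g u z = ln (2 * Re ?b) / 2"
    by (simp only: conf_factor_def)
  then show ?thesis
    by (simp add: gbar_def)
qed


section \<open>The vector fields \<xi>[Y, T, \<omega>; g]\<close>

definition conformal_killing :: "complex set \<Rightarrow> (ang \<Rightarrow> complex \<Rightarrow> complex) \<Rightarrow> bool" where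
  "conformal_killing \<Omega> Y \<longleftrightarrow>
    Y Zeta holomorphic_on \<Omega> \<and> (\<forall>z\<in>\<Omega>. Y Zetabar z = cnj (Y Zeta z))"

type_synonym params = "(ang \<Rightarrow> complex \<Rightarrow> complex) \<times> (complex \<Rightarrow> real) \<times> (real \<Rightarrow> complex \<Rightarrow> real)"

definition div_bar ::
    "(real \<Rightarrow> complex \<Rightarrow> real) \<Rightarrow> (ang \<Rightarrow> complex \<Rightarrow> complex) \<Rightarrow> real \<Rightarrow> complex \<Rightarrow> complex" where
  "div_bar \<phi> Y u z =
    (\<Sum>A\<in>UNIV. dang A (Y A) z + 2 * Y A z * dang A (\<lambda>w. of_real (\<phi> u w)) z)"

fun f_of :: "(real \<Rightarrow> complex \<Rightarrow> real) \<Rightarrow> params \<Rightarrow> real \<Rightarrow> complex \<Rightarrow> complex" where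
  "f_of \<phi> (Y, T, \<omega>) u z =
    of_real (exp (\<phi> u z)) *
    (of_real (T z)
     + (LBINT v=0..u. of_real (exp (- \<phi> v z)) * (div_bar \<phi> Y v z - 2 * of_real (\<omega> v z))) / 2)"

text \<open>V^A enters through the inverse metric, as V^A = - g^{rA}.\<close>

definition xi :: "params \<Rightarrow> metric \<Rightarrow> vfield" where
  "xi p g \<mu> u r z =
    (let f = f_of (conf_factor g) p in
     case \<mu> of
       Cu \<Rightarrow> f u z
     | Cx A \<Rightarrow> fst p A z
         - (\<Sum>B\<in>UNIV. dang B (f u) z * (LBINT s=r..\<infinity>. metric_inv g (Cx A) (Cx B) u s z))
     | Cr \<Rightarrow> - of_real r * vector_derivative (\<lambda>v. f v z) (at u)
         + laplace_bar (conf_factor g) f u z / 2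
         + (\<Sum>A\<in>UNIV. dang A (f u) z * (LBINT s=r..\<infinity>. - metric_inv g Cr (Cx A) u s z)))"


section \<open>The modified Lie bracket\<close>

definition lie_bracket :: "vfield \<Rightarrow> vfield \<Rightarrow> vfield" where
  "lie_bracket X Z \<mu> u r z =
    (\<Sum>\<nu>\<in>UNIV. X \<nu> u r z * pd \<nu> (Z \<mu>) u r z - Z \<nu> u r z * pd \<nu> (X \<mu>) u r z)"

definition lie_metric :: "vfield \<Rightarrow> metric \<Rightarrow> metric" where
  "lie_metric X g \<mu> \<nu> u r z =
    (\<Sum>\<rho>\<in>UNIV. X \<rho> u r z * pd \<rho> (g \<mu> \<nu>) u r z
       + g \<rho> \<nu> u r z * pd \<mu> (X \<rho>) u r z + g \<mu> \<rho> u r z * pd \<nu> (X \<rho>) u r z)"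

text \<open>First-order variation of a metric-dependent vector field under \<open>\<delta>g = h\<close>.\<close>

definition variation :: "metric \<Rightarrow> (metric \<Rightarrow> vfield) \<Rightarrow> metric \<Rightarrow> vfield" where
  "variation h \<Xi> g \<mu> u r z =
    vector_derivative
      (\<lambda>\<epsilon>. \<Xi> (\<lambda>\<alpha> \<beta> u r z. g \<alpha> \<beta> u r z + of_real \<epsilon> * h \<alpha> \<beta> u r z) \<mu> u r z) (at 0)"

definition mod_bracket :: "(metric \<Rightarrow> vfield) \<Rightarrow> (metric \<Rightarrow> vfield) \<Rightarrow> metric \<Rightarrow> vfield" where
  "mod_bracket \<Xi>1 \<Xi>2 g \<mu> u r z =
    lie_bracket (\<Xi>1 g) (\<Xi>2 g) \<mu> u r z
    - variation (lie_metric (\<Xi>1 g) g) \<Xi>2 g \<mu> u r z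
    + variation (lie_metric (\<Xi>2 g) g) \<Xi>1 g \<mu> u r z"


section \<open>The bracket of the extended bms4 algebra\<close>

definition bracket_Y ::
    "(ang \<Rightarrow> complex \<Rightarrow> complex) \<Rightarrow> (ang \<Rightarrow> complex \<Rightarrow> complex) \<Rightarrow> ang \<Rightarrow> complex \<Rightarrow> complex" where
  "bracket_Y Y1 Y2 A z = (\<Sum>B\<in>UNIV. Y1 B z * dang B (Y2 A) z - Y2 B z * dang B (Y1 A) z)"

definition bracket_T ::
    "(ang \<Rightarrow> complex \<Rightarrow> complex) \<Rightarrow> (complex \<Rightarrow> real) \<Rightarrow> (ang \<Rightarrow> complex \<Rightarrow> complex) \<Rightarrow> (complex \<Rightarrow> real)
      \<Rightarrow> complex \<Rightarrow> complex" where
  "bracket_T Y1 T1 Y2 T2 z =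
    (\<Sum>A\<in>UNIV. Y1 A z * dang A (\<lambda>w. of_real (T2 w)) z - Y2 A z * dang A (\<lambda>w. of_real (T1 w)) z
       + (of_real (T1 z) * dang A (Y2 A) z - of_real (T2 z) * dang A (Y1 A) z) / 2)"

text \<open>
  \<open>bracket_T\<close> is real-valued (\<open>bracket_T_real\<close>), so \<open>Re\<close> only changes its type.
\<close>

fun ebms_bracket :: "params \<Rightarrow> params \<Rightarrow> params" where
  "ebms_bracket (Y1, T1, \<omega>1) (Y2, T2, \<omega>2) =
    (bracket_Y Y1 Y2, (\<lambda>z. Re (bracket_T Y1 T1 Y2 T2 z)), (\<lambda>u z. 0))"

lemma frechet_cnj:
  assumes "h differentiable (at z)"
  shows "frechet_derivative (\<lambda>w. cnj (h w)) (at z) = (\<lambda>v. cnj (frechet_derivative h (at z) v))"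
proof -
  have "(h has_derivative frechet_derivative h (at z)) (at z)"
    using assms frechet_derivative_works by blast
  then have "((\<lambda>w. cnj (h w)) has_derivative (\<lambda>v. cnj (frechet_derivative h (at z) v))) (at z)"
    by (rule bounded_linear.has_derivative[OF bounded_linear_cnj])
  then show ?thesis
    by (metis frechet_derivative_at)
qed

lemma dang_cnj:
  assumes "h differentiable (at z)"
  shows "cnj (dang A h z) = dang (conj_ang A) (\<lambda>w. cnj (h w)) z"
  by (cases A) (simp_all add: dang_def Let_def frechet_cnj[OF assms])

lemma bracket_T_real:
  assumes "open \<Omega>" "z \<in> \<Omega>" "conformal_killing \<Omega> Y1" "conformal_killing \<Omega> Y2"
    and "smooth_on \<Omega> T1" "smooth_on \<Omega> T2"
  shows "complex_of_real (Re (bracket_T Y1 T1 Y2 T2 z)) = bracket_T Y1 T1 Y2 T2 z"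
proof -
  have cong: "dang A h z = dang A k z" if "\<And>w. w \<in> \<Omega> \<Longrightarrow> h w = k w" for A h k
  proof -
    have "(h has_derivative D) (at z) \<longleftrightarrow> (k has_derivative D) (at z)" for D
      using that assms(1,2) has_derivative_transform_within_open by metis
    then show ?thesis
      by (simp add: dang_def frechet_derivative_def)
  qed
  have Y: "cnj (dang Zeta (Y Zeta) z) = dang Zetabar (Y Zetabar) z"
    if "conformal_killing \<Omega> Y" for Y
  proof -
    have "Y Zeta field_differentiable (at z)"
      using that assms(1,2) holomorphic_on_imp_differentiable_at
      unfolding conformal_killing_def by blast
    then have "Y Zeta differentiable (at z)"
      unfolding field_differentiable_def differentiable_def has_field_derivative_def by blast
    then have "cnj (dang Zeta (Y Zeta) z) = dang Zetabar (\<lambda>w. cnj (Y Zeta w)) z"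
      using dang_cnj[of "Y Zeta" z Zeta] by simp
    also have "\<dots> = dang Zetabar (Y Zetabar) z"
      using that by (intro cong) (simp add: conformal_killing_def)
    finally show ?thesis .
  qed
  have T: "cnj (dang Zeta (\<lambda>w. complex_of_real (T w)) z) = dang Zetabar (\<lambda>w. complex_of_real (T w)) z"
    if "smooth_on \<Omega> T" for T
  proof -
    have "T differentiable (at z)"
      using that assms(2) unfolding smooth_on_def by (metis foldr_Nil id_apply)
    then obtain D where "(T has_derivative D) (at z)"
      unfolding differentiable_def by blast
    then have "((\<lambda>w. complex_of_real (T w)) has_derivative (\<lambda>v. complex_of_real (D v))) (at z)"
      by (rule has_derivative_of_real)
    then have "(\<lambda>w. complex_of_real (T w)) differentiable (at z)"
      unfolding differentiable_def by blast
    from dang_cnj[OF this, of Zeta] show ?thesis by simp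
  qed
  have Yv: "cnj (Y Zeta z) = Y Zetabar z" if "conformal_killing \<Omega> Y" for Y
    using that assms(2) by (simp add: conformal_killing_def)
  have sym: "cnj (a + cnj a) = a + cnj a" for a by simp
  have "bracket_T Y1 T1 Y2 T2 z =
      (let a = Y1 Zeta z * dang Zeta (\<lambda>w. of_real (T2 w)) z
             - Y2 Zeta z * dang Zeta (\<lambda>w. of_real (T1 w)) z
             + (of_real (T1 z) * dang Zeta (Y2 Zeta) z - of_real (T2 z) * dang Zeta (Y1 Zeta) z) / 2
       in a + cnj a)"
    using assms(3-6)
    by (simp add: bracket_T_def UNIV_ang Let_def Y T Yv)
  then have "cnj (bracket_T Y1 T1 Y2 T2 z) = bracket_T Y1 T1 Y2 T2 z"
    by (simp add: Let_def)
  then show ?thesis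
    by (metis Reals_cnj_iff of_real_Re)
qed

end

theory Submission
  imports Defs "HOL-Complex_Analysis.Cauchy_Integral_Formula"
begin

text \<open>
  Writing f for the u-component of \<xi>, the gauge conditions integrate to the radial equation
  \<open>\<partial>\<^sub>r \<xi>\<^sup>\<mu> = g\<^sup>\<mu>\<^sup>\<rho> \<partial>\<^sub>\<rho> f\<close>. Let fhat be the u-component of the modified bracket of \<xi>1 and \<xi>2. Since
  \<open>\<delta>g = \<L>\<^sub>\<xi> g\<close>, the r-derivative of each component of the modified bracket is \<open>g\<^sup>\<mu>\<^sup>\<rho> \<partial>\<^sub>\<rho>\<close> fhat: all terms
  in which the metric is differentiated cancel. The function exp (-\<phi>) fhat satisfies in u the same
  equation, with the same initial value, as the one built from the bracket parameters, so fhat is the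
  u-component of the right-hand side. Both sides then satisfy the same radial equation, and it
  remains to compare their limits as r tends to infinity.
\<close>

section \<open>Smooth functions\<close>

text \<open>The obstacle is the variation. \<open>variation\<close> differentiates along g + e h
  with h the Lie derivative of g, so the limit defining \<open>conf_factor\<close> and the tail
  integrals of the inverse metric must be controlled on a whole interval of e, uniformly up to
  infinite radius. This needs h_AB = O(r^2), h_uA = O(1), h_r\<mu> = 0 and the exact r^2 part of the
  off-diagonal h_AB, namely 2 \<omega> times that of g; the bound on h_uA rests on a cancellation of
  terms linear in r. The conformal factor of g + e h is \<phi> + ln (1 + 2 e \<omega>) / 2, hence
  not affine in e. The f of the perturbed metric is treated as a function of (u, e, \<zeta>) with e
  in the slot of r, which makes its variation a partial derivative. Tail integrals are never shown
  to be smooth: first derivatives and the radial derivatives of these are all that the bracket uses.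
  In the limit of the r-component, the angular derivatives of that component grow like r, so the 1/r
  correction of the angular components contributes and has to be kept.\<close>

definition ddir :: "'a::real_normed_vector \<Rightarrow> ('a \<Rightarrow> 'b::real_normed_vector) \<Rightarrow> 'a \<Rightarrow> 'b" where
  "ddir v f x = frechet_derivative f (at x) v"

text \<open>\<open>smooth_on\<close> quantifies over lists of directions, a form in which the
  product or chain rule gives no induction. Counting orders does: one derivative of a product is a
  sum of products of one order less.\<close>

primrec Ck :: "nat \<Rightarrow> 'a::real_normed_vector set \<Rightarrow> ('a \<Rightarrow> 'b::real_normed_vector) \<Rightarrow> bool" where
  "Ck 0 S f \<longleftrightarrow> continuous_on S f"
| "Ck (Suc k) S f \<longleftrightarrow> (\<forall>x\<in>S. f differentiable (at x)) \<and> (\<forall>v. Ck k S (ddir v f))"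

lemma smooth_on_iff: "smooth_on S f \<longleftrightarrow> (\<forall>x\<in>S. f differentiable (at x)) \<and> (\<forall>v. smooth_on S (ddir v f))"
proof
  assume L: "smooth_on S f"
  show "(\<forall>x\<in>S. f differentiable (at x)) \<and> (\<forall>v. smooth_on S (ddir v f))"
  proof (intro conjI ballI allI)
    fix x assume "x \<in> S"
    then show "f differentiable (at x)"
      using L[unfolded smooth_on_def, rule_format, of x "[]"] by simp
  next
    fix v
    show "smooth_on S (ddir v f)"
      unfolding smooth_on_def
    proof (intro allI ballI)
      fix vs x assume "x \<in> S"
      then show "foldr (\<lambda>v h y. frechet_derivative h (at y) v) vs (ddir v f) differentiable at x"
        \<comment> \<open>\<open>foldr\<close> applies the last entry of the list first, so
          appending \<open>v\<close> differentiates along \<open>v\<close> before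
          \<open>vs\<close>.\<close>
        using L[unfolded smooth_on_def, rule_format, of x "vs @ [v]"]
        by (simp add: ddir_def[abs_def])
    qed
  qed
next
  assume R: "(\<forall>x\<in>S. f differentiable (at x)) \<and> (\<forall>v. smooth_on S (ddir v f))"
  show "smooth_on S f"
    unfolding smooth_on_def
  proof (intro allI ballI)
    fix vs x assume x: "x \<in> S"
    show "foldr (\<lambda>v h y. frechet_derivative h (at y) v) vs f differentiable at x"
    proof (cases vs rule: rev_cases)
      case Nil then show ?thesis using R x by simp
    next
      case (snoc ws w)
      have "smooth_on S (ddir w f)" using R by blast
      then show ?thesis
        using x snoc unfolding smooth_on_def by (simp add: ddir_def[abs_def])
    qed
  qed
qed

lemma smooth_on_differentiable: "smooth_on S f \<Longrightarrow> x \<in> S \<Longrightarrow> f differentiable (at x)"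
  by (simp add: smooth_on_iff[of S f])

lemma smooth_on_ddir: "smooth_on S f \<Longrightarrow> smooth_on S (ddir v f)"
  by (simp add: smooth_on_iff[of S f])

lemma smooth_on_continuous: "smooth_on S f \<Longrightarrow> continuous_on S f"
  by (simp add: continuous_at_imp_continuous_on differentiable_imp_continuous_within smooth_on_differentiable)

lemma smooth_on_subset: "smooth_on S f \<Longrightarrow> T \<subseteq> S \<Longrightarrow> smooth_on T f"
  unfolding smooth_on_def by blast

lemma has_ddir: "f differentiable (at x) \<Longrightarrow> (f has_derivative (\<lambda>v. ddir v f x)) (at x)"
  unfolding ddir_def using frechet_derivative_works by blast

lemma ddir_eqI: "(f has_derivative D) (at x) \<Longrightarrow> ddir v f x = D v"
  unfolding ddir_def using frechet_derivative_at by metis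

lemma ddir_cong:
  assumes "open S" "x \<in> S" "\<And>y. y \<in> S \<Longrightarrow> f y = g y"
  shows "ddir v f x = ddir v g x"
proof -
  have "(f has_derivative D) (at x) \<longleftrightarrow> (g has_derivative D) (at x)" for D
    using assms has_derivative_transform_within_open by metis
  then show ?thesis by (simp add: ddir_def frechet_derivative_def)
qed

lemma differentiable_cong_open:
  assumes "open S" "x \<in> S" "\<And>y. y \<in> S \<Longrightarrow> f y = g y"
  shows "f differentiable (at x) \<longleftrightarrow> g differentiable (at x)"
  unfolding differentiable_def using assms has_derivative_transform_within_open by metis

lemma Ck_continuous: "Ck k S f \<Longrightarrow> continuous_on S f"
  by (cases k) (auto simp: continuous_at_imp_continuous_on differentiable_imp_continuous_within)

lemma Ck_Suc_D: "Ck (Suc k) S f \<Longrightarrow> Ck k S f"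
proof (induction k arbitrary: f)
  case 0
  then show ?case by (simp only: Ck.simps(1)) (rule Ck_continuous)
next
  case (Suc k)
  then have "Ck (Suc k) S (ddir v f)" for v by simp
  then have "Ck k S (ddir v f)" for v by (rule Suc.IH)
  with Suc.prems show ?case by simp
qed

lemma Ck_cong:
  assumes "open S" "\<And>y. y \<in> S \<Longrightarrow> f y = g y"
  shows "Ck k S f \<longleftrightarrow> Ck k S g"
  using assms(2)
proof (induction k arbitrary: f g)
  case 0
  then show ?case by (simp cong: continuous_on_cong)
next
  case (Suc k)
  have "Ck k S (ddir v f) \<longleftrightarrow> Ck k S (ddir v g)" for v
    by (rule Suc.IH) (rule ddir_cong[OF assms(1) _ Suc.prems])
  moreover have "x \<in> S \<Longrightarrow> f differentiable (at x) \<longleftrightarrow> g differentiable (at x)" for x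
    by (rule differentiable_cong_open[OF assms(1) _ Suc.prems])
  ultimately show ?case by simp
qed

lemma smooth_on_imp_Ck: "smooth_on S f \<Longrightarrow> Ck k S f"
proof (induction k arbitrary: f)
  case 0 then show ?case by (simp add: smooth_on_continuous)
next
  case (Suc k)
  then show ?case by (simp add: smooth_on_differentiable smooth_on_ddir)
qed

lemma smooth_onI_Ck:
  assumes "\<And>k. Ck k S f" shows "smooth_on S f"
proof -
  have *: "\<forall>x\<in>S. foldr (\<lambda>v h y. frechet_derivative h (at y) v) vs f differentiable (at x)"
    if "Ck (Suc (length vs)) S f" for vs f
    using that
  proof (induction vs arbitrary: f rule: rev_induct)
    case Nil then show ?case by auto
  next
    case (snoc w ws)
    then have "Ck (Suc (length ws)) S (ddir w f)" by simp
    from snoc.IH[OF this] show ?case by (simp add: ddir_def[abs_def])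
  qed
  show ?thesis unfolding smooth_on_def using * assms by blast
qed

lemma smooth_on_cong:
  assumes "open S" "\<And>y. y \<in> S \<Longrightarrow> f y = g y"
  shows "smooth_on S f \<longleftrightarrow> smooth_on S g"
proof -
  have "Ck k S f \<longleftrightarrow> Ck k S g" for k by (rule Ck_cong[OF assms])
  then show ?thesis by (meson smooth_onI_Ck smooth_on_imp_Ck)
qed

text \<open>The common route of the closure lemmas below: once the derivative has an explicit
  formula \<open>D\<close> on the open set, order k + 1 is reduced to order k of that
  formula.\<close>

lemma Ck_SucI:
  assumes "open S" "\<And>x. x \<in> S \<Longrightarrow> (f has_derivative D x) (at x)"
    "\<And>v. Ck k S (\<lambda>x. D x v)"
  shows "Ck (Suc k) S f"
proof -
  have "ddir v f x = D x v" if "x \<in> S" for x v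
    using ddir_eqI[OF assms(2)[OF that]] .
  then have "Ck k S (ddir v f)" for v
    by (subst Ck_cong[OF assms(1), of _ "\<lambda>x. D x v"]) (simp_all add: assms(3))
  moreover have "\<forall>x\<in>S. f differentiable (at x)"
    using assms(2) differentiableI by blast
  ultimately show ?thesis by simp
qed

lemma Ck_SucE:
  assumes "Ck (Suc k) S f" "x \<in> S"
  shows "(f has_derivative (\<lambda>v. ddir v f x)) (at x)"
  using assms by (intro has_ddir) simp

lemma Ck_const: "open S \<Longrightarrow> Ck k S (\<lambda>x. c)"
proof (induction k arbitrary: c)
  case (Suc k)
  show ?case
    by (rule Ck_SucI[where D="\<lambda>x v. 0"]) (simp_all add: Suc)
qed simp

lemma smooth_on_const: "open S \<Longrightarrow> smooth_on S (\<lambda>x. c)"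
  by (rule smooth_onI_Ck) (rule Ck_const)

lemma Ck_bounded_linear_comp:
  assumes "bounded_linear L" "open S" "Ck k S f"
  shows "Ck k S (\<lambda>x. L (f x))"
  using assms(3)
proof (induction k arbitrary: f)
  case 0
  then show ?case
    by (simp add: bounded_linear.continuous_on[OF assms(1)])
next
  case (Suc k)
  show ?case
  proof (rule Ck_SucI[OF assms(2), where D="\<lambda>x v. L (ddir v f x)"])
    show "((\<lambda>x. L (f x)) has_derivative (\<lambda>v. L (ddir v f x))) (at x)" if "x \<in> S" for x
      using bounded_linear.has_derivative[OF assms(1) Ck_SucE[OF Suc.prems that]] .
    show "Ck k S (\<lambda>x. L (ddir v f x))" for v
      using Suc.IH[of "ddir v f"] Suc.prems by (simp add: o_def)
  qed
qed

lemma smooth_on_bounded_linear_comp: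
  "bounded_linear L \<Longrightarrow> open S \<Longrightarrow> smooth_on S f \<Longrightarrow> smooth_on S (\<lambda>x. L (f x))"
  by (rule smooth_onI_Ck, rule Ck_bounded_linear_comp) (auto intro: smooth_on_imp_Ck)

lemma smooth_on_bounded_linear:
  assumes "bounded_linear L" "open S" shows "smooth_on S L"
proof (rule smooth_onI_Ck)
  fix k show "Ck k S L"
  proof (cases k)
    case 0 then show ?thesis using linear_continuous_on[OF assms(1)] by simp
  next
    case (Suc n)
    show ?thesis unfolding Suc
      by (rule Ck_SucI[OF assms(2), where D="\<lambda>x. L"])
         (use bounded_linear.has_derivative[OF assms(1), of "\<lambda>x. x"] assms Ck_const in \<open>auto intro: has_derivative_ident\<close>)
  qed
qed

lemma Ck_linear_precomp:
  assumes "bounded_linear L" "open S" "open T" "Ck k T f" "\<And>x. x \<in> S \<Longrightarrow> L x \<in> T"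
  shows "Ck k S (\<lambda>x. f (L x))"
  using assms(4)
proof (induction k arbitrary: f)
  case 0
  then show ?case
    using assms(5) continuous_on_compose2[OF _ linear_continuous_on[OF assms(1)], of T f S] by auto
next
  case (Suc k)
  show ?case
  proof (rule Ck_SucI[OF assms(2), where D="\<lambda>x v. ddir (L v) f (L x)"])
    show "((\<lambda>x. f (L x)) has_derivative (\<lambda>v. ddir (L v) f (L x))) (at x)" if "x \<in> S" for x
      using has_derivative_compose[OF bounded_linear_imp_has_derivative[OF assms(1)]
        Ck_SucE[OF Suc.prems assms(5)[OF that]]] .
    show "Ck k S (\<lambda>x. ddir (L v) f (L x))" for v
      using Suc.IH[of "ddir (L v) f"] Suc.prems by simp
  qed
qed

lemma smooth_on_linear_precomp:
  "bounded_linear L \<Longrightarrow> open S \<Longrightarrow> open T \<Longrightarrow> smooth_on T f \<Longrightarrow> (\<And>x. x \<in> S \<Longrightarrow> L x \<in> T)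
   \<Longrightarrow> smooth_on S (\<lambda>x. f (L x))"
  by (rule smooth_onI_Ck, rule Ck_linear_precomp) (auto intro: smooth_on_imp_Ck)

lemma Ck_add: "open S \<Longrightarrow> Ck k S f \<Longrightarrow> Ck k S g \<Longrightarrow> Ck k S (\<lambda>x. f x + g x)"
proof (induction k arbitrary: f g)
  case 0 then show ?case by (auto intro!: continuous_intros)
next
  case (Suc k)
  show ?case
    by (rule Ck_SucI[where D="\<lambda>x v. ddir v f x + ddir v g x"])
       (use Suc in \<open>auto intro!: has_derivative_add Ck_SucE simp del: Ck.simps(2)\<close>, simp)
qed

lemma Ck_mult:
  fixes f g :: "'a::real_normed_vector \<Rightarrow> 'b::real_normed_algebra"
  shows "open S \<Longrightarrow> Ck k S f \<Longrightarrow> Ck k S g \<Longrightarrow> Ck k S (\<lambda>x. f x * g x)"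
proof (induction k arbitrary: f g)
  case 0 then show ?case by (auto intro!: continuous_intros)
next
  case (Suc k)
  show ?case
  proof (rule Ck_SucI[where D="\<lambda>x v. f x * ddir v g x + ddir v f x * g x"])
    show "((\<lambda>x. f x * g x) has_derivative (\<lambda>v. f x * ddir v g x + ddir v f x * g x)) (at x)" if "x \<in> S" for x
      using has_derivative_mult[OF Ck_SucE[OF Suc.prems(2) that] Ck_SucE[OF Suc.prems(3) that]] .
    show "Ck k S (\<lambda>x. f x * ddir v g x + ddir v f x * g x)" for v
      using Suc.prems by (intro Ck_add Suc.IH) (auto intro: Ck_Suc_D)
  qed (rule Suc.prems)
qed

lemma Ck_inverse:
  fixes f :: "'a::real_normed_vector \<Rightarrow> 'b::real_normed_field"
  shows "open S \<Longrightarrow> (\<And>x. x \<in> S \<Longrightarrow> f x \<noteq> 0) \<Longrightarrow> Ck k S f \<Longrightarrow> Ck k S (\<lambda>x. inverse (f x))"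
proof (induction k)
  case 0 then show ?case by (auto intro!: continuous_intros)
next
  case (Suc k)
  have IH: "Ck k S (\<lambda>x. inverse (f x))"
    using Suc.IH[OF Suc.prems(1,2) Ck_Suc_D[OF Suc.prems(3)]] .
  show ?case
  proof (rule Ck_SucI[where D="\<lambda>x v. - (inverse (f x) * ddir v f x * inverse (f x))"])
    show "((\<lambda>x. inverse (f x)) has_derivative (\<lambda>v. - (inverse (f x) * ddir v f x * inverse (f x)))) (at x)" if "x \<in> S" for x
      using Deriv.has_derivative_inverse[OF Suc.prems(2)[OF that] Ck_SucE[OF Suc.prems(3) that]] .
    show "Ck k S (\<lambda>x. - (inverse (f x) * ddir v f x * inverse (f x)))" for v
      using Suc.prems IH
      by (intro Ck_bounded_linear_comp[OF bounded_linear_minus[OF bounded_linear_ident]] Ck_mult) auto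
  qed (rule Suc.prems)
qed

lemma Ck_exp:
  fixes f :: "'a::real_normed_vector \<Rightarrow> 'b::{banach,real_normed_field}"
  shows "open S \<Longrightarrow> Ck k S f \<Longrightarrow> Ck k S (\<lambda>x. exp (f x))"
proof (induction k)
  case 0 then show ?case by (auto intro!: continuous_intros)
next
  case (Suc k)
  have IH: "Ck k S (\<lambda>x. exp (f x))"
    using Suc.IH[OF Suc.prems(1) Ck_Suc_D[OF Suc.prems(2)]] .
  show ?case
  proof (rule Ck_SucI[where D="\<lambda>x v. exp (f x) * ddir v f x"])
    show "((\<lambda>x. exp (f x)) has_derivative (\<lambda>v. exp (f x) * ddir v f x)) (at x)" if "x \<in> S" for x
      using has_derivative_compose[OF Ck_SucE[OF Suc.prems(2) that], of exp "(*) (exp (f x))"]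
        DERIV_exp[of "f x"] by (simp add: has_field_derivative_def)
    show "Ck k S (\<lambda>x. exp (f x) * ddir v f x)" for v
      using Suc.prems IH by (intro Ck_mult) auto
  qed (rule Suc.prems)
qed

lemma smooth_on_ln:
  fixes f :: "'a::real_normed_vector \<Rightarrow> real"
  assumes "open S" "\<And>x. x \<in> S \<Longrightarrow> f x > 0" "smooth_on S f"
  shows "smooth_on S (\<lambda>x. ln (f x))"
proof (rule smooth_onI_Ck)
  fix k
  have "Ck (Suc k) S (\<lambda>x. ln (f x))"
  proof (rule Ck_SucI[where D="\<lambda>x v. ddir v f x * inverse (f x)"])
    show "((\<lambda>x. ln (f x)) has_derivative (\<lambda>v. ddir v f x * inverse (f x))) (at x)" if "x \<in> S" for x
      using has_derivative_ln[OF assms(2)[OF that] has_ddir[OF smooth_on_differentiable[OF assms(3) that]]]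
      .
    show "Ck k S (\<lambda>x. ddir v f x * inverse (f x))" for v
      using smooth_on_imp_Ck[OF smooth_on_ddir[OF assms(3)]] smooth_on_imp_Ck[OF assms(3)] assms(1,2)
      by (intro Ck_mult Ck_inverse) (auto simp: less_imp_neq[symmetric])
  qed (rule assms(1))
  then show "Ck k S (\<lambda>x. ln (f x))" by (rule Ck_Suc_D)
qed

lemma smooth_on_add: "open S \<Longrightarrow> smooth_on S f \<Longrightarrow> smooth_on S g \<Longrightarrow> smooth_on S (\<lambda>x. f x + g x)"
  by (rule smooth_onI_Ck, rule Ck_add) (auto intro: smooth_on_imp_Ck)

lemma smooth_on_mult:
  fixes f g :: "'a::real_normed_vector \<Rightarrow> 'b::real_normed_algebra"
  shows "open S \<Longrightarrow> smooth_on S f \<Longrightarrow> smooth_on S g \<Longrightarrow> smooth_on S (\<lambda>x. f x * g x)"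
  by (rule smooth_onI_Ck, rule Ck_mult) (auto intro: smooth_on_imp_Ck)

lemma smooth_on_inverse:
  fixes f :: "'a::real_normed_vector \<Rightarrow> 'b::real_normed_field"
  shows "open S \<Longrightarrow> (\<And>x. x \<in> S \<Longrightarrow> f x \<noteq> 0) \<Longrightarrow> smooth_on S f \<Longrightarrow> smooth_on S (\<lambda>x. inverse (f x))"
  by (rule smooth_onI_Ck, rule Ck_inverse) (auto intro: smooth_on_imp_Ck)

lemma smooth_on_exp:
  fixes f :: "'a::real_normed_vector \<Rightarrow> 'b::{banach,real_normed_field}"
  shows "open S \<Longrightarrow> smooth_on S f \<Longrightarrow> smooth_on S (\<lambda>x. exp (f x))"
  by (rule smooth_onI_Ck, rule Ck_exp) (auto intro: smooth_on_imp_Ck)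

lemma smooth_on_minus: "open S \<Longrightarrow> smooth_on S f \<Longrightarrow> smooth_on S (\<lambda>x. - f x)"
  by (rule smooth_on_bounded_linear_comp[OF bounded_linear_minus[OF bounded_linear_ident]])

lemma smooth_on_diff: "open S \<Longrightarrow> smooth_on S f \<Longrightarrow> smooth_on S g \<Longrightarrow> smooth_on S (\<lambda>x. f x - g x)"
  using smooth_on_add[OF _ _ smooth_on_minus] by fastforce

text \<open>The real derivative is multiplication by \<open>deriv f x\<close>, and
  \<open>deriv f\<close> is again holomorphic, so the induction runs over all holomorphic
  functions.\<close>

lemma smooth_on_holomorphic:
  assumes "open S" "f holomorphic_on S"
  shows "smooth_on S f"
proof (rule smooth_onI_Ck)
  fix k show "Ck k S f"
    using assms(2)
  proof (induction k arbitrary: f)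
    case 0 then show ?case by (simp add: holomorphic_on_imp_continuous_on)
  next
    case (Suc k)
    show ?case
    proof (rule Ck_SucI[where D="\<lambda>x v. deriv f x * v"])
      show "(f has_derivative (\<lambda>v. deriv f x * v)) (at x)" if "x \<in> S" for x
        using holomorphic_derivI[OF Suc.prems assms(1) that] by (simp add: has_field_derivative_def)
      show "Ck k S (\<lambda>x. deriv f x * v)" for v
        using Suc.IH[OF holomorphic_deriv[OF Suc.prems assms(1)]] assms(1)
        by (intro Ck_mult Ck_const)
    qed (rule assms(1))
  qed
qed

text \<open>Both orders of differentiation are obtained by differentiating the fundamental theorem
  \<open>h(s,t) - h(s,0) = \<integral>\<^sub>0\<^sup>t \<partial>\<^sub>t h\<close> under the integral sign.\<close>

lemma mixed_partials_commute:
  fixes h hs ht hst :: "real \<Rightarrow> real \<Rightarrow> 'b::euclidean_space"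
  assumes d: "d > 0"
    and hs: "\<And>s t. \<bar>s\<bar> < d \<Longrightarrow> \<bar>t\<bar> < d \<Longrightarrow> ((\<lambda>s. h s t) has_vector_derivative hs s t) (at s)"
    and ht: "\<And>s t. \<bar>s\<bar> < d \<Longrightarrow> \<bar>t\<bar> < d \<Longrightarrow> ((\<lambda>t. h s t) has_vector_derivative ht s t) (at t)"
    and hst: "\<And>s t. \<bar>s\<bar> < d \<Longrightarrow> \<bar>t\<bar> < d \<Longrightarrow> ((\<lambda>s. ht s t) has_vector_derivative hst s t) (at s)"
    and cont: "continuous_on ({-d<..<d} \<times> {-d<..<d}) (\<lambda>(s, t). hst s t)"
  shows "((\<lambda>t. hs 0 t) has_vector_derivative hst 0 0) (at 0)"
proof -
  \<comment> \<open>A compact interval strictly inside the given one, on which both the fundamental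
    theorem and the Leibniz rule apply.\<close>
  define e where "e = d / 2"
  have e: "0 < e" "e < d" using d by (auto simp: e_def)
  define U where "U = {-e..e}"
  have U: "s \<in> U \<Longrightarrow> \<bar>s\<bar> < d" for s using e by (auto simp: U_def)
  have ftc: "(ht s has_integral (h s t - h s (-e))) {-e..t}" if "s \<in> U" "t \<in> U" for s t
    using that e by (intro fundamental_theorem_of_calculus)
      (auto simp: U_def intro!: has_vector_derivative_at_within[OF ht])
  have contU: "continuous_on (U \<times> cbox (-e) t) (\<lambda>(s, t). hst s t)" if "t \<in> U" for t
    using that e by (intro continuous_on_subset[OF cont]) (auto simp: U_def)
  \<comment> \<open>The s-derivative at 0 of h(s,t) - h(s,-e) is computed twice, directly and under
    the integral. The base point is -e, so that 0 is interior when this identity is differentiated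
    in t.\<close>
  have A: "hs 0 t = hs 0 (-e) + integral (cbox (-e) t) (hst 0)" if t: "t \<in> {-e<..<e}" for t
  proof -
    have tU: "t \<in> U" using t by (auto simp: U_def)
    have "((\<lambda>s. integral (cbox (-e) t) (ht s)) has_vector_derivative integral (cbox (-e) t) (hst 0)) (at 0 within U)"
    proof (rule leibniz_rule_vector_derivative)
      show "((\<lambda>s. ht s \<tau>) has_vector_derivative hst s \<tau>) (at s within U)" if "s \<in> U" "\<tau> \<in> cbox (-e) t" for s \<tau>
        using that tU e by (intro has_vector_derivative_at_within[OF hst]) (auto simp: U_def)
      show "ht s integrable_on cbox (-e) t" if "s \<in> U" for s
        using ftc[OF that tU] by auto
      show "continuous_on (U \<times> cbox (-e) t) (\<lambda>(s, t). hst s t)" using contU[OF tU] .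
      show "0 \<in> U" "convex U" using e by (auto simp: U_def)
    qed
    then have "((\<lambda>s. integral (cbox (-e) t) (ht s)) has_vector_derivative integral (cbox (-e) t) (hst 0)) (at 0)"
      using e at_within_interior[of 0 U] by (simp add: U_def)
    moreover have "integral (cbox (-e) t) (ht s) = h s t - h s (-e)" if "s \<in> {-e<..<e}" for s
      using ftc[of s t] that tU by (auto simp: U_def)
    ultimately have "((\<lambda>s. h s t - h s (-e)) has_vector_derivative integral (cbox (-e) t) (hst 0)) (at 0)"
      using e by - (erule has_vector_derivative_transform_within_open[where S="{-e<..<e}"], auto)
    moreover have "((\<lambda>s. h s t - h s (-e)) has_vector_derivative (hs 0 t - hs 0 (-e))) (at 0)"
      using e t by (intro has_vector_derivative_diff hs) auto
    ultimately show ?thesis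
      using vector_derivative_unique_at by fastforce
  qed
  have "continuous_on {-e..e} (hst 0)"
    using continuous_on_compose2[OF cont, of "{-e..e}" "\<lambda>t. (0, t)"] e
    by (force intro: continuous_on_Pair continuous_on_const continuous_on_id)
  then have "((\<lambda>t. integral {-e..t} (hst 0)) has_vector_derivative hst 0 0) (at 0 within {-e..e})"
    using e by (intro integral_has_vector_derivative) auto
  then have "((\<lambda>t. integral {-e..t} (hst 0)) has_vector_derivative hst 0 0) (at 0)"
    using e at_within_interior[of 0 "{-e..e}"] by simp
  then have "((\<lambda>t. hs 0 (-e) + integral (cbox (-e) t) (hst 0)) has_vector_derivative hst 0 0) (at 0)"
    by (intro derivative_eq_intros) auto
  then show ?thesis
    using A e by - (erule has_vector_derivative_transform_within_open[where S="{-e<..<e}"], auto)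
qed

text \<open>Restricting f to the plane x + s v + t w turns the two directional derivatives into
  ordinary partial derivatives in s and t.\<close>

lemma ddir_commute:
  fixes f :: "'a::real_normed_vector \<Rightarrow> 'b::euclidean_space"
  assumes S: "open S" "x \<in> S" and f: "smooth_on S f"
  shows "ddir v (ddir w f) x = ddir w (ddir v f) x"
proof -
  obtain r where r: "r > 0" "ball x r \<subseteq> S" using S openE by metis
  \<comment> \<open>Small enough to keep the whole parallelogram in the ball of radius r; the
    summand 1 avoids division by zero when both directions vanish.\<close>
  define d where "d = r / (norm v + norm w + 1)"
  have nz: "norm v + norm w + 1 > 0" by (simp add: add_nonneg_pos)
  have d: "d > 0" using r nz by (simp add: d_def)
  have inS: "x + (s *\<^sub>R v + t *\<^sub>R w) \<in> S" if "\<bar>s\<bar> < d" "\<bar>t\<bar> < d" for s t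
  proof -
    have "norm (s *\<^sub>R v + t *\<^sub>R w) \<le> \<bar>s\<bar> * norm v + \<bar>t\<bar> * norm w"
      using norm_triangle_ineq[of "s *\<^sub>R v" "t *\<^sub>R w"] by simp
    also have "\<dots> \<le> d * norm v + d * norm w"
      using that by (intro add_mono mult_right_mono) auto
    also have "\<dots> < d * (norm v + norm w + 1)" using d by (simp add: algebra_simps)
    also have "\<dots> = r" using nz by (simp add: d_def)
    finally have "x + (s *\<^sub>R v + t *\<^sub>R w) \<in> ball x r"
      by (metis add_diff_cancel_left' dist_commute dist_norm mem_ball)
    then show ?thesis using r(2) by blast
  qed
  have along: "((\<lambda>s. F (p + s *\<^sub>R q)) has_vector_derivative ddir q F (p + s *\<^sub>R q)) (at s)"
    if "p + s *\<^sub>R q \<in> S" "smooth_on S F" for F :: "'a \<Rightarrow> 'b" and p q s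
  proof -
    have "((\<lambda>s. p + s *\<^sub>R q) has_derivative (\<lambda>h. h *\<^sub>R q)) (at s)"
      by (auto intro!: derivative_eq_intros)
    from has_derivative_compose[OF this has_ddir[OF smooth_on_differentiable[OF that(2,1)]]]
    have "((\<lambda>s. F (p + s *\<^sub>R q)) has_derivative (\<lambda>h. ddir (h *\<^sub>R q) F (p + s *\<^sub>R q))) (at s)" .
    moreover have "ddir (h *\<^sub>R q) F (p + s *\<^sub>R q) = h *\<^sub>R ddir q F (p + s *\<^sub>R q)" for h
      using linear_frechet_derivative[OF smooth_on_differentiable[OF that(2,1)]]
      by (simp add: ddir_def linear_scale)
    ultimately show ?thesis by (simp add: has_vector_derivative_def)
  qed
  note sm = f smooth_on_ddir[OF f] smooth_on_ddir[OF smooth_on_ddir[OF f]]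
  have "((\<lambda>t. ddir v f (x + (0 *\<^sub>R v + t *\<^sub>R w))) has_vector_derivative ddir v (ddir w f) (x + (0 *\<^sub>R v + 0 *\<^sub>R w))) (at 0)"
  proof (rule mixed_partials_commute[OF d, where h="\<lambda>s t. f (x + (s *\<^sub>R v + t *\<^sub>R w))"
        and hs="\<lambda>s t. ddir v f (x + (s *\<^sub>R v + t *\<^sub>R w))"
        and ht="\<lambda>s t. ddir w f (x + (s *\<^sub>R v + t *\<^sub>R w))"
        and hst="\<lambda>s t. ddir v (ddir w f) (x + (s *\<^sub>R v + t *\<^sub>R w))"])
    fix s t :: real assume st: "\<bar>s\<bar> < d" "\<bar>t\<bar> < d"
    have e1: "x + (s' *\<^sub>R v + t *\<^sub>R w) = (x + t *\<^sub>R w) + s' *\<^sub>R v" for s' by simp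
    have e2: "x + (s *\<^sub>R v + t' *\<^sub>R w) = (x + s *\<^sub>R v) + t' *\<^sub>R w" for t' by simp
    show "((\<lambda>s. f (x + (s *\<^sub>R v + t *\<^sub>R w))) has_vector_derivative ddir v f (x + (s *\<^sub>R v + t *\<^sub>R w))) (at s)"
      "((\<lambda>s. ddir w f (x + (s *\<^sub>R v + t *\<^sub>R w))) has_vector_derivative ddir v (ddir w f) (x + (s *\<^sub>R v + t *\<^sub>R w))) (at s)"
      using inS[OF st] sm unfolding e1 by (auto intro!: along)
    show "((\<lambda>t. f (x + (s *\<^sub>R v + t *\<^sub>R w))) has_vector_derivative ddir w f (x + (s *\<^sub>R v + t *\<^sub>R w))) (at t)"
      using inS[OF st] sm unfolding e2 by (auto intro!: along)
  next
    show "continuous_on ({- d<..<d} \<times> {- d<..<d}) (\<lambda>(s, t). ddir v (ddir w f) (x + (s *\<^sub>R v + t *\<^sub>R w)))"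
      unfolding split_beta
      by (rule continuous_on_compose2[OF smooth_on_continuous[OF sm(3)]])
         (auto intro!: continuous_intros inS)
  qed
  moreover have "((\<lambda>t. ddir v f (x + t *\<^sub>R w)) has_vector_derivative ddir w (ddir v f) (x + 0 *\<^sub>R w)) (at 0)"
    using S(2) sm by (intro along) auto
  ultimately show ?thesis
    using vector_derivative_unique_at by fastforce
qed

section \<open>Differentiation under the integral sign\<close>

text \<open>Dominated convergence along an arbitrary sequence tending to x, applied to the
  normalized remainder of the linear approximation. The mean value inequality on the ball turns the
  bound on the derivative into one on the increments.\<close>

lemma has_derivative_integral_dominated:
  fixes F :: "'a::real_normed_vector \<Rightarrow> 's \<Rightarrow> 'b::{banach, second_countable_topology}"
  assumes e: "e > 0"
    and D: "\<And>y s. y \<in> ball x e \<Longrightarrow> s \<in> space M \<Longrightarrow> ((\<lambda>y. F y s) has_derivative D y s) (at y)"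
    and bd: "\<And>y s v. y \<in> ball x e \<Longrightarrow> s \<in> space M \<Longrightarrow> norm (D y s v) \<le> B s * norm v"
    and B0: "\<And>s. s \<in> space M \<Longrightarrow> 0 \<le> B s"
    and F: "\<And>y. y \<in> ball x e \<Longrightarrow> integrable M (F y)"
    and B: "integrable M B"
    and meas: "\<And>v. (\<lambda>s. D x s v) \<in> borel_measurable M"
  shows "((\<lambda>y. \<integral>s. F y s \<partial>M) has_derivative (\<lambda>v. \<integral>s. D x s v \<partial>M)) (at x)"
proof -
  have x: "x \<in> ball x e" using e by simp
  have iD: "integrable M (\<lambda>s. D x s v)" for v
    by (rule Bochner_Integration.integrable_bound[of _ "\<lambda>s. B s * norm v"])
       (use B meas bd[OF x] B0 in \<open>auto intro!: AE_I2\<close>)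
  have lin: "linear (D x s)" if "s \<in> space M" for s
    using D[OF x that] has_derivative_linear by blast
  have bl: "bounded_linear (\<lambda>v. \<integral>s. D x s v \<partial>M)"
  proof (rule bounded_linear_intro[where K="\<integral>s. B s \<partial>M"])
    show "(\<integral>s. D x s (v + w) \<partial>M) = (\<integral>s. D x s v \<partial>M) + (\<integral>s. D x s w \<partial>M)" for v w
      by (subst Bochner_Integration.integral_add[symmetric, OF iD iD])
         (auto intro!: Bochner_Integration.integral_cong simp: linear_add[OF lin])
    show "(\<integral>s. D x s (c *\<^sub>R v) \<partial>M) = c *\<^sub>R (\<integral>s. D x s v \<partial>M)" for c v
    proof -
      have "(\<integral>s. D x s (c *\<^sub>R v) \<partial>M) = (\<integral>s. c *\<^sub>R D x s v \<partial>M)"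
        by (intro Bochner_Integration.integral_cong) (auto simp: linear_scale[OF lin])
      then show ?thesis by simp
    qed
    show "norm (\<integral>s. D x s v \<partial>M) \<le> norm v * (\<integral>s. B s \<partial>M)" for v
    proof -
      have "norm (\<integral>s. D x s v \<partial>M) \<le> (\<integral>s. norm (D x s v) \<partial>M)" by (rule integral_norm_bound)
      also have "\<dots> \<le> (\<integral>s. B s * norm v \<partial>M)"
        using iD B bd[OF x] by (intro integral_mono) auto
      finally show ?thesis by (simp add: mult.commute)
    qed
  qed
  have lip: "norm (F y s - F x s) \<le> B s * norm (y - x)" if "y \<in> ball x e" "s \<in> space M" for y s
  proof (rule differentiable_bound[where S="ball x e" and f'="\<lambda>y. D y s"])
    show "((\<lambda>y. F y s) has_derivative D z s) (at z within ball x e)" if "z \<in> ball x e" for z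
      using D[OF that \<open>s \<in> space M\<close>] has_derivative_at_withinI by blast
    show "onorm (D z s) \<le> B s" if "z \<in> ball x e" for z
      using bd[OF that \<open>s \<in> space M\<close>] B0[OF \<open>s \<in> space M\<close>] by (intro onorm_bound) auto
  qed (use that x in auto)
  let ?f = "\<lambda>y. \<integral>s. F y s \<partial>M" and ?D = "\<lambda>v. \<integral>s. D x s v \<partial>M"
  let ?q = "\<lambda>y s. (F y s - F x s - D x s (y - x)) /\<^sub>R norm (y - x)"
  have eq: "((?f y - ?f x) - ?D (y - x)) /\<^sub>R norm (y - x) = (\<integral>s. ?q y s \<partial>M)" if "y \<in> ball x e" for y
    using F[OF that] F[OF x] iD by simp
  have "((\<lambda>y. ((?f y - ?f x) - ?D (y - x)) /\<^sub>R norm (y - x)) \<longlongrightarrow> 0) (at x within ball x e)"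
    unfolding tendsto_at_iff_sequentially o_def
  proof (intro allI impI)
    fix X assume X: "\<forall>i. X i \<in> ball x e - {x}" "X \<longlonglongrightarrow> x"
    have "(\<lambda>i. \<integral>s. ?q (X i) s \<partial>M) \<longlonglongrightarrow> (\<integral>s. 0 \<partial>M)"
    \<comment> \<open>One \<open>B s\<close> bounds the increment of \<open>F\<close>, the other its
      linear part.\<close>
    proof (rule integral_dominated_convergence[where w="\<lambda>s. 2 * B s"])
      show "(\<lambda>s. ?q (X i) s) \<in> borel_measurable M" for i
        using F[of "X i"] F[OF x] X(1) meas by (intro borel_measurable_scaleR borel_measurable_diff borel_measurable_const) auto
      show "integrable M (\<lambda>s. 2 * B s)" using B by simp
      show "AE s in M. (\<lambda>i. ?q (X i) s) \<longlonglongrightarrow> 0"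
      proof (rule AE_I2)
        fix s assume s: "s \<in> space M"
        have "((\<lambda>y. ?q y s) \<longlongrightarrow> 0) (at x)"
          using D[OF x s] unfolding has_derivative_at_within by blast
        then have "((\<lambda>y. ?q y s) \<longlongrightarrow> 0) (at x within ball x e)"
          using tendsto_within_subset by blast
        then show "(\<lambda>i. ?q (X i) s) \<longlonglongrightarrow> 0"
          unfolding tendsto_at_iff_sequentially o_def using X by blast
      qed
      show "AE s in M. norm (?q (X i) s) \<le> 2 * B s" for i
      proof (rule AE_I2)
        fix s assume s: "s \<in> space M"
        have Xi: "X i \<in> ball x e" "norm (X i - x) > 0" using X(1) by auto
        have "norm (F (X i) s - F x s - D x s (X i - x)) \<le> norm (F (X i) s - F x s) + norm (D x s (X i - x))"
          by (rule norm_triangle_ineq4)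
        also have "\<dots> \<le> B s * norm (X i - x) + B s * norm (X i - x)"
          using lip[OF Xi(1) s] bd[OF x s] by (rule add_mono)
        finally have "norm (F (X i) s - F x s - D x s (X i - x)) / norm (X i - x) \<le> 2 * B s"
          using Xi(2) by (simp add: pos_divide_le_eq)
        then show "norm (?q (X i) s) \<le> 2 * B s"
          by (simp only: norm_scaleR abs_norm_cancel norm_inverse divide_inverse_commute abs_inverse)
      qed
    qed simp
    then show "(\<lambda>i. ((?f (X i) - ?f x) - ?D (X i - x)) /\<^sub>R norm (X i - x)) \<longlonglongrightarrow> 0"
      using X(1) eq by (subst eq) auto
  qed
  then have "((\<lambda>y. ((?f y - ?f x) - ?D (y - x)) /\<^sub>R norm (y - x)) \<longlongrightarrow> 0) (at x)"
    using at_within_open[OF x open_ball] by metis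
  then show ?thesis
    using bl by (simp add: has_derivative_at_within)
qed

lemma has_derivative_set_integral_dominated:
  fixes F :: "'a::real_normed_vector \<Rightarrow> 's \<Rightarrow> 'b::{banach, second_countable_topology}"
  assumes e: "e > 0"
    and D: "\<And>y s. y \<in> ball x e \<Longrightarrow> s \<in> A \<Longrightarrow> ((\<lambda>y. F y s) has_derivative D y s) (at y)"
    and bd: "\<And>y s v. y \<in> ball x e \<Longrightarrow> s \<in> A \<Longrightarrow> norm (D y s v) \<le> B s * norm v"
    and B0: "\<And>s. s \<in> A \<Longrightarrow> 0 \<le> B s"
    and F: "\<And>y. y \<in> ball x e \<Longrightarrow> set_integrable M A (F y)"
    and B: "set_integrable M A B"
    and meas: "\<And>v. set_borel_measurable M A (\<lambda>s. D x s v)"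
  shows "((\<lambda>y. LINT s:A|M. F y s) has_derivative (\<lambda>v. LINT s:A|M. D x s v)) (at x)"
  unfolding set_lebesgue_integral_def
proof (rule has_derivative_integral_dominated[OF e, where D="\<lambda>y s v. indicator A s *\<^sub>R D y s v" and B="\<lambda>s. indicator A s * B s"])
  show "((\<lambda>y. indicat_real A s *\<^sub>R F y s) has_derivative (\<lambda>v. indicat_real A s *\<^sub>R D y s v)) (at y)"
    if "y \<in> ball x e" for y s
    using D[OF that] by (cases "s \<in> A") (auto intro: has_derivative_scaleR_right)
  show "norm (indicat_real A s *\<^sub>R D y s v) \<le> indicat_real A s * B s * norm v" if "y \<in> ball x e" for y s v
    using bd[OF that] by (cases "s \<in> A") auto
  show "0 \<le> indicat_real A s * B s" for s using B0 by (cases "s \<in> A") auto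
qed (use F B meas in \<open>simp_all add: set_integrable_def set_borel_measurable_def\<close>)

section \<open>Partial derivatives of scalars\<close>

abbreviation uncurried :: "scalar \<Rightarrow> real \<times> real \<times> complex \<Rightarrow> complex" where
  "uncurried F \<equiv> (\<lambda>(u, r, z). F u r z)"

abbreviation sm :: "(real \<times> real \<times> complex) set \<Rightarrow> scalar \<Rightarrow> bool" where
  "sm S F \<equiv> smooth_on S (uncurried F)"

text \<open>Differentiability slice by slice is what the rules for \<open>pd\<close> need. Tail
  integrals are handled at this level only: their differentiability jointly in (u, r, \<zeta>) is
  never established.\<close>

definition pdiff :: "scalar \<Rightarrow> real \<Rightarrow> real \<Rightarrow> complex \<Rightarrow> bool" where
  "pdiff F u r z \<longleftrightarrow> (\<lambda>v. F v r z) differentiable (at u) \<and> (\<lambda>s. F u s z) differentiable (at r)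
     \<and> F u r differentiable (at z)"

lemma dang_eqI:
  assumes "(h has_derivative D) (at z)"
  shows "dang A h z = (case A of Zeta \<Rightarrow> (D 1 - \<i> * D \<i>) / 2 | Zetabar \<Rightarrow> (D 1 + \<i> * D \<i>) / 2)"
  by (simp add: dang_def Let_def frechet_derivative_at[OF assms, symmetric])

lemma dang_cong:
  assumes "open X" "z \<in> X" "\<And>w. w \<in> X \<Longrightarrow> h w = k w"
  shows "dang A h z = dang A k z"
  using ddir_cong[OF assms] by (simp add: dang_def ddir_def Let_def split: ang.split)

lemma dang_add: "f differentiable (at z) \<Longrightarrow> g differentiable (at z) \<Longrightarrow>
    dang A (\<lambda>z. f z + g z) z = dang A f z + dang A g z"
  by (subst dang_eqI[OF has_derivative_add[OF has_ddir has_ddir]])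
     (auto simp: dang_def ddir_def Let_def field_simps split: ang.split)

lemma dang_mult: "f differentiable (at z) \<Longrightarrow> g differentiable (at z) \<Longrightarrow>
    dang A (\<lambda>z. f z * g z) z = f z * dang A g z + dang A f z * g z"
  by (subst dang_eqI[OF has_derivative_mult[OF has_ddir has_ddir]])
     (auto simp: dang_def ddir_def Let_def field_simps split: ang.split)

lemma dang_const: "dang A (\<lambda>z. c) z = 0"
  by (subst dang_eqI[OF has_derivative_const]) (auto split: ang.split)

lemma dang_chain:
  assumes "f differentiable (at z)" "(g has_field_derivative g') (at (f z))"
  shows "dang A (\<lambda>z. g (f z)) z = g' * dang A f z"
  by (subst dang_eqI[OF has_derivative_compose[OF has_ddir[OF assms(1)] assms(2)[unfolded has_field_derivative_def]]])
     (auto simp: dang_def ddir_def Let_def field_simps split: ang.split)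

lemma pd_add: "pdiff F u r z \<Longrightarrow> pdiff G u r z \<Longrightarrow>
    pd \<mu> (\<lambda>u r z. F u r z + G u r z) u r z = pd \<mu> F u r z + pd \<mu> G u r z"
  by (auto simp: pd_def pdiff_def dang_add split: coord.split)

lemma pd_mult: "pdiff F u r z \<Longrightarrow> pdiff G u r z \<Longrightarrow>
    pd \<mu> (\<lambda>u r z. F u r z * G u r z) u r z = F u r z * pd \<mu> G u r z + pd \<mu> F u r z * G u r z"
  by (auto simp: pd_def pdiff_def dang_mult split: coord.split)

lemma pd_const: "pd \<mu> (\<lambda>u r z. c) u r z = 0"
  by (auto simp: pd_def dang_const split: coord.split)

lemma pd_chain:
  assumes "pdiff F u r z" "(g has_field_derivative g') (at (F u r z))"
  shows "pd \<mu> (\<lambda>u r z. g (F u r z)) u r z = g' * pd \<mu> F u r z"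
proof -
  have "vector_derivative (\<lambda>v. g (h v)) (at x) = g' * vector_derivative h (at x)"
    if "h differentiable (at x)" "(g has_field_derivative g') (at (h x))" for h :: "real \<Rightarrow> complex" and x
    using that vector_derivative_works field_vector_diff_chain_at[of h _ x g g']
    by (metis (no_types, lifting) comp_def mult.commute vector_derivative_at ext)
  then show ?thesis
    using assms by (auto simp: pd_def pdiff_def dang_chain split: coord.split)
qed

lemma pdiff_const: "pdiff (\<lambda>u r z. c) u r z" by (simp add: pdiff_def)

lemma pdiff_add: "pdiff F u r z \<Longrightarrow> pdiff G u r z \<Longrightarrow> pdiff (\<lambda>u r z. F u r z + G u r z) u r z"
  by (auto simp: pdiff_def)

lemma pdiff_mult: "pdiff F u r z \<Longrightarrow> pdiff G u r z \<Longrightarrow> pdiff (\<lambda>u r z. F u r z * G u r z) u r z"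
  by (auto simp: pdiff_def)

lemma pdiff_minus: "pdiff F u r z \<Longrightarrow> pdiff (\<lambda>u r z. - F u r z) u r z"
  by (auto simp: pdiff_def)

lemma pdiff_diff: "pdiff F u r z \<Longrightarrow> pdiff G u r z \<Longrightarrow> pdiff (\<lambda>u r z. F u r z - G u r z) u r z"
  by (auto simp: pdiff_def)

lemma pdiff_inverse: "pdiff F u r z \<Longrightarrow> F u r z \<noteq> 0 \<Longrightarrow> pdiff (\<lambda>u r z. inverse (F u r z)) u r z"
  by (auto simp: pdiff_def)

lemma pdiff_sum: "(\<And>i. i \<in> I \<Longrightarrow> pdiff (F i) u r z) \<Longrightarrow> pdiff (\<lambda>u r z. \<Sum>i\<in>I. F i u r z) u r z"
  by (cases "finite I") (auto simp: pdiff_def)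

lemma pd_minus: "pdiff F u r z \<Longrightarrow> pd \<mu> (\<lambda>u r z. - F u r z) u r z = - pd \<mu> F u r z"
  using pd_mult[OF pdiff_const[of "-1"], of F u r z \<mu>] by (simp add: pd_const)

lemma pd_diff: "pdiff F u r z \<Longrightarrow> pdiff G u r z \<Longrightarrow>
    pd \<mu> (\<lambda>u r z. F u r z - G u r z) u r z = pd \<mu> F u r z - pd \<mu> G u r z"
  using pd_add[OF _ pdiff_minus, of F u r z G \<mu>] by (simp add: pd_minus)

lemma pd_sum: "finite I \<Longrightarrow> (\<And>i. i \<in> I \<Longrightarrow> pdiff (F i) u r z) \<Longrightarrow>
    pd \<mu> (\<lambda>u r z. \<Sum>i\<in>I. F i u r z) u r z = (\<Sum>i\<in>I. pd \<mu> (F i) u r z)"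
proof (induction I rule: finite_induct)
  case empty then show ?case by (simp add: pd_const)
next
  case (insert i I)
  then show ?case by (simp add: pd_add pdiff_sum)
qed

lemma pd_inverse: "pdiff F u r z \<Longrightarrow> F u r z \<noteq> 0 \<Longrightarrow>
    pd \<mu> (\<lambda>u r z. inverse (F u r z)) u r z = - (inverse (F u r z))\<^sup>2 * pd \<mu> F u r z"
  by (subst pd_chain[OF _ DERIV_inverse]) (auto simp: power2_eq_square)

lemma pd_exp: "pdiff F u r z \<Longrightarrow> pd \<mu> (\<lambda>u r z. exp (F u r z)) u r z = exp (F u r z) * pd \<mu> F u r z"
  by (rule pd_chain) auto

lemma open_slices:
  assumes "open S" "(u, r, z) \<in> (S :: (real \<times> real \<times> complex) set)"
  shows "open {v. (v, r, z) \<in> S}" "open {s. (u, s, z) \<in> S}" "open {w. (u, r, w) \<in> S}"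
proof -
  have "continuous_on UNIV (\<lambda>v. (v, r, z))" "continuous_on UNIV (\<lambda>s. (u, s, z))"
    "continuous_on UNIV (\<lambda>w. (u, r, w))"
    by (intro continuous_intros)+
  from this[THEN open_vimage[OF assms(1)]]
  show "open {v. (v, r, z) \<in> S}" "open {s. (u, s, z) \<in> S}" "open {w. (u, r, w) \<in> S}"
    by (simp_all add: vimage_def)
qed

lemma vector_derivative_cong_open:
  assumes "open X" "x \<in> X" "\<And>y. y \<in> X \<Longrightarrow> f y = g y"
  shows "vector_derivative f (at x) = vector_derivative g (at x)"
proof -
  have "(f has_vector_derivative D) (at x) \<longleftrightarrow> (g has_vector_derivative D) (at x)" for D
    using assms has_vector_derivative_transform_within_open by metis
  then show ?thesis by (simp add: vector_derivative_def)
qed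

lemma pd_cong:
  assumes S: "open S" "(u, r, z) \<in> S" and eq: "\<And>u r z. (u, r, z) \<in> S \<Longrightarrow> F u r z = G u r z"
  shows "pd \<mu> F u r z = pd \<mu> G u r z"
proof (cases \<mu>)
  case Cu
  then show ?thesis
    using vector_derivative_cong_open[OF open_slices(1)[OF S], of u "\<lambda>v. F v r z" "\<lambda>v. G v r z"] S eq
    by (simp add: pd_def)
next
  case Cr
  then show ?thesis
    using vector_derivative_cong_open[OF open_slices(2)[OF S], of r "\<lambda>v. F u v z" "\<lambda>v. G u v z"] S eq
    by (simp add: pd_def)
next
  case (Cx A)
  then show ?thesis
    using dang_cong[OF open_slices(3)[OF S], of z "F u r" "G u r"] S eq
    by (simp add: pd_def)
qed

lemma pdiff_cong:
  assumes S: "open S" "(u, r, z) \<in> S" and eq: "\<And>u r z. (u, r, z) \<in> S \<Longrightarrow> F u r z = G u r z"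
  shows "pdiff F u r z \<longleftrightarrow> pdiff G u r z"
  using differentiable_cong_open[OF open_slices(1)[OF S], of u "\<lambda>v. F v r z" "\<lambda>v. G v r z"]
    differentiable_cong_open[OF open_slices(2)[OF S], of r "\<lambda>v. F u v z" "\<lambda>v. G u v z"]
    differentiable_cong_open[OF open_slices(3)[OF S], of z "F u r" "G u r"] S eq
  by (simp add: pdiff_def)

text \<open>Coefficients of the operator \<open>pd \<mu>\<close> in the real directions u, r, Re \<open>\<zeta>\<close>, Im \<open>\<zeta>\<close>.\<close>

fun dir_vec :: "nat \<Rightarrow> real \<times> real \<times> complex" where
  "dir_vec 0 = (1, 0, 0)"
| "dir_vec (Suc 0) = (0, 1, 0)"
| "dir_vec (Suc (Suc 0)) = (0, 0, 1)"
| "dir_vec (Suc (Suc (Suc n))) = (0, 0, \<i>)"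

fun dir_coeff :: "coord \<Rightarrow> nat \<Rightarrow> complex" where
  "dir_coeff Cu n = (if n = 0 then 1 else 0)"
| "dir_coeff Cr n = (if n = 1 then 1 else 0)"
| "dir_coeff (Cx Zeta) n = (if n = 2 then 1 / 2 else if n = 3 then - \<i> / 2 else 0)"
| "dir_coeff (Cx Zetabar) n = (if n = 2 then 1 / 2 else if n = 3 then \<i> / 2 else 0)"

lemma slice_derivatives:
  assumes "uncurried F differentiable (at (u, r, z))"
  shows "((\<lambda>v. F v r z) has_vector_derivative ddir (1, 0, 0) (uncurried F) (u, r, z)) (at u)"
    and "((\<lambda>s. F u s z) has_vector_derivative ddir (0, 1, 0) (uncurried F) (u, r, z)) (at r)"
    and "(F u r has_derivative (\<lambda>v. ddir (0, 0, v) (uncurried F) (u, r, z))) (at z)"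
proof -
  note D = has_ddir[OF assms]
  note lin = has_derivative_linear[OF D]
  have "((\<lambda>v. (v, r, z)) has_derivative (\<lambda>h. (h, 0, 0))) (at u)"
    by (auto intro!: derivative_eq_intros simp: zero_prod_def)
  from has_derivative_compose[OF this D]
  have "((\<lambda>v. F v r z) has_derivative (\<lambda>h. ddir (h *\<^sub>R (1, 0, 0)) (uncurried F) (u, r, z))) (at u)" by simp
  then show "((\<lambda>v. F v r z) has_vector_derivative ddir (1, 0, 0) (uncurried F) (u, r, z)) (at u)"
    unfolding has_vector_derivative_def linear_scale[OF lin] .
  have "((\<lambda>s. (u, s, z)) has_derivative (\<lambda>h. (0, h, 0))) (at r)"
    by (auto intro!: derivative_eq_intros)
  from has_derivative_compose[OF this D]
  have "((\<lambda>s. F u s z) has_derivative (\<lambda>h. ddir (h *\<^sub>R (0, 1, 0)) (uncurried F) (u, r, z))) (at r)" by simp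
  then show "((\<lambda>s. F u s z) has_vector_derivative ddir (0, 1, 0) (uncurried F) (u, r, z)) (at r)"
    unfolding has_vector_derivative_def linear_scale[OF lin] .
  have "((\<lambda>w. (u, r, w)) has_derivative (\<lambda>h. (0, 0, h))) (at z)"
    by (auto intro!: derivative_eq_intros)
  from has_derivative_compose[OF this D]
  show "(F u r has_derivative (\<lambda>v. ddir (0, 0, v) (uncurried F) (u, r, z))) (at z)" by simp
qed

lemma pdiff_of_differentiable: "uncurried F differentiable (at (u, r, z)) \<Longrightarrow> pdiff F u r z"
  using slice_derivatives[of F u r z]
  by (auto simp: pdiff_def intro: differentiableI_vector differentiableI)

text \<open>Expressing \<open>pd\<close> with constant coefficients in four fixed real directions
  lets smoothness and commutation pass from \<open>ddir\<close> to Wirtinger derivatives.\<close>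

lemma pd_eq_ddir:
  assumes "uncurried F differentiable (at (u, r, z))"
  shows "pd \<mu> F u r z = (\<Sum>n<4. dir_coeff \<mu> n * ddir (dir_vec n) (uncurried F) (u, r, z))"
proof -
  note D = slice_derivatives[OF assms]
  have n4: "{..<4::nat} = {0, 1, 2, 3}" by auto
  show ?thesis
    unfolding n4
  proof (cases \<mu>)
    case (Cx A)
    then show "pd \<mu> F u r z = (\<Sum>n\<in>{0, 1, 2, 3}. dir_coeff \<mu> n * ddir (dir_vec n) (uncurried F) (u, r, z))"
      by (cases A) (auto simp: pd_def dang_eqI[OF D(3)] numeral_2_eq_2 numeral_3_eq_3 field_simps)
  qed (auto simp: pd_def vector_derivative_at[OF D(1)] vector_derivative_at[OF D(2)]
          numeral_2_eq_2 numeral_3_eq_3)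
qed

lemma smooth_on_sum:
  assumes "open S" "\<And>i. i \<in> I \<Longrightarrow> smooth_on S (f i)"
  shows "smooth_on S (\<lambda>x. \<Sum>i\<in>I. f i x)"
  using assms(2)
  by (induction I rule: infinite_finite_induct) (auto intro: smooth_on_const smooth_on_add assms(1))

lemma sm_pdiff: "sm S F \<Longrightarrow> (u, r, z) \<in> S \<Longrightarrow> pdiff F u r z"
  by (intro pdiff_of_differentiable smooth_on_differentiable)

lemma sm_pd:
  assumes "open S" "sm S F"
  shows "sm S (pd \<mu> F)"
proof -
  have "sm S (pd \<mu> F) \<longleftrightarrow> smooth_on S (\<lambda>x. \<Sum>n<4. dir_coeff \<mu> n * ddir (dir_vec n) (uncurried F) x)"
    by (rule smooth_on_cong[OF assms(1)])
       (auto simp: pd_eq_ddir[OF smooth_on_differentiable[OF assms(2)]] simp del: dir_vec.simps dir_coeff.simps)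
  then show ?thesis
    using assms by (auto intro!: smooth_on_sum smooth_on_mult smooth_on_const smooth_on_ddir)
qed

lemma pd_commute:
  assumes S: "open S" "sm S F" "(u, r, z) \<in> S"
  shows "pd \<mu> (pd \<nu> F) u r z = pd \<nu> (pd \<mu> F) u r z"
proof -
  have *: "pd \<mu> (pd \<nu> F) u r z = (\<Sum>m<4. \<Sum>n<4. dir_coeff \<mu> m * dir_coeff \<nu> n *
      ddir (dir_vec m) (ddir (dir_vec n) (uncurried F)) (u, r, z))" for \<mu> \<nu>
  proof -
    let ?P = "\<lambda>x. \<Sum>n<4. dir_coeff \<nu> n * ddir (dir_vec n) (uncurried F) x"
    have "ddir v (uncurried (pd \<nu> F)) (u, r, z) = ddir v ?P (u, r, z)" for v
      by (rule ddir_cong[OF S(1,3)]) (auto simp: pd_eq_ddir[OF smooth_on_differentiable[OF S(2)]])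
    also have "ddir v ?P (u, r, z) = (\<Sum>n<4. dir_coeff \<nu> n * ddir v (ddir (dir_vec n) (uncurried F)) (u, r, z))" for v
      using S by (intro ddir_eqI has_derivative_sum has_derivative_mult_right has_ddir
          smooth_on_differentiable[OF smooth_on_ddir])
    finally show ?thesis
      by (subst pd_eq_ddir[OF smooth_on_differentiable[OF sm_pd[OF S(1,2)] S(3)]])
         (simp add: sum_distrib_left mult.assoc)
  qed
  show ?thesis
    unfolding *[of \<mu> \<nu>] *[of \<nu> \<mu>] ddir_commute[OF S(1,3,2), of "dir_vec _" "dir_vec _"]
    apply (subst sum.swap)
    apply (rule sum.cong[OF refl])
    apply (rule sum.cong[OF refl])
    by (simp add: mult.commute ddir_commute[OF S(1,3,2)])
qed

section \<open>Integrals over a variable interval\<close>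

text \<open>Each of the finitely many basis directions is bounded by compactness, and linearity in
  the direction does the rest. This supplies the constant dominating function for integrals over
  compact intervals.\<close>

lemma ddir_bound_compact:
  fixes G :: "'a::euclidean_space \<Rightarrow> 'b::real_normed_vector"
  assumes G: "smooth_on S G" and K: "compact K" "K \<subseteq> S"
  shows "\<exists>B\<ge>0. \<forall>p\<in>K. \<forall>v. norm (ddir v G p) \<le> B * norm v"
proof -
  have "\<exists>M. \<forall>p\<in>K. norm (ddir b G p) \<le> M" for b
  proof -
    have "continuous_on K (ddir b G)"
      using smooth_on_continuous[OF smooth_on_ddir[OF G]] K(2) continuous_on_subset by blast
    then have "bounded (ddir b G ` K)"
      using compact_continuous_image[OF _ K(1)] compact_imp_bounded by blast
    then show ?thesis by (auto simp: bounded_iff)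
  qed
  then obtain M where M: "\<And>p b. p \<in> K \<Longrightarrow> norm (ddir b G p) \<le> M b" by metis
  let ?B = "\<Sum>b\<in>Basis. \<bar>M b\<bar>"
  have "norm (ddir v G p) \<le> ?B * norm v" if p: "p \<in> K" for p v
  proof -
    have lin: "linear (\<lambda>v. ddir v G p)"
      using has_derivative_linear[OF has_ddir[OF smooth_on_differentiable[OF G]]] p K(2) by blast
    have "ddir v G p = ddir (\<Sum>b\<in>Basis. (v \<bullet> b) *\<^sub>R b) G p" by (simp add: euclidean_representation)
    also have "\<dots> = (\<Sum>b\<in>Basis. (v \<bullet> b) *\<^sub>R ddir b G p)"
      by (simp add: linear_sum[OF lin] linear_scale[OF lin])
    also have "norm \<dots> \<le> (\<Sum>b\<in>Basis. norm v * \<bar>M b\<bar>)"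
    proof (rule sum_norm_le)
      fix b :: 'a assume b: "b \<in> Basis"
      show "norm ((v \<bullet> b) *\<^sub>R ddir b G p) \<le> norm v * \<bar>M b\<bar>"
        using Basis_le_norm[OF b, of v] M[OF p, of b] by (auto intro!: mult_mono)
    qed
    also have "\<dots> = ?B * norm v" by (simp add: sum_distrib_left mult.commute)
    finally show ?thesis .
  qed
  then show ?thesis by (intro exI[of _ ?B]) (auto intro: sum_nonneg)
qed

lemma interval_subsetI:
  fixes J :: "real set"
  assumes "is_interval J" "a \<in> J" "b \<in> J"
  shows "{min a b..max a b} \<subseteq> J"
proof
  fix x assume "x \<in> {min a b..max a b}"
  moreover have "min a b \<in> J" "max a b \<in> J" using assms by (simp_all add: min_def max_def)
  ultimately show "x \<in> J" using mem_is_interval_1_I[OF assms(1), of "min a b" "max a b" x] by simp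
qed

lemma interval_integrable_on_interval:
  fixes g :: "real \<Rightarrow> 'b::{banach, second_countable_topology}"
  assumes "is_interval J" "a \<in> J" "b \<in> J" "continuous_on J g"
  shows "interval_lebesgue_integrable lborel (ereal a) (ereal b) g"
proof (cases "a \<le> b")
  case True
  then show ?thesis
    using interval_subsetI[OF assms(1-3)] continuous_on_subset[OF assms(4)]
    by (intro interval_integrable_continuous_on) (auto simp: min_def max_def)
next
  case False
  then show ?thesis
    using interval_subsetI[OF assms(1-3)] continuous_on_subset[OF assms(4)]
    by (subst interval_integrable_endpoints_reverse, intro interval_integrable_continuous_on)
       (auto simp: min_def max_def)
qed

text \<open>The fundamental theorem gives a derivative within a compact interval. Enlarging the
  interval between a and u by \<open>e\<close> inside \<open>J\<close> makes u an interior point,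
  and covers both orders of a and u.\<close>

lemma has_vector_derivative_upper_limit:
  fixes g :: "real \<Rightarrow> 'b::euclidean_space"
  assumes J: "open J" "is_interval J" and ab: "a \<in> J" "u \<in> J" and g: "continuous_on J g"
  shows "((\<lambda>u. LBINT v=a..ereal u. g v) has_vector_derivative g u) (at u)"
proof -
  obtain e where e: "e > 0" "cball (min a u) e \<subseteq> J" "cball (max a u) e \<subseteq> J"
  proof -
    have m: "min a u \<in> J" "max a u \<in> J" using ab by (auto simp: min_def max_def)
    obtain e1 e2 where "e1 > 0" "cball (min a u) e1 \<subseteq> J" "e2 > 0" "cball (max a u) e2 \<subseteq> J"
      using J(1) m open_contains_cball by metis
    then show ?thesis by (intro that[of "min e1 e2"]) (auto simp: cball_def)
  qed
  let ?l = "min a u - e" and ?h = "max a u + e"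
  have "?l \<in> J" "?h \<in> J" using e by (auto simp: dist_real_def)
  then have sub: "{?l..?h} \<subseteq> J" using interval_subsetI[OF J(2), of ?l ?h] e(1) by (simp add: min_def max_def split: if_splits)
  have "((\<lambda>u. LBINT v=a..ereal u. g v) has_vector_derivative g u) (at u within {?l..?h})"
    using e(1) by (intro interval_integral_FTC2 continuous_on_subset[OF g sub]) auto
  moreover have "u \<in> interior {?l..?h}" using e(1) by auto
  ultimately show ?thesis by (metis at_within_interior)
qed

lemma has_derivative_interval_integral_param:
  fixes G :: "real \<times> 'a::euclidean_space \<Rightarrow> 'b::euclidean_space"
  assumes J: "open J" "is_interval J" "0 \<in> J" "u \<in> J" and X: "open X" "x \<in> X"
    and G: "smooth_on (J \<times> X) G"
  shows "((\<lambda>x. LBINT v=0..ereal u. G (v, x)) has_derivative (\<lambda>y. LBINT v=0..ereal u. ddir (0, y) G (v, x))) (at x)"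
proof -
  let ?A = "{min 0 u<..<max 0 u}"
  have sub: "{min 0 u..max 0 u} \<subseteq> J" by (rule interval_subsetI[OF J(2-4)])
  obtain e where e: "e > 0" "cball x e \<subseteq> X" using X open_contains_cball by metis
  let ?K = "{min 0 u..max 0 u} \<times> cball x e"
  have K: "compact ?K" "?K \<subseteq> J \<times> X" using sub e by (auto intro: compact_Times)
  obtain B where B: "B \<ge> 0" "\<And>p v. p \<in> ?K \<Longrightarrow> norm (ddir v G p) \<le> B * norm v"
    using ddir_bound_compact[OF G K] by blast
  have cont: "continuous_on {min 0 u..max 0 u} (\<lambda>v. H (v, y))"
    if "smooth_on (J \<times> X) H" "y \<in> X" for H :: "real \<times> 'a \<Rightarrow> 'b" and y
    by (rule continuous_on_compose2[OF smooth_on_continuous[OF that(1)]])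
       (use that sub in \<open>auto intro!: continuous_intros\<close>)
  have int: "set_integrable lborel ?A (\<lambda>v. H (v, y))"
    if "smooth_on (J \<times> X) H" "y \<in> X" for H :: "real \<times> 'a \<Rightarrow> 'b" and y
    by (rule set_integrable_subset[OF borel_integrable_atLeastAtMost'[OF cont[OF that]]]) auto
  have D: "((\<lambda>x. LINT v:?A|lborel. G (v, x)) has_derivative (\<lambda>y. LINT v:?A|lborel. ddir (0, y) G (v, x))) (at x)"
  proof (rule has_derivative_set_integral_dominated[OF e(1), where D="\<lambda>x v y. ddir (0, y) G (v, x)" and B="\<lambda>_. B"])
    show "((\<lambda>y. G (v, y)) has_derivative (\<lambda>w. ddir (0, w) G (v, y))) (at y)" if "y \<in> ball x e" "v \<in> ?A" for y v
    proof -
      have "(v, y) \<in> J \<times> X" using that e sub by (auto simp: subset_eq)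
      moreover have "((\<lambda>y. (v, y)) has_derivative (\<lambda>w. (0, w))) (at y)"
        by (auto intro!: derivative_eq_intros)
      ultimately show ?thesis
        using has_derivative_compose has_ddir[OF smooth_on_differentiable[OF G]] by blast
    qed
    show "norm (ddir (0, w) G (v, y)) \<le> B * norm w" if "y \<in> ball x e" "v \<in> ?A" for y v w
      using B(2)[of "(v, y)" "(0, w)"] that by (auto simp: norm_Pair)
    show "set_integrable lborel ?A (\<lambda>v. G (v, y))" if "y \<in> ball x e" for y
      using e that by (intro int[OF G]) auto
    show "set_integrable lborel ?A (\<lambda>_. B)"
      by (rule set_integrable_subset[OF borel_integrable_atLeastAtMost'[of "min 0 u" "max 0 u"]]) auto
    show "set_borel_measurable lborel ?A (\<lambda>v. ddir (0, w) G (v, x))" for w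
      using int[OF smooth_on_ddir[OF G] X(2)] unfolding set_integrable_def set_borel_measurable_def by auto
  qed (use B in auto)
  show ?thesis
  proof (cases "0 \<le> u")
    case True
    then show ?thesis using D by (simp add: interval_lebesgue_integral_def min_def max_def zero_ereal_def)
  next
    case False
    then show ?thesis using has_derivative_minus[OF D]
      by (simp add: interval_lebesgue_integral_def min_def max_def zero_ereal_def)
  qed
qed

text \<open>The criterion for joint differentiability asks for one partial derivative at the point
  and for the other near it, with continuity. The derivative in u is G(u, x) and hence continuous,
  so the pair is swapped to put u second and swapped back at the end.\<close>

lemma has_derivative_interval_integral_joint:
  fixes G :: "real \<times> 'a::euclidean_space \<Rightarrow> 'b::euclidean_space"
  assumes J: "open J" "is_interval J" "0 \<in> J" "u \<in> J" and X: "open X" "x \<in> X"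
    and G: "smooth_on (J \<times> X) G"
  shows "((\<lambda>(u, x). LBINT v=0..ereal u. G (v, x)) has_derivative
    (\<lambda>(a, y). a *\<^sub>R G (u, x) + (LBINT v=0..ereal u. ddir (0, y) G (v, x)))) (at (u, x))"
proof -
  obtain e where e: "e > 0" "ball u e \<subseteq> J" using J open_contains_ball by metis
  have uB: "u \<in> ball u e" using e by simp
  have "((\<lambda>(x, u). LBINT v=0..ereal u. G (v, x)) has_derivative
    (\<lambda>(y, a). (LBINT v=0..ereal u. ddir (0, y) G (v, x)) + blinfun_scaleR_left (G (u, x)) a)) (at (x, u) within X \<times> ball u e)"
  proof (rule has_derivative_partialsI[where f="\<lambda>x u. LBINT v=0..ereal u. G (v, x)" and fy="\<lambda>x u. blinfun_scaleR_left (G (u, x))"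
        and fx="\<lambda>y. LBINT v=0..ereal u. ddir (0, y) G (v, x)"])
    show "((\<lambda>x. LBINT v=0..ereal u. G (v, x)) has_derivative (\<lambda>y. LBINT v=0..ereal u. ddir (0, y) G (v, x))) (at x within X)"
      using has_derivative_interval_integral_param[OF J X G] has_derivative_at_withinI by blast
    show "((\<lambda>w. LBINT v=0..ereal w. G (v, y)) has_derivative blinfun_apply (blinfun_scaleR_left (G (w, y)))) (at w within ball u e)"
      if "y \<in> X" "w \<in> ball u e" for y w
    proof -
      have "continuous_on J (\<lambda>v. G (v, y))"
        by (rule continuous_on_compose2[OF smooth_on_continuous[OF G]])
           (use that in \<open>auto intro!: continuous_intros\<close>)
      moreover have "w \<in> J" using that e by blast
      ultimately have "((\<lambda>w. LBINT v=ereal 0..ereal w. G (v, y)) has_vector_derivative G (w, y)) (at w)"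
        by (intro has_vector_derivative_upper_limit[OF J(1,2,3)])
      then show ?thesis
        by (auto simp: has_vector_derivative_def zero_ereal_def intro: has_derivative_at_withinI)
    qed
    have "continuous (at (u, x)) G"
      using has_derivative_continuous[OF has_ddir[OF smooth_on_differentiable[OF G]]] J X by blast
    then have "isCont (\<lambda>p. G (snd p, fst p)) (x, u)"
      by (intro isCont_o2[where f="\<lambda>p. (snd p, fst p)" and g=G] continuous_intros) auto
    then have "continuous (at (x, u)) (\<lambda>p. blinfun_scaleR_left (G (snd p, fst p)))"
      by (rule bounded_linear.continuous[OF bounded_linear_blinfun_scaleR_left])
    then show "continuous (at (x, u) within X \<times> ball u e) (\<lambda>(x, u). blinfun_scaleR_left (G (u, x)))"
      unfolding split_beta by (rule continuous_at_imp_continuous_at_within)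
  qed (use uB in auto)
  then have D: "((\<lambda>(x, u). LBINT v=0..ereal u. G (v, x)) has_derivative
    (\<lambda>(y, a). (LBINT v=0..ereal u. ddir (0, y) G (v, x)) + a *\<^sub>R G (u, x))) (at (x, u))"
    using at_within_open[of "(x, u)" "X \<times> ball u e"] X uB by (simp add: open_Times)
  have "(prod.swap has_derivative prod.swap) (at (u, x))"
    unfolding prod.swap_def by (auto intro!: derivative_eq_intros)
  then have "((\<lambda>q. (\<lambda>p. LBINT v=0..ereal (snd p). G (v, fst p)) (prod.swap q)) has_derivative
      (\<lambda>q. (\<lambda>p. snd p *\<^sub>R G (u, x) + (LBINT v=0..ereal u. ddir (0, fst p) G (v, x))) (prod.swap q))) (at (u, x))"
    by (rule has_derivative_compose) (use D in \<open>simp add: case_prod_unfold add.commute\<close>)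
  then show ?thesis by (simp add: case_prod_unfold)
qed

text \<open>The derivative in direction (a, y) is a G plus an integral of the same kind with
  \<open>ddir (0, y) G\<close> as its integrand, so the induction on the order runs over all smooth
  integrands.\<close>

lemma smooth_on_interval_integral:
  fixes G :: "real \<times> 'a::euclidean_space \<Rightarrow> 'b::euclidean_space"
  assumes J: "open J" "is_interval J" "0 \<in> J" and X: "open X" and G: "smooth_on (J \<times> X) G"
  shows "smooth_on (J \<times> X) (\<lambda>(u, x). LBINT v=0..ereal u. G (v, x))"
proof (rule smooth_onI_Ck)
  fix k
  show "Ck k (J \<times> X) (\<lambda>(u, x). LBINT v=0..ereal u. G (v, x))"
    using G
  proof (induction k arbitrary: G)
    case 0
    show ?case
      unfolding Ck.simps
    proof (rule continuous_at_imp_continuous_on, safe)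
      fix u x assume "u \<in> J" "x \<in> X"
      then show "isCont (\<lambda>(u, x). LBINT v=0..ereal u. G (v, x)) (u, x)"
        using has_derivative_continuous[OF has_derivative_interval_integral_joint[OF J _ X _ 0]] by blast
    qed
  next
    case (Suc k)
    have op: "open (J \<times> X)" using J X by (simp add: open_Times)
    show ?case
    proof (rule Ck_SucI[OF op, where D="\<lambda>(u, x) (a, y). a *\<^sub>R G (u, x) + (LBINT v=0..ereal u. ddir (0, y) G (v, x))"])
      fix p assume "p \<in> J \<times> X"
      then show "((\<lambda>(u, x). LBINT v=0..ereal u. G (v, x)) has_derivative
          (case p of (u, x) \<Rightarrow> \<lambda>(a, y). a *\<^sub>R G (u, x) + (LBINT v=0..ereal u. ddir (0, y) G (v, x)))) (at p)"
        using has_derivative_interval_integral_joint[OF J _ X _ Suc.prems] by auto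
    next
      fix w :: "real \<times> 'a"
      have "Ck k (J \<times> X) (\<lambda>p. fst w *\<^sub>R G p)"
        by (rule Ck_bounded_linear_comp[OF bounded_linear_scaleR_right op smooth_on_imp_Ck[OF Suc.prems]])
      from Ck_add[OF op this Suc.IH[OF smooth_on_ddir[OF Suc.prems, of "(0, snd w)"]]]
      show "Ck k (J \<times> X) (\<lambda>p. (case p of (u, x) \<Rightarrow> \<lambda>(a, y). a *\<^sub>R G (u, x) + (LBINT v=0..ereal u. ddir (0, y) G (v, x))) w)"
        by (simp add: split_beta)
    qed
  qed
qed

definition int0 :: "scalar \<Rightarrow> scalar" where
  "int0 G u r z = (LBINT v=0..u. G v r z)"

context
  fixes J :: "real set" and X :: "(real \<times> complex) set" and G :: scalar
  assumes J: "open J" "is_interval J" "0 \<in> J" and X: "open X" and G: "sm (J \<times> X) G"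
begin

lemma int0_uncurried: "uncurried (int0 G) = (\<lambda>(u, x). LBINT v=0..ereal u. uncurried G (v, x))"
  by (auto simp: int0_def fun_eq_iff)

lemma sm_int0: "sm (J \<times> X) (int0 G)"
  unfolding int0_uncurried by (rule smooth_on_interval_integral[OF J X G])

lemma continuous_on_slice_u:
  assumes "sm (J \<times> X) H" "(r, z) \<in> X"
  shows "continuous_on J (\<lambda>v. H v r z)"
proof -
  have "continuous_on J (\<lambda>v. uncurried H (v, (r, z)))"
    by (rule continuous_on_compose2[OF smooth_on_continuous[OF assms(1)]])
       (use assms in \<open>auto intro!: continuous_intros\<close>)
  then show ?thesis by simp
qed

lemma pd_int0_u: "u \<in> J \<Longrightarrow> (r, z) \<in> X \<Longrightarrow> pd Cu (int0 G) u r z = G u r z"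
  using vector_derivative_at[OF has_vector_derivative_upper_limit[OF J _ continuous_on_slice_u[OF G], of u r z]]
  by (simp add: pd_def int0_def[abs_def] zero_ereal_def)

lemma pd_int0:
  assumes "\<mu> \<noteq> Cu" "u \<in> J" "(r, z) \<in> X"
  shows "pd \<mu> (int0 G) u r z = int0 (pd \<mu> G) u r z"
proof -
  have op: "open (J \<times> X)" using J X by (simp add: open_Times)
  have n4: "{..<4::nat} = {0, 1, 2, 3}" by auto
  \<comment> \<open>For \<open>\<mu> \<noteq> Cu\<close> the u-direction drops out, and the
    remaining directions (0, y) may be taken under the integral.\<close>
  have c0: "dir_coeff \<mu> 0 = 0" 
  proof (cases \<mu>)
    case (Cx A) then show ?thesis by (cases A) auto
  qed (use assms(1) in auto)
  have d: "ddir (0, y) (uncurried (int0 G)) (u, r, z) = (LBINT v=0..ereal u. ddir (0, y) (uncurried G) (v, r, z))" for y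
    unfolding int0_uncurried
    using ddir_eqI[OF has_derivative_interval_integral_joint[OF J assms(2) X assms(3) G], of "(0, y)"] by simp
  have integ: "interval_lebesgue_integrable lborel 0 u (\<lambda>v. ddir w (uncurried G) (v, r, z))" for w
  proof -
    have "sm (J \<times> X) (\<lambda>u r z. ddir w (uncurried G) (u, r, z))"
      using smooth_on_ddir[OF G, of w] by (simp add: split_beta)
    from interval_integrable_on_interval[OF J(2,3) assms(2) continuous_on_slice_u[OF this assms(3)]]
    show ?thesis by (simp add: zero_ereal_def)
  qed
  have "pd \<mu> (int0 G) u r z = (\<Sum>n<4. dir_coeff \<mu> n * ddir (dir_vec n) (uncurried (int0 G)) (u, r, z))"
    using assms by (intro pd_eq_ddir smooth_on_differentiable[OF sm_int0]) auto
  also have "\<dots> = (LBINT v=0..ereal u. (\<Sum>n<4. dir_coeff \<mu> n * ddir (dir_vec n) (uncurried G) (v, r, z)))"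
    unfolding n4 using integ
    by (simp add: c0 d numeral_2_eq_2 numeral_3_eq_3)
  also have "\<dots> = int0 (pd \<mu> G) u r z"
    unfolding int0_def
  proof (rule interval_integral_cong)
    fix v assume "v \<in> einterval (min 0 (ereal u)) (max 0 (ereal u))"
    then have "v \<in> {min 0 u..max 0 u}"
      by (auto simp: einterval_def min_def max_def zero_ereal_def split: if_splits)
    then have "(v, r, z) \<in> J \<times> X" using interval_subsetI[OF J(2,3) assms(2)] assms(3) by auto
    then show "(\<Sum>n<4. dir_coeff \<mu> n * ddir (dir_vec n) (uncurried G) (v, r, z)) = pd \<mu> G v r z"
      by (rule pd_eq_ddir[OF smooth_on_differentiable[OF G], symmetric])
  qed
  finally show ?thesis .
qed

end

section \<open>Growth in the radial coordinate\<close>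

locale region =
  fixes I :: "real set" and \<Omega> :: "complex set" and r0 :: real
  assumes open_I: "open I" and open_\<Omega>: "open \<Omega>"
begin

abbreviation "reg \<equiv> I \<times> {r0<..} \<times> \<Omega>"

lemma open_reg: "open reg"
  using open_I open_\<Omega> by (auto intro!: open_Times)

definition bnd :: "int \<Rightarrow> scalar \<Rightarrow> bool" where
  "bnd k F \<longleftrightarrow> (\<forall>K. compact K \<and> K \<subseteq> I \<times> \<Omega> \<longrightarrow>
     (\<exists>c. \<forall>\<^sub>F r in at_top. \<forall>(u, z)\<in>K. cmod (F u r z) \<le> c * r powi k))"

lemma bndE:
  assumes "bnd k F" "compact K" "K \<subseteq> I \<times> \<Omega>"
  obtains c R where "c \<ge> 0" "R \<ge> 1" "\<And>r u z. r \<ge> R \<Longrightarrow> (u, z) \<in> K \<Longrightarrow> cmod (F u r z) \<le> c * r powi k"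
proof -
  obtain c where "\<forall>\<^sub>F r in at_top. \<forall>(u, z)\<in>K. cmod (F u r z) \<le> c * r powi k"
    using assms unfolding bnd_def by blast
  then obtain R where R: "\<And>r. r \<ge> R \<Longrightarrow> \<forall>(u, z)\<in>K. cmod (F u r z) \<le> c * r powi k"
    unfolding eventually_at_top_linorder by blast
  show thesis
  proof (rule that[of "max c 0" "max R 1"])
    fix r u z assume r: "r \<ge> max R 1" and "(u, z) \<in> K"
    then have "cmod (F u r z) \<le> c * r powi k" using R[of r] by auto
    also have "\<dots> \<le> max c 0 * r powi k" using r by (intro mult_right_mono) auto
    finally show "cmod (F u r z) \<le> max c 0 * r powi k" .
  qed auto
qed

lemma bndI:
  assumes "\<And>K. compact K \<Longrightarrow> K \<subseteq> I \<times> \<Omega> \<Longrightarrow>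
    \<exists>c R. \<forall>r\<ge>R. \<forall>u z. (u, z) \<in> K \<longrightarrow> cmod (F u r z) \<le> c * r powi k"
  shows "bnd k F"
  unfolding bnd_def eventually_at_top_linorder using assms by (fast intro: case_prodI2)

lemma bnd_cong:
  assumes "\<And>u r z. u \<in> I \<Longrightarrow> r > R \<Longrightarrow> z \<in> \<Omega> \<Longrightarrow> F u r z = G u r z" "bnd k F"
  shows "bnd k G"
proof (rule bndI)
  fix K assume K: "compact K" "K \<subseteq> I \<times> \<Omega>"
  obtain c R' where R': "\<And>r u z. r \<ge> R' \<Longrightarrow> (u, z) \<in> K \<Longrightarrow> cmod (F u r z) \<le> c * r powi k"
    using bndE[OF assms(2) K] by metis
  show "\<exists>c R. \<forall>r\<ge>R. \<forall>u z. (u, z) \<in> K \<longrightarrow> cmod (G u r z) \<le> c * r powi k"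
    by (rule exI[of _ c], rule exI[of _ "max R' (R + 1)"])
       (use R' assms(1) K(2) in force)
qed

lemma bnd_mono: "bnd k F \<Longrightarrow> k \<le> l \<Longrightarrow> bnd l F"
proof (rule bndI)
  fix K assume F: "bnd k F" "k \<le> l" and K: "compact K" "K \<subseteq> I \<times> \<Omega>"
  obtain c R where R: "c \<ge> 0" "R \<ge> 1" "\<And>r u z. r \<ge> R \<Longrightarrow> (u, z) \<in> K \<Longrightarrow> cmod (F u r z) \<le> c * r powi k"
    using bndE[OF F(1) K] by metis
  have "c * r powi k \<le> c * r powi l" if "r \<ge> R" for r
    using R(1,2) that F(2) by (intro mult_left_mono power_int_increasing) auto
  then show "\<exists>c R. \<forall>r\<ge>R. \<forall>u z. (u, z) \<in> K \<longrightarrow> cmod (F u r z) \<le> c * r powi l"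
    using R(3) order_trans by meson
qed

lemma bnd_add: "bnd k F \<Longrightarrow> bnd k G \<Longrightarrow> bnd k (\<lambda>u r z. F u r z + G u r z)"
proof (rule bndI)
  fix K assume F: "bnd k F" "bnd k G" and K: "compact K" "K \<subseteq> I \<times> \<Omega>"
  obtain c R where R: "\<And>r u z. r \<ge> R \<Longrightarrow> (u, z) \<in> K \<Longrightarrow> cmod (F u r z) \<le> c * r powi k"
    using bndE[OF F(1) K] by metis
  obtain c' R' where R': "\<And>r u z. r \<ge> R' \<Longrightarrow> (u, z) \<in> K \<Longrightarrow> cmod (G u r z) \<le> c' * r powi k"
    using bndE[OF F(2) K] by metis
  have "cmod (F u r z + G u r z) \<le> (c + c') * r powi k" if "r \<ge> max R R'" "(u, z) \<in> K" for r u z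
    using norm_triangle_le[OF add_mono[OF R R'], of r u z] that by (simp add: distrib_right)
  then show "\<exists>c R. \<forall>r\<ge>R. \<forall>u z. (u, z) \<in> K \<longrightarrow> cmod (F u r z + G u r z) \<le> c * r powi k"
    by blast
qed

lemma bnd_mult: "bnd k F \<Longrightarrow> bnd l G \<Longrightarrow> bnd (k + l) (\<lambda>u r z. F u r z * G u r z)"
proof (rule bndI)
  fix K assume F: "bnd k F" "bnd l G" and K: "compact K" "K \<subseteq> I \<times> \<Omega>"
  obtain c R where R: "c \<ge> 0" "R \<ge> 1" "\<And>r u z. r \<ge> R \<Longrightarrow> (u, z) \<in> K \<Longrightarrow> cmod (F u r z) \<le> c * r powi k"
    using bndE[OF F(1) K] by metis
  obtain c' R' where R': "c' \<ge> 0" "\<And>r u z. r \<ge> R' \<Longrightarrow> (u, z) \<in> K \<Longrightarrow> cmod (G u r z) \<le> c' * r powi l"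
    using bndE[OF F(2) K] by metis
  have "cmod (F u r z * G u r z) \<le> (c * c') * r powi (k + l)" if "r \<ge> max R R'" "(u, z) \<in> K" for r u z
  proof -
    have "cmod (F u r z * G u r z) \<le> (c * r powi k) * (c' * r powi l)"
      unfolding norm_mult using R R' that by (intro mult_mono) auto
    also have "\<dots> = (c * c') * r powi (k + l)"
      using R(2) that by (subst power_int_add) auto
    finally show ?thesis .
  qed
  then show "\<exists>c R. \<forall>r\<ge>R. \<forall>u z. (u, z) \<in> K \<longrightarrow> cmod (F u r z * G u r z) \<le> c * r powi (k + l)"
    by blast
qed

lemma bnd_minus: "bnd k F \<Longrightarrow> bnd k (\<lambda>u r z. - F u r z)"
  by (simp add: bnd_def)

lemma bnd_diff: "bnd k F \<Longrightarrow> bnd k G \<Longrightarrow> bnd k (\<lambda>u r z. F u r z - G u r z)"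
  using bnd_add[OF _ bnd_minus, of k F G] by simp

lemma bnd_zero: "bnd k (\<lambda>u r z. 0)"
  unfolding bnd_def by (auto intro!: exI[of _ 0])

lemma bnd_sum: "(\<And>i. i \<in> A \<Longrightarrow> bnd k (F i)) \<Longrightarrow> bnd k (\<lambda>u r z. \<Sum>i\<in>A. F i u r z)"
  by (induction A rule: infinite_finite_induct) (auto intro: bnd_zero bnd_add)

lemma bnd_indep:
  assumes "continuous_on (I \<times> \<Omega>) (\<lambda>(u, z). a u z)"
  shows "bnd 0 (\<lambda>u r z. a u z)"
proof (rule bndI)
  fix K assume K: "compact K" "K \<subseteq> I \<times> \<Omega>"
  have "compact ((\<lambda>(u, z). a u z) ` K)"
    using compact_continuous_image[OF continuous_on_subset[OF assms K(2)] K(1)] .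
  then obtain c where "\<forall>x\<in>(\<lambda>(u, z). a u z) ` K. cmod x \<le> c"
    using compact_imp_bounded bounded_iff by metis
  then show "\<exists>c R. \<forall>r\<ge>R. \<forall>u z. (u, z) \<in> K \<longrightarrow> cmod (a u z) \<le> c * r powi 0"
    by (intro exI[of _ c]) force
qed

lemma bnd_rpow: "bnd k (\<lambda>u r z. of_real (r powi k))"
proof (rule bndI)
  fix K :: "(real \<times> complex) set"
  show "\<exists>c R. \<forall>r\<ge>R. \<forall>u z. (u, z) \<in> K \<longrightarrow> cmod (of_real (r powi k)) \<le> c * r powi k"
    by (rule exI[of _ 1], rule exI[of _ 1]) (auto simp del: of_real_power_int)
qed

lemma bnd_tendsto:
  assumes "bnd (-1) F" "u \<in> I" "z \<in> \<Omega>"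
  shows "((\<lambda>r. F u r z) \<longlongrightarrow> 0) at_top"
proof -
  obtain c R where R: "\<And>r u' z'. r \<ge> R \<Longrightarrow> (u', z') \<in> {(u, z)} \<Longrightarrow> cmod (F u' r z') \<le> c * r powi (-1)"
  proof -
    have "compact {(u, z)}" "{(u, z)} \<subseteq> I \<times> \<Omega>" using assms(2,3) by auto
    then show ?thesis using that bndE[OF assms(1)] by metis
  qed
  have "((\<lambda>r. c * r powi (-1)) \<longlongrightarrow> 0) at_top"
    unfolding power_int_minus power_int_1_right
    using tendsto_mult[OF tendsto_const[of c] tendsto_inverse_0_at_top[OF filterlim_ident]] by simp
  then show ?thesis
    by (rule Lim_null_comparison[rotated]) (use R in \<open>auto simp: eventually_at_top_linorder\<close>)
qed

section \<open>Orders of growth with one derivative\<close>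

definition "R1 = max r0 1"

text \<open>A symbol class cut off after one derivative: \<partial>_u and \<partial>_A keep the
  order, \<partial>_r lowers it by one. One derivative is enough because Lie derivatives and
  brackets contain only first derivatives of the fields. Since \<open>R1\<close> is at least 1,
  negative powers of r are differentiable on the range considered.\<close>

definition Ord :: "int \<Rightarrow> scalar \<Rightarrow> bool" where
  "Ord k F \<longleftrightarrow> (\<forall>u\<in>I. \<forall>r>R1. \<forall>z\<in>\<Omega>. pdiff F u r z) \<and> bnd k F
     \<and> (\<forall>\<mu>. bnd (k - (if \<mu> = Cr then 1 else 0)) (pd \<mu> F))"

lemma Ord_bnd: "Ord k F \<Longrightarrow> bnd k F" by (simp add: Ord_def)

lemma Ord_pd: "Ord k F \<Longrightarrow> bnd (k - (if \<mu> = Cr then 1 else 0)) (pd \<mu> F)" by (simp add: Ord_def)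

lemma Ord_pd_le: "Ord k F \<Longrightarrow> bnd k (pd \<mu> F)"
  by (rule bnd_mono[OF Ord_pd]) auto

lemma OrdI:
  assumes "\<And>u r z. u \<in> I \<Longrightarrow> r > R1 \<Longrightarrow> z \<in> \<Omega> \<Longrightarrow> pdiff F u r z" "bnd k F"
    "\<And>\<mu>. \<exists>G. (\<forall>u\<in>I. \<forall>r>R1. \<forall>z\<in>\<Omega>. pd \<mu> F u r z = G u r z) \<and> bnd (k - (if \<mu> = Cr then 1 else 0)) G"
  shows "Ord k F"
  unfolding Ord_def
proof (intro conjI allI)
  fix \<mu>
  obtain G where "\<And>u r z. u \<in> I \<Longrightarrow> r > R1 \<Longrightarrow> z \<in> \<Omega> \<Longrightarrow> G u r z = pd \<mu> F u r z"
    "bnd (k - (if \<mu> = Cr then 1 else 0)) G" using assms(3) by metis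
  then show "bnd (k - (if \<mu> = Cr then 1 else 0)) (pd \<mu> F)" by (rule bnd_cong)
qed (use assms in auto)

lemma Ord_cong:
  assumes eq: "\<And>u r z. u \<in> I \<Longrightarrow> r > R1 \<Longrightarrow> z \<in> \<Omega> \<Longrightarrow> F u r z = G u r z" and F: "Ord k F"
  shows "Ord k G"
proof (rule OrdI)
  let ?S = "I \<times> {R1<..} \<times> \<Omega>"
  have S: "open ?S" using open_I open_\<Omega> by (auto intro!: open_Times)
  show "bnd k G" using bnd_cong[OF eq Ord_bnd[OF F]] .
  fix u r z assume x: "u \<in> I" "r > R1" "z \<in> \<Omega>"
  show "pdiff G u r z"
    using pdiff_cong[OF S, of u r z F G] x eq F by (auto simp: Ord_def)
next
  let ?S = "I \<times> {R1<..} \<times> \<Omega>"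
  have S: "open ?S" using open_I open_\<Omega> by (auto intro!: open_Times)
  fix \<mu>
  have "pd \<mu> G u r z = pd \<mu> F u r z" if "u \<in> I" "r > R1" "z \<in> \<Omega>" for u r z
    using pd_cong[OF S, of u r z G F] that eq by auto
  then show "\<exists>H. (\<forall>u\<in>I. \<forall>r>R1. \<forall>z\<in>\<Omega>. pd \<mu> G u r z = H u r z) \<and> bnd (k - (if \<mu> = Cr then 1 else 0)) H"
    using Ord_pd[OF F] by blast
qed

lemma Ord_mono: "Ord k F \<Longrightarrow> k \<le> l \<Longrightarrow> Ord l F"
proof -
  assume F: "Ord k F" and l: "k \<le> l"
  have "bnd (l - (if \<mu> = Cr then 1 else 0)) (pd \<mu> F)" for \<mu>
    by (rule bnd_mono[OF Ord_pd[OF F]]) (use l in simp)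
  then show "Ord l F" using F bnd_mono[OF Ord_bnd[OF F] l] by (simp add: Ord_def)
qed

lemma Ord_add: assumes "Ord k F" "Ord k G" shows "Ord k (\<lambda>u r z. F u r z + G u r z)"
proof (rule OrdI)
  show "\<exists>H. (\<forall>u\<in>I. \<forall>r>R1. \<forall>z\<in>\<Omega>. pd \<mu> (\<lambda>u r z. F u r z + G u r z) u r z = H u r z)
      \<and> bnd (k - (if \<mu> = Cr then 1 else 0)) H" for \<mu>
    using assms
    by (intro exI[of _ "\<lambda>u r z. pd \<mu> F u r z + pd \<mu> G u r z"] conjI bnd_add Ord_pd)
       (auto simp: Ord_def pd_add)
qed (use assms in \<open>auto simp: Ord_def intro: pdiff_add bnd_add\<close>)

lemma Ord_minus: assumes "Ord k F" shows "Ord k (\<lambda>u r z. - F u r z)"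
proof (rule OrdI)
  show "\<exists>H. (\<forall>u\<in>I. \<forall>r>R1. \<forall>z\<in>\<Omega>. pd \<mu> (\<lambda>u r z. - F u r z) u r z = H u r z)
      \<and> bnd (k - (if \<mu> = Cr then 1 else 0)) H" for \<mu>
    using assms
    by (intro exI[of _ "\<lambda>u r z. - pd \<mu> F u r z"] conjI bnd_minus Ord_pd)
       (auto simp: Ord_def pd_minus)
qed (use assms in \<open>auto simp: Ord_def intro: pdiff_minus bnd_minus\<close>)

lemma Ord_diff: "Ord k F \<Longrightarrow> Ord k G \<Longrightarrow> Ord k (\<lambda>u r z. F u r z - G u r z)"
  using Ord_add[OF _ Ord_minus, of k F G] by simp

lemma Ord_mult: assumes "Ord k F" "Ord l G" shows "Ord (k + l) (\<lambda>u r z. F u r z * G u r z)"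
proof (rule OrdI)
  fix \<mu>
  let ?d = "if \<mu> = Cr then 1 else (0::int)"
  have "bnd (k + (l - ?d)) (\<lambda>u r z. F u r z * pd \<mu> G u r z)"
    by (rule bnd_mult[OF Ord_bnd[OF assms(1)] Ord_pd[OF assms(2)]])
  moreover have "bnd ((k - ?d) + l) (\<lambda>u r z. pd \<mu> F u r z * G u r z)"
    by (rule bnd_mult[OF Ord_pd[OF assms(1)] Ord_bnd[OF assms(2)]])
  ultimately have "bnd (k + l - ?d) (\<lambda>u r z. F u r z * pd \<mu> G u r z + pd \<mu> F u r z * G u r z)"
    by (intro bnd_add) (simp_all add: algebra_simps split: if_splits)
  moreover have "\<forall>u\<in>I. \<forall>r>R1. \<forall>z\<in>\<Omega>. pd \<mu> (\<lambda>u r z. F u r z * G u r z) u r z = F u r z * pd \<mu> G u r z + pd \<mu> F u r z * G u r z"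
    using assms by (auto simp: Ord_def pd_mult)
  ultimately show "\<exists>H. (\<forall>u\<in>I. \<forall>r>R1. \<forall>z\<in>\<Omega>. pd \<mu> (\<lambda>u r z. F u r z * G u r z) u r z = H u r z)
      \<and> bnd (k + l - ?d) H"
    by (intro exI[of _ "\<lambda>u r z. F u r z * pd \<mu> G u r z + pd \<mu> F u r z * G u r z"] conjI)
qed (use assms in \<open>auto simp: Ord_def intro: pdiff_mult bnd_mult\<close>)

lemma Ord_zero: "Ord k (\<lambda>u r z. 0)"
  by (rule OrdI) (auto simp: pd_const pdiff_const intro: bnd_zero)

lemma Ord_sum: "(\<And>i. i \<in> A \<Longrightarrow> Ord k (F i)) \<Longrightarrow> Ord k (\<lambda>u r z. \<Sum>i\<in>A. F i u r z)"
  by (induction A rule: infinite_finite_induct) (auto intro: Ord_zero Ord_add)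

text \<open>An upper bound on \<open>F\<close> says nothing about its inverse, so the bound for the
  inverse is an assumption; the derivative -F' / F^2 then has order -2k + k, lowered by one for
  \<partial>_r.\<close>

lemma Ord_inverse:
  assumes F: "Ord k F" and B: "bnd (-k) (\<lambda>u r z. inverse (F u r z))"
    and nz: "\<And>u r z. u \<in> I \<Longrightarrow> r > R1 \<Longrightarrow> z \<in> \<Omega> \<Longrightarrow> F u r z \<noteq> 0"
  shows "Ord (-k) (\<lambda>u r z. inverse (F u r z))"
proof (rule OrdI)
  fix \<mu>
  let ?d = "if \<mu> = Cr then 1 else (0::int)"
  have "bnd ((-k + -k) + (k - ?d)) (\<lambda>u r z. (inverse (F u r z) * inverse (F u r z)) * pd \<mu> F u r z)"
    by (intro bnd_mult B Ord_pd F)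
  from bnd_minus[OF this]
  have "bnd (-k - ?d) (\<lambda>u r z. - (inverse (F u r z))\<^sup>2 * pd \<mu> F u r z)"
    by (simp add: power2_eq_square algebra_simps split: if_splits)
  then show "\<exists>H. (\<forall>u\<in>I. \<forall>r>R1. \<forall>z\<in>\<Omega>. pd \<mu> (\<lambda>u r z. inverse (F u r z)) u r z = H u r z)
      \<and> bnd (-k - ?d) H"
    using F nz by (intro exI conjI) (auto simp: Ord_def pd_inverse)
qed (use assms in \<open>auto simp: Ord_def intro: pdiff_inverse\<close>)

text \<open>With the radial slot ranging over all reals the function may be read at r = 0, where
  compactness in (u, \<zeta>) bounds it and its tangential derivatives. The radial derivative
  vanishes, so it satisfies the lowered order trivially.\<close>

lemma Ord_indep:
  assumes "sm (I \<times> UNIV \<times> \<Omega>) (\<lambda>u r z. a u z)"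
  shows "Ord 0 (\<lambda>u r z. a u z)"
proof -
  have S: "open (I \<times> (UNIV :: real set) \<times> \<Omega>)" using open_I open_\<Omega> by (auto intro!: open_Times)
  have cont: "continuous_on (I \<times> \<Omega>) (\<lambda>(u, z). F u 0 z)" if "sm (I \<times> UNIV \<times> \<Omega>) F" for F
  proof -
    have "continuous_on (I \<times> \<Omega>) (\<lambda>p. uncurried F (fst p, 0, snd p))"
      by (rule continuous_on_compose2[OF smooth_on_continuous[OF that]])
         (auto intro!: continuous_intros)
    then show ?thesis by (simp add: split_beta)
  qed
  show ?thesis
  proof (rule OrdI)
    show "bnd 0 (\<lambda>u r z. a u z)" using bnd_indep[OF cont[OF assms]] .
    show "pdiff (\<lambda>u r z. a u z) u r z" if "u \<in> I" "r > R1" "z \<in> \<Omega>" for u r z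
      using sm_pdiff[OF assms] that by simp
    fix \<mu>
    show "\<exists>G. (\<forall>u\<in>I. \<forall>r>R1. \<forall>z\<in>\<Omega>. pd \<mu> (\<lambda>u r z. a u z) u r z = G u r z)
        \<and> bnd (0 - (if \<mu> = Cr then 1 else 0)) G"
    proof (cases "\<mu> = Cr")
      case True
      then show ?thesis by (auto simp: pd_def intro!: exI[of _ "\<lambda>u r z. 0"] bnd_zero)
    next
      case False
      have "pd \<mu> (\<lambda>u r z. a u z) u r z = pd \<mu> (\<lambda>u r z. a u z) u 0 z" for u r z
        using False by (cases \<mu>) (auto simp: pd_def)
      then show ?thesis
        using bnd_indep[OF cont[OF sm_pd[OF S assms, of \<mu>]]] False
        by (intro exI[of _ "\<lambda>u r z. pd \<mu> (\<lambda>u r z. a u z) u 0 z"]) auto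
    qed
  qed
qed

lemma Ord_rpow: "Ord k (\<lambda>u r z. of_real (r powi k))"
proof (rule OrdI)
  have D: "((\<lambda>s. complex_of_real (s powi k)) has_vector_derivative of_int k * of_real (r powi (k - 1))) (at r)" if "r > R1" for r
  proof -
    have "((\<lambda>s. s powi k) has_real_derivative of_int k * r powi (k - 1) * 1) (at r)"
      using that by (intro DERIV_power_int DERIV_ident) (auto simp: R1_def)
    then have "((\<lambda>s. complex_of_real (s powi k)) has_vector_derivative of_real (of_int k * r powi (k - 1))) (at r)"
      by (intro has_vector_derivative_of_real) (simp add: has_real_derivative_iff_has_vector_derivative)
    then show ?thesis by simp
  qed
  show "bnd k (\<lambda>u r z. of_real (r powi k))" by (rule bnd_rpow)
  show "pdiff (\<lambda>u r z. of_real (r powi k)) u r z" if "r > R1" for u r z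
    using differentiableI_vector[OF D[OF that]] by (auto simp: pdiff_def simp del: of_real_power_int)
  fix \<mu>
  show "\<exists>G. (\<forall>u\<in>I. \<forall>r>R1. \<forall>z\<in>\<Omega>. pd \<mu> (\<lambda>u r z. complex_of_real (r powi k)) u r z = G u r z)
        \<and> bnd (k - (if \<mu> = Cr then 1 else 0)) G"
  proof (cases "\<mu> = Cr")
    case True
    have "bnd (0 + (k - 1)) (\<lambda>u r z. of_int k * of_real (r powi (k - 1)))"
      by (rule bnd_mult[OF bnd_indep bnd_rpow]) (simp add: split_beta)
    then show ?thesis using True vector_derivative_at[OF D]
      by (intro exI[of _ "\<lambda>u r z. of_int k * of_real (r powi (k - 1))"]) (auto simp: pd_def simp del: of_real_power_int)
  next
    case False
    then show ?thesis
      by (intro exI[of _ "\<lambda>u r z. 0"]) (cases \<mu>, auto simp: pd_def dang_const intro: bnd_zero)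
  qed
qed

lemma asymp_O_bnd: "asymp_O I \<Omega> k F \<Longrightarrow> bnd (k - int (count_list ds Cr)) (foldr pd ds F)"
  unfolding asymp_O_def bnd_def by blast

lemma asymp_O_Ord:
  assumes "asymp_O I \<Omega> k F" "\<And>u r z. u \<in> I \<Longrightarrow> r > R1 \<Longrightarrow> z \<in> \<Omega> \<Longrightarrow> pdiff F u r z"
  shows "Ord k F"
proof -
  have "bnd k F" using asymp_O_bnd[OF assms(1), of "[]"] by simp
  moreover have "bnd (k - (if \<mu> = Cr then 1 else 0)) (pd \<mu> F)" for \<mu>
    using asymp_O_bnd[OF assms(1), of "[\<mu>]"] by (auto split: if_splits)
  ultimately show ?thesis using assms(2) by (simp add: Ord_def)
qed

lemma asymp_o_imp_O: "asymp_o I \<Omega> k F \<Longrightarrow> asymp_O I \<Omega> k F"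
  unfolding asymp_o_def asymp_O_def by (meson zero_less_one)

section \<open>Tail integrals\<close>

lemma uncurried_pair_derivative:
  assumes "uncurried F differentiable (at (u, r, z))"
  shows "((\<lambda>(u, z). F u r z) has_derivative (\<lambda>(a, v). ddir (a, 0, v) (uncurried F) (u, r, z))) (at (u, z))"
proof -
  have "((\<lambda>p. (fst p, r, snd p)) has_derivative (\<lambda>p. (fst p, 0, snd p))) (at (u, z))"
    by (auto intro!: derivative_eq_intros)
  from has_derivative_compose[OF this, of "uncurried F" "\<lambda>v. ddir v (uncurried F) (u, r, z)"] has_ddir[OF assms]
  show ?thesis by (simp add: case_prod_unfold)
qed

end

text \<open>The Wirtinger form of the differential. It lets the derivative of a tail integral be
  expressed through the tails of the \<open>pd\<close> of the integrand.\<close>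

lemma ddir_eq_pd:
  assumes "uncurried F differentiable (at (u, r, z))"
  shows "ddir (a, b, v) (uncurried F) (u, r, z) =
    of_real a * pd Cu F u r z + of_real b * pd Cr F u r z
    + v * pd (Cx Zeta) F u r z + cnj v * pd (Cx Zetabar) F u r z"
proof -
  note D = slice_derivatives[OF assms]
  have lin: "linear (\<lambda>v. ddir v (uncurried F) (u, r, z))"
    by (rule has_derivative_linear[OF has_ddir[OF assms]])
  have "(a, b, v) = a *\<^sub>R (1, 0, 0) + (b *\<^sub>R (0, 1, 0) + (Re v *\<^sub>R (0, 0, 1) + Im v *\<^sub>R (0, 0, \<i>)))"
    by (auto simp: complex_eq_iff)
  then have "ddir (a, b, v) (uncurried F) (u, r, z) =
     a *\<^sub>R ddir (1, 0, 0) (uncurried F) (u, r, z) + (b *\<^sub>R ddir (0, 1, 0) (uncurried F) (u, r, z)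
     + (Re v *\<^sub>R ddir (0, 0, 1) (uncurried F) (u, r, z) + Im v *\<^sub>R ddir (0, 0, \<i>) (uncurried F) (u, r, z)))"
    by (simp only: linear_add[OF lin] linear_scale[OF lin])
  moreover have "v * ((x - \<i> * y) / 2) + cnj v * ((x + \<i> * y) / 2) = of_real (Re v) * x + of_real (Im v) * y" for x y
    by (simp add: complex_eq_iff field_simps)
  ultimately show ?thesis
    by (simp add: pd_def vector_derivative_at[OF D(1)] vector_derivative_at[OF D(2)] dang_eqI[OF D(3)]
        scaleR_conv_of_real add.assoc)
qed

definition tail :: "scalar \<Rightarrow> scalar" where
  "tail P u r z = (LBINT s=r..\<infinity>. P u s z)"

lemma tail_eq: "tail P u r z = (LINT s:{r<..}|lborel. P u s z)"
  by (simp add: tail_def interval_integral_to_infinity_eq)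

lemma inverse_square_tail:
  fixes R :: real
  assumes "R > 0"
  shows "set_integrable lborel {R<..} (\<lambda>s. s powi (-2))"
    and "(LINT s:{R<..}|lborel. s powi (-2)) = inverse R"
proof -
  have D: "DERIV (\<lambda>s. - inverse s) s :> s powi (-2)" if "R < s" for s :: real
    using that assms by (auto intro!: derivative_eq_intros simp: power_int_minus power2_eq_square)
  have 1: "(((\<lambda>s. - inverse s) \<circ> real_of_ereal) \<longlongrightarrow> - inverse R) (at_right (ereal R))"
    using assms by (auto simp: ereal_tendsto_simps intro!: tendsto_intros)
  have 2: "(((\<lambda>s. - inverse s) \<circ> real_of_ereal) \<longlongrightarrow> 0) (at_left \<infinity>)"
    using tendsto_minus[OF tendsto_inverse_0_at_top[OF filterlim_ident]] by (simp add: ereal_tendsto_simps)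
  have c: "isCont (\<lambda>s::real. s powi (-2)) s" if "R < s" for s
    using that assms by (auto intro!: continuous_intros simp: power_int_minus)
  have nn: "AE s in lborel. ereal R < ereal s \<longrightarrow> ereal s < \<infinity> \<longrightarrow> 0 \<le> s powi (-2)"
    using assms by (intro AE_I2) auto
  note ftc = interval_integral_FTC_nonneg[OF _ _ _ nn 1 2]
  show "set_integrable lborel {R<..} (\<lambda>s. s powi (-2))"
    using ftc(1) D c by simp
  show "(LINT s:{R<..}|lborel. s powi (-2)) = inverse R"
    using ftc(2) D c by (simp add: interval_integral_to_infinity_eq)
qed

text \<open>Decay like s^-2 is known only for large s; up to \<open>R\<close> a constant takes over,
  to be scaled by a bound obtained from compactness.\<close>

definition dominator :: "real \<Rightarrow> real \<Rightarrow> real" where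
  "dominator R s = (if s \<le> R then 1 else s powi (-2))"

lemma dominator_nonneg: "0 < R \<Longrightarrow> 0 \<le> dominator R s"
  by (auto simp: dominator_def)

lemma set_integrable_dominator:
  assumes "0 < R"
  shows "set_integrable lborel {r<..} (dominator R)"
proof -
  have "set_integrable lborel ({min r R..R} \<union> {R<..}) (dominator R)"
  proof (rule set_integrable_Un)
    show "set_integrable lborel {min r R..R} (dominator R)"
    proof (subst set_integrable_cong[where M=lborel and M'=lborel and A'="{min r R..R}" and f'="\<lambda>_. 1::real"])
      show "set_integrable lborel {min r R..R} (\<lambda>_. 1::real)"
        by (rule borel_integrable_atLeastAtMost') auto
    qed (auto simp: dominator_def)
    show "set_integrable lborel {R<..} (dominator R)"
      by (subst set_integrable_cong[where M=lborel and M'=lborel and A'="{R<..}" and f'="\<lambda>s. s powi (-2)"])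
         (use inverse_square_tail(1)[OF assms] in \<open>auto simp: dominator_def\<close>)
  qed auto
  then show ?thesis by (rule set_integrable_subset) auto
qed

text \<open>The tail is split at a point \<open>a\<close> between r0 and r, so that only a finite
  integral with upper limit r depends on r.\<close>

lemma tail_radial_derivative:
  fixes g :: "real \<Rightarrow> complex"
  assumes g: "continuous_on {r0<..} g" and int: "\<And>r. r > r0 \<Longrightarrow> set_integrable lborel {r<..} g" and r: "r > r0"
  shows "((\<lambda>r. LINT s:{r<..}|lborel. g s) has_vector_derivative - g r) (at r)"
proof -
  define a where "a = (r0 + r) / 2"
  have a: "r0 < a" "a < r" using r by (auto simp: a_def)
  have split: "(LINT s:{x<..}|lborel. g s) = (LINT s:{a<..}|lborel. g s) - (LBINT s=a..x. g s)" if "a < x" for x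
  proof -
    have "(LBINT s=a..x. g s) + (LBINT s=x..\<infinity>. g s) = (LBINT s=a..\<infinity>. g s)"
      by (rule interval_integral_sum) (use that int[OF a(1)] in \<open>simp add: interval_lebesgue_integrable_def\<close>)
    then show ?thesis by (simp add: interval_integral_to_infinity_eq algebra_simps)
  qed
  have "((\<lambda>x. LBINT s=a..x. g s) has_vector_derivative g r) (at r)"
    using a r by (intro has_vector_derivative_upper_limit[where J="{r0<..}"] g) (auto simp: is_interval_1)
  from has_vector_derivative_diff[OF has_vector_derivative_const[of "LINT s:{a<..}|lborel. g s"] this]
  have "((\<lambda>x. (LINT s:{a<..}|lborel. g s) - (LBINT s=a..x. g s)) has_vector_derivative - g r) (at r)" by simp
  then show ?thesis
    by (rule has_vector_derivative_transform_within_open[where S="{a<..}"]) (use a split in auto)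
qed

context region
begin

lemma sm_slice_r: "sm reg P \<Longrightarrow> u \<in> I \<Longrightarrow> z \<in> \<Omega> \<Longrightarrow> continuous_on {r0<..} (\<lambda>s. P u s z)"
  using continuous_on_compose2[OF smooth_on_continuous[of reg "uncurried P"], of "{r0<..}" "\<lambda>s. (u, s, z)"]
  by (force intro: continuous_on_Pair continuous_on_const continuous_on_id)

text \<open>The bound is uniform over the compact set of (u, \<zeta>), as differentiation under the
  tail integral requires: the decay estimate serves beyond \<open>R\<close>, continuity on the
  compact stretch between r and \<open>R\<close> before it.\<close>

lemma dominated:
  assumes P: "sm reg P" "bnd (-2) P" and K: "compact K" "K \<subseteq> I \<times> \<Omega>" and r: "r > r0"
  obtains c R where "c \<ge> 0" "R > 0" "\<And>u z s. (u, z) \<in> K \<Longrightarrow> s \<ge> r \<Longrightarrow> cmod (P u s z) \<le> c * dominator R s"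
proof -
  obtain c R where R: "c \<ge> 0" "R \<ge> 1" "\<And>s u z. s \<ge> R \<Longrightarrow> (u, z) \<in> K \<Longrightarrow> cmod (P u s z) \<le> c * s powi (-2)"
    using bndE[OF P(2) K] by metis
  let ?g = "\<lambda>(s, u, z). P u s z"
  have "continuous_on ({r..R} \<times> K) (\<lambda>p. uncurried P (fst (snd p), fst p, snd (snd p)))"
    by (rule continuous_on_compose2[OF smooth_on_continuous[OF P(1)]])
       (use r K in \<open>auto intro!: continuous_intros\<close>)
  then have "compact (?g ` ({r..R} \<times> K))"
    by (intro compact_continuous_image compact_Times K) (auto simp: case_prod_unfold)
  then obtain d where "\<forall>x\<in>?g ` ({r..R} \<times> K). cmod x \<le> d"
    using compact_imp_bounded bounded_iff by metis
  then have d: "cmod (P u s z) \<le> d" if "(u, z) \<in> K" "r \<le> s" "s \<le> R" for u s z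
    using that by force
  show thesis
  proof (rule that[of "max c d" R])
    fix u z s assume uz: "(u, z) \<in> K" "s \<ge> r"
    show "cmod (P u s z) \<le> max c d * dominator R s"
    proof (cases "s \<le> R")
      case True then show ?thesis using d[OF uz(1) uz(2)] by (auto simp: dominator_def)
    next
      case False
      then have "cmod (P u s z) \<le> c * s powi (-2)" using R(3) uz by auto
      also have "\<dots> \<le> max c d * s powi (-2)" using False R(2) by (intro mult_right_mono) auto
      finally show ?thesis using False by (simp add: dominator_def)
    qed
  qed (use R in auto)
qed

lemma tail_integrable:
  assumes P: "sm reg P" "bnd (-2) P" and uz: "u \<in> I" "z \<in> \<Omega>" and r: "r > r0"
  shows "set_integrable lborel {r<..} (\<lambda>s. P u s z)"
proof -
  have K: "compact {(u, z)}" "{(u, z)} \<subseteq> I \<times> \<Omega>" using uz by auto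
  obtain c R where R: "c \<ge> 0" "R > 0" "\<And>u' z' s. (u', z') \<in> {(u, z)} \<Longrightarrow> s \<ge> r \<Longrightarrow> cmod (P u' s z') \<le> c * dominator R s"
    using dominated[OF P K r] by metis
  show ?thesis
  proof (rule set_integrable_bound[of _ _ "\<lambda>s. c * dominator R s"])
    show "set_integrable lborel {r<..} (\<lambda>s. c * dominator R s)"
      using set_integrable_dominator[OF R(2)] by simp
    have "continuous_on {r<..} (\<lambda>s. P u s z)"
      by (rule continuous_on_subset[OF sm_slice_r[OF P(1) uz]]) (use r in auto)
    then show "set_borel_measurable lborel {r<..} (\<lambda>s. P u s z)"
      using set_measurable_continuous_on[of "{r<..}"] by (auto simp: set_borel_measurable_def)
    show "AE s in lborel. s \<in> {r<..} \<longrightarrow> cmod (P u s z) \<le> norm (c * dominator R s)"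
      using R dominator_nonneg[OF R(2)] by (intro AE_I2) (auto simp: abs_mult)
  qed
qed

text \<open>At fixed r the dominating function is the sum of the dominators of the three tangential
  derivatives over a closed ball around (u, \<zeta>). Slicing this derivative gives every
  \<open>pd\<close> of the tail except the radial one.\<close>

lemma tail_has_derivative:
  assumes P: "sm reg P" "Ord (-2) P" and uz: "u \<in> I" "z \<in> \<Omega>" and r: "r > r0"
  shows "((\<lambda>(u, z). tail P u r z) has_derivative
    (\<lambda>(a, v). of_real a * tail (pd Cu P) u r z + v * tail (pd (Cx Zeta) P) u r z + cnj v * tail (pd (Cx Zetabar) P) u r z)) (at (u, z))"
proof -
  have "open (I \<times> \<Omega>)" using open_I open_\<Omega> by (auto intro!: open_Times)
  then obtain e where e: "e > 0" "cball (u, z) e \<subseteq> I \<times> \<Omega>"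
    using uz open_contains_cball by (metis mem_Sigma_iff)
  let ?K = "cball (u, z) e"
  have K: "compact ?K" by simp
  have B: "bnd (-2) P" "bnd (-2) (pd \<mu> P)" for \<mu> using Ord_bnd[OF P(2)] Ord_pd_le[OF P(2)] by auto
  have S: "sm reg (pd \<mu> P)" for \<mu> by (rule sm_pd[OF open_reg P(1)])
  have "\<exists>c R. c \<ge> 0 \<and> R > 0 \<and> (\<forall>u z s. (u, z) \<in> ?K \<longrightarrow> s \<ge> r \<longrightarrow> cmod (pd \<mu> P u s z) \<le> c * dominator R s)" for \<mu>
    using dominated[OF S B(2) K e(2) r] by metis
  then obtain c R where cR: "\<And>\<mu>. c \<mu> \<ge> 0" "\<And>\<mu>. R \<mu> > 0"
    "\<And>\<mu> u z s. (u, z) \<in> ?K \<Longrightarrow> s \<ge> r \<Longrightarrow> cmod (pd \<mu> P u s z) \<le> c \<mu> * dominator (R \<mu>) s" by metis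
  define B where "B s = (\<Sum>\<mu>\<in>{Cu, Cx Zeta, Cx Zetabar}. c \<mu> * dominator (R \<mu>) s)" for s
  have diff: "uncurried P differentiable (at (u', s, z'))" if "(u', z') \<in> ball (u, z) e" "s > r" for u' s z'
  proof -
    have "(u', z') \<in> I \<times> \<Omega>" using that(1) e(2) ball_subset_cball by blast
    then show ?thesis using that(2) r by (intro smooth_on_differentiable[OF P(1)]) auto
  qed
  have "((\<lambda>p. LINT s:{r<..}|lborel. (\<lambda>(u, z). P u s z) p) has_derivative
     (\<lambda>w. LINT s:{r<..}|lborel. ddir (fst w, 0, snd w) (uncurried P) (fst (u, z), s, snd (u, z)))) (at (u, z))"
  proof (rule has_derivative_set_integral_dominated[OF e(1), where
        D="\<lambda>p s w. ddir (fst w, 0, snd w) (uncurried P) (fst p, s, snd p)" and B=B])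
    fix p w :: "real \<times> complex" and s :: real assume p: "p \<in> ball (u, z) e" and s: "s \<in> {r<..}"
    obtain u' z' where p': "p = (u', z')" by (cases p)
    show "((\<lambda>(u, z). P u s z) has_derivative (\<lambda>w. ddir (fst w, 0, snd w) (uncurried P) (fst p, s, snd p))) (at p)"
      using uncurried_pair_derivative[OF diff[of u' z' s]] p s by (simp add: p' case_prod_unfold)
    obtain a v where w: "w = (a, v)" by (cases w)
    have n: "\<bar>a\<bar> \<le> norm w" "cmod v \<le> norm w"
      unfolding w by (auto intro: order_trans[OF _ norm_fst_le] order_trans[OF _ norm_snd_le] simp: norm_Pair)
    have bb: "cmod (pd \<mu> P u' s z') \<le> c \<mu> * dominator (R \<mu>) s" for \<mu>
      using cR(3)[of u' z' s \<mu>] p s p' by auto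
    have "cmod (ddir (a, 0, v) (uncurried P) (u', s, z')) \<le> \<bar>a\<bar> * cmod (pd Cu P u' s z')
        + cmod v * cmod (pd (Cx Zeta) P u' s z') + cmod v * cmod (pd (Cx Zetabar) P u' s z')"
      using p s p' by (subst ddir_eq_pd[OF diff])
        (auto intro!: order_trans[OF norm_triangle_ineq] add_mono simp: norm_mult)
    also have "\<dots> \<le> norm w * (c Cu * dominator (R Cu) s) + norm w * (c (Cx Zeta) * dominator (R (Cx Zeta)) s)
        + norm w * (c (Cx Zetabar) * dominator (R (Cx Zetabar)) s)"
      using n bb by (intro add_mono mult_mono) auto
    also have "\<dots> = B s * norm w" by (simp add: B_def algebra_simps)
    finally show "cmod (ddir (fst w, 0, snd w) (uncurried P) (fst p, s, snd p)) \<le> B s * norm w"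
      by (simp add: w p')
  next
    show "0 \<le> B s" for s
      unfolding B_def using cR dominator_nonneg by (intro sum_nonneg mult_nonneg_nonneg) auto
    show "set_integrable lborel {r<..} (\<lambda>s. case p of (u, z) \<Rightarrow> P u s z)" if "p \<in> ball (u, z) e" for p
    proof -
      have "p \<in> I \<times> \<Omega>" using that e(2) ball_subset_cball by blast
      then show ?thesis by (cases p) (auto intro!: tail_integrable[OF P(1) B(1)] r)
    qed
    show "set_integrable lborel {r<..} B"
      unfolding B_def using set_integrable_dominator[OF cR(2)] by simp
    have "set_integrable lborel {r<..} (\<lambda>s. of_real a * pd Cu P u s z + v * pd (Cx Zeta) P u s z + cnj v * pd (Cx Zetabar) P u s z)" for a v
      using tail_integrable[OF S B(2) uz r] by simp
    then have "set_borel_measurable lborel {r<..} (\<lambda>s. of_real a * pd Cu P u s z + v * pd (Cx Zeta) P u s z + cnj v * pd (Cx Zetabar) P u s z)" for a v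
      unfolding set_integrable_def set_borel_measurable_def by auto
    moreover have "indicat_real {r<..} s *\<^sub>R ddir (a, 0, v) (uncurried P) (u, s, z) =
       indicat_real {r<..} s *\<^sub>R (of_real a * pd Cu P u s z + v * pd (Cx Zeta) P u s z + cnj v * pd (Cx Zetabar) P u s z)" for a v s
      using ddir_eq_pd[OF diff[of u z s], of a 0 v] e(1) by (cases "s > r") auto
    ultimately show "set_borel_measurable lborel {r<..} (\<lambda>s. ddir (fst w, 0, snd w) (uncurried P) (fst (u, z), s, snd (u, z)))" for w
      unfolding set_borel_measurable_def fst_conv snd_conv by (simp only:)
  qed
  moreover have "(LINT s:{r<..}|lborel. ddir (a, 0, v) (uncurried P) (u, s, z)) =
      of_real a * tail (pd Cu P) u r z + v * tail (pd (Cx Zeta) P) u r z + cnj v * tail (pd (Cx Zetabar) P) u r z" for a v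
  proof -
    have "(LINT s:{r<..}|lborel. ddir (a, 0, v) (uncurried P) (u, s, z)) =
      (LINT s:{r<..}|lborel. of_real a * pd Cu P u s z + v * pd (Cx Zeta) P u s z + cnj v * pd (Cx Zetabar) P u s z)"
      using e(1) by (intro set_lebesgue_integral_cong) (auto simp: ddir_eq_pd[OF diff])
    then show ?thesis
      using tail_integrable[OF S B(2) uz r] by (simp add: tail_eq)
  qed
  ultimately show ?thesis by (simp add: tail_eq case_prod_unfold)
qed

text \<open>Exchanging \<partial>_r with another derivative of \<open>tail P\<close> cannot rely on
  commuting partial derivatives, since the tail is not known to be smooth. Instead \<partial>_\<mu>
  is moved under the integral first, and the resulting tail is differentiated in its lower
  limit.\<close>

lemma
  assumes P: "sm reg P" "Ord (-2) P" and uz: "u \<in> I" "z \<in> \<Omega>" and r: "r > r0"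
  shows pd_tail: "\<mu> \<noteq> Cr \<Longrightarrow> pd \<mu> (tail P) u r z = tail (pd \<mu> P) u r z"
    and pd_tail_r: "pd Cr (tail P) u r z = - P u r z"
    and tail_has_vector_derivative: "((\<lambda>r. tail P u r z) has_vector_derivative - P u r z) (at r)"
    and pd_tail_has_vector_derivative: "\<mu> \<noteq> Cr \<Longrightarrow> ((\<lambda>r. pd \<mu> (tail P) u r z) has_vector_derivative - pd \<mu> P u r z) (at r)"
    and pdiff_tail: "pdiff (tail P) u r z"
proof -
  have B: "bnd (-2) P" "bnd (-2) (pd \<mu> P)" for \<mu> using Ord_bnd[OF P(2)] Ord_pd_le[OF P(2)] by auto
  have S: "sm reg (pd \<mu> P)" for \<mu> by (rule sm_pd[OF open_reg P(1)])
  have D1: "((\<lambda>v. tail P v s z) has_vector_derivative tail (pd Cu P) u s z) (at u)"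
    and D3: "(tail P u s has_derivative (\<lambda>v. v * tail (pd (Cx Zeta) P) u s z + cnj v * tail (pd (Cx Zetabar) P) u s z)) (at z)"
    if "s > r0" for s
  proof -
    note D = tail_has_derivative[OF P uz that]
    have "((\<lambda>v. (v, z)) has_derivative (\<lambda>a. (a, 0))) (at u)" by (auto intro!: derivative_eq_intros)
    from has_derivative_compose[OF this D]
    show "((\<lambda>v. tail P v s z) has_vector_derivative tail (pd Cu P) u s z) (at u)"
      by (simp add: has_vector_derivative_def scaleR_conv_of_real)
    have "((\<lambda>w. (u, w)) has_derivative (\<lambda>a. (0, a))) (at z)" by (auto intro!: derivative_eq_intros)
    from has_derivative_compose[OF this D]
    show "(tail P u s has_derivative (\<lambda>v. v * tail (pd (Cx Zeta) P) u s z + cnj v * tail (pd (Cx Zetabar) P) u s z)) (at z)"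
      by simp
  qed
  show D2: "((\<lambda>r. tail P u r z) has_vector_derivative - P u r z) (at r)"
    unfolding tail_eq using tail_integrable[OF P(1) B(1) uz] r
    by (intro tail_radial_derivative[OF sm_slice_r[OF P(1) uz]]) auto
  show pdr: "pd Cr (tail P) u r z = - P u r z" using vector_derivative_at[OF D2] by (simp add: pd_def)
  have pdm: "pd \<mu> (tail P) u s z = tail (pd \<mu> P) u s z" if "s > r0" "\<mu> \<noteq> Cr" for s \<mu>
  proof (cases \<mu>)
    case Cu then show ?thesis using vector_derivative_at[OF D1[OF that(1)]] by (simp add: pd_def)
  next
    case (Cx A)
    then show ?thesis using dang_eqI[OF D3[OF that(1)], of A]
      by (cases A) (simp_all add: pd_def algebra_simps)
  qed (use that in simp)
  show "pd \<mu> (tail P) u r z = tail (pd \<mu> P) u r z" if "\<mu> \<noteq> Cr" using pdm[OF r that] .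
  show "((\<lambda>r. pd \<mu> (tail P) u r z) has_vector_derivative - pd \<mu> P u r z) (at r)" if "\<mu> \<noteq> Cr"
  proof (rule has_vector_derivative_transform_within_open[where S="{r0<..}"])
    show "((\<lambda>r. tail (pd \<mu> P) u r z) has_vector_derivative - pd \<mu> P u r z) (at r)"
      unfolding tail_eq using tail_integrable[OF S B(2) uz] r
      by (intro tail_radial_derivative[OF sm_slice_r[OF S uz]]) auto
  qed (use pdm that r in auto)
  show "pdiff (tail P) u r z"
    unfolding pdiff_def using D1[OF r] D2 D3[OF r] by (auto intro: differentiableI_vector differentiableI)
qed

text \<open>Only the integral of s^-2 is computed: for s > r the remaining factor s^(1-k) is at most
  r^(1-k) because k is at least 1, and r^(1-k) times 1/r is r^-k.\<close>

lemma bnd_tail: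
  assumes P: "sm reg P" "bnd (-k - 1) P" and k: "k \<ge> 1"
  shows "bnd (-k) (tail P)"
proof (rule bndI)
  fix K assume K: "compact K" "K \<subseteq> I \<times> \<Omega>"
  obtain c R where R: "c \<ge> 0" "R \<ge> 1" "\<And>r u z. r \<ge> R \<Longrightarrow> (u, z) \<in> K \<Longrightarrow> cmod (P u r z) \<le> c * r powi (-k - 1)"
    using bndE[OF P(2) K] by metis
  have "cmod (tail P u r z) \<le> c * r powi (-k)" if r: "r \<ge> max R (r0 + 1)" and uz: "(u, z) \<in> K" for r u z
  proof -
    have r1: "r \<ge> 1" "r > r0" "r \<ge> R" using r R(2) by auto
    have int: "set_integrable lborel {r<..} (\<lambda>s. P u s z)"
      using uz K(2) k by (intro tail_integrable P(1) bnd_mono[OF P(2)] r1) auto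
    have le: "cmod (P u s z) \<le> (c * r powi (1 - k)) * s powi (-2)" if s: "s > r" for s
    proof -
      have "cmod (P u s z) \<le> c * s powi (-k - 1)" using R(3) s r1 uz by auto
      also have "s powi (-k - 1) = s powi (1 - k) * s powi (-2)"
        proof -
          have e: "-k - 1 = (1 - k) + (-2)" by simp
          show ?thesis unfolding e using s r1 by (intro power_int_add) auto
        qed
      also have "c * (s powi (1 - k) * s powi (-2)) \<le> c * (r powi (1 - k) * s powi (-2))"
      proof -
        have "s powi (1 - k) = inverse (s ^ nat (k - 1))" "r powi (1 - k) = inverse (r ^ nat (k - 1))"
          using k by (auto simp: power_int_def power_inverse)
        then have "s powi (1 - k) \<le> r powi (1 - k)"
          using s r1 by (auto intro!: le_imp_inverse_le power_mono)
        then show ?thesis using R(1) s r1 by (intro mult_left_mono mult_right_mono) auto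
      qed
      finally show ?thesis by (simp add: mult.assoc)
    qed
    have "cmod (tail P u r z) \<le> (LINT s:{r<..}|lborel. cmod (P u s z))"
      unfolding tail_eq by (rule set_integral_norm_bound[OF int])
    also have "\<dots> \<le> (LINT s:{r<..}|lborel. (c * r powi (1 - k)) * s powi (-2))"
      using le inverse_square_tail(1)[of r] r1
      by (intro set_integral_mono set_integrable_norm[OF int]) auto
    also have "\<dots> = c * (r powi (1 - k) * inverse r)"
      using inverse_square_tail(2)[of r] r1 by simp
    also have "r powi (1 - k) * inverse r = r powi (-k)"
      using r1 by (simp add: power_int_diff power_int_minus field_simps)
    finally show ?thesis .
  qed
  then show "\<exists>c R. \<forall>r\<ge>R. \<forall>u z. (u, z) \<in> K \<longrightarrow> cmod (tail P u r z) \<le> c * r powi (-k)" by blast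
qed

lemma Ord_tail:
  assumes P: "sm reg P" "Ord (-k - 1) P" and k: "k \<ge> 1"
  shows "Ord (-k) (tail P)"
proof -
  have P2: "Ord (-2) P" by (rule Ord_mono[OF P(2)]) (use k in auto)
  have r: "r > R1 \<Longrightarrow> r > r0" for r by (simp add: R1_def)
  show ?thesis
  proof (rule OrdI)
    show "pdiff (tail P) u r z" if "u \<in> I" "r > R1" "z \<in> \<Omega>" for u r z
      using pdiff_tail[OF P(1) P2] that r by blast
    show "bnd (-k) (tail P)" by (rule bnd_tail[OF P(1) Ord_bnd[OF P(2)] k])
    fix \<mu>
    show "\<exists>G. (\<forall>u\<in>I. \<forall>r>R1. \<forall>z\<in>\<Omega>. pd \<mu> (tail P) u r z = G u r z) \<and> bnd (-k - (if \<mu> = Cr then 1 else 0)) G"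
    proof (cases "\<mu> = Cr")
      case True
      then show ?thesis using pd_tail_r[OF P(1) P2] r bnd_minus[OF Ord_bnd[OF P(2)]]
        by (intro exI[of _ "\<lambda>u r z. - P u r z"]) auto
    next
      case False
      then show ?thesis using pd_tail[OF P(1) P2] r bnd_tail[OF sm_pd[OF open_reg P(1)] Ord_pd_le[OF P(2)] k]
        by (intro exI[of _ "tail (pd \<mu> P)"]) auto
    qed
  qed
qed

end

section \<open>The function f and its dependence on the conformal factor\<close>

abbreviation lift2 :: "(real \<Rightarrow> complex \<Rightarrow> real) \<Rightarrow> scalar" where
  "lift2 a \<equiv> (\<lambda>u r z. of_real (a u z))"

lemma pd_divide: "pdiff F u r z \<Longrightarrow> pd \<mu> (\<lambda>u r z. F u r z / c) u r z = pd \<mu> F u r z / c"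
  using pd_mult[OF _ pdiff_const[of "inverse c"], of F u r z \<mu>] by (simp add: pd_const divide_inverse)

text \<open>The conformal factor enters as a general scalar \<sigma> that may depend on the radial
  slot too. Later that slot carries the parameter of a family of metrics.\<close>

definition psi :: "scalar \<Rightarrow> (ang \<Rightarrow> complex \<Rightarrow> complex) \<Rightarrow> scalar \<Rightarrow> scalar" where
  "psi \<sigma> Y w u r z = (\<Sum>A\<in>UNIV. pd (Cx A) (\<lambda>u r z. Y A z) u r z + 2 * Y A z * pd (Cx A) \<sigma> u r z) - 2 * w u r z"

definition famG :: "scalar \<Rightarrow> (ang \<Rightarrow> complex \<Rightarrow> complex) \<Rightarrow> scalar \<Rightarrow> scalar" where
  "famG \<sigma> Y w u r z = exp (- \<sigma> u r z) * psi \<sigma> Y w u r z"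

text \<open>Splitting f as \<open>exp \<sigma>\<close> times this function removes the term f
  \<partial>_u \<sigma> from the evolution equation: the u-derivative of \<open>famF\<close> is just
  half of \<open>famG\<close>.\<close>

definition famF :: "scalar \<Rightarrow> (ang \<Rightarrow> complex \<Rightarrow> complex) \<Rightarrow> (complex \<Rightarrow> real) \<Rightarrow> scalar \<Rightarrow> scalar" where
  "famF \<sigma> Y T w u r z = of_real (T z) + int0 (famG \<sigma> Y w) u r z / 2"

definition fam :: "scalar \<Rightarrow> (ang \<Rightarrow> complex \<Rightarrow> complex) \<Rightarrow> (complex \<Rightarrow> real) \<Rightarrow> scalar \<Rightarrow> scalar" where
  "fam \<sigma> Y T w u r z = exp (\<sigma> u r z) * famF \<sigma> Y T w u r z"

text \<open>The first-order variation of \<open>fam \<sigma> Y T w\<close> under \<open>\<delta>\<sigma> = w'\<close>.\<close>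

definition dvarG :: "scalar \<Rightarrow> scalar \<Rightarrow> (ang \<Rightarrow> complex \<Rightarrow> complex) \<Rightarrow> scalar \<Rightarrow> scalar" where
  "dvarG w' \<sigma> Y w u r z = exp (- \<sigma> u r z) *
     (- w' u r z * psi \<sigma> Y w u r z + (\<Sum>A\<in>UNIV. 2 * Y A z * pd (Cx A) w' u r z))"

definition dvar :: "scalar \<Rightarrow> scalar \<Rightarrow> (ang \<Rightarrow> complex \<Rightarrow> complex) \<Rightarrow> (complex \<Rightarrow> real) \<Rightarrow> scalar \<Rightarrow> scalar" where
  "dvar w' \<sigma> Y T w u r z = w' u r z * fam \<sigma> Y T w u r z
     + exp (\<sigma> u r z) * (int0 (dvarG w' \<sigma> Y w) u r z / 2)"

lemma dang_Cx: "dang A (F u r) z = pd (Cx A) F u r z" by (simp add: pd_def)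

text \<open>The radial slot \<open>e\<close> is free. For the given metric it is any value of r; for
  the perturbed metrics it is the family parameter, and \<sigma> has to match the conformal factor
  at that parameter only.\<close>

lemma f_of_fam:
  assumes J: "is_interval J" "0 \<in> J" "u \<in> J" and B: "open B" "z \<in> B"
    and eq: "\<And>v w. v \<in> J \<Longrightarrow> w \<in> B \<Longrightarrow> \<sigma> v e w = of_real (\<phi> v w)"
  shows "f_of \<phi> (Y, T, \<omega>) u z = fam \<sigma> Y T (lift2 \<omega>) u e z"
proof -
  have "(LBINT v=0..u. of_real (exp (- \<phi> v z)) * (div_bar \<phi> Y v z - 2 * of_real (\<omega> v z)))
     = int0 (famG \<sigma> Y (lift2 \<omega>)) u e z"
    unfolding int0_def
  proof (rule interval_integral_cong)
    fix v assume "v \<in> einterval (min 0 (ereal u)) (max 0 (ereal u))"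
    then have "v \<in> {min 0 u..max 0 u}"
      by (auto simp: einterval_def min_def max_def zero_ereal_def split: if_splits)
    then have v: "v \<in> J" using interval_subsetI[OF J] by auto
    have d: "dang A (\<lambda>w. of_real (\<phi> v w)) z = pd (Cx A) \<sigma> v e z" for A
      unfolding pd_def using dang_cong[OF B, of "\<sigma> v e" "\<lambda>w. of_real (\<phi> v w)" A] eq[OF v] by simp
    have e: "exp (- complex_of_real x) = of_real (exp (-x))" for x
      by (metis exp_of_real of_real_minus)
    show "of_real (exp (- \<phi> v z)) * (div_bar \<phi> Y v z - 2 * of_real (\<omega> v z)) = famG \<sigma> Y (lift2 \<omega>) v e z"
      using eq[OF v B(2)] d
      by (simp add: famG_def psi_def div_bar_def pd_def e)
  qed
  then show ?thesis
    using eq[OF J(3) B(2)] by (simp add: fam_def famF_def exp_of_real)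
qed

text \<open>The u-interval contains 0, the lower limit of the integral in f. The middle factor
  \<open>R\<close> is either a range of radii, or the whole line for data independent of r, or an
  interval of family parameters.\<close>

locale box =
  fixes J :: "real set" and R :: "real set" and B :: "complex set"
  assumes J: "open J" "is_interval J" "0 \<in> J" and R: "open R" and B: "open B"
begin

abbreviation "S \<equiv> J \<times> R \<times> B"

lemma open_S: "open S" using J R B by (auto intro!: open_Times)

lemma open_RB: "open (R \<times> B)" using R B by (auto intro!: open_Times)

lemmas sm_intros = smooth_on_const[OF open_S] smooth_on_add[OF open_S] smooth_on_diff[OF open_S]
  smooth_on_mult[OF open_S] smooth_on_minus[OF open_S] smooth_on_exp[OF open_S] smooth_on_sum[OF open_S]

lemma sm_add: "sm S F \<Longrightarrow> sm S G \<Longrightarrow> sm S (\<lambda>u r z. F u r z + G u r z)"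
  using sm_intros(2)[of "uncurried F" "uncurried G"] by (simp add: case_prod_unfold)

lemma sm_diff: "sm S F \<Longrightarrow> sm S G \<Longrightarrow> sm S (\<lambda>u r z. F u r z - G u r z)"
  using sm_intros(3)[of "uncurried F" "uncurried G"] by (simp add: case_prod_unfold)

lemma sm_mult: "sm S F \<Longrightarrow> sm S G \<Longrightarrow> sm S (\<lambda>u r z. F u r z * G u r z)"
  using sm_intros(4)[of "uncurried F" "uncurried G"] by (simp add: case_prod_unfold)

lemma sm_divide: "sm S F \<Longrightarrow> sm S (\<lambda>u r z. F u r z / c)"
  using sm_intros(4)[of "uncurried F" "\<lambda>_. inverse c", OF _ sm_intros(1)] by (simp add: case_prod_unfold divide_inverse)

lemma sm_minus: "sm S F \<Longrightarrow> sm S (\<lambda>u r z. - F u r z)"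
  using sm_intros(5)[of "uncurried F"] by (simp add: case_prod_unfold)

lemma sm_exp: "sm S F \<Longrightarrow> sm S (\<lambda>u r z. exp (F u r z))"
  using sm_intros(6)[of "uncurried F"] by (simp add: case_prod_unfold)

lemma sm_const: "sm S (\<lambda>u r z. c)"
  using sm_intros(1)[of c] by (simp add: case_prod_unfold)

lemma sm_sum: "(\<And>i. i \<in> A \<Longrightarrow> sm S (F i)) \<Longrightarrow> sm S (\<lambda>u r z. \<Sum>i\<in>A. F i u r z)"
  using sm_intros(7)[of A "\<lambda>i. uncurried (F i)"] by (simp add: case_prod_unfold)

lemma sm_PD: "sm S F \<Longrightarrow> sm S (pd \<mu> F)"
  by (rule sm_pd[OF open_S])

lemma sm_INT: "sm S F \<Longrightarrow> sm S (int0 F)"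
  by (rule sm_int0[OF J open_RB])

lemma sm_CONG: "(\<And>u r z. (u, r, z) \<in> S \<Longrightarrow> F u r z = G u r z) \<Longrightarrow> sm S F \<longleftrightarrow> sm S G"
  by (rule smooth_on_cong[OF open_S]) auto

lemmas sm_rules = sm_divide sm_add sm_diff sm_mult sm_minus sm_exp sm_const sm_sum sm_PD sm_INT

lemma pd_INT_u: "sm S G \<Longrightarrow> (u, r, z) \<in> S \<Longrightarrow> pd Cu (int0 G) u r z = G u r z"
  using pd_int0_u[OF J open_RB] by auto

lemma pd_INT: "sm S G \<Longrightarrow> \<mu> \<noteq> Cu \<Longrightarrow> (u, r, z) \<in> S \<Longrightarrow> pd \<mu> (int0 G) u r z = int0 (pd \<mu> G) u r z"
  using pd_int0[OF J open_RB] by auto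

lemma int0_cong: 
  assumes "u \<in> J" "\<And>v. v \<in> J \<Longrightarrow> F v r z = G v r z"
  shows "int0 F u r z = int0 G u r z"
  unfolding int0_def
proof (rule interval_integral_cong)
  fix v assume "v \<in> einterval (min 0 (ereal u)) (max 0 (ereal u))"
  then have "v \<in> {min 0 u..max 0 u}"
    by (auto simp: einterval_def min_def max_def zero_ereal_def split: if_splits)
  then show "F v r z = G v r z" using interval_subsetI[OF J(2,3) assms(1)] assms(2) by auto
qed

lemma int0_zero: "int0 G 0 r z = 0"
  using interval_integral_endpoints_same[of 0] by (simp add: int0_def zero_ereal_def)

text \<open>The difference of \<open>N\<close> and \<open>int0 (pd Cu N)\<close> has vanishing
  u-derivative on an interval, and \<open>int0\<close> vanishes at u = 0.\<close>

lemma ftc_u: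
  assumes N: "sm S N" and p: "(u, r, z) \<in> S"
  shows "N u r z = N 0 r z + int0 (pd Cu N) u r z"
proof -
  have sm: "sm S (\<lambda>u r z. N u r z - int0 (pd Cu N) u r z)"
    by (intro sm_rules N)
  have "((\<lambda>v. N v r z - int0 (pd Cu N) v r z) has_vector_derivative 0) (at v)" if "v \<in> J" for v
  proof -
    have q: "(v, r, z) \<in> S" using that p by auto
    have "((\<lambda>v. N v r z - int0 (pd Cu N) v r z) has_vector_derivative
       pd Cu (\<lambda>u r z. N u r z - int0 (pd Cu N) u r z) v r z) (at v)"
      using sm_pdiff[OF sm q] unfolding pdiff_def pd_def by (auto simp: vector_derivative_works)
    moreover have "pd Cu (\<lambda>u r z. N u r z - int0 (pd Cu N) u r z) v r z = 0"
      using N q by (simp add: pd_diff sm_pdiff[OF _ q] sm_rules pd_INT_u)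
    ultimately show ?thesis by simp
  qed
  then have "((\<lambda>v. N v r z - int0 (pd Cu N) v r z) has_derivative (\<lambda>h. 0)) (at v within J)" if "v \<in> J" for v
    using that has_derivative_at_withinI unfolding has_vector_derivative_def by fastforce
  then have "\<exists>c. \<forall>v\<in>J. N v r z - int0 (pd Cu N) v r z = c"
    by (intro has_derivative_zero_constant[OF is_interval_convex[OF J(2)]])
  then obtain c where c: "\<And>v. v \<in> J \<Longrightarrow> N v r z - int0 (pd Cu N) v r z = c" by auto
  from c[of u] c[OF J(3)] p show ?thesis by (simp add: int0_zero algebra_simps)
qed

end

locale box_params = box +
  fixes \<sigma> :: scalar and Y :: "ang \<Rightarrow> complex \<Rightarrow> complex" and T :: "complex \<Rightarrow> real" and w :: scalar
  assumes sm_chi: "sm S \<sigma>" and sm_Y: "\<And>A. sm S (\<lambda>u r z. Y A z)"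
    and sm_T: "sm S (\<lambda>u r z. of_real (T z))" and sm_w: "sm S w"
begin

lemma sm_psi: "sm S (psi \<sigma> Y w)"
  unfolding psi_def[abs_def] by (intro sm_rules sm_chi sm_Y sm_w)

lemma sm_famG: "sm S (famG \<sigma> Y w)"
  unfolding famG_def[abs_def] by (intro sm_rules sm_chi sm_psi)

lemma sm_famF: "sm S (famF \<sigma> Y T w)"
  unfolding famF_def[abs_def] by (intro sm_rules sm_T sm_famG)

lemma sm_fam: "sm S (fam \<sigma> Y T w)"
  unfolding fam_def[abs_def] by (intro sm_rules sm_chi sm_famF)

lemma sm_dvarG: "sm S w' \<Longrightarrow> sm S (dvarG w' \<sigma> Y w)"
  unfolding dvarG_def[abs_def] by (intro sm_rules sm_chi sm_psi sm_Y)

lemma sm_dvar: "sm S w' \<Longrightarrow> sm S (dvar w' \<sigma> Y T w)"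
  unfolding dvar_def[abs_def] by (intro sm_rules sm_chi sm_fam sm_dvarG)

lemmas sms = sm_chi sm_Y sm_T sm_w sm_psi sm_famG sm_famF sm_fam

context
  fixes u r z assumes p: "(u, r, z) \<in> S"
begin

lemma PDI: "sm S F \<Longrightarrow> pdiff F u r z" by (rule sm_pdiff[OF _ p])

lemmas pd_rules = pd_add[OF PDI PDI] pd_diff[OF PDI PDI] pd_mult[OF PDI PDI] pd_minus[OF PDI] pd_exp[OF PDI]
  pd_const pd_sum[OF _ PDI] pd_divide[OF PDI]

lemma pd_u_Y: "pd Cu (\<lambda>u r z. Y A z) u r z = 0" by (simp add: pd_def)
lemma pd_r_Y: "pd Cr (\<lambda>u r z. Y A z) u r z = 0" by (simp add: pd_def)

lemma pd_u_famF: "pd Cu (famF \<sigma> Y T w) u r z = famG \<sigma> Y w u r z / 2"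
proof -
  have "pd Cu (\<lambda>u r z. of_real (T z)) u r z = (0 :: complex)" by (simp add: pd_def)
  then show ?thesis
    unfolding famF_def[abs_def]
    by (simp add: pd_rules sm_rules sms pd_INT_u[OF sm_famG p] cong del: if_weak_cong)
qed

lemma pd_fam: "pd \<mu> (fam \<sigma> Y T w) u r z = exp (\<sigma> u r z) * (pd \<mu> \<sigma> u r z * famF \<sigma> Y T w u r z + pd \<mu> (famF \<sigma> Y T w) u r z)"
  unfolding fam_def[abs_def]
  by (simp add: pd_rules sm_rules sms algebra_simps)

lemma pd_u_fam: "pd Cu (fam \<sigma> Y T w) u r z = fam \<sigma> Y T w u r z * pd Cu \<sigma> u r z + (1 / 2) * psi \<sigma> Y w u r z"
  unfolding pd_fam pd_u_famF
  by (simp add: fam_def famG_def algebra_simps flip: exp_add)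

lemma pd_psi: "pd \<mu> (psi \<sigma> Y w) u r z =
  (\<Sum>A\<in>UNIV. pd \<mu> (pd (Cx A) (\<lambda>u r z. Y A z)) u r z + 2 * (Y A z * pd \<mu> (pd (Cx A) \<sigma>) u r z + pd \<mu> (\<lambda>u r z. Y A z) u r z * pd (Cx A) \<sigma> u r z))
  - 2 * pd \<mu> w u r z"
  unfolding psi_def[abs_def]
  by (simp add: pd_rules sm_rules sms algebra_simps)

lemma pd_famG: "pd \<mu> (famG \<sigma> Y w) u r z = exp (- \<sigma> u r z) * (pd \<mu> (psi \<sigma> Y w) u r z - pd \<mu> \<sigma> u r z * psi \<sigma> Y w u r z)"
  unfolding famG_def[abs_def]
  by (simp add: pd_rules sm_rules sms algebra_simps)

end

text \<open>With the family parameter stored in the radial slot, \<open>pd Cr\<close> is the variation.\<close>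

lemma pd_r_fam:
  assumes p: "(u, 0, z) \<in> S" and wr: "\<And>v y. pd Cr w v 0 y = 0"
    and \<sigma>r: "\<And>v y. v \<in> J \<Longrightarrow> y \<in> B \<Longrightarrow> pd Cr \<sigma> v 0 y = w' v 0 y"
  shows "pd Cr (fam \<sigma> Y T w) u 0 z = dvar w' \<sigma> Y T w u 0 z"
proof -
  have "pd Cr (famG \<sigma> Y w) v 0 z = dvarG w' \<sigma> Y w v 0 z" if "v \<in> J" for v
  proof -
    have q: "(v, 0, z) \<in> S" and z: "z \<in> B" using that p by auto
    \<comment> \<open>Exchanging the variation with \<partial>_A is a case of commuting partial
      derivatives, because the parameter is a coordinate.\<close>
    have "pd Cr (pd (Cx A) \<sigma>) v 0 z = pd (Cx A) (pd Cr \<sigma>) v 0 z" for A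
      by (rule pd_commute[OF open_S sm_chi q])
    also have "pd (Cx A) (pd Cr \<sigma>) v 0 z = pd (Cx A) w' v 0 z" for A
      using dang_cong[OF B z, of "pd Cr \<sigma> v 0" "w' v 0" A] \<sigma>r[OF that] by (simp add: pd_def[of "Cx A"])
    finally have c: "pd Cr (pd (Cx A) \<sigma>) v 0 z = pd (Cx A) w' v 0 z" for A .
    have y: "pd Cr (pd (Cx A) (\<lambda>u r z. Y A z)) v 0 z = 0" for A
      unfolding pd_def by simp
    show ?thesis
      unfolding pd_famG[OF q] pd_psi[OF q] dvarG_def c y wr pd_r_Y[OF q] \<sigma>r[OF that z]
      by (simp add: algebra_simps sum_distrib_left)
  qed
  then have i: "int0 (pd Cr (famG \<sigma> Y w)) u 0 z = int0 (dvarG w' \<sigma> Y w) u 0 z"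
    using p by (intro int0_cong) auto
  have "pd Cr (\<lambda>u r z. of_real (T z)) u 0 z = (0 :: complex)" by (simp add: pd_def)
  then have "pd Cr (famF \<sigma> Y T w) u 0 z = int0 (dvarG w' \<sigma> Y w) u 0 z / 2"
    unfolding famF_def[abs_def]
    by (simp add: pd_rules[OF p] sm_rules sms pd_INT[OF sm_famG _ p] i)
  then show ?thesis
    unfolding pd_fam[OF p] dvar_def fam_def using \<sigma>r p by (simp add: algebra_simps)
qed

end

section \<open>The bracket of two parameter triples\<close>

locale two_params = b1: box_params J R B \<sigma> Y1 T1 w1 + b2: box_params J R B \<sigma> Y2 T2 w2
  for J R B \<sigma> Y1 T1 w1 Y2 T2 w2 +
  assumes hol: "\<And>u r z. (u, r, z) \<in> J \<times> R \<times> B \<Longrightarrow> pd (Cx Zetabar) (\<lambda>u r z. Y1 Zeta z) u r z = 0"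
    "\<And>u r z. (u, r, z) \<in> J \<times> R \<times> B \<Longrightarrow> pd (Cx Zeta) (\<lambda>u r z. Y1 Zetabar z) u r z = 0"
    "\<And>u r z. (u, r, z) \<in> J \<times> R \<times> B \<Longrightarrow> pd (Cx Zetabar) (\<lambda>u r z. Y2 Zeta z) u r z = 0"
    "\<And>u r z. (u, r, z) \<in> J \<times> R \<times> B \<Longrightarrow> pd (Cx Zeta) (\<lambda>u r z. Y2 Zetabar z) u r z = 0"
begin

abbreviation "S \<equiv> J \<times> R \<times> B"

lemma hol2:
  assumes "(u, r, z) \<in> S"
  shows "pd \<mu> (pd (Cx Zetabar) (\<lambda>u r z. Y1 Zeta z)) u r z = 0" "pd \<mu> (pd (Cx Zeta) (\<lambda>u r z. Y1 Zetabar z)) u r z = 0"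
    "pd \<mu> (pd (Cx Zetabar) (\<lambda>u r z. Y2 Zeta z)) u r z = 0" "pd \<mu> (pd (Cx Zeta) (\<lambda>u r z. Y2 Zetabar z)) u r z = 0"
  using pd_cong[OF b1.open_S assms, of _ "\<lambda>u r z. 0" \<mu>] hol by (auto simp: pd_const)

lemma hol3:
  assumes "(u, r, z) \<in> S"
  shows "pd (Cx Zetabar) (pd \<mu> (\<lambda>u r z. Y1 Zeta z)) u r z = 0" "pd (Cx Zeta) (pd \<mu> (\<lambda>u r z. Y1 Zetabar z)) u r z = 0"
    "pd (Cx Zetabar) (pd \<mu> (\<lambda>u r z. Y2 Zeta z)) u r z = 0" "pd (Cx Zeta) (pd \<mu> (\<lambda>u r z. Y2 Zetabar z)) u r z = 0"
  using hol2[OF assms] pd_commute[OF b1.open_S b1.sm_Y assms, of "Cx _"] pd_commute[OF b1.open_S b2.sm_Y assms, of "Cx _"]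
  by auto

definition fhat :: scalar where
  "fhat u r z = fam \<sigma> Y1 T1 w1 u r z * pd Cu (fam \<sigma> Y2 T2 w2) u r z - fam \<sigma> Y2 T2 w2 u r z * pd Cu (fam \<sigma> Y1 T1 w1) u r z
    + (\<Sum>A\<in>UNIV. Y1 A z * pd (Cx A) (fam \<sigma> Y2 T2 w2) u r z - Y2 A z * pd (Cx A) (fam \<sigma> Y1 T1 w1) u r z)
    - dvar w1 \<sigma> Y2 T2 w2 u r z + dvar w2 \<sigma> Y1 T1 w1 u r z"

definition Nhat :: scalar where
  "Nhat u r z = (1/2) * (\<Sum>A\<in>UNIV. famF \<sigma> Y1 T1 w1 u r z * pd (Cx A) (\<lambda>u r z. Y2 A z) u r z - famF \<sigma> Y2 T2 w2 u r z * pd (Cx A) (\<lambda>u r z. Y1 A z) u r z)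
    + (\<Sum>A\<in>UNIV. Y1 A z * pd (Cx A) (famF \<sigma> Y2 T2 w2) u r z - Y2 A z * pd (Cx A) (famF \<sigma> Y1 T1 w1) u r z)
    - (1/2) * (int0 (dvarG w1 \<sigma> Y2 w2) u r z - int0 (dvarG w2 \<sigma> Y1 w1) u r z)"

lemma sm_Nhat: "sm S Nhat"
  unfolding Nhat_def[abs_def]
  by (intro b1.sm_rules b1.sms b2.sms b1.sm_dvarG b2.sm_dvarG)

text \<open>By the evolution equation, f1 \<partial>_u f2 - f2 \<partial>_u f1 is (f1 \<psi>2 - f2
  \<psi>1) / 2. The Y \<partial>\<sigma> parts of \<psi> cancel the derivatives of the factors
  \<open>exp \<sigma>\<close> in Y \<partial>f, and the w parts cancel the terms w f of the two
  variations.\<close>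

lemma fhat_Nhat:
  assumes p: "(u, r, z) \<in> S"
  shows "fhat u r z = exp (\<sigma> u r z) * Nhat u r z"
proof -
  have e: "exp (\<sigma> u r z) * exp (- \<sigma> u r z) = 1" by (simp flip: exp_add)
  show ?thesis
    unfolding fhat_def Nhat_def b1.pd_fam[OF p] b2.pd_fam[OF p] b1.pd_u_famF[OF p] b2.pd_u_famF[OF p]
      dvar_def fam_def famG_def psi_def UNIV_ang
    using e by simp algebra
qed

text \<open>The terms quadratic in \<psi> leave (\<psi>1 w2 - \<psi>2 w1) / 2, which the variations
  of the integrands cancel, as they do the derivatives of w; hence no rescaling survives in the
  bracket. The second derivatives of \<sigma> drop out by antisymmetry, and what is left is the
  divergence belonging to [Y1, Y2].\<close>

lemma pd_u_Nhat:
  assumes p: "(u, r, z) \<in> S"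
  shows "pd Cu Nhat u r z = (1 / 2) * famG \<sigma> (bracket_Y Y1 Y2) (\<lambda>u r z. 0) u r z"
proof -
  have yu: "pd Cu (pd (Cx A) (\<lambda>u r z. Y1 A z)) u r z = 0" "pd Cu (pd (Cx A) (\<lambda>u r z. Y2 A z)) u r z = 0" for A
    unfolding pd_def by simp_all
  have FF: "pd Cu (pd (Cx A) (famF \<sigma> Y1 T1 w1)) u r z = pd (Cx A) (famG \<sigma> Y1 w1) u r z / 2"
    "pd Cu (pd (Cx A) (famF \<sigma> Y2 T2 w2)) u r z = pd (Cx A) (famG \<sigma> Y2 w2) u r z / 2" for A
  proof -
    have "pd (Cx A) (pd Cu (famF \<sigma> Y1 T1 w1)) u r z = pd (Cx A) (\<lambda>u r z. famG \<sigma> Y1 w1 u r z / 2) u r z"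
      by (rule pd_cong[OF b1.open_S p]) (rule b1.pd_u_famF)
    moreover have "pd (Cx A) (pd Cu (famF \<sigma> Y2 T2 w2)) u r z = pd (Cx A) (\<lambda>u r z. famG \<sigma> Y2 w2 u r z / 2) u r z"
      by (rule pd_cong[OF b1.open_S p]) (rule b2.pd_u_famF)
    ultimately show "pd Cu (pd (Cx A) (famF \<sigma> Y1 T1 w1)) u r z = pd (Cx A) (famG \<sigma> Y1 w1) u r z / 2"
      "pd Cu (pd (Cx A) (famF \<sigma> Y2 T2 w2)) u r z = pd (Cx A) (famG \<sigma> Y2 w2) u r z / 2"
      using pd_commute[OF b1.open_S b1.sm_famF p, of Cu "Cx A"] pd_commute[OF b1.open_S b2.sm_famF p, of Cu "Cx A"]
      by (simp_all add: b1.pd_rules[OF p] b1.sm_rules b1.sms b2.sms)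
  qed
  have br: "pd (Cx A) (\<lambda>u r z. bracket_Y Y1 Y2 A z) u r z =
     Y1 A z * pd (Cx A) (pd (Cx A) (\<lambda>u r z. Y2 A z)) u r z - Y2 A z * pd (Cx A) (pd (Cx A) (\<lambda>u r z. Y1 A z)) u r z" 
    and bv: "bracket_Y Y1 Y2 A z = Y1 A z * pd (Cx A) (\<lambda>u r z. Y2 A z) u r z - Y2 A z * pd (Cx A) (\<lambda>u r z. Y1 A z) u r z" for A
  proof -
    have "bracket_Y Y1 Y2 A = (\<lambda>z. \<Sum>B\<in>UNIV. Y1 B z * pd (Cx B) (\<lambda>u r z. Y2 A z) u r z - Y2 B z * pd (Cx B) (\<lambda>u r z. Y1 A z) u r z)"
      by (simp add: bracket_Y_def fun_eq_iff pd_def)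
    then have b: "(\<lambda>u r z. bracket_Y Y1 Y2 A z) = (\<lambda>u r z. \<Sum>B\<in>UNIV. Y1 B z * pd (Cx B) (\<lambda>u r z. Y2 A z) u r z - Y2 B z * pd (Cx B) (\<lambda>u r z. Y1 A z) u r z)"
      by (simp add: fun_eq_iff pd_def)
    show "bracket_Y Y1 Y2 A z = Y1 A z * pd (Cx A) (\<lambda>u r z. Y2 A z) u r z - Y2 A z * pd (Cx A) (\<lambda>u r z. Y1 A z) u r z"
      using fun_cong[OF fun_cong[OF fun_cong[OF b, of u], of r], of z]
      by (cases A) (simp_all add: UNIV_ang hol[OF p])
    show "pd (Cx A) (\<lambda>u r z. bracket_Y Y1 Y2 A z) u r z =
     Y1 A z * pd (Cx A) (pd (Cx A) (\<lambda>u r z. Y2 A z)) u r z - Y2 A z * pd (Cx A) (pd (Cx A) (\<lambda>u r z. Y1 A z)) u r z"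
      unfolding b
      by (cases A) (simp_all add: UNIV_ang b1.pd_rules[OF p] b1.sm_rules b1.sms b2.sms hol[OF p] hol2[OF p] hol3[OF p])
  qed
  have c: "pd (Cx Zetabar) (pd (Cx Zeta) \<sigma>) u r z = pd (Cx Zeta) (pd (Cx Zetabar) \<sigma>) u r z"
    by (rule pd_commute[OF b1.open_S b1.sm_chi p])
  have "pd Cu Nhat u r z =
    (1/2) * (\<Sum>A\<in>UNIV. (1/2) * famG \<sigma> Y1 w1 u r z * pd (Cx A) (\<lambda>u r z. Y2 A z) u r z - (1/2) * famG \<sigma> Y2 w2 u r z * pd (Cx A) (\<lambda>u r z. Y1 A z) u r z)
    + (\<Sum>A\<in>UNIV. Y1 A z * ((1/2) * pd (Cx A) (famG \<sigma> Y2 w2) u r z) - Y2 A z * ((1/2) * pd (Cx A) (famG \<sigma> Y1 w1) u r z))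
    - (1/2) * (dvarG w1 \<sigma> Y2 w2 u r z - dvarG w2 \<sigma> Y1 w1 u r z)"
    unfolding Nhat_def[abs_def]
    by (simp add: b1.pd_rules[OF p] b1.sm_rules b1.sms b2.sms b1.sm_dvarG b2.sm_dvarG yu FF b1.pd_u_Y[OF p] b2.pd_u_Y[OF p]
       b1.pd_u_famF[OF p] b2.pd_u_famF[OF p] b1.pd_INT_u[OF b1.sm_dvarG p] b1.pd_INT_u[OF b2.sm_dvarG p])
  also have "\<dots> = (1 / 2) * famG \<sigma> (bracket_Y Y1 Y2) (\<lambda>u r z. 0) u r z"
    unfolding b1.pd_famG[OF p] b2.pd_famG[OF p] b1.pd_psi[OF p] b2.pd_psi[OF p] dvarG_def
    unfolding famG_def psi_def br bv UNIV_ang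
    by (simp add: hol[OF p] hol2[OF p] hol3[OF p] c) algebra
  finally show ?thesis .
qed

lemma fhat_eq:
  assumes p: "(u, r, z) \<in> S" and T: "\<And>z. z \<in> B \<Longrightarrow> of_real (That z) = bracket_T Y1 T1 Y2 T2 z"
  shows "fhat u r z = fam \<sigma> (bracket_Y Y1 Y2) That (\<lambda>u r z. 0) u r z"
proof -
  have p0: "(0, r, z) \<in> S" using p b1.J by auto
  have "int0 (pd Cu Nhat) u r z = int0 (\<lambda>u r z. (1 / 2) * famG \<sigma> (bracket_Y Y1 Y2) (\<lambda>u r z. 0) u r z) u r z"
    using p by (intro b1.int0_cong pd_u_Nhat) auto
  also have "\<dots> = int0 (famG \<sigma> (bracket_Y Y1 Y2) (\<lambda>u r z. 0)) u r z / 2"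
    unfolding int0_def by simp
  finally have i: "int0 (pd Cu Nhat) u r z = int0 (famG \<sigma> (bracket_Y Y1 Y2) (\<lambda>u r z. 0)) u r z / 2" .
  have F0: "famF \<sigma> Y1 T1 w1 0 r y = of_real (T1 y)" "famF \<sigma> Y2 T2 w2 0 r y = of_real (T2 y)" for y
    by (simp_all add: famF_def b1.int0_zero)
  then have F1: "famF \<sigma> Y1 T1 w1 0 r = (\<lambda>y. of_real (T1 y))" "famF \<sigma> Y2 T2 w2 0 r = (\<lambda>y. of_real (T2 y))"
    by auto
  \<comment> \<open>At u = 0 all integrals vanish, \<open>famF\<close> reduces to T, and
    \<open>Nhat\<close> becomes the supertranslation bracket.\<close>
  have "Nhat 0 r z = of_real (That z)"
    unfolding T[OF p0[THEN SigmaD2, THEN SigmaD2]] Nhat_def bracket_T_def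
    by (simp add: b1.int0_zero F1 pd_def UNIV_ang field_simps)
  then show ?thesis
    unfolding fhat_Nhat[OF p] b1.ftc_u[OF sm_Nhat p] i by (simp add: fam_def famF_def)
qed

end

section \<open>The inverse of a metric in Newman-Unti form\<close>

lemma matrix_inv_eqI:
  fixes M N :: "complex^'n^'n"
  assumes "M ** N = mat 1" "N ** M = mat 1"
  shows "matrix_inv M = N"
proof -
  have "M ** matrix_inv M = mat 1 \<and> matrix_inv M ** M = mat 1"
    unfolding matrix_inv_def by (rule someI[where P="\<lambda>A'. M ** A' = mat 1 \<and> A' ** M = mat 1", of N]) (use assms in auto)
  then show ?thesis using assms by (metis matrix_mul_assoc matrix_mul_lid matrix_mul_rid)
qed

text \<open>Written for symmetric m: one off-diagonal entry stands for both, here and in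
  \<open>inv2\<close>.\<close>

definition det2 :: "(ang \<Rightarrow> ang \<Rightarrow> complex) \<Rightarrow> complex" where
  "det2 m = m Zeta Zeta * m Zetabar Zetabar - m Zeta Zetabar * m Zeta Zetabar"

fun inv2 :: "(ang \<Rightarrow> ang \<Rightarrow> complex) \<Rightarrow> ang \<Rightarrow> ang \<Rightarrow> complex" where
  "inv2 m Zeta Zeta = m Zetabar Zetabar * inverse (det2 m)"
| "inv2 m Zetabar Zetabar = m Zeta Zeta * inverse (det2 m)"
| "inv2 m Zeta Zetabar = - m Zeta Zetabar * inverse (det2 m)"
| "inv2 m Zetabar Zeta = - m Zeta Zetabar * inverse (det2 m)"

text \<open>Here k, p, m stand for g_uu, g_uA, g_AB. The inverse is expressed in these covariant
  components rather than in W and V, because for the perturbed metric only the covariant components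
  are given.\<close>

fun nu_inv :: "complex \<Rightarrow> (ang \<Rightarrow> complex) \<Rightarrow> (ang \<Rightarrow> ang \<Rightarrow> complex) \<Rightarrow> coord \<Rightarrow> coord \<Rightarrow> complex" where
  "nu_inv k p m Cr Cu = -1"
| "nu_inv k p m Cr Cr = (\<Sum>A\<in>UNIV. \<Sum>B\<in>UNIV. inv2 m A B * p A * p B) - k"
| "nu_inv k p m Cr (Cx A) = (\<Sum>B\<in>UNIV. inv2 m A B * p B)"
| "nu_inv k p m Cu Cr = -1"
| "nu_inv k p m Cu Cu = 0"
| "nu_inv k p m Cu (Cx A) = 0"
| "nu_inv k p m (Cx A) Cr = (\<Sum>B\<in>UNIV. inv2 m A B * p B)"
| "nu_inv k p m (Cx A) Cu = 0"
| "nu_inv k p m (Cx A) (Cx B) = inv2 m A B"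

lemma inv2_sym: "inv2 m A B = inv2 m B A"
  by (cases A; cases B) auto

lemma nu_inv_sym: "nu_inv k p m \<mu> \<nu> = nu_inv k p m \<nu> \<mu>"
  by (cases \<mu>; cases \<nu>) (auto simp: inv2_sym)

text \<open>A condition at a single point on covariant components only, so that it can be checked
  for g + e h as well: h_r\<mu> = 0 preserves the gauge entries, and small e keeps the determinant
  away from 0.\<close>

definition nu_shape :: "metric \<Rightarrow> real \<Rightarrow> real \<Rightarrow> complex \<Rightarrow> bool" where
  "nu_shape m u r z \<longleftrightarrow> m Cr Cr u r z = 0 \<and> m Cu Cr u r z = -1 \<and> m Cr Cu u r z = -1
    \<and> (\<forall>A. m Cr (Cx A) u r z = 0 \<and> m (Cx A) Cr u r z = 0 \<and> m (Cx A) Cu u r z = m Cu (Cx A) u r z)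
    \<and> m (Cx Zetabar) (Cx Zeta) u r z = m (Cx Zeta) (Cx Zetabar) u r z
    \<and> det2 (\<lambda>A B. m (Cx A) (Cx B) u r z) \<noteq> 0"

lemma sum_coord: "(\<Sum>\<mu>\<in>UNIV. f \<mu>) = f Cu + f Cr + f (Cx Zeta) + (f (Cx Zetabar) :: complex)"
  by (simp add: UNIV_coord add.assoc)

lemma sum_ang: "(\<Sum>A\<in>UNIV. f A) = f Zeta + (f Zetabar :: complex)"
  by (simp add: UNIV_ang)

lemma forall_coord: "(\<forall>\<mu>. P \<mu>) \<longleftrightarrow> P Cu \<and> P Cr \<and> P (Cx Zeta) \<and> P (Cx Zetabar)"
proof -
  have "(\<forall>\<mu>. P \<mu>) \<longleftrightarrow> (\<forall>\<mu>\<in>(UNIV :: coord set). P \<mu>)" by simp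
  then show ?thesis by (simp only: UNIV_coord) auto
qed

lemma nu_inv_identities:
  fixes a b c i p1 p2 :: complex
  assumes "a * c * i - b * b * i = 1"
  shows "2 * (i * (p1 * (p2 * b))) - a * i * p2 * p2 - c * i * p1 * p1
      + (c * i * p1 - b * i * p2) * p1 + (a * i * p2 - b * i * p1) * p2 = 0"
    and "(c * i * p1 - b * i * p2) * a - p1 + (a * i * p2 - b * i * p1) * b = 0"
    and "(c * i * p1 - b * i * p2) * b - p2 + (a * i * p2 - b * i * p1) * c = 0"
    and "c * i * a - b * i * b = 1" and "a * i * c - b * i * b = 1"
proof -
  show "2 * (i * (p1 * (p2 * b))) - a * i * p2 * p2 - c * i * p1 * p1
      + (c * i * p1 - b * i * p2) * p1 + (a * i * p2 - b * i * p1) * p2 = 0"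
    by (simp add: algebra_simps)
  have "(c * i * p1 - b * i * p2) * a - p1 + (a * i * p2 - b * i * p1) * b = p1 * (a * c * i - b * b * i) - p1"
    by (simp add: algebra_simps)
  then show "(c * i * p1 - b * i * p2) * a - p1 + (a * i * p2 - b * i * p1) * b = 0" by (simp add: assms)
  have "(c * i * p1 - b * i * p2) * b - p2 + (a * i * p2 - b * i * p1) * c = p2 * (a * c * i - b * b * i) - p2"
    by (simp add: algebra_simps)
  then show "(c * i * p1 - b * i * p2) * b - p2 + (a * i * p2 - b * i * p1) * c = 0" by (simp add: assms)
  show "c * i * a - b * i * b = 1" "a * i * c - b * i * b = 1"
    using assms by (simp_all add: algebra_simps)
qed

lemma metric_inv_nu:
  assumes m: "nu_shape m u r z"
  shows "metric_inv m \<mu> \<nu> u r z = nu_inv (m Cu Cu u r z) (\<lambda>A. m Cu (Cx A) u r z) (\<lambda>A B. m (Cx A) (Cx B) u r z) \<mu> \<nu>"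
    and "(\<Sum>\<alpha>\<in>UNIV. metric_inv m \<mu> \<alpha> u r z * m \<alpha> \<nu> u r z) = (if \<mu> = \<nu> then 1 else 0)"
proof -
  define k p q where "k = m Cu Cu u r z" and "p = (\<lambda>A. m Cu (Cx A) u r z)" and "q = (\<lambda>A B. m (Cx A) (Cx B) u r z)"
  define i where "i = inverse (det2 q)"
  have di: "det2 q * i = 1" using m unfolding i_def nu_shape_def q_def by (intro right_inverse) auto
  have di': "q Zeta Zeta * q Zetabar Zetabar * i - q Zeta Zetabar * q Zeta Zetabar * i = 1"
    using di unfolding det2_def by (simp add: algebra_simps)
  have v: "m Cr Cr u r z = 0" "m Cu Cr u r z = -1" "m Cr Cu u r z = -1" "m Cr (Cx A) u r z = 0" "m (Cx A) Cr u r z = 0"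
     "m (Cx A) Cu u r z = p A" "m Cu (Cx A) u r z = p A" "m Cu Cu u r z = k" "m (Cx Zetabar) (Cx Zeta) u r z = q Zeta Zetabar"
     "m (Cx Zeta) (Cx B) u r z = q Zeta B" "m (Cx Zetabar) (Cx Zetabar) u r z = q Zetabar Zetabar" for A B
    using m by (auto simp: nu_shape_def p_def q_def k_def)
  let ?M = "\<chi> \<alpha> \<beta>. m \<alpha> \<beta> u r z" and ?N = "\<chi> \<mu> \<nu>. nu_inv k p q \<mu> \<nu>"
  have NM: "(\<Sum>\<alpha>\<in>UNIV. nu_inv k p q \<mu> \<alpha> * m \<alpha> \<nu> u r z) = (if \<mu> = \<nu> then 1 else 0)" for \<mu> \<nu>
  proof -
    have "\<forall>\<mu> \<nu>. (\<Sum>\<alpha>\<in>UNIV. nu_inv k p q \<mu> \<alpha> * m \<alpha> \<nu> u r z) = (if \<mu> = \<nu> then 1 else 0)"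
      unfolding forall_coord sum_coord
      apply (simp add: v sum_ang flip: i_def)
      using nu_inv_identities[OF di'] by simp
    then show ?thesis by blast
  qed
  have "?N ** ?M = mat 1"
    by (simp add: matrix_matrix_mult_def mat_def vec_eq_iff NM)
  moreover from this have "?M ** ?N = mat 1" using matrix_left_right_inverse by blast
  ultimately have "matrix_inv ?M = ?N" by (intro matrix_inv_eqI)
  then have e: "metric_inv m \<mu> \<nu> u r z = nu_inv k p q \<mu> \<nu>" for \<mu> \<nu> by (simp add: metric_inv_def)
  show "metric_inv m \<mu> \<nu> u r z = nu_inv (m Cu Cu u r z) (\<lambda>A. m Cu (Cx A) u r z) (\<lambda>A B. m (Cx A) (Cx B) u r z) \<mu> \<nu>"
    using e by (simp add: k_def p_def q_def)
  show "(\<Sum>\<alpha>\<in>UNIV. metric_inv m \<mu> \<alpha> u r z * m \<alpha> \<nu> u r z) = (if \<mu> = \<nu> then 1 else 0)"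
    using NM by (simp add: e)
qed

lemma invertible_det2:
  assumes "invertible (\<chi> A B. m A B)" "m Zetabar Zeta = m Zeta Zetabar"
  shows "det2 m \<noteq> 0"
proof -
  obtain N :: "complex^ang^ang" where N: "(\<chi> A B. m A B) ** N = mat 1" using assms(1) invertible_def by blast
  have n: "(\<Sum>C\<in>UNIV. m A C * N $ C $ B) = (if A = B then 1 else 0)" for A B
    using N by (simp add: matrix_matrix_mult_def mat_def vec_eq_iff)
  note n[of Zeta Zeta] n[of Zeta Zetabar] n[of Zetabar Zeta] n[of Zetabar Zetabar]
  then have "det2 m * (N $ Zeta $ Zeta * N $ Zetabar $ Zetabar - N $ Zeta $ Zetabar * N $ Zetabar $ Zeta) = 1"
    unfolding sum_ang det2_def assms(2) by simp algebra
  then show ?thesis by auto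
qed

section \<open>Asymptotics of the inverse metric\<close>

locale nu_metric = region +
  fixes \<phi> :: "real \<Rightarrow> complex \<Rightarrow> real" and g :: metric
    and W :: scalar and V :: "ang \<Rightarrow> scalar" and C :: "ang \<Rightarrow> ang \<Rightarrow> real \<Rightarrow> complex \<Rightarrow> complex"
  assumes I: "is_interval I" "0 \<in> I"
    and sm_\<phi>: "smooth_on (I \<times> \<Omega>) (\<lambda>(u, z). \<phi> u z)"
    and sm_W: "sm reg W" and sm_V: "\<And>A. sm reg (V A)" and sm_gx: "\<And>A B. sm reg (g (Cx A) (Cx B))"
    and sm_C: "\<And>A B. smooth_on (I \<times> \<Omega>) (\<lambda>(u, z). C A B u z)"
    and guu: "\<And>u r z. u \<in> I \<Longrightarrow> r > r0 \<Longrightarrow> z \<in> \<Omega> \<Longrightarrow> g Cu Cu u r z = W u r z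
          + (\<Sum>A\<in>UNIV. \<Sum>B\<in>UNIV. g (Cx A) (Cx B) u r z * V A u r z * V B u r z)"
    and gr: "\<And>u r z. u \<in> I \<Longrightarrow> r > r0 \<Longrightarrow> z \<in> \<Omega> \<Longrightarrow> g Cu Cr u r z = -1"
      "\<And>u r z. u \<in> I \<Longrightarrow> r > r0 \<Longrightarrow> z \<in> \<Omega> \<Longrightarrow> g Cr Cu u r z = -1"
      "\<And>u r z. u \<in> I \<Longrightarrow> r > r0 \<Longrightarrow> z \<in> \<Omega> \<Longrightarrow> g Cr Cr u r z = 0"
      "\<And>u r z A. u \<in> I \<Longrightarrow> r > r0 \<Longrightarrow> z \<in> \<Omega> \<Longrightarrow> g Cr (Cx A) u r z = 0"
      "\<And>u r z A. u \<in> I \<Longrightarrow> r > r0 \<Longrightarrow> z \<in> \<Omega> \<Longrightarrow> g (Cx A) Cr u r z = 0"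
    and guA: "\<And>u r z A. u \<in> I \<Longrightarrow> r > r0 \<Longrightarrow> z \<in> \<Omega> \<Longrightarrow> g Cu (Cx A) u r z = - (\<Sum>B\<in>UNIV. g (Cx A) (Cx B) u r z * V B u r z)"
      "\<And>u r z A. u \<in> I \<Longrightarrow> r > r0 \<Longrightarrow> z \<in> \<Omega> \<Longrightarrow> g (Cx A) Cu u r z = - (\<Sum>B\<in>UNIV. g (Cx A) (Cx B) u r z * V B u r z)"
    and gsym: "\<And>u r z A B. u \<in> I \<Longrightarrow> r > r0 \<Longrightarrow> z \<in> \<Omega> \<Longrightarrow> g (Cx A) (Cx B) u r z = g (Cx B) (Cx A) u r z"
    and ginv: "\<And>u r z. u \<in> I \<Longrightarrow> r > r0 \<Longrightarrow> z \<in> \<Omega> \<Longrightarrow> invertible (\<chi> A B. g (Cx A) (Cx B) u r z)"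
    and asym_g: "\<And>A B. asymp_o I \<Omega> 1
        (\<lambda>u r z. g (Cx A) (Cx B) u r z - (of_real (r^2) * gbar \<phi> A B u z + of_real r * C A B u z))"
    and asym_V: "\<And>A. asymp_O I \<Omega> (-2) (V A)"
    and asym_W: "asymp_O I \<Omega> (-1) (\<lambda>u r z. W u r z
        - (of_real (- 2 * r * vector_derivative (\<lambda>v. \<phi> v z) (at u))
           + laplace_bar \<phi> (\<lambda>u z. of_real (\<phi> u z)) u z))"
begin

sublocale bx: box I "{r0<..}" \<Omega>
  using open_I open_\<Omega> I by unfold_locales auto

text \<open>Home of the data independent of r, such as \<phi> and f: with the radial slot
  unrestricted they can be evaluated at r = 0.\<close>

sublocale ux: box I UNIV \<Omega>
  using open_I open_\<Omega> I by unfold_locales auto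

lemma sm_reg_of_ux: "sm (I \<times> UNIV \<times> \<Omega>) F \<Longrightarrow> sm reg F"
  by (erule smooth_on_subset) auto

lemma sm_lift:
  fixes a :: "real \<Rightarrow> complex \<Rightarrow> 'b::real_normed_vector"
  assumes a: "smooth_on (J \<times> B) (\<lambda>(u, z). a u z)" and o: "open J" "open B" "open R"
  shows "smooth_on (J \<times> R \<times> B) (\<lambda>(u, r, z). a u z)"
proof -
  have "smooth_on (J \<times> R \<times> B) (\<lambda>x. (\<lambda>(u, z). a u z) (fst x, snd (snd x)))"
    by (rule smooth_on_linear_precomp[OF _ _ _ a])
       (use o in \<open>auto intro!: open_Times bounded_linear_Pair bounded_linear_fst bounded_linear_compose[OF bounded_linear_snd bounded_linear_snd]\<close>)
  then show ?thesis by (simp add: case_prod_unfold)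
qed

lemma sm_lift2:
  assumes a: "smooth_on (J \<times> B) (\<lambda>(u, z). a u z)" and o: "open J" "open B" "open R"
  shows "sm (J \<times> R \<times> B) (lift2 a)"
proof -
  have "open (J \<times> R \<times> B)" using o by (auto intro!: open_Times)
  from smooth_on_bounded_linear_comp[OF bounded_linear_of_real this sm_lift[OF a o]]
  show ?thesis by (simp add: case_prod_unfold)
qed

abbreviation "\<Phi> \<equiv> lift2 \<phi>"

lemma sm_\<Phi>: "sm (I \<times> UNIV \<times> \<Omega>) \<Phi>"
  by (rule sm_lift2[OF sm_\<phi> open_I open_\<Omega> open_UNIV])

lemma nu_shape_g:
  assumes "u \<in> I" "r > r0" "z \<in> \<Omega>"
  shows "nu_shape g u r z"
  unfolding nu_shape_def
  using gr[OF assms] guA[OF assms] gsym[OF assms] invertible_det2[of "\<lambda>A B. g (Cx A) (Cx B) u r z", OF ginv[OF assms]]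
  by auto

definition Gi :: "coord \<Rightarrow> coord \<Rightarrow> scalar" where "Gi \<mu> \<nu> = metric_inv g \<mu> \<nu>"

lemma sm_g: "sm reg (g \<mu> \<nu>)"
proof -
  have S: "sm reg (\<lambda>u r z. W u r z + (\<Sum>A\<in>UNIV. \<Sum>B\<in>UNIV. g (Cx A) (Cx B) u r z * V A u r z * V B u r z))"
    "sm reg (\<lambda>u r z. - (\<Sum>B\<in>UNIV. g (Cx A) (Cx B) u r z * V B u r z))"
    "sm reg (\<lambda>u r z. c)" for A c
    by (intro bx.sm_rules sm_W sm_V sm_gx)+
  have "sm reg (g Cu Cu)" "sm reg (g Cu Cr)" "sm reg (g Cr Cu)" "sm reg (g Cr Cr)"
    "sm reg (g Cr (Cx A))" "sm reg (g (Cx A) Cr)" "sm reg (g Cu (Cx A))" "sm reg (g (Cx A) Cu)" for A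
    using S(1) S(2)[of A] S(3)[of "-1"] S(3)[of 0]
      bx.sm_CONG[of "g Cu Cu" "\<lambda>u r z. W u r z + (\<Sum>A\<in>UNIV. \<Sum>B\<in>UNIV. g (Cx A) (Cx B) u r z * V A u r z * V B u r z)"]
      bx.sm_CONG[of "g Cu (Cx A)" "\<lambda>u r z. - (\<Sum>B\<in>UNIV. g (Cx A) (Cx B) u r z * V B u r z)"]
      bx.sm_CONG[of "g (Cx A) Cu" "\<lambda>u r z. - (\<Sum>B\<in>UNIV. g (Cx A) (Cx B) u r z * V B u r z)"]
      bx.sm_CONG[of "g Cu Cr" "\<lambda>u r z. -1"] bx.sm_CONG[of "g Cr Cu" "\<lambda>u r z. -1"] bx.sm_CONG[of "g Cr Cr" "\<lambda>u r z. 0"]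
      bx.sm_CONG[of "g Cr (Cx A)" "\<lambda>u r z. 0"] bx.sm_CONG[of "g (Cx A) Cr" "\<lambda>u r z. 0"]
    by (auto simp: guu guA gr)
  then show ?thesis using sm_gx by (cases \<mu>; cases \<nu>) auto
qed

abbreviation gx :: "real \<Rightarrow> real \<Rightarrow> complex \<Rightarrow> ang \<Rightarrow> ang \<Rightarrow> complex" where
  "gx u r z \<equiv> \<lambda>A B. g (Cx A) (Cx B) u r z"

lemma Gi_eq:
  assumes "u \<in> I" "r > r0" "z \<in> \<Omega>"
  shows "Gi \<mu> \<nu> u r z = nu_inv (g Cu Cu u r z) (\<lambda>A. g Cu (Cx A) u r z) (gx u r z) \<mu> \<nu>"
    and "(\<Sum>\<alpha>\<in>UNIV. Gi \<mu> \<alpha> u r z * g \<alpha> \<nu> u r z) = (if \<mu> = \<nu> then 1 else 0)"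
  unfolding Gi_def using metric_inv_nu[OF nu_shape_g[OF assms]] by auto

lemma Gi_sym: "u \<in> I \<Longrightarrow> r > r0 \<Longrightarrow> z \<in> \<Omega> \<Longrightarrow> Gi \<mu> \<nu> u r z = Gi \<nu> \<mu> u r z"
  by (simp add: Gi_eq(1) nu_inv_sym)

lemma g_sym: "u \<in> I \<Longrightarrow> r > r0 \<Longrightarrow> z \<in> \<Omega> \<Longrightarrow> g \<mu> \<nu> u r z = g \<nu> \<mu> u r z"
  by (cases \<mu>; cases \<nu>) (auto simp: gr guA intro: gsym)

lemma det_nonzero: "u \<in> I \<Longrightarrow> r > r0 \<Longrightarrow> z \<in> \<Omega> \<Longrightarrow> det2 (gx u r z) \<noteq> 0"
  using nu_shape_g by (auto simp: nu_shape_def)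

lemma sm_det: "sm reg (\<lambda>u r z. det2 (gx u r z))"
  unfolding det2_def by (intro bx.sm_rules sm_gx)

lemma sm_idet: "sm reg (\<lambda>u r z. inverse (det2 (gx u r z)))"
  using smooth_on_inverse[OF open_reg _ sm_det] det_nonzero by (auto simp: case_prod_unfold)

lemma sm_inv2: "sm reg (\<lambda>u r z. inv2 (gx u r z) A B)"
  by (cases A; cases B; simp only: inv2.simps; intro bx.sm_rules sm_gx sm_idet)

lemma sm_Gi: "sm reg (Gi \<mu> \<nu>)"
proof -
  have "sm reg (\<lambda>u r z. nu_inv (g Cu Cu u r z) (\<lambda>A. g Cu (Cx A) u r z) (gx u r z) \<mu> \<nu>)"
    by (cases \<mu>; cases \<nu>; simp only: nu_inv.simps; intro bx.sm_rules sm_inv2 sm_g)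
  then show ?thesis by (subst bx.sm_CONG) (auto simp: Gi_eq(1))
qed

lemma Gi_rA: "u \<in> I \<Longrightarrow> r > r0 \<Longrightarrow> z \<in> \<Omega> \<Longrightarrow> Gi Cr (Cx A) u r z = - V A u r z"
proof -
  assume p: "u \<in> I" "r > r0" "z \<in> \<Omega>"
  have e: "(\<Sum>C\<in>UNIV. Gi (Cx A) (Cx C) u r z * g (Cx C) (Cx D) u r z) = (if A = D then 1 else 0)" for D
    using Gi_eq(2)[OF p, of "Cx A" "Cx D"] by (simp add: sum_coord sum_ang gr[OF p] Gi_eq(1)[OF p])
  have "Gi Cr (Cx A) u r z = (\<Sum>C\<in>UNIV. Gi (Cx A) (Cx C) u r z * (- (\<Sum>D\<in>UNIV. g (Cx C) (Cx D) u r z * V D u r z)))"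
    by (simp add: Gi_eq(1)[OF p] guA[OF p])
  also have "\<dots> = - (\<Sum>D\<in>UNIV. (\<Sum>C\<in>UNIV. Gi (Cx A) (Cx C) u r z * g (Cx C) (Cx D) u r z) * V D u r z)"
    unfolding sum_ang by algebra
  also have "\<dots> = - V A u r z" unfolding e by (cases A) (simp_all add: sum_ang)
  finally show ?thesis .
qed

lemma R1_r0: "r > R1 \<Longrightarrow> r > r0" by (simp add: R1_def)

abbreviation "gam \<equiv> (\<lambda>u r z. complex_of_real (exp (2 * \<phi> u z) / 2))"

lemma sm_expPhi: "sm (I \<times> UNIV \<times> \<Omega>) (\<lambda>u r z. complex_of_real (exp (c * \<phi> u z) / d))"
proof -
  have "sm (I \<times> UNIV \<times> \<Omega>) (\<lambda>u r z. exp (of_real c * \<Phi> u r z) / of_real d)"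
    by (intro ux.sm_rules sm_\<Phi>)
  then show ?thesis by (simp add: exp_of_real flip: of_real_mult)
qed

lemma Ord_gam: "Ord 0 gam" by (rule Ord_indep[OF sm_expPhi])

lemma Ord_r2: "Ord 2 (\<lambda>u r z. of_real (r^2))"
  using Ord_rpow[of 2] by simp

lemma Ord_r: "Ord 1 (\<lambda>u r z. of_real r)"
  using Ord_rpow[of 1] by simp

lemma Ord_g1: "Ord 1 (\<lambda>u r z. g (Cx A) (Cx B) u r z - of_real (r^2) * gbar \<phi> A B u z)"
proof -
  have gb: "sm (I \<times> UNIV \<times> \<Omega>) (\<lambda>u r z. gbar \<phi> A B u z)"
    using sm_expPhi[of 2 2] ux.sm_const[of 0] by (cases "A = B") (simp_all add: gbar_def)
  have c: "sm (I \<times> UNIV \<times> \<Omega>) (\<lambda>u r z. C A B u z)" by (rule sm_lift[OF sm_C open_I open_\<Omega> open_UNIV])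
  have c': "Ord 1 (\<lambda>u r z. of_real r * C A B u z)" using Ord_mult[OF Ord_r Ord_indep[OF c]] by simp
  have "Ord 1 (\<lambda>u r z. g (Cx A) (Cx B) u r z - (of_real (r^2) * gbar \<phi> A B u z + of_real r * C A B u z))"
  proof (rule asymp_O_Ord[OF asymp_o_imp_O[OF asym_g]])
    fix u r z assume p: "u \<in> I" "r > R1" "z \<in> \<Omega>"
    have "pdiff (\<lambda>u r z. gbar \<phi> A B u z) u r z" "pdiff (\<lambda>u r z. C A B u z) u r z"
      using sm_pdiff[OF gb] sm_pdiff[OF c] p by auto
    moreover have "pdiff (g (Cx A) (Cx B)) u r z" using sm_pdiff[OF sm_gx] p R1_r0 by auto
    moreover have "pdiff (\<lambda>u r z. of_real (r^2)) u r z" "pdiff (\<lambda>u r z. of_real r) u r z"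
      using Ord_r2 Ord_r p unfolding Ord_def by auto
    ultimately show "pdiff (\<lambda>u r z. g (Cx A) (Cx B) u r z - (of_real (r^2) * gbar \<phi> A B u z + of_real r * C A B u z)) u r z"
      by (intro pdiff_diff pdiff_add pdiff_mult)
  qed
  from Ord_add[OF this c'] show ?thesis by (simp add: algebra_simps)
qed

text \<open>In complex coordinates \<open>gbar\<close> is purely off-diagonal, so the diagonal
  entries lack the r^2 term.\<close>

lemma Ord_gdiag: "Ord 1 (g (Cx A) (Cx A))"
  using Ord_g1[of A A] by (simp add: gbar_def)

lemma Ord_goff: "A \<noteq> B \<Longrightarrow> Ord 1 (\<lambda>u r z. g (Cx A) (Cx B) u r z - of_real (r^2) * gam u r z)"
  using Ord_g1[of A B] by (simp add: gbar_def)

lemma Ord_g: "Ord 2 (g (Cx A) (Cx B))"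
proof (cases "A = B")
  case True then show ?thesis using Ord_mono[OF Ord_gdiag, of 2 A] by simp
next
  case False
  from Ord_add[OF Ord_mono[OF Ord_goff[OF False], of 2] Ord_mult[OF Ord_r2 Ord_gam, simplified]]
  show ?thesis by simp
qed

text \<open>The sum is the error term: the determinant of an off-diagonal metric is minus the square
  of its entry r^2 \<open>gam\<close>.\<close>

lemma Ord_det: "Ord 3 (\<lambda>u r z. det2 (gx u r z) + of_real (r^2) * gam u r z * (of_real (r^2) * gam u r z))"
proof -
  let ?b = "\<lambda>u r z. g (Cx Zeta) (Cx Zetabar) u r z - of_real (r^2) * gam u r z"
  have b: "Ord 1 ?b" by (rule Ord_goff) simp
  have rg: "Ord 2 (\<lambda>u r z. of_real (r^2) * gam u r z)" using Ord_mult[OF Ord_r2 Ord_gam] by simp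
  have 1: "Ord 3 (\<lambda>u r z. g (Cx Zeta) (Cx Zeta) u r z * g (Cx Zetabar) (Cx Zetabar) u r z)"
    using Ord_mono[OF Ord_mult[OF Ord_gdiag Ord_gdiag], of 3] by simp
  have 2: "Ord 3 (\<lambda>u r z. ?b u r z * ?b u r z)" using Ord_mono[OF Ord_mult[OF b b], of 3] by simp
  have 3: "Ord 3 (\<lambda>u r z. ?b u r z * (of_real (r^2) * gam u r z))" using Ord_mult[OF b rg] by simp
  have "Ord 3 (\<lambda>u r z. g (Cx Zeta) (Cx Zeta) u r z * g (Cx Zetabar) (Cx Zetabar) u r z
     - (?b u r z * ?b u r z + (?b u r z * (of_real (r^2) * gam u r z) + ?b u r z * (of_real (r^2) * gam u r z))))"
    by (rule Ord_diff[OF 1 Ord_add[OF 2 Ord_add[OF 3 3]]])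
  then show ?thesis by (simp add: det2_def algebra_simps)
qed

lemma Ord_det4: "Ord 4 (\<lambda>u r z. det2 (gx u r z))"
  unfolding det2_def
  using Ord_diff[OF Ord_mult[OF Ord_g[of Zeta Zeta] Ord_g[of Zetabar Zetabar]] Ord_mult[OF Ord_g[of Zeta Zetabar] Ord_g[of Zeta Zetabar]]]
  by simp

lemma Ord_idet: "Ord (-4) (\<lambda>u r z. inverse (det2 (gx u r z)))"
proof (rule Ord_inverse[OF Ord_det4])
  show "bnd (-4) (\<lambda>u r z. inverse (det2 (gx u r z)))"
  proof (rule bndI)
    fix K assume K: "compact K" "K \<subseteq> I \<times> \<Omega>"
    obtain c R where R: "c \<ge> 0" "R \<ge> 1" "\<And>r u z. r \<ge> R \<Longrightarrow> (u, z) \<in> K \<Longrightarrow>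
       cmod (det2 (gx u r z) + of_real (r^2) * gam u r z * (of_real (r^2) * gam u r z)) \<le> c * r powi 3"
      using bndE[OF Ord_bnd[OF Ord_det] K] by metis
    \<comment> \<open>The function 4 exp (-4 \<phi>) is the inverse of the square of
      \<open>gam\<close>. Bounding it by \<open>M\<close> on the compact set bounds that square
      below by m = 1 / (M + 1), the summand 1 keeping m finite.\<close>
    have "bnd 0 (\<lambda>u r z. complex_of_real (exp ((-4) * \<phi> u z) / (1/4)))"
      by (rule Ord_bnd[OF Ord_indep[OF sm_expPhi]])
    from bndE[OF this K] obtain M R' where M: "M \<ge> 0" "R' \<ge> 1" "\<And>r u z. r \<ge> R' \<Longrightarrow> (u, z) \<in> K \<Longrightarrow>
       cmod (complex_of_real (exp ((-4) * \<phi> u z) / (1/4))) \<le> M * r powi 0"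
      by metis
    define m where "m = 1 / (M + 1)"
    have m: "m > 0" using M by (simp add: m_def)
    have gm: "(exp (2 * \<phi> u z) / 2)^2 \<ge> m" if "(u, z) \<in> K" for u z
    proof -
      have "4 * exp (- (4 * \<phi> u z)) \<le> M + 1" using M(3)[OF order_refl that] by simp
      then have "1 / (M + 1) \<le> 1 / (4 * exp (- (4 * \<phi> u z)))"
        by (intro divide_left_mono) (use M in \<open>auto intro!: mult_pos_pos\<close>)
      also have "\<dots> = (exp (2 * \<phi> u z) / 2)^2"
        by (simp add: exp_minus field_simps power2_eq_square flip: exp_add)
      finally show ?thesis by (simp add: m_def)
    qed
    \<comment> \<open>From r = 2 c / m on, the error c r^3 is at most half of the leading term m
      r^4.\<close>
    have "cmod (inverse (det2 (gx u r z))) \<le> (2 / m) * r powi (-4)"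
      if r: "r \<ge> max R (2 * c / m)" and uz: "(u, z) \<in> K" for r u z
    proof -
      have r1: "r \<ge> 1" "r \<ge> R" "r * m \<ge> 2 * c" using r R m by (auto simp: field_simps)
      let ?x = "of_real (r^2) * gam u r z * (of_real (r^2) * gam u r z)"
      have x: "cmod ?x = r^4 * (exp (2 * \<phi> u z) / 2)^2"
        by (simp add: norm_mult norm_power power2_eq_square power4_eq_xxxx)
      have "m * r^4 \<le> cmod ?x" 
        unfolding x using mult_left_mono[OF gm[OF uz], of "r^4"] by (simp add: mult.commute)
      moreover have "cmod ?x \<le> cmod (det2 (gx u r z) + ?x) + cmod (det2 (gx u r z))"
        using norm_triangle_ineq4[of "det2 (gx u r z) + ?x" "det2 (gx u r z)"] by simp
      moreover have "cmod (det2 (gx u r z) + ?x) \<le> c * r^3" using R(3)[OF r1(2) uz] by simp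
      moreover have "c * r^3 \<le> m / 2 * r^4"
      proof -
        have "(2 * c) * r^3 \<le> (r * m) * r^3" using r1 by (intro mult_right_mono) auto
        then show ?thesis by (simp add: power4_eq_xxxx power3_eq_cube algebra_simps)
      qed
      ultimately have d: "m / 2 * r^4 \<le> cmod (det2 (gx u r z))" by simp
      have "0 < m / 2 * r^4" using m r1 by auto
      then have "inverse (cmod (det2 (gx u r z))) \<le> inverse (m / 2 * r^4)"
        using d by (rule le_imp_inverse_le[rotated])
      also have "inverse (m / 2 * r^4) = (2 / m) * r powi (-4)"
        using r1 by (simp add: power_int_minus field_simps)
      finally show ?thesis by (simp add: norm_inverse)
    qed
    then show "\<exists>c R. \<forall>r\<ge>R. \<forall>u z. (u, z) \<in> K \<longrightarrow> cmod (inverse (det2 (gx u r z))) \<le> c * r powi (-4)"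
      by blast
  qed
qed (use det_nonzero R1_r0 in auto)

lemma Ord_Gi_diag: "Ord (-3) (Gi (Cx A) (Cx A))"
proof (rule Ord_cong)
  show "Ord (-3) (\<lambda>u r z. inv2 (gx u r z) A A)"
    using Ord_mult[OF Ord_gdiag[of Zeta] Ord_idet] Ord_mult[OF Ord_gdiag[of Zetabar] Ord_idet]
    by (cases A) simp_all
qed (auto simp: Gi_eq(1) R1_r0)

text \<open>The leading coefficient 2 exp (-2 \<phi>) of the off-diagonal inverse metric, written in
  the form of \<open>sm_expPhi\<close>.\<close>

abbreviation "igam \<equiv> (\<lambda>u r z. complex_of_real (exp ((-2) * \<phi> u z) / (1/2)))"

lemma Ord_igam: "Ord 0 igam" by (rule Ord_indep[OF sm_expPhi])

text \<open>Over a common denominator the difference is minus (det + r^2 \<open>gam\<close> times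
  g_\<zeta>\<zeta>') divided by det r^2 \<open>gam\<close>, with \<zeta>' the conjugate. The r^4
  terms of the numerator cancel, leaving O(r^3) over r^6; \<open>?n\<close> is that numerator,
  arranged in terms of the deviation from r^2 \<open>gam\<close>.\<close>

lemma Ord_Gi_off:
  assumes "A \<noteq> B"
  shows "Ord (-3) (\<lambda>u r z. Gi (Cx A) (Cx B) u r z - of_real (r powi (-2)) * igam u r z)"
proof (rule Ord_cong)
  let ?b = "\<lambda>u r z. g (Cx Zeta) (Cx Zetabar) u r z - of_real (r^2) * gam u r z"
  let ?n = "\<lambda>u r z. g (Cx Zeta) (Cx Zeta) u r z * g (Cx Zetabar) (Cx Zetabar) u r z
     - (?b u r z * ?b u r z + ?b u r z * (of_real (r^2) * gam u r z))"
  have b: "Ord 1 ?b" by (rule Ord_goff) simp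
  have rg: "Ord 2 (\<lambda>u r z. of_real (r^2) * gam u r z)" using Ord_mult[OF Ord_r2 Ord_gam] by simp
  have 1: "Ord 3 (\<lambda>u r z. g (Cx Zeta) (Cx Zeta) u r z * g (Cx Zetabar) (Cx Zetabar) u r z)"
    using Ord_mono[OF Ord_mult[OF Ord_gdiag Ord_gdiag], of 3] by simp
  have 2: "Ord 3 (\<lambda>u r z. ?b u r z * ?b u r z)" using Ord_mono[OF Ord_mult[OF b b], of 3] by simp
  have 3: "Ord 3 (\<lambda>u r z. ?b u r z * (of_real (r^2) * gam u r z))" using Ord_mult[OF b rg] by simp
  have n: "Ord 3 ?n" by (rule Ord_diff[OF 1 Ord_add[OF 2 3]])
  have "Ord (3 + (-4) + (-2) + 0) (\<lambda>u r z. ?n u r z * inverse (det2 (gx u r z)) * of_real (r powi (-2)) * igam u r z)"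
    by (intro Ord_mult n Ord_idet Ord_rpow Ord_igam)
  from Ord_minus[OF this]
  show "Ord (-3) (\<lambda>u r z. - (?n u r z * inverse (det2 (gx u r z)) * of_real (r powi (-2)) * igam u r z))" by simp
  fix u r z assume p: "u \<in> I" "r > R1" "z \<in> \<Omega>"
  have r: "r > 0" "r > r0" using p by (auto simp: R1_def)
  let ?a = "g (Cx Zeta) (Cx Zeta) u r z" and ?c = "g (Cx Zetabar) (Cx Zetabar) u r z" and ?m = "g (Cx Zeta) (Cx Zetabar) u r z"
  define e where "e = of_real (r^2) * gam u r z"
  define i where "i = complex_of_real (r powi (-2)) * igam u r z"
  have ei: "e * i = 1"
  proof -
    have "r^2 * (exp (2 * \<phi> u z) / 2) * (r powi (-2) * (exp ((-2) * \<phi> u z) / (1/2))) = 1"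
      using r by (simp add: power_int_minus field_simps flip: exp_add)
    then show ?thesis unfolding e_def i_def by (metis of_real_1 of_real_mult)
  qed
  define d where "d = inverse (det2 (gx u r z))"
  have d: "det2 (gx u r z) * d = 1" unfolding d_def using det_nonzero[OF p(1) r(2) p(3)] by simp
  have G: "Gi (Cx A) (Cx B) u r z = - ?m * d"
    using assms by (cases A; cases B) (auto simp: Gi_eq(1)[OF p(1) r(2) p(3)] d_def)
  have "- ((?a * ?c - ((?m - e) * (?m - e) + (?m - e) * e)) * d * i) = - ?m * d - i"
    using d ei unfolding det2_def by algebra
  then show "- (?n u r z * inverse (det2 (gx u r z)) * of_real (r powi (-2)) * igam u r z) =
      Gi (Cx A) (Cx B) u r z - of_real (r powi (-2)) * igam u r z"
    unfolding G d_def[symmetric] e_def[symmetric] i_def by (simp add: mult.assoc)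
qed

lemma Ord_Gi: "Ord (-2) (Gi (Cx A) (Cx B))"
proof (cases "A = B")
  case True then show ?thesis using Ord_mono[OF Ord_Gi_diag, of "-2" A] by simp
next
  case False
  have "Ord (-2) (\<lambda>u r z. of_real (r powi (-2)) * igam u r z)" using Ord_mult[OF Ord_rpow[of "-2"] Ord_igam] by simp
  from Ord_add[OF Ord_mono[OF Ord_Gi_off[OF False], of "-2"] this]
  show ?thesis by simp
qed

lemma Ord_V: "Ord (-2) (V A)"
  by (rule asymp_O_Ord[OF asym_V]) (auto intro!: sm_pdiff[OF sm_V] simp: R1_r0)

lemma Ord_Gi_rA: "Ord (-2) (Gi Cr (Cx A))"
  by (rule Ord_cong[OF _ Ord_minus[OF Ord_V]]) (simp add: Gi_rA R1_r0)

lemma Ord_guA: "Ord 0 (g Cu (Cx A))"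
proof (rule Ord_cong)
  have "Ord 0 (\<lambda>u r z. g (Cx A) (Cx B) u r z * V B u r z)" for B
    using Ord_mult[OF Ord_g Ord_V] by simp
  then show "Ord 0 (\<lambda>u r z. - (\<Sum>B\<in>UNIV. g (Cx A) (Cx B) u r z * V B u r z))"
    by (intro Ord_minus Ord_sum)
qed (simp add: guA R1_r0)

text \<open>A bound without derivatives is enough, since g_uu enters h_uA undifferentiated. The
  linear term is the one that has to cancel in \<open>bnd_h_uA\<close>.\<close>

lemma bnd_guu: "bnd 0 (\<lambda>u r z. g Cu Cu u r z + 2 * of_real r * pd Cu \<Phi> u r z)"
proof (rule bnd_cong)
  let ?L = "\<lambda>u z. laplace_bar \<phi> (\<lambda>u z. of_real (\<phi> u z)) u z"
  have "Ord 0 (\<lambda>u r z. g (Cx A) (Cx B) u r z * V A u r z * V B u r z)" for A B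
    using Ord_mono[OF Ord_mult[OF Ord_mult[OF Ord_g Ord_V] Ord_V], of 0] by simp
  then have 1: "bnd 0 (\<lambda>u r z. \<Sum>A\<in>UNIV. \<Sum>B\<in>UNIV. g (Cx A) (Cx B) u r z * V A u r z * V B u r z)"
    by (intro Ord_bnd Ord_sum)
  have "sm (I \<times> UNIV \<times> \<Omega>) (\<lambda>u r z. complex_of_real (exp ((-2) * \<phi> u z) / (1/4)) * pd (Cx Zeta) (pd (Cx Zetabar) \<Phi>) u r z)"
    by (intro ux.sm_rules sm_\<Phi> sm_expPhi)
  then have "sm (I \<times> UNIV \<times> \<Omega>) (\<lambda>u r z. ?L u z)"
    by (simp add: laplace_bar_def pd_def mult.commute)
  then have 2: "bnd 0 (\<lambda>u r z. ?L u z)" by (intro Ord_bnd Ord_indep)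
  have 3: "bnd 0 (\<lambda>u r z. W u r z - (of_real (- 2 * r * vector_derivative (\<lambda>v. \<phi> v z) (at u)) + ?L u z))"
    using bnd_mono[OF asymp_O_bnd[OF asym_W, of "[]"], of 0] by simp
  show "bnd 0 (\<lambda>u r z. (W u r z - (of_real (- 2 * r * vector_derivative (\<lambda>v. \<phi> v z) (at u)) + ?L u z)) + ?L u z
     + (\<Sum>A\<in>UNIV. \<Sum>B\<in>UNIV. g (Cx A) (Cx B) u r z * V A u r z * V B u r z))"
    by (rule bnd_add[OF bnd_add[OF 3 2] 1])
  fix u r z assume p: "u \<in> I" "r > r0" "z \<in> \<Omega>"
  have "(\<lambda>v. \<phi> v z) differentiable (at u)"
  proof -
    have "((\<lambda>v. (v, z)) has_derivative (\<lambda>h. (h, 0))) (at u)" by (auto intro!: derivative_eq_intros)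
    moreover have "((\<lambda>(u, z). \<phi> u z) has_derivative (\<lambda>v. ddir v (\<lambda>(u, z). \<phi> u z) (u, z))) (at (u, z))"
      using p by (intro has_ddir smooth_on_differentiable[OF sm_\<phi>]) auto
    ultimately have "((\<lambda>v. (\<lambda>(u, z). \<phi> u z) (v, z)) has_derivative (\<lambda>h. ddir (h, 0) (\<lambda>(u, z). \<phi> u z) (u, z))) (at u)"
      by (rule has_derivative_compose)
    then show ?thesis by (auto simp: differentiable_def)
  qed
  then have "((\<lambda>v. \<phi> v z) has_vector_derivative vector_derivative (\<lambda>v. \<phi> v z) (at u)) (at u)"
    by (simp add: vector_derivative_works)
  then have "((\<lambda>v. complex_of_real (\<phi> v z)) has_vector_derivative of_real (vector_derivative (\<lambda>v. \<phi> v z) (at u))) (at u)"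
    by (intro has_vector_derivative_of_real) (simp add: has_real_derivative_iff_has_vector_derivative)
  then have "pd Cu \<Phi> u r z = of_real (vector_derivative (\<lambda>v. \<phi> v z) (at u))"
    by (simp add: pd_def vector_derivative_at)
  then show "(W u r z - (of_real (- 2 * r * vector_derivative (\<lambda>v. \<phi> v z) (at u)) + ?L u z)) + ?L u z
     + (\<Sum>A\<in>UNIV. \<Sum>B\<in>UNIV. g (Cx A) (Cx B) u r z * V A u r z * V B u r z)
     = g Cu Cu u r z + 2 * of_real r * pd Cu \<Phi> u r z"
    by (simp add: guu[OF p])
qed

end

section \<open>The vector fields\<close>

locale nu_xi = nu_metric +
  fixes Y :: "ang \<Rightarrow> complex \<Rightarrow> complex" and T :: "complex \<Rightarrow> real" and \<omega> :: "real \<Rightarrow> complex \<Rightarrow> real"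
  assumes cf: "\<And>u z. u \<in> I \<Longrightarrow> z \<in> \<Omega> \<Longrightarrow> conf_factor g u z = \<phi> u z"
    and Y: "conformal_killing \<Omega> Y" and T: "smooth_on \<Omega> T"
    and \<omega>: "smooth_on (I \<times> \<Omega>) (\<lambda>(u, z). \<omega> u z)"
begin

lemma sm_lift_z:
  fixes a :: "complex \<Rightarrow> 'b::real_normed_vector"
  assumes a: "smooth_on B a" and o: "open J" "open B" "open R"
  shows "smooth_on (J \<times> R \<times> B) (\<lambda>(u :: real, r :: real, z). a z)"
proof -
  have "smooth_on (J \<times> R \<times> B) (\<lambda>x. a (snd (snd x)))"
    by (rule smooth_on_linear_precomp[OF _ _ _ a])
       (use o in \<open>auto intro!: open_Times bounded_linear_compose[OF bounded_linear_snd bounded_linear_snd]\<close>)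
  then show ?thesis by (simp add: case_prod_unfold)
qed

lemma smooth_Y: "smooth_on \<Omega> (Y A)"
proof (cases A)
  case Zeta
  then show ?thesis using Y smooth_on_holomorphic[OF open_\<Omega>] unfolding conformal_killing_def by blast
next
  case Zetabar
  have "smooth_on \<Omega> (\<lambda>z. cnj (Y Zeta z))"
    using Y by (intro smooth_on_bounded_linear_comp[OF bounded_linear_cnj open_\<Omega>] smooth_on_holomorphic open_\<Omega>)
      (simp add: conformal_killing_def)
  then show ?thesis
    using smooth_on_cong[OF open_\<Omega>, of "Y Zetabar" "\<lambda>z. cnj (Y Zeta z)"] Y Zetabar
    by (simp add: conformal_killing_def)
qed

lemma params_box:
  assumes "open J" "open R" "open B" "B \<subseteq> \<Omega>" "J \<subseteq> I"
  shows "sm (J \<times> R \<times> B) (\<lambda>u r z. Y A z)" "sm (J \<times> R \<times> B) (\<lambda>u r z. of_real (T z))" "sm (J \<times> R \<times> B) (lift2 \<omega>)"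
proof -
  show "sm (J \<times> R \<times> B) (\<lambda>u r z. Y A z)"
    by (rule sm_lift_z[OF smooth_on_subset[OF smooth_Y assms(4)] assms(1,3,2)])
  have o: "open (J \<times> R \<times> B)" using assms by (auto intro!: open_Times)
  from smooth_on_bounded_linear_comp[OF bounded_linear_of_real o sm_lift_z[OF smooth_on_subset[OF T assms(4)] assms(1,3,2)]]
  show "sm (J \<times> R \<times> B) (\<lambda>u r z. of_real (T z))" by (simp add: case_prod_unfold)
  show "sm (J \<times> R \<times> B) (lift2 \<omega>)"
    by (rule sm_lift2[OF smooth_on_subset[OF \<omega>] assms(1,3,2)]) (use assms in auto)
qed

sublocale pm: box_params I UNIV \<Omega> \<Phi> Y T "lift2 \<omega>"
  by unfold_locales (use params_box open_I open_\<Omega> sm_\<Phi> in auto)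

definition indep :: "scalar \<Rightarrow> bool" where "indep F \<longleftrightarrow> (\<forall>u r s z. F u r z = F u s z)"

lemma indep_eq: "indep F \<Longrightarrow> F = (\<lambda>u r z. F u 0 z)"
  by (auto simp: indep_def fun_eq_iff)

lemma indep_pd: "indep F \<Longrightarrow> \<mu> \<noteq> Cr \<Longrightarrow> indep (pd \<mu> F)"
  by (subst indep_eq, assumption) (cases \<mu>, auto simp: indep_def pd_def)

lemma indep_pd_r: "indep F \<Longrightarrow> pd Cr F u r z = 0"
  by (subst indep_eq, assumption) (simp add: pd_def)

lemma Ord_of_indep: "indep F \<Longrightarrow> sm (I \<times> UNIV \<times> \<Omega>) F \<Longrightarrow> Ord 0 F"
proof -
  assume a: "indep F" "sm (I \<times> UNIV \<times> \<Omega>) F"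
  from a(2) have "sm (I \<times> UNIV \<times> \<Omega>) (\<lambda>u r z. F u 0 z)" by (subst (asm) indep_eq[OF a(1)])
  then have "Ord 0 (\<lambda>u r z. F u 0 z)" by (rule Ord_indep)
  then show "Ord 0 F" by (subst indep_eq[OF a(1)])
qed

definition f :: scalar where "f = fam \<Phi> Y T (lift2 \<omega>)"

lemma sm_f: "sm (I \<times> UNIV \<times> \<Omega>) f" unfolding f_def by (rule pm.sm_fam)

lemma indep_f: "indep f"
  unfolding f_def indep_def fam_def famF_def famG_def psi_def int0_def pd_def by simp

lemma pd_u_f: "u \<in> I \<Longrightarrow> z \<in> \<Omega> \<Longrightarrow> pd Cu f u r z = f u r z * pd Cu \<Phi> u r z + psi \<Phi> Y (lift2 \<omega>) u r z / 2"
  unfolding f_def using pm.pd_u_fam by simp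

definition lap :: scalar where
  "lap u r z = 4 * exp (- 2 * \<Phi> u r z) * pd (Cx Zeta) (pd (Cx Zetabar) f) u r z"

lemma sm_lap: "sm (I \<times> UNIV \<times> \<Omega>) lap"
  unfolding lap_def[abs_def] by (intro ux.sm_rules sm_\<Phi> sm_f)

lemma indep_\<Phi>: "indep \<Phi>" by (simp add: indep_def)

lemma indep_lap: "indep lap"
proof -
  have i: "indep (pd (Cx Zeta) (pd (Cx Zetabar) f))" by (intro indep_pd indep_f) auto
  have "lap u r z = lap u s z" for u r s z
  proof -
    have e: "pd (Cx Zeta) (pd (Cx Zetabar) f) u r z = pd (Cx Zeta) (pd (Cx Zetabar) f) u s z"
      using i unfolding indep_def by blast
    show ?thesis unfolding lap_def e ..
  qed
  then show ?thesis unfolding indep_def by blast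
qed

text \<open>One integrand serves all components of \<xi>: for \<mu> = r the entry g^rB is -V^B,
  which gives the sign of the V-integral, and for \<mu> = u it vanishes.\<close>

definition P :: "coord \<Rightarrow> scalar" where
  "P \<mu> u r z = (\<Sum>B\<in>UNIV. pd (Cx B) f u r z * Gi \<mu> (Cx B) u r z)"

primrec base :: "coord \<Rightarrow> scalar" where
  "base Cu = f"
| "base Cr = (\<lambda>u r z. - of_real r * pd Cu f u r z + lap u r z / 2)"
| "base (Cx A) = (\<lambda>u r z. Y A z)"

definition X :: "coord \<Rightarrow> scalar" where
  "X \<mu> u r z = base \<mu> u r z - tail (P \<mu>) u r z"

definition grad :: "coord \<Rightarrow> scalar" where
  "grad \<mu> u r z = (\<Sum>\<rho>\<in>UNIV. Gi \<mu> \<rho> u r z * pd \<rho> f u r z)"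

lemma sm_P: "sm reg (P \<mu>)"
  unfolding P_def[abs_def] by (intro bx.sm_rules sm_Gi sm_reg_of_ux[OF sm_f])

lemma sm_grad: "sm reg (grad \<mu>)"
  unfolding grad_def[abs_def] by (intro bx.sm_rules sm_Gi sm_reg_of_ux[OF sm_f])

lemma sm_r: "sm (I \<times> UNIV \<times> \<Omega>) (\<lambda>u r z. of_real r)"
proof -
  have "smooth_on (I \<times> UNIV \<times> \<Omega>) (\<lambda>x. complex_of_real (fst (snd x)))"
    by (intro smooth_on_bounded_linear ux.open_S bounded_linear_compose[OF bounded_linear_of_real]
      bounded_linear_compose[OF bounded_linear_fst bounded_linear_snd])
  then show ?thesis by (simp add: case_prod_unfold)
qed

lemma sm_base: "sm (I \<times> UNIV \<times> \<Omega>) (base \<mu>)"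
  by (cases \<mu>; simp only: base.simps; intro ux.sm_rules sm_f sm_lap pm.sm_Y sm_r)

lemma Ord_f: "Ord 0 f" by (rule Ord_of_indep[OF indep_f sm_f])

lemma Ord_pdf: "\<mu> \<noteq> Cr \<Longrightarrow> Ord 0 (pd \<mu> f)"
  by (rule Ord_of_indep[OF indep_pd[OF indep_f] ux.sm_PD[OF sm_f]])

lemma Ord_lap: "Ord 0 lap" by (rule Ord_of_indep[OF indep_lap sm_lap])

lemma Ord_Y: "Ord 0 (\<lambda>u r z. Y A z)" by (rule Ord_of_indep[OF _ pm.sm_Y]) (simp add: indep_def)

lemma Ord_P: "Ord (-2) (P \<mu>)"
proof (cases "\<mu> = Cu")
  case True
  then show ?thesis
    by (intro Ord_cong[OF _ Ord_zero]) (simp add: P_def Gi_eq(1) R1_r0)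
next
  case False
  then have "Ord (-2) (Gi \<mu> (Cx B))" for B using Ord_Gi Ord_Gi_rA by (cases \<mu>) auto
  then have "Ord (-2) (\<lambda>u r z. pd (Cx B) f u r z * Gi \<mu> (Cx B) u r z)" for B
    using Ord_mult[OF Ord_pdf[of "Cx B"]] by fastforce
  then show ?thesis unfolding P_def[abs_def] by (intro Ord_sum)
qed

lemma Ord_tailP: "Ord (-1) (tail (P \<mu>))"
  by (rule Ord_tail[OF sm_P]) (use Ord_P in auto)

context
  fixes u r z assumes p: "u \<in> I" "r > r0" "z \<in> \<Omega>"
begin

lemma pdiff_reg: "sm reg F \<Longrightarrow> pdiff F u r z" using sm_pdiff p by auto

lemma pdiff_ux: "sm (I \<times> UNIV \<times> \<Omega>) F \<Longrightarrow> pdiff F u r z" using sm_pdiff p by auto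

lemma pdiff_X: "pdiff (X \<mu>) u r z"
  unfolding X_def[abs_def] by (intro pdiff_diff pdiff_ux[OF sm_base] pdiff_tail[OF sm_P Ord_P p(1,3,2)])

lemma pd_X: "pd \<nu> (X \<mu>) u r z = pd \<nu> (base \<mu>) u r z - pd \<nu> (tail (P \<mu>)) u r z"
  unfolding X_def[abs_def] by (intro pd_diff pdiff_ux[OF sm_base] pdiff_tail[OF sm_P Ord_P p(1,3,2)])

lemma grad_base: "grad \<mu> u r z = pd Cr (base \<mu>) u r z + P \<mu> u r z"
proof -
  have r': "pd Cr (\<lambda>u r z. of_real r) u r z = (1 :: complex)"
  proof -
    have "((\<lambda>s. complex_of_real s) has_vector_derivative of_real 1) (at r)"
      by (intro has_vector_derivative_of_real) (rule DERIV_ident)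
    then show ?thesis by (simp add: pd_def vector_derivative_at)
  qed
  have b: "pd Cr (base Cr) u r z = - pd Cu f u r z"
    using indep_pd_r[OF indep_pd[OF indep_f, of Cu]] indep_pd_r[OF indep_lap]
    by (simp add: pd_add pd_diff pd_mult pd_divide pd_minus pdiff_mult pdiff_minus pdiff_ux ux.sm_rules sm_r sm_f sm_lap r')
  show ?thesis
    using indep_pd_r[OF indep_f] b
    by (cases \<mu>) (simp_all add: grad_def P_def sum_coord sum_ang Gi_eq(1)[OF p] pd_def[of Cr "\<lambda>u r z. Y _ z"] algebra_simps)
qed

lemma pd_r_X: "pd Cr (X \<mu>) u r z = grad \<mu> u r z"
  by (simp add: pd_X grad_base pd_tail_r[OF sm_P Ord_P p(1,3,2)])

end

text \<open>The base part is smooth, so its partial derivatives commute; the tail part needs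
  \<open>pd_tail_has_vector_derivative\<close>. For \<nu> = r the radial equation is differentiated
  instead.\<close>

lemma pd_X_radial:
  assumes p: "u \<in> I" "r > r0" "z \<in> \<Omega>"
  shows "((\<lambda>r. pd \<nu> (X \<mu>) u r z) has_vector_derivative pd \<nu> (grad \<mu>) u r z) (at r)"
proof (cases "\<nu> = Cr")
  case True
  have "((\<lambda>r. grad \<mu> u r z) has_vector_derivative pd Cr (grad \<mu>) u r z) (at r)"
    using pdiff_reg[OF p sm_grad] by (simp add: pd_def pdiff_def vector_derivative_works)
  then have "((\<lambda>r. pd Cr (X \<mu>) u r z) has_vector_derivative pd Cr (grad \<mu>) u r z) (at r)"
    by (rule has_vector_derivative_transform_within_open[where S="{r0<..}"]) (use p pd_r_X in auto)
  with True show ?thesis by simp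
next
  case False
  have b: "((\<lambda>r. pd \<nu> (base \<mu>) u r z) has_vector_derivative pd Cr (pd \<nu> (base \<mu>)) u r z) (at r)"
    using pdiff_ux[OF p ux.sm_PD[OF sm_base]] by (simp add: pd_def[of Cr] pdiff_def vector_derivative_works)
  have "((\<lambda>r. pd \<nu> (base \<mu>) u r z - pd \<nu> (tail (P \<mu>)) u r z) has_vector_derivative
      pd Cr (pd \<nu> (base \<mu>)) u r z - - pd \<nu> (P \<mu>) u r z) (at r)"
    by (rule has_vector_derivative_diff[OF b pd_tail_has_vector_derivative[OF sm_P Ord_P p(1,3,2) False]])
  moreover have "pd Cr (pd \<nu> (base \<mu>)) u r z = pd \<nu> (pd Cr (base \<mu>)) u r z"
    using p by (intro pd_commute[OF ux.open_S sm_base]) auto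
  moreover have "pd \<nu> (grad \<mu>) u r z = pd \<nu> (\<lambda>u r z. pd Cr (base \<mu>) u r z + P \<mu> u r z) u r z"
    by (rule pd_cong[OF open_reg]) (use p grad_base in auto)
  ultimately have "((\<lambda>r. pd \<nu> (base \<mu>) u r z - pd \<nu> (tail (P \<mu>)) u r z) has_vector_derivative pd \<nu> (grad \<mu>) u r z) (at r)"
    by (simp add: pd_add pdiff_ux[OF p] ux.sm_PD sm_base pdiff_reg[OF p] sm_P)
  then show ?thesis
    by (rule has_vector_derivative_transform_within_open[where S="{r0<..}"]) (use p pd_X in auto)
qed

lemma X_radial:
  assumes p: "u \<in> I" "r > r0" "z \<in> \<Omega>"
  shows "((\<lambda>r. X \<mu> u r z) has_vector_derivative grad \<mu> u r z) (at r)"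
  using pdiff_X[OF p, of \<mu>] pd_r_X[OF p, of \<mu>] by (simp add: pd_def pdiff_def vector_derivative_works)

lemma f_of_eq: "u \<in> I \<Longrightarrow> z \<in> \<Omega> \<Longrightarrow> f_of (conf_factor g) (Y, T, \<omega>) u z = f u r z"
  unfolding f_def by (rule f_of_fam[OF I _ open_\<Omega>]) (auto simp: cf)

lemma f_of_derivs:
  assumes p: "u \<in> I" "z \<in> \<Omega>"
  shows "dang A (f_of (conf_factor g) (Y, T, \<omega>) u) z = pd (Cx A) f u r z"
    and "vector_derivative (\<lambda>v. f_of (conf_factor g) (Y, T, \<omega>) v z) (at u) = pd Cu f u r z"
    and "laplace_bar (conf_factor g) (f_of (conf_factor g) (Y, T, \<omega>)) u z = lap u r z"
proof -
  have d: "dang A (f_of (conf_factor g) (Y, T, \<omega>) u) z = pd (Cx A) f u r z" if "z \<in> \<Omega>" for A z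
    unfolding pd_def using dang_cong[OF open_\<Omega> that, of "f_of (conf_factor g) (Y, T, \<omega>) u" "f u r"] f_of_eq[OF p(1)] by simp
  show "dang A (f_of (conf_factor g) (Y, T, \<omega>) u) z = pd (Cx A) f u r z" by (rule d[OF p(2)])
  show "vector_derivative (\<lambda>v. f_of (conf_factor g) (Y, T, \<omega>) v z) (at u) = pd Cu f u r z"
    unfolding pd_def using vector_derivative_cong_open[OF open_I p(1), of "\<lambda>v. f_of (conf_factor g) (Y, T, \<omega>) v z" "\<lambda>v. f v r z"]
      f_of_eq[OF _ p(2)] by simp
  have "dang Zeta (dang Zetabar (f_of (conf_factor g) (Y, T, \<omega>) u)) z = dang Zeta (\<lambda>z. pd (Cx Zetabar) f u r z) z"
    by (rule dang_cong[OF open_\<Omega> p(2)]) (rule d)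
  then show "laplace_bar (conf_factor g) (f_of (conf_factor g) (Y, T, \<omega>)) u z = lap u r z"
    by (simp add: laplace_bar_def lap_def cf[OF p] dang_Cx flip: exp_of_real)
qed

lemma Gi_integrable: "u \<in> I \<Longrightarrow> z \<in> \<Omega> \<Longrightarrow> r > r0 \<Longrightarrow> \<mu> \<noteq> Cu \<Longrightarrow> set_integrable lborel {r<..} (\<lambda>s. Gi \<mu> (Cx B) u s z)"
  using tail_integrable[OF sm_Gi Ord_bnd] Ord_Gi Ord_Gi_rA by (cases \<mu>) auto

lemma tail_P:
  assumes p: "u \<in> I" "r > r0" "z \<in> \<Omega>" and \<mu>: "\<mu> \<noteq> Cu"
  shows "tail (P \<mu>) u r z = (\<Sum>B\<in>UNIV. pd (Cx B) f u r z * tail (Gi \<mu> (Cx B)) u r z)"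
proof -
  have e: "pd (Cx B) f u s z = pd (Cx B) f u r z" for s B
    using indep_pd[OF indep_f, of "Cx B"] unfolding indep_def by blast
  have "P \<mu> u s z = (\<Sum>B\<in>UNIV. pd (Cx B) f u r z * Gi \<mu> (Cx B) u s z)" for s
    unfolding P_def by (rule sum.cong[OF refl]) (metis e)
  then show ?thesis
    unfolding tail_eq sum_ang
    using Gi_integrable[OF p(1,3,2) \<mu>] by simp
qed

lemma xi_eq:
  assumes p: "u \<in> I" "r > r0" "z \<in> \<Omega>"
  shows "xi (Y, T, \<omega>) g \<mu> u r z = X \<mu> u r z"
proof (cases \<mu>)
  case Cu
  have "tail (P Cu) u r z = (LINT s:{r<..}|lborel. 0)"
    unfolding tail_eq by (rule set_lebesgue_integral_cong) (use p in \<open>auto simp: P_def Gi_eq(1)\<close>)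
  then have "tail (P Cu) u r z = 0" by (simp add: set_lebesgue_integral_def)
  then show ?thesis using Cu f_of_eq[OF p(1,3)] by (simp add: xi_def X_def)
next
  case Cr
  have "(LBINT s=r..\<infinity>. - metric_inv g Cr (Cx A) u s z) = - tail (Gi Cr (Cx A)) u r z" for A
    by (simp add: tail_def Gi_def interval_lebesgue_integral_uminus)
  then show ?thesis
    using Cr tail_P[OF p, of Cr] f_of_derivs(1)[OF p(1,3), of _ r] f_of_derivs(2,3)[OF p(1,3), of r]
    by (simp add: xi_def X_def sum_negf)
next
  case (Cx A)
  have "(LBINT s=r..\<infinity>. metric_inv g (Cx A) (Cx B) u s z) = tail (Gi (Cx A) (Cx B)) u r z" for B
    by (simp add: tail_def Gi_def)
  then show ?thesis
    using Cx tail_P[OF p, of "Cx A"] f_of_derivs(1)[OF p(1,3), of _ r] f_of_derivs(2,3)[OF p(1,3), of r]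
    by (simp add: xi_def X_def)
qed

lemma pd_xi: "u \<in> I \<Longrightarrow> r > r0 \<Longrightarrow> z \<in> \<Omega> \<Longrightarrow> pd \<nu> (xi (Y, T, \<omega>) g \<mu>) u r z = pd \<nu> (X \<mu>) u r z"
  by (rule pd_cong[OF open_reg]) (auto simp: xi_eq)

section \<open>The Lie derivative of the metric\<close>

definition h :: metric where "h = lie_metric (xi (Y, T, \<omega>) g) g"

context
  fixes u r z assumes p: "u \<in> I" "r > r0" "z \<in> \<Omega>"
begin

lemma h_eq: "h \<mu> \<nu> u r z = (\<Sum>\<rho>\<in>UNIV. X \<rho> u r z * pd \<rho> (g \<mu> \<nu>) u r z
       + g \<rho> \<nu> u r z * pd \<mu> (X \<rho>) u r z + g \<mu> \<rho> u r z * pd \<nu> (X \<rho>) u r z)"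
  by (simp add: h_def lie_metric_def xi_eq[OF p] pd_xi[OF p])

lemma pd_g_sym: "pd \<rho> (g \<mu> \<nu>) u r z = pd \<rho> (g \<nu> \<mu>) u r z"
  by (rule pd_cong[OF open_reg]) (use p g_sym in auto)

lemma h_sym: "h \<mu> \<nu> u r z = h \<nu> \<mu> u r z"
  unfolding h_eq using g_sym[OF p] pd_g_sym
  by (intro sum.cong refl) (metis (no_types, lifting) add.assoc add.commute)

lemma pd_g_r: "pd \<rho> (g Cr \<nu>) u r z = 0"
proof -
  have "pd \<rho> (g Cr \<nu>) u r z = pd \<rho> (\<lambda>u r z. if \<nu> = Cu then -1 else 0) u r z"
    by (rule pd_cong[OF open_reg]) (use p gr in \<open>auto, cases \<nu>, auto\<close>)
  then show ?thesis by (simp add: pd_const)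
qed

lemma Gi_g: "(\<Sum>\<alpha>\<in>UNIV. Gi \<mu> \<alpha> u r z * g \<alpha> \<nu> u r z) = (if \<mu> = \<nu> then 1 else 0)"
  by (rule Gi_eq(2)[OF p])

lemma g_Gi: "(\<Sum>\<alpha>\<in>UNIV. g \<alpha> \<nu> u r z * Gi \<alpha> \<mu> u r z) = (if \<mu> = \<nu> then 1 else 0)"
  using Gi_g[of \<mu> \<nu>] Gi_sym[OF p] by (simp add: mult.commute)

lemma g_Gi': "(\<Sum>\<beta>\<in>UNIV. g \<rho> \<beta> u r z * Gi \<beta> \<nu> u r z) = (if \<nu> = \<rho> then 1 else 0)"
  using g_Gi[of \<rho> \<nu>] g_sym[OF p, of \<rho>] by simp

lemma tail_P_u: "X Cu u r z = f u r z"
  using xi_eq[OF p, of Cu] f_of_eq[OF p(1,3)] by (simp add: xi_def)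

end

lemma pd_X_u:
  assumes p: "u \<in> I" "r > r0" "z \<in> \<Omega>"
  shows "pd \<nu> (X Cu) u r z = pd \<nu> f u r z"
  by (rule pd_cong[OF open_reg]) (use p tail_P_u in auto)

text \<open>Preservation of the gauge. The radial equation gives g_\<rho>\<nu> \<partial>_r X^\<rho>
  = \<partial>_\<nu> f, while g_r\<rho> \<partial>_\<nu> X^\<rho> = -\<partial>_\<nu> f because g_ru
  = -1 is the only nonzero entry of that row.\<close>

lemma h_r:
  assumes p: "u \<in> I" "r > r0" "z \<in> \<Omega>"
  shows "h Cr \<nu> u r z = 0" "h \<nu> Cr u r z = 0"
proof -
  have "(\<Sum>\<rho>\<in>UNIV. g \<rho> \<nu> u r z * pd Cr (X \<rho>) u r z) = (\<Sum>\<sigma>\<in>UNIV. (\<Sum>\<rho>\<in>UNIV. g \<rho> \<nu> u r z * Gi \<rho> \<sigma> u r z) * pd \<sigma> f u r z)"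
    unfolding pd_r_X[OF p] grad_def sum_distrib_left sum_distrib_right
    by (subst sum.swap) (simp add: mult.assoc)
  also have "\<dots> = pd \<nu> f u r z" by (simp add: g_Gi[OF p] if_distrib if_distribR cong: if_cong)
  finally have a: "(\<Sum>\<rho>\<in>UNIV. g \<rho> \<nu> u r z * pd Cr (X \<rho>) u r z) = pd \<nu> f u r z" .
  have b: "(\<Sum>\<rho>\<in>UNIV. g Cr \<rho> u r z * pd \<nu> (X \<rho>) u r z) = - pd \<nu> f u r z"
    by (simp add: sum_coord gr[OF p] pd_X_u[OF p])
  show "h Cr \<nu> u r z = 0"
    unfolding h_eq[OF p] sum.distrib a b by (simp add: pd_g_r[OF p])
  then show "h \<nu> Cr u r z = 0" using h_sym[OF p] by simp
qed

text \<open>The Lie derivative of the inverse metric, hence its variation under \<open>\<delta>g = h\<close>.\<close>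

definition lie_inv :: "coord \<Rightarrow> coord \<Rightarrow> scalar" where
  "lie_inv \<mu> \<nu> u r z = (\<Sum>\<rho>\<in>UNIV. X \<rho> u r z * pd \<rho> (Gi \<mu> \<nu>) u r z
     - Gi \<rho> \<nu> u r z * pd \<rho> (X \<mu>) u r z - Gi \<mu> \<rho> u r z * pd \<rho> (X \<nu>) u r z)"

lemma pd_Gi:
  assumes p: "u \<in> I" "r > r0" "z \<in> \<Omega>"
  shows "pd \<rho> (Gi \<mu> \<nu>) u r z = - (\<Sum>\<alpha>\<in>UNIV. \<Sum>\<beta>\<in>UNIV. Gi \<mu> \<alpha> u r z * pd \<rho> (g \<alpha> \<beta>) u r z * Gi \<beta> \<nu> u r z)"
proof -
  have "pd \<rho> (\<lambda>u r z. \<Sum>\<alpha>\<in>UNIV. Gi \<mu> \<alpha> u r z * g \<alpha> \<beta> u r z) u r z = pd \<rho> (\<lambda>u r z. if \<mu> = \<beta> then 1 else 0) u r z" for \<beta>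
    by (rule pd_cong[OF open_reg]) (use p Gi_g in auto)
  then have 0: "(\<Sum>\<alpha>\<in>UNIV. Gi \<mu> \<alpha> u r z * pd \<rho> (g \<alpha> \<beta>) u r z + pd \<rho> (Gi \<mu> \<alpha>) u r z * g \<alpha> \<beta> u r z) = 0" for \<beta>
    by (simp add: pd_const pd_sum pd_mult pdiff_mult pdiff_reg[OF p] sm_Gi sm_g)
  have "0 = (\<Sum>\<beta>\<in>UNIV. (\<Sum>\<alpha>\<in>UNIV. Gi \<mu> \<alpha> u r z * pd \<rho> (g \<alpha> \<beta>) u r z + pd \<rho> (Gi \<mu> \<alpha>) u r z * g \<alpha> \<beta> u r z) * Gi \<beta> \<nu> u r z)"
    by (simp add: 0)
  also have "\<dots> = (\<Sum>\<beta>\<in>UNIV. \<Sum>\<alpha>\<in>UNIV. Gi \<mu> \<alpha> u r z * pd \<rho> (g \<alpha> \<beta>) u r z * Gi \<beta> \<nu> u r z)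
     + (\<Sum>\<beta>\<in>UNIV. \<Sum>\<alpha>\<in>UNIV. pd \<rho> (Gi \<mu> \<alpha>) u r z * g \<alpha> \<beta> u r z * Gi \<beta> \<nu> u r z)"
    by (simp add: sum_distrib_right distrib_right sum.distrib)
  also have "(\<Sum>\<beta>\<in>UNIV. \<Sum>\<alpha>\<in>UNIV. pd \<rho> (Gi \<mu> \<alpha>) u r z * g \<alpha> \<beta> u r z * Gi \<beta> \<nu> u r z)
     = (\<Sum>\<alpha>\<in>UNIV. pd \<rho> (Gi \<mu> \<alpha>) u r z * (\<Sum>\<beta>\<in>UNIV. g \<beta> \<alpha> u r z * Gi \<beta> \<nu> u r z))"
    unfolding sum_distrib_left by (subst sum.swap) (simp add: mult.assoc g_sym[OF p])
  also have "\<dots> = pd \<rho> (Gi \<mu> \<nu>) u r z"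
    by (simp add: g_Gi[OF p] if_distrib cong: if_cong)
  also have "(\<Sum>\<beta>\<in>UNIV. \<Sum>\<alpha>\<in>UNIV. Gi \<mu> \<alpha> u r z * pd \<rho> (g \<alpha> \<beta>) u r z * Gi \<beta> \<nu> u r z) =
    (\<Sum>\<alpha>\<in>UNIV. \<Sum>\<beta>\<in>UNIV. Gi \<mu> \<alpha> u r z * pd \<rho> (g \<alpha> \<beta>) u r z * Gi \<beta> \<nu> u r z)" by (rule sum.swap)
  finally show ?thesis by (simp add: eq_neg_iff_add_eq_0 add.commute)
qed

text \<open>The transport term comes from the derivative of an inverse matrix; in each of the two
  Jacobian terms of h, one contraction of g with its inverse collapses.\<close>

lemma lie_inv_h:
  assumes p: "u \<in> I" "r > r0" "z \<in> \<Omega>"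
  shows "lie_inv \<mu> \<nu> u r z = - (\<Sum>\<alpha>\<in>UNIV. \<Sum>\<beta>\<in>UNIV. Gi \<mu> \<alpha> u r z * h \<alpha> \<beta> u r z * Gi \<beta> \<nu> u r z)"
proof -
  let ?G = "\<lambda>\<mu> \<nu>. Gi \<mu> \<nu> u r z" and ?g = "\<lambda>\<mu> \<nu>. g \<mu> \<nu> u r z" and ?X = "\<lambda>\<mu>. X \<mu> u r z"
    and ?d = "\<lambda>\<nu> \<mu>. pd \<nu> (X \<mu>) u r z"
  have 1: "(\<Sum>\<alpha>\<in>UNIV. \<Sum>\<beta>\<in>UNIV. ?G \<mu> \<alpha> * (\<Sum>\<rho>\<in>UNIV. ?X \<rho> * pd \<rho> (g \<alpha> \<beta>) u r z) * ?G \<beta> \<nu>) = - (\<Sum>\<rho>\<in>UNIV. ?X \<rho> * pd \<rho> (Gi \<mu> \<nu>) u r z)"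
    unfolding pd_Gi[OF p] sum_coord by algebra
  have 2: "(\<Sum>\<alpha>\<in>UNIV. \<Sum>\<beta>\<in>UNIV. ?G \<mu> \<alpha> * (\<Sum>\<rho>\<in>UNIV. ?g \<rho> \<beta> * ?d \<alpha> \<rho>) * ?G \<beta> \<nu>) = (\<Sum>\<alpha>\<in>UNIV. ?G \<mu> \<alpha> * ?d \<alpha> \<nu>)"
  proof -
    have "(\<Sum>\<beta>\<in>UNIV. ?G \<mu> \<alpha> * (\<Sum>\<rho>\<in>UNIV. ?g \<rho> \<beta> * ?d \<alpha> \<rho>) * ?G \<beta> \<nu>) = ?G \<mu> \<alpha> * (\<Sum>\<rho>\<in>UNIV. (\<Sum>\<beta>\<in>UNIV. ?g \<rho> \<beta> * ?G \<beta> \<nu>) * ?d \<alpha> \<rho>)" for \<alpha>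
      unfolding sum_coord by algebra
    then show ?thesis by (simp add: g_Gi'[OF p] if_distrib if_distribR cong: if_cong)
  qed
  have 3: "(\<Sum>\<alpha>\<in>UNIV. \<Sum>\<beta>\<in>UNIV. ?G \<mu> \<alpha> * (\<Sum>\<rho>\<in>UNIV. ?g \<alpha> \<rho> * ?d \<beta> \<rho>) * ?G \<beta> \<nu>) = (\<Sum>\<beta>\<in>UNIV. ?G \<beta> \<nu> * ?d \<beta> \<mu>)"
  proof -
    have "(\<Sum>\<alpha>\<in>UNIV. ?G \<mu> \<alpha> * (\<Sum>\<rho>\<in>UNIV. ?g \<alpha> \<rho> * ?d \<beta> \<rho>) * ?G \<beta> \<nu>) = ?G \<beta> \<nu> * (\<Sum>\<rho>\<in>UNIV. (\<Sum>\<alpha>\<in>UNIV. ?G \<mu> \<alpha> * ?g \<alpha> \<rho>) * ?d \<beta> \<rho>)" for \<beta>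
      unfolding sum_coord by algebra
    then show ?thesis by (subst sum.swap) (simp add: Gi_g[OF p] if_distrib if_distribR cong: if_cong)
  qed
  have "(\<Sum>\<alpha>\<in>UNIV. \<Sum>\<beta>\<in>UNIV. ?G \<mu> \<alpha> * h \<alpha> \<beta> u r z * ?G \<beta> \<nu>) =
     (\<Sum>\<alpha>\<in>UNIV. \<Sum>\<beta>\<in>UNIV. ?G \<mu> \<alpha> * (\<Sum>\<rho>\<in>UNIV. ?X \<rho> * pd \<rho> (g \<alpha> \<beta>) u r z) * ?G \<beta> \<nu>)
    + (\<Sum>\<alpha>\<in>UNIV. \<Sum>\<beta>\<in>UNIV. ?G \<mu> \<alpha> * (\<Sum>\<rho>\<in>UNIV. ?g \<rho> \<beta> * ?d \<alpha> \<rho>) * ?G \<beta> \<nu>)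
    + (\<Sum>\<alpha>\<in>UNIV. \<Sum>\<beta>\<in>UNIV. ?G \<mu> \<alpha> * (\<Sum>\<rho>\<in>UNIV. ?g \<alpha> \<rho> * ?d \<beta> \<rho>) * ?G \<beta> \<nu>)"
    unfolding h_eq[OF p] by (simp add: sum.distrib distrib_left distrib_right)
  then show ?thesis
    unfolding 1 2 3 lie_inv_def by (simp add: sum_subtractf sum.distrib)
qed

text \<open>Continuity along r is what the estimates on the half line ask of h: it yields
  measurability, and bounds on compact stretches.\<close>

lemma h_continuous:
  assumes "u \<in> I" "z \<in> \<Omega>"
  shows "continuous_on {r0<..} (\<lambda>s. h \<mu> \<nu> u s z)"
proof -
  have X: "continuous_on {r0<..} (\<lambda>s. X \<rho> u s z)" "continuous_on {r0<..} (\<lambda>s. pd \<nu> (X \<rho>) u s z)" for \<nu> \<rho>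
    using X_radial[OF assms(1) _ assms(2)] pd_X_radial[OF assms(1) _ assms(2)]
    by (auto intro!: continuous_at_imp_continuous_on has_vector_derivative_continuous)
  have g: "continuous_on {r0<..} (\<lambda>s. g \<mu> \<nu> u s z)" "continuous_on {r0<..} (\<lambda>s. pd \<rho> (g \<mu> \<nu>) u s z)" for \<mu> \<nu> \<rho>
    using sm_slice_r[OF sm_g assms] sm_slice_r[OF bx.sm_PD[OF sm_g] assms] .
  have "continuous_on {r0<..} (\<lambda>s. \<Sum>\<rho>\<in>UNIV. X \<rho> u s z * pd \<rho> (g \<mu> \<nu>) u s z
       + g \<rho> \<nu> u s z * pd \<mu> (X \<rho>) u s z + g \<mu> \<rho> u s z * pd \<nu> (X \<rho>) u s z)"
    by (intro continuous_on_sum continuous_on_add continuous_on_mult X g)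
  then show ?thesis
    by (rule continuous_on_eq) (use assms h_eq in auto)
qed

end

context region
begin

lemma bnd_mult_le: "bnd k F \<Longrightarrow> bnd l G \<Longrightarrow> k + l \<le> m \<Longrightarrow> bnd m (\<lambda>u r z. F u r z * G u r z)"
  using bnd_mono[OF bnd_mult] by blast

end

context nu_xi
begin

section \<open>Asymptotics of the vector fields and of the variation of the metric\<close>

text \<open>The functions \<open>igam\<close> and \<open>gam\<close>, rewritten through the complex
  exponential of \<open>\<Phi>\<close> so that the derivative rules for \<open>pd\<close>
  apply.\<close>

definition igam' :: scalar where "igam' u r z = 2 * exp (- 2 * \<Phi> u r z)"
definition gam' :: scalar where "gam' u r z = exp (2 * \<Phi> u r z) / 2"

lemma gam_igam: "gam' u r z * igam' u r z = 1"
  by (simp add: gam'_def igam'_def flip: exp_add)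

lemma sm_gam': "sm (I \<times> UNIV \<times> \<Omega>) gam'" "sm (I \<times> UNIV \<times> \<Omega>) igam'"
  unfolding gam'_def[abs_def] igam'_def[abs_def] by (intro ux.sm_rules sm_\<Phi>)+

lemma pd_gam': "u \<in> I \<Longrightarrow> z \<in> \<Omega> \<Longrightarrow> pd \<mu> gam' u r z = 2 * pd \<mu> \<Phi> u r z * gam' u r z"
  "u \<in> I \<Longrightarrow> z \<in> \<Omega> \<Longrightarrow> pd \<mu> igam' u r z = - 2 * pd \<mu> \<Phi> u r z * igam' u r z"
proof -
  assume p: "u \<in> I" "z \<in> \<Omega>"
  note i = sm_pdiff[OF _ , of "I \<times> UNIV \<times> \<Omega>" _ u r z]
  have d: "pdiff \<Phi> u r z" "\<And>c. pdiff (\<lambda>u r z. c * \<Phi> u r z) u r z" "\<And>c. pdiff (\<lambda>u r z. exp (c * \<Phi> u r z)) u r z"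
    using p by (auto intro!: i ux.sm_rules sm_\<Phi>)
  have "pd \<mu> (\<lambda>u r z. exp (c * \<Phi> u r z)) u r z = exp (c * \<Phi> u r z) * (c * pd \<mu> \<Phi> u r z)" for c
    using pd_exp[OF d(2)] pd_mult[OF pdiff_const d(1)] by (simp add: pd_const)
  note E = this
  show "pd \<mu> gam' u r z = 2 * pd \<mu> \<Phi> u r z * gam' u r z" "pd \<mu> igam' u r z = - 2 * pd \<mu> \<Phi> u r z * igam' u r z"
    unfolding gam'_def[abs_def] igam'_def[abs_def]
    using pd_divide[OF d(3)[of 2], of \<mu> 2] pd_mult[OF pdiff_const[of 2] d(3)[of "-2"], of \<mu>] E[of 2] E[of "-2"]
    by (simp_all add: pd_const)
qed

lemma indep_gam': "indep gam'" "indep igam'" by (simp_all add: indep_def gam'_def igam'_def)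

text \<open>The index of \<partial>f raised with the inverse of \<open>gbar\<close>: the coefficient
  of r^-2 in the integrand \<open>P (Cx A)\<close>, hence of 1/r in its tail.\<close>

definition Q :: "ang \<Rightarrow> scalar" where "Q A u r z = igam' u r z * pd (Cx (conj_ang A)) f u r z"

lemma sm_Q: "sm (I \<times> UNIV \<times> \<Omega>) (Q A)"
  unfolding Q_def[abs_def] by (intro ux.sm_rules sm_gam' sm_f)

lemma indep_Q: "indep (Q A)"
proof -
  have "Q A u r z = Q A u s z" for u r s z
    using indep_gam'(2) indep_pd[OF indep_f, of "Cx (conj_ang A)"] unfolding Q_def indep_def by (metis coord.distinct(5))
  then show ?thesis unfolding indep_def by blast
qed

lemma Ord_Gi_off': "A \<noteq> B \<Longrightarrow> Ord (-3) (\<lambda>u r z. Gi (Cx A) (Cx B) u r z - of_real (r powi (-2)) * igam' u r z)"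
  by (rule Ord_cong[OF _ Ord_Gi_off, of A B]) (simp_all add: igam'_def flip: exp_of_real)

lemma Ord_goff': "A \<noteq> B \<Longrightarrow> Ord 1 (\<lambda>u r z. g (Cx A) (Cx B) u r z - of_real (r^2) * gam' u r z)"
  by (rule Ord_cong[OF _ Ord_goff, of A B]) (simp_all add: gam'_def flip: exp_of_real)

lemma Ord_PQ: "Ord (-3) (\<lambda>u r z. P (Cx A) u r z - of_real (r powi (-2)) * Q A u r z)"
proof -
  have A: "A \<noteq> conj_ang A" by (cases A) auto
  have "Ord (-3) (\<lambda>u r z. pd (Cx A) f u r z * Gi (Cx A) (Cx A) u r z
     + pd (Cx (conj_ang A)) f u r z * (Gi (Cx A) (Cx (conj_ang A)) u r z - of_real (r powi (-2)) * igam' u r z))"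
    using Ord_add[OF Ord_mult[OF Ord_pdf Ord_Gi_diag] Ord_mult[OF Ord_pdf Ord_Gi_off'[OF A]]] by simp
  then show ?thesis
    by (rule Ord_cong[rotated]) (cases A; simp add: P_def Q_def sum_ang algebra_simps)
qed

text \<open>The comparison term r^-2 Q needs r > 0, which r > r0 does not give. The tail lemmas are
  therefore reused on the region beyond \<open>R1\<close>, whose own \<open>R1\<close> and
  \<open>Ord\<close> are the same.\<close>

sublocale rg: region I \<Omega> R1
  using open_I open_\<Omega> by unfold_locales

sublocale bg: box I "{R1<..}" \<Omega>
  using open_I open_\<Omega> I by unfold_locales auto

lemma rg_R1: "rg.R1 = R1" using rg.R1_def by (metis R1_def max.left_idem max.commute max.assoc)

lemma rg_Ord: "rg.Ord = Ord" by (intro ext) (simp add: rg.Ord_def Ord_def rg_R1)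

lemma sm_rpow2: "smooth_on (I \<times> {R1<..} \<times> \<Omega>) (\<lambda>(u, r, z). complex_of_real (r powi (-2)))"
proof -
  have s: "smooth_on (I \<times> {R1<..} \<times> \<Omega>) (uncurried (\<lambda>u r z. of_real r))"
    by (rule smooth_on_subset[OF sm_r]) auto
  have "smooth_on (I \<times> {R1<..} \<times> \<Omega>) (\<lambda>p. inverse (uncurried (\<lambda>u r z. of_real r) p))"
    by (rule smooth_on_inverse[OF bg.open_S _ s]) (auto simp: R1_def)
  then have i: "sm (I \<times> {R1<..} \<times> \<Omega>) (\<lambda>u r z. inverse (of_real r))" by (simp add: case_prod_unfold)
  have "sm (I \<times> {R1<..} \<times> \<Omega>) (\<lambda>u r z. inverse (of_real r) * inverse (of_real r))"
    by (intro bg.sm_mult i)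
  then show ?thesis by (simp add: power_int_minus power2_eq_square)
qed

text \<open>The tail is taken of the difference between the integrand and its leading part; the
  integral of s^-2 from r is 1/r, and Q is constant along r.\<close>

lemma Ord_tailQ: "Ord (-2) (\<lambda>u r z. tail (P (Cx A)) u r z - of_real (r powi (-1)) * Q A u r z)"
proof -
  have sub: "I \<times> {R1<..} \<times> \<Omega> \<subseteq> reg" "I \<times> {R1<..} \<times> \<Omega> \<subseteq> I \<times> UNIV \<times> \<Omega>" by (auto simp: R1_def)
  have s: "sm (I \<times> {R1<..} \<times> \<Omega>) (\<lambda>u r z. P (Cx A) u r z - of_real (r powi (-2)) * Q A u r z)"
    by (intro bg.sm_rules sm_rpow2 smooth_on_subset[OF sm_P sub(1)] smooth_on_subset[OF sm_Q sub(2)])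
  have "rg.Ord (-2) (tail (\<lambda>u r z. P (Cx A) u r z - of_real (r powi (-2)) * Q A u r z))"
    by (rule rg.Ord_tail[OF s]) (use Ord_PQ in \<open>simp_all add: rg_Ord\<close>)
  then have "Ord (-2) (tail (\<lambda>u r z. P (Cx A) u r z - of_real (r powi (-2)) * Q A u r z))" by (simp add: rg_Ord)
  then show ?thesis
  proof (rule Ord_cong[rotated])
    fix u r z assume p: "u \<in> I" "r > R1" "z \<in> \<Omega>"
    have r: "r > 0" "r > r0" using p by (auto simp: R1_def)
    have e: "Q A u s z = Q A u r z" for s using indep_Q unfolding indep_def by blast
    have "set_integrable lborel {r<..} (\<lambda>s. of_real (s powi (-2)) * Q A u r z)"
      using inverse_square_tail(1)[OF r(1)]
      unfolding set_integrable_def by (simp add: scaleR_conv_of_real mult.assoc[symmetric] del: of_real_power_int flip: of_real_mult)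
    moreover have "(LINT s:{r<..}|lborel. of_real (s powi (-2)) * Q A u r z) = of_real (r powi (-1)) * Q A u r z"
      unfolding set_integral_mult_left set_integral_complex_of_real inverse_square_tail(2)[OF r(1)]
      by (simp add: power_int_minus)
    moreover have "tail (\<lambda>u r z. P (Cx A) u r z - of_real (r powi (-2)) * Q A u r z) u r z =
       (LINT s:{r<..}|lborel. P (Cx A) u s z - of_real (s powi (-2)) * Q A u r z)"
    proof -
      have "P (Cx A) u s z - of_real (s powi (-2)) * Q A u s z = P (Cx A) u s z - of_real (s powi (-2)) * Q A u r z" for s
        by (metis e)
      then show ?thesis unfolding tail_eq by presburger
    qed
    ultimately show "tail (\<lambda>u r z. P (Cx A) u r z - of_real (r powi (-2)) * Q A u r z) u r z =
       tail (P (Cx A)) u r z - of_real (r powi (-1)) * Q A u r z"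
      using tail_integrable[OF sm_P Ord_bnd[OF Ord_P] p(1,3) r(2)] by (simp add: tail_eq del: of_real_power_int)
  qed
qed

lemma Ord_XY: "Ord (-1) (\<lambda>u r z. X (Cx A) u r z - Y A z)"
  by (rule Ord_cong[OF _ Ord_minus[OF Ord_tailP]]) (simp add: X_def)

lemma Ord_XA: "Ord 0 (X (Cx A))"
  using Ord_add[OF Ord_mono[OF Ord_XY, of 0 A] Ord_Y[of A]] by simp

lemma Ord_Xu: "Ord 0 (X Cu)"
  by (rule Ord_cong[OF _ Ord_f]) (simp add: tail_P_u R1_r0)

text \<open>What remains of the r-component after its linear growth -r \<partial>_u f is
  removed.\<close>

definition Rr :: scalar where "Rr u r z = lap u r z / 2 - tail (P Cr) u r z"

lemma Xr: "X Cr u r z = - of_real r * pd Cu f u r z + Rr u r z"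
  by (simp add: X_def Rr_def)

lemma Ord_Rr: "Ord 0 Rr"
proof -
  have "Ord 0 (\<lambda>u r z. (1/2) * lap u r z)"
    using Ord_mult[OF Ord_indep Ord_lap, of "\<lambda>u z. 1/2"] ux.sm_const[of "1/2"] by simp
  from Ord_diff[OF this Ord_mono[OF Ord_tailP]] show ?thesis
    by (simp add: Rr_def[abs_def])
qed

lemma Ord_Xr: "Ord 1 (X Cr)"
proof -
  have "Ord 1 (\<lambda>u r z. - (of_real r * pd Cu f u r z))"
    using Ord_minus[OF Ord_mult[OF Ord_r Ord_pdf[of Cu]]] by simp
  from Ord_add[OF this Ord_mono[OF Ord_Rr, of 1]]
  have "Ord 1 (\<lambda>u r z. - (of_real r * pd Cu f u r z) + Rr u r z)" by simp
  then show ?thesis by (rule Ord_cong[rotated]) (simp add: Xr)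
qed

lemma Ord_X: "Ord (if \<mu> = Cr then 1 else 0) (X \<mu>)"
  using Ord_Xr Ord_XA Ord_Xu by (cases \<mu>) auto

text \<open>Transport along X does not raise the order: the r-component grows like r, but it
  multiplies a radial derivative, which gains one power.\<close>

lemma bnd_X_dg:
  assumes G: "Ord k G"
  shows "bnd k (\<lambda>u r z. X \<rho> u r z * pd \<rho> G u r z)"
  by (rule bnd_mult_le[OF Ord_bnd[OF Ord_X] Ord_pd[OF G]]) auto

lemma bnd_h_AB: "bnd 2 (h (Cx A) (Cx B))"
proof (rule bnd_cong[where R=r0])
  have 0: "bnd 2 (\<lambda>u r z. g \<rho> (Cx B) u r z * pd (Cx A) (X \<rho>) u r z)" for A B \<rho>
  proof (cases \<rho>)
    case Cu
    then show ?thesis using bnd_mult_le[OF Ord_bnd[OF Ord_guA] Ord_pd_le[OF Ord_Xu]] by simp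
  next
    case Cr
    have "bnd 2 (\<lambda>u r z. g Cr (Cx B) u r z * pd (Cx A) (X Cr) u r z)"
      by (rule bnd_cong[OF _ bnd_zero, of r0]) (simp add: gr)
    then show ?thesis using Cr by simp
  next
    case (Cx D)
    then show ?thesis using bnd_mult_le[OF Ord_bnd[OF Ord_g] Ord_pd_le[OF Ord_XA]] by simp
  qed
  show "bnd 2 (\<lambda>u r z. \<Sum>\<rho>\<in>UNIV. X \<rho> u r z * pd \<rho> (g (Cx A) (Cx B)) u r z
       + g \<rho> (Cx B) u r z * pd (Cx A) (X \<rho>) u r z + g \<rho> (Cx A) u r z * pd (Cx B) (X \<rho>) u r z)"
    by (intro bnd_sum bnd_add bnd_X_dg Ord_g 0)
  fix u r z assume p: "u \<in> I" "r > r0" "z \<in> \<Omega>"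
  show "(\<Sum>\<rho>\<in>UNIV. X \<rho> u r z * pd \<rho> (g (Cx A) (Cx B)) u r z
       + g \<rho> (Cx B) u r z * pd (Cx A) (X \<rho>) u r z + g \<rho> (Cx A) u r z * pd (Cx B) (X \<rho>) u r z) = h (Cx A) (Cx B) u r z"
    unfolding h_eq[OF p] by (intro sum.cong refl) (metis g_sym[OF p])
qed

lemma pd_u_XA:
  assumes p: "u \<in> I" "r > R1" "z \<in> \<Omega>"
  shows "pd Cu (X (Cx A)) u r z = - pd Cu (tail (P (Cx A))) u r z"
  using pd_X[OF p(1) R1_r0[OF p(2)] p(3), of Cu "Cx A"] by (simp add: pd_def[of Cu "\<lambda>u r z. Y A z"])

lemma pd_mult_r:
  assumes "pdiff F u r z" "\<mu> \<noteq> Cr"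
  shows "pd \<mu> (\<lambda>u r z. of_real (a r) * F u r z) u r z = of_real (a r) * pd \<mu> F u r z"
proof (cases \<mu>)
  case Cu
  then show ?thesis using assms by (simp add: pd_def pdiff_def)
next
  case (Cx A)
  then show ?thesis using assms by (simp add: pd_def pdiff_def dang_mult dang_const)
qed (use assms in simp)

text \<open>Three terms grow linearly: g_uu \<partial>_A f like -2r \<partial>_u \<phi> \<partial>_A
  f, the term -\<partial>_A X^r like r \<partial>_A \<partial>_u f, and the off-diagonal g_AB
  \<partial>_u X^B like -r (\<partial>_A \<partial>_u f - 2 \<partial>_u \<phi> \<partial>_A f),
  through the u-derivative of Q. They sum to zero, and the regrouped expression contains bounded
  terms only.\<close>

lemma bnd_h_uA: "bnd 0 (h Cu (Cx A))"
proof (rule bnd_cong[where R=R1])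
  let ?A' = "conj_ang A"
  have A': "?A' \<noteq> A" by (cases A) auto
  define d1 where "d1 = (\<lambda>u r z. g (Cx ?A') (Cx A) u r z - of_real (r^2) * gam' u r z)"
  define E where "E = (\<lambda>u r z. tail (P (Cx ?A')) u r z - of_real (r powi (-1)) * Q ?A' u r z)"
  have d1: "Ord 1 d1" unfolding d1_def by (rule Ord_goff'[OF A'])
  have E: "Ord (-2) E" unfolding E_def by (rule Ord_tailQ)
  have XA1: "bnd (-1) (pd Cu (tail (P (Cx A))))" for A by (rule Ord_pd_le[OF Ord_tailP])
  have rg: "bnd 2 (\<lambda>u r z. of_real (r^2) * gam' u r z)"
    using bnd_mult_le[OF Ord_bnd[OF Ord_r2] Ord_bnd[OF Ord_of_indep[OF indep_gam'(1) sm_gam'(1)]], of 2] by simp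
  show "bnd 0 (\<lambda>u r z. (\<Sum>\<rho>\<in>UNIV. X \<rho> u r z * pd \<rho> (g Cu (Cx A)) u r z)
      + g Cu (Cx A) u r z * pd Cu f u r z
      + (g Cu Cu u r z + 2 * of_real r * pd Cu \<Phi> u r z) * pd (Cx A) f u r z
      - pd (Cx A) Rr u r z
      - g (Cx A) (Cx A) u r z * pd Cu (tail (P (Cx A))) u r z
      - d1 u r z * pd Cu (tail (P (Cx ?A'))) u r z
      - of_real (r^2) * gam' u r z * pd Cu E u r z
      + (\<Sum>D\<in>UNIV. g Cu (Cx D) u r z * pd (Cx A) (X (Cx D)) u r z))"
    apply (intro bnd_add bnd_diff bnd_sum)
           apply (rule bnd_X_dg[OF Ord_guA])
          apply (rule bnd_mult_le[OF Ord_bnd[OF Ord_guA] Ord_bnd[OF Ord_pdf]]; simp)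
         apply (rule bnd_mult_le[OF bnd_guu Ord_bnd[OF Ord_pdf]]; simp)
        apply (rule Ord_pd_le[OF Ord_Rr])
       apply (rule bnd_mult_le[OF Ord_bnd[OF Ord_gdiag] XA1]; simp)
      apply (rule bnd_mult_le[OF Ord_bnd[OF d1] XA1]; simp)
     apply (rule bnd_mult_le[OF rg Ord_pd_le[OF E]]; simp)
    apply (rule bnd_mult_le[OF Ord_bnd[OF Ord_guA] Ord_pd_le[OF Ord_XA]]; simp)
    done
  fix u r z assume p: "u \<in> I" "r > R1" "z \<in> \<Omega>"
  have r: "r > r0" "r > 0" using p by (auto simp: R1_def)
  note q = p(1) r(1) p(3)
  have i: "pdiff (pd \<mu> f) u r z" "pdiff (Q ?A') u r z" "pdiff igam' u r z" for \<mu>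
    using pdiff_ux[OF q] ux.sm_PD[OF sm_f] sm_Q sm_gam' by auto
  have t: "pdiff (tail (P \<mu>)) u r z" for \<mu> by (rule pdiff_tail[OF sm_P Ord_P p(1,3) r(1)])
  have Rd: "pdiff Rr u r z" using Ord_Rr p unfolding Ord_def by blast
  have xr: "pd (Cx A) (X Cr) u r z = - of_real r * pd (Cx A) (pd Cu f) u r z + pd (Cx A) Rr u r z"
  proof -
    have "pd (Cx A) (X Cr) u r z = pd (Cx A) (\<lambda>u r z. of_real (- r) * pd Cu f u r z + Rr u r z) u r z"
      by (rule pd_cong[OF open_reg]) (use q Xr in auto)
    also have "\<dots> = pd (Cx A) (\<lambda>u r z. of_real (- r) * pd Cu f u r z) u r z + pd (Cx A) Rr u r z"
    proof (rule pd_add)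
      have "pdiff (\<lambda>u r z. - (of_real r * pd Cu f u r z)) u r z"
        by (intro pdiff_minus pdiff_mult i(1) pdiff_ux[OF q sm_r])
      then show "pdiff (\<lambda>u r z. of_real (- r) * pd Cu f u r z) u r z" by simp
    qed (rule Rd)
    finally show ?thesis using pd_mult_r[OF i(1)[of Cu], of "Cx A" uminus] by simp
  qed
  have pe: "pd Cu (tail (P (Cx ?A'))) u r z = pd Cu E u r z + of_real (r powi (-1)) * pd Cu (Q ?A') u r z"
  proof -
    have rq: "pdiff (\<lambda>u r z. of_real (r powi (-1)) * Q ?A' u r z) u r z"
      using Ord_rpow[of "-1"] p i(2) by (intro pdiff_mult) (auto simp: Ord_def)
    have "pd Cu E u r z = pd Cu (tail (P (Cx ?A'))) u r z - pd Cu (\<lambda>u r z. of_real (r powi (-1)) * Q ?A' u r z) u r z"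
      unfolding E_def by (rule pd_diff[OF t rq])
    then show ?thesis using pd_mult_r[OF i(2), of Cu "\<lambda>r. r powi (-1)"] by simp
  qed
  have Qu: "pd Cu (Q ?A') u r z = igam' u r z * pd Cu (pd (Cx A) f) u r z + pd Cu igam' u r z * pd (Cx A) f u r z"
  proof -
    have "conj_ang ?A' = A" by (cases A) auto
    then show ?thesis unfolding Q_def[abs_def] using pd_mult[OF i(3) i(1)[of "Cx A"]] by simp
  qed
  have c: "pd Cu (pd (Cx A) f) u r z = pd (Cx A) (pd Cu f) u r z"
    using p by (intro pd_commute[OF ux.open_S sm_f]) auto
  have rr: "complex_of_real (r^2) * of_real (r powi (-1)) = of_real r"
  proof -
    have "r^2 * r powi (-1) = r" using r by (simp add: power_int_minus power2_eq_square)
    then show ?thesis by (metis of_real_mult)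
  qed
  have ang_sum: "(\<Sum>D\<in>UNIV. F D) = F A + F ?A'" for F :: "ang \<Rightarrow> complex"
    by (cases A) (simp_all add: sum_ang)
  have H: "h Cu (Cx A) u r z = (\<Sum>\<rho>\<in>UNIV. X \<rho> u r z * pd \<rho> (g Cu (Cx A)) u r z)
     + (g Cu (Cx A) u r z * pd Cu f u r z + (g (Cx A) (Cx A) u r z * pd Cu (X (Cx A)) u r z + g (Cx ?A') (Cx A) u r z * pd Cu (X (Cx ?A')) u r z))
     + (g Cu Cu u r z * pd (Cx A) f u r z - pd (Cx A) (X Cr) u r z + (\<Sum>D\<in>UNIV. g Cu (Cx D) u r z * pd (Cx A) (X (Cx D)) u r z))"
  proof -
    have "(\<Sum>\<rho>\<in>UNIV. g \<rho> (Cx A) u r z * pd Cu (X \<rho>) u r z) = g Cu (Cx A) u r z * pd Cu f u r z + (g (Cx A) (Cx A) u r z * pd Cu (X (Cx A)) u r z + g (Cx ?A') (Cx A) u r z * pd Cu (X (Cx ?A')) u r z)"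
      by (cases A) (simp_all add: sum_coord gr[OF q] pd_X_u[OF q])
    moreover have "(\<Sum>\<rho>\<in>UNIV. g Cu \<rho> u r z * pd (Cx A) (X \<rho>) u r z) = g Cu Cu u r z * pd (Cx A) f u r z - pd (Cx A) (X Cr) u r z + (\<Sum>D\<in>UNIV. g Cu (Cx D) u r z * pd (Cx A) (X (Cx D)) u r z)"
      by (simp add: sum_coord sum_ang gr[OF q] pd_X_u[OF q])
    ultimately show ?thesis unfolding h_eq[OF q] sum.distrib by simp
  qed
  define gm ig where "gm = gam' u r z" and "ig = igam' u r z"
  have gi: "gm * ig = 1" by (simp add: gm_def ig_def gam_igam)
  have g': "g (Cx ?A') (Cx A) u r z = d1 u r z + of_real (r^2) * gm" by (simp add: d1_def gm_def)
  have key: "of_real (r^2) * gm * (of_real (r powi (-1)) * pd Cu (Q ?A') u r z) =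
      of_real r * (pd (Cx A) (pd Cu f) u r z - 2 * pd Cu \<Phi> u r z * pd (Cx A) f u r z)"
  proof -
    have "of_real (r^2) * gm * (of_real (r powi (-1)) * pd Cu (Q ?A') u r z) =
       (complex_of_real (r^2) * of_real (r powi (-1))) * (gm * ig) * (pd (Cx A) (pd Cu f) u r z - 2 * pd Cu \<Phi> u r z * pd (Cx A) f u r z)"
      unfolding Qu c pd_gam'(2)[OF p(1,3)] ig_def[symmetric] by algebra
    then show ?thesis unfolding rr gi by simp
  qed
  show "(\<Sum>\<rho>\<in>UNIV. X \<rho> u r z * pd \<rho> (g Cu (Cx A)) u r z)
      + g Cu (Cx A) u r z * pd Cu f u r z
      + (g Cu Cu u r z + 2 * of_real r * pd Cu \<Phi> u r z) * pd (Cx A) f u r z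
      - pd (Cx A) Rr u r z
      - g (Cx A) (Cx A) u r z * pd Cu (tail (P (Cx A))) u r z
      - d1 u r z * pd Cu (tail (P (Cx ?A'))) u r z
      - of_real (r^2) * gam' u r z * pd Cu E u r z
      + (\<Sum>D\<in>UNIV. g Cu (Cx D) u r z * pd (Cx A) (X (Cx D)) u r z) = h Cu (Cx A) u r z"
    unfolding H pd_u_XA[OF p] xr g' gm_def[symmetric]
    using key pe by algebra
qed

text \<open>The r^2 part is \<open>gam'\<close> times 2 f \<partial>_u \<phi> - 2 \<partial>_u f + 2
  Y \<partial>\<phi> + div Y, and the evolution equation of f says that this factor is 2
  \<omega>.\<close>

lemma bnd_h_zz: "bnd 1 (\<lambda>u r z. h (Cx Zeta) (Cx Zetabar) u r z - of_real (r^2) * (gam' u r z * (2 * of_real (\<omega> u z))))"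
proof (rule bnd_cong[where R=R1])
  define d1 where "d1 = (\<lambda>u r z. g (Cx Zeta) (Cx Zetabar) u r z - of_real (r^2) * gam' u r z)"
  have d1: "Ord 1 d1" unfolding d1_def by (rule Ord_goff') simp
  let ?g = "g (Cx Zeta) (Cx Zetabar)"
  let ?D = "\<lambda>A u r z. X (Cx A) u r z - Y A z"
  have rf: "bnd 1 (\<lambda>u r z. of_real r * pd Cu f u r z)"
    using bnd_mult_le[OF Ord_bnd[OF Ord_r] Ord_bnd[OF Ord_pdf[of Cu]], of 1] by simp
  have Yb: "bnd 0 (pd \<mu> (\<lambda>u r z. Y A z))" for \<mu> A by (rule Ord_pd_le[OF Ord_Y])
  show "bnd 1 (\<lambda>u r z. f u r z * pd Cu d1 u r z
      + Rr u r z * pd Cr ?g u r z - of_real r * pd Cu f u r z * pd Cr d1 u r z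
      + (\<Sum>A\<in>UNIV. ?D A u r z * pd (Cx A) ?g u r z + Y A z * pd (Cx A) d1 u r z)
      + g Cu (Cx Zetabar) u r z * pd (Cx Zeta) f u r z + g Cu (Cx Zeta) u r z * pd (Cx Zetabar) f u r z
      + (?g u r z * pd (Cx Zeta) (?D Zeta) u r z + d1 u r z * pd (Cx Zeta) (\<lambda>u r z. Y Zeta z) u r z)
      + (?g u r z * pd (Cx Zetabar) (?D Zetabar) u r z + d1 u r z * pd (Cx Zetabar) (\<lambda>u r z. Y Zetabar z) u r z)
      + g (Cx Zetabar) (Cx Zetabar) u r z * pd (Cx Zeta) (X (Cx Zetabar)) u r z
      + g (Cx Zeta) (Cx Zeta) u r z * pd (Cx Zetabar) (X (Cx Zeta)) u r z)"
    apply (intro bnd_add bnd_diff bnd_sum)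
               apply (rule bnd_mult_le[OF Ord_bnd[OF Ord_f] Ord_pd_le[OF d1]]; simp)
              apply (rule bnd_mult_le[OF Ord_bnd[OF Ord_Rr] Ord_pd[OF Ord_g]]; simp)
             apply (rule bnd_mult_le[OF rf Ord_pd[OF d1]]; simp)
            apply (rule bnd_mult_le[OF Ord_bnd[OF Ord_XY] Ord_pd_le[OF Ord_g]]; simp)
           apply (rule bnd_mult_le[OF Ord_bnd[OF Ord_Y] Ord_pd_le[OF d1]]; simp)
          apply (rule bnd_mult_le[OF Ord_bnd[OF Ord_guA] Ord_bnd[OF Ord_pdf]]; simp)
         apply (rule bnd_mult_le[OF Ord_bnd[OF Ord_guA] Ord_bnd[OF Ord_pdf]]; simp)
        apply (rule bnd_mult_le[OF Ord_bnd[OF Ord_g] Ord_pd_le[OF Ord_XY]]; simp)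
       apply (rule bnd_mult_le[OF Ord_bnd[OF d1] Yb]; simp)
      apply (rule bnd_mult_le[OF Ord_bnd[OF Ord_g] Ord_pd_le[OF Ord_XY]]; simp)
     apply (rule bnd_mult_le[OF Ord_bnd[OF d1] Yb]; simp)
    apply (rule bnd_mult_le[OF Ord_bnd[OF Ord_gdiag] Ord_pd_le[OF Ord_XA]]; simp)
   apply (rule bnd_mult_le[OF Ord_bnd[OF Ord_gdiag] Ord_pd_le[OF Ord_XA]]; simp)
    done
  fix u r z assume p: "u \<in> I" "r > R1" "z \<in> \<Omega>"
  have r: "r > r0" "r > 0" using p by (auto simp: R1_def)
  note q = p(1) r(1) p(3)
  have gd: "pdiff gam' u r z" "pdiff (\<lambda>u r z. Y A z) u r z" "pdiff ?g u r z" for A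
    using pdiff_ux[OF q] sm_gam' pm.sm_Y pdiff_reg[OF q sm_g] by auto
  have r2d: "pdiff (\<lambda>u r z. of_real (r^2)) u r z" using Ord_r2 p unfolding Ord_def by blast
  have dX: "pd (Cx A) (?D A) u r z = pd (Cx A) (X (Cx A)) u r z - pd (Cx A) (\<lambda>u r z. Y A z) u r z" for A
    by (rule pd_diff[OF pdiff_X[OF q] gd(2)])
  have d1d: "pd \<mu> d1 u r z = pd \<mu> ?g u r z - (of_real (r^2) * pd \<mu> gam' u r z + pd \<mu> (\<lambda>u r z. of_real (r^2)) u r z * gam' u r z)" for \<mu>
    unfolding d1_def by (simp only: pd_diff[OF gd(3) pdiff_mult[OF r2d gd(1)]] pd_mult[OF r2d gd(1)])
  have r2: "pd Cu (\<lambda>u r z. of_real (r^2)) u r z = (0::complex)" "pd (Cx A) (\<lambda>u r z. of_real (r^2)) u r z = (0::complex)"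
    "pd Cr (\<lambda>u r z. of_real (r^2)) u r z = 2 * complex_of_real r" for A
  proof -
    show "pd Cu (\<lambda>u r z. of_real (r^2)) u r z = (0::complex)" "pd (Cx A) (\<lambda>u r z. of_real (r^2)) u r z = (0::complex)"
      by (simp_all add: pd_def dang_const del: of_real_power)
    have "((\<lambda>s. complex_of_real (s^2)) has_vector_derivative of_real (2 * r)) (at r)"
      by (intro has_vector_derivative_of_real) (auto intro!: derivative_eq_intros)
    then show "pd Cr (\<lambda>u r z. of_real (r^2)) u r z = 2 * complex_of_real r"
      by (simp add: pd_def vector_derivative_at del: of_real_power)
  qed
  have H: "h (Cx Zeta) (Cx Zetabar) u r z = (\<Sum>\<rho>\<in>UNIV. X \<rho> u r z * pd \<rho> ?g u r z)
     + (g Cu (Cx Zetabar) u r z * pd (Cx Zeta) f u r z + ?g u r z * pd (Cx Zeta) (X (Cx Zeta)) u r z + g (Cx Zetabar) (Cx Zetabar) u r z * pd (Cx Zeta) (X (Cx Zetabar)) u r z)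
     + (g Cu (Cx Zeta) u r z * pd (Cx Zetabar) f u r z + g (Cx Zeta) (Cx Zeta) u r z * pd (Cx Zetabar) (X (Cx Zeta)) u r z + ?g u r z * pd (Cx Zetabar) (X (Cx Zetabar)) u r z)"
    unfolding h_eq[OF q] sum.distrib
    by (simp add: sum_coord gr[OF q] pd_X_u[OF q] g_sym[OF q, of _ Cu] add.assoc)
  have ps: "psi \<Phi> Y (lift2 \<omega>) u r z = pd (Cx Zeta) (\<lambda>u r z. Y Zeta z) u r z + 2 * Y Zeta z * pd (Cx Zeta) \<Phi> u r z
     + (pd (Cx Zetabar) (\<lambda>u r z. Y Zetabar z) u r z + 2 * Y Zetabar z * pd (Cx Zetabar) \<Phi> u r z) - 2 * of_real (\<omega> u z)"
    by (simp add: psi_def sum_ang)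
  have fu: "2 * pd Cu f u r z = 2 * f u r z * pd Cu \<Phi> u r z + (pd (Cx Zeta) (\<lambda>u r z. Y Zeta z) u r z + 2 * Y Zeta z * pd (Cx Zeta) \<Phi> u r z
     + (pd (Cx Zetabar) (\<lambda>u r z. Y Zetabar z) u r z + 2 * Y Zetabar z * pd (Cx Zetabar) \<Phi> u r z) - 2 * of_real (\<omega> u z))"
    unfolding pd_u_f[OF p(1,3), of r] ps by (simp add: field_simps)
  define rc where "rc = complex_of_real r"
  have rc: "complex_of_real (r^2) = rc * rc" by (simp add: rc_def power2_eq_square)
  define gm where "gm = gam' u r z"
  show "f u r z * pd Cu d1 u r z
      + Rr u r z * pd Cr ?g u r z - of_real r * pd Cu f u r z * pd Cr d1 u r z
      + (\<Sum>A\<in>UNIV. ?D A u r z * pd (Cx A) ?g u r z + Y A z * pd (Cx A) d1 u r z)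
      + g Cu (Cx Zetabar) u r z * pd (Cx Zeta) f u r z + g Cu (Cx Zeta) u r z * pd (Cx Zetabar) f u r z
      + (?g u r z * pd (Cx Zeta) (?D Zeta) u r z + d1 u r z * pd (Cx Zeta) (\<lambda>u r z. Y Zeta z) u r z)
      + (?g u r z * pd (Cx Zetabar) (?D Zetabar) u r z + d1 u r z * pd (Cx Zetabar) (\<lambda>u r z. Y Zetabar z) u r z)
      + g (Cx Zetabar) (Cx Zetabar) u r z * pd (Cx Zeta) (X (Cx Zetabar)) u r z
      + g (Cx Zeta) (Cx Zeta) u r z * pd (Cx Zetabar) (X (Cx Zeta)) u r z
     = h (Cx Zeta) (Cx Zetabar) u r z - of_real (r^2) * (gam' u r z * (2 * of_real (\<omega> u z)))"
    using fu
    unfolding H sum_coord sum_ang Xr tail_P_u[OF q] d1d r2 dX pd_gam'(1)[OF p(1,3)] indep_pd_r[OF indep_\<Phi>] rc rc_def[symmetric]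
    unfolding d1_def rc gm_def[symmetric] by algebra
qed

end

section \<open>One-parameter families on a half line\<close>

text \<open>The bounds are uniform in the parameter, so that tail integrals can be differentiated in it.\<close>

definition dominated_family :: "real \<Rightarrow> real \<Rightarrow> int \<Rightarrow> (real \<Rightarrow> real \<Rightarrow> complex) \<Rightarrow> (real \<Rightarrow> real \<Rightarrow> complex) \<Rightarrow> bool" where
  "dominated_family \<delta> r k F F' \<longleftrightarrow>
    (\<forall>e\<in>{-\<delta><..<\<delta>}. continuous_on {r<..} (F e) \<and> continuous_on {r<..} (F' e)
       \<and> (\<forall>s>r. ((\<lambda>e. F e s) has_vector_derivative F' e s) (at e)))
    \<and> (\<exists>C\<ge>0. \<forall>e\<in>{-\<delta><..<\<delta>}. \<forall>s>r. cmod (F e s) \<le> C * (max 1 s) powi k \<and> cmod (F' e s) \<le> C * (max 1 s) powi k)"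

lemma dominated_familyE:
  assumes "dominated_family \<delta> r k F F'"
  obtains C where "C \<ge> 0" "\<And>e s. e \<in> {-\<delta><..<\<delta>} \<Longrightarrow> s > r \<Longrightarrow> cmod (F e s) \<le> C * (max 1 s) powi k"
    "\<And>e s. e \<in> {-\<delta><..<\<delta>} \<Longrightarrow> s > r \<Longrightarrow> cmod (F' e s) \<le> C * (max 1 s) powi k"
  using assms unfolding dominated_family_def by metis

lemma dominated_familyD:
  assumes "dominated_family \<delta> r k F F'" "e \<in> {-\<delta><..<\<delta>}"
  shows "continuous_on {r<..} (F e)" "continuous_on {r<..} (F' e)"
    "s > r \<Longrightarrow> ((\<lambda>e. F e s) has_vector_derivative F' e s) (at e)"
  using assms unfolding dominated_family_def by auto

lemma dominated_familyI:
  assumes "\<And>e. e \<in> {-\<delta><..<\<delta>} \<Longrightarrow> continuous_on {r<..} (F e)"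
    "\<And>e. e \<in> {-\<delta><..<\<delta>} \<Longrightarrow> continuous_on {r<..} (F' e)"
    "\<And>e s. e \<in> {-\<delta><..<\<delta>} \<Longrightarrow> s > r \<Longrightarrow> ((\<lambda>e. F e s) has_vector_derivative F' e s) (at e)"
    "C \<ge> 0" "\<And>e s. e \<in> {-\<delta><..<\<delta>} \<Longrightarrow> s > r \<Longrightarrow> cmod (F e s) \<le> C * (max 1 s) powi k"
    "\<And>e s. e \<in> {-\<delta><..<\<delta>} \<Longrightarrow> s > r \<Longrightarrow> cmod (F' e s) \<le> C * (max 1 s) powi k"
  shows "dominated_family \<delta> r k F F'"
  unfolding dominated_family_def using assms by blast

lemma dominated_family_add:
  assumes F: "dominated_family \<delta> r k F F'" and G: "dominated_family \<delta> r k G G'"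
  shows "dominated_family \<delta> r k (\<lambda>e s. F e s + G e s) (\<lambda>e s. F' e s + G' e s)"
proof -
  obtain C where C: "C \<ge> 0" "\<And>e s. e \<in> {-\<delta><..<\<delta>} \<Longrightarrow> s > r \<Longrightarrow> cmod (F e s) \<le> C * (max 1 s) powi k"
    "\<And>e s. e \<in> {-\<delta><..<\<delta>} \<Longrightarrow> s > r \<Longrightarrow> cmod (F' e s) \<le> C * (max 1 s) powi k" using dominated_familyE[OF F] by blast
  obtain D where D: "D \<ge> 0" "\<And>e s. e \<in> {-\<delta><..<\<delta>} \<Longrightarrow> s > r \<Longrightarrow> cmod (G e s) \<le> D * (max 1 s) powi k"
    "\<And>e s. e \<in> {-\<delta><..<\<delta>} \<Longrightarrow> s > r \<Longrightarrow> cmod (G' e s) \<le> D * (max 1 s) powi k" using dominated_familyE[OF G] by blast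
  show ?thesis
  proof (rule dominated_familyI[where C="C + D"])
    fix e s assume es: "e \<in> {-\<delta><..<\<delta>}" "s > r"
    show "cmod (F e s + G e s) \<le> (C + D) * (max 1 s) powi k"
      using norm_triangle_le[OF add_mono[OF C(2)[OF es] D(2)[OF es]]] by (simp add: distrib_right)
    show "cmod (F' e s + G' e s) \<le> (C + D) * (max 1 s) powi k"
      using norm_triangle_le[OF add_mono[OF C(3)[OF es] D(3)[OF es]]] by (simp add: distrib_right)
  qed (use C D in \<open>auto intro!: continuous_on_add has_vector_derivative_add dominated_familyD[OF F] dominated_familyD[OF G]\<close>)
qed

lemma dominated_family_minus: "dominated_family \<delta> r k F F' \<Longrightarrow> dominated_family \<delta> r k (\<lambda>e s. - F e s) (\<lambda>e s. - F' e s)"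
  unfolding dominated_family_def by (auto intro!: continuous_on_minus has_vector_derivative_minus)

lemma dominated_family_mult:
  assumes F: "dominated_family \<delta> r k F F'" and G: "dominated_family \<delta> r l G G'"
  shows "dominated_family \<delta> r (k + l) (\<lambda>e s. F e s * G e s) (\<lambda>e s. F e s * G' e s + F' e s * G e s)"
proof -
  obtain C where C: "C \<ge> 0" "\<And>e s. e \<in> {-\<delta><..<\<delta>} \<Longrightarrow> s > r \<Longrightarrow> cmod (F e s) \<le> C * (max 1 s) powi k"
    "\<And>e s. e \<in> {-\<delta><..<\<delta>} \<Longrightarrow> s > r \<Longrightarrow> cmod (F' e s) \<le> C * (max 1 s) powi k" using dominated_familyE[OF F] by blast
  obtain D where D: "D \<ge> 0" "\<And>e s. e \<in> {-\<delta><..<\<delta>} \<Longrightarrow> s > r \<Longrightarrow> cmod (G e s) \<le> D * (max 1 s) powi l"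
    "\<And>e s. e \<in> {-\<delta><..<\<delta>} \<Longrightarrow> s > r \<Longrightarrow> cmod (G' e s) \<le> D * (max 1 s) powi l" using dominated_familyE[OF G] by blast
  have m: "cmod (a * b) \<le> (C * D) * (max 1 s) powi (k + l)"
    if "cmod a \<le> C * (max 1 s) powi k" "cmod b \<le> D * (max 1 s) powi l" for a b :: complex and s :: real
  proof -
    have "cmod (a * b) \<le> (C * (max 1 s) powi k) * (D * (max 1 s) powi l)"
      unfolding norm_mult using that C(1) by (intro mult_mono) auto
    also have "\<dots> = (C * D) * (max 1 s) powi (k + l)" by (subst power_int_add) auto
    finally show ?thesis .
  qed
  show ?thesis
  proof (rule dominated_familyI[where C="C * D + C * D"])
    fix e s assume es: "e \<in> {-\<delta><..<\<delta>}" "s > r"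
    have "0 \<le> C * D * max 1 s powi (k + l)" using C D by (auto intro!: mult_nonneg_nonneg zero_le_power_int)
    then show "cmod (F e s * G e s) \<le> (C * D + C * D) * (max 1 s) powi (k + l)"
      using m[OF C(2)[OF es] D(2)[OF es]] by (simp add: distrib_right)
    show "cmod (F e s * G' e s + F' e s * G e s) \<le> (C * D + C * D) * (max 1 s) powi (k + l)"
      using norm_triangle_le[OF add_mono[OF m[OF C(2)[OF es] D(3)[OF es]] m[OF C(3)[OF es] D(2)[OF es]]]]
      by (simp add: distrib_right)
    show "((\<lambda>e. F e s * G e s) has_vector_derivative F e s * G' e s + F' e s * G e s) (at e)"
      by (intro has_vector_derivative_mult dominated_familyD[OF F] dominated_familyD[OF G] es)
  qed (use C D in \<open>auto intro!: continuous_on_add continuous_on_mult dominated_familyD[OF F] dominated_familyD[OF G]\<close>)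
qed

text \<open>The lower bound must hold with one constant m for all parameters and all radii; it
  bounds the inverse, and with it the derivative -F' / F^2.\<close>

lemma dominated_family_inverse:
  assumes F: "dominated_family \<delta> r k F F'" and m: "m > 0" "\<And>e s. e \<in> {-\<delta><..<\<delta>} \<Longrightarrow> s > r \<Longrightarrow> m * (max 1 s) powi k \<le> cmod (F e s)"
  shows "dominated_family \<delta> r (-k) (\<lambda>e s. inverse (F e s)) (\<lambda>e s. - (inverse (F e s) * F' e s * inverse (F e s)))"
proof -
  obtain C where C: "C \<ge> 0" "\<And>e s. e \<in> {-\<delta><..<\<delta>} \<Longrightarrow> s > r \<Longrightarrow> cmod (F e s) \<le> C * (max 1 s) powi k"
    "\<And>e s. e \<in> {-\<delta><..<\<delta>} \<Longrightarrow> s > r \<Longrightarrow> cmod (F' e s) \<le> C * (max 1 s) powi k" using dominated_familyE[OF F] by blast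
  have x: "(max 1 s) powi k > 0" for s :: real by (intro zero_less_power_int) auto
  have nz: "F e s \<noteq> 0" if "e \<in> {-\<delta><..<\<delta>}" "s > r" for e s
  proof
    assume "F e s = 0"
    then have "m * (max 1 s) powi k \<le> 0" using m(2)[OF that] by simp
    then show False using mult_pos_pos[OF m(1) x[of s]] by linarith
  qed
  have i: "cmod (inverse (F e s)) \<le> inverse m * (max 1 s) powi (-k)" if "e \<in> {-\<delta><..<\<delta>}" "s > r" for e s
  proof -
    have "inverse (cmod (F e s)) \<le> inverse (m * (max 1 s) powi k)"
      using m(2)[OF that] mult_pos_pos[OF m(1) x[of s]] by (rule le_imp_inverse_le)
    then show ?thesis by (simp add: norm_inverse power_int_minus mult.commute)
  qed
  show ?thesis
  proof (rule dominated_familyI[where C="inverse m + inverse m * C * inverse m"])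
    fix e s assume es: "e \<in> {-\<delta><..<\<delta>}" "s > r"
    have im: "0 \<le> inverse m" using m by simp
    have x': "0 \<le> (max 1 s) powi (-k)" by (intro zero_le_power_int) auto
    show "cmod (inverse (F e s)) \<le> (inverse m + inverse m * C * inverse m) * (max 1 s) powi (-k)"
      using i[OF es] x' im C(1) by (simp add: distrib_right add_increasing2)
    have "cmod (- (inverse (F e s) * F' e s * inverse (F e s))) \<le>
       (inverse m * (max 1 s) powi (-k)) * (C * (max 1 s) powi k) * (inverse m * (max 1 s) powi (-k))"
      unfolding norm_minus_cancel norm_mult
      using i[OF es] C(3)[OF es] C(1) im x' less_imp_le[OF x[of s]] by (intro mult_mono mult_nonneg_nonneg) auto
    also have "\<dots> = inverse m * C * inverse m * (max 1 s) powi (-k)"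
      using x[of s] by (simp add: power_int_minus)
    also have "\<dots> \<le> (inverse m + inverse m * C * inverse m) * (max 1 s) powi (-k)"
      using x' im by (intro mult_right_mono) auto
    finally show "cmod (- (inverse (F e s) * F' e s * inverse (F e s))) \<le> (inverse m + inverse m * C * inverse m) * (max 1 s) powi (-k)" .
    have "((\<lambda>e. inverse (F e s)) has_derivative (\<lambda>h. - (inverse (F e s) * (h *\<^sub>R F' e s) * inverse (F e s)))) (at e)"
      using dominated_familyD(3)[OF F es] nz[OF es] unfolding has_vector_derivative_def by (rule Deriv.has_derivative_inverse[rotated])
    then show "((\<lambda>e. inverse (F e s)) has_vector_derivative - (inverse (F e s) * F' e s * inverse (F e s))) (at e)"
      by (simp add: has_vector_derivative_def)
  next
    fix e assume e: "e \<in> {-\<delta><..<\<delta>}"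
    show "continuous_on {r<..} (\<lambda>s. inverse (F e s))"
      using nz[OF e] by (intro continuous_on_inverse dominated_familyD[OF F e]) auto
    then show "continuous_on {r<..} (\<lambda>s. - (inverse (F e s) * F' e s * inverse (F e s)))"
      by (intro continuous_on_minus continuous_on_mult dominated_familyD[OF F e])
  qed (use m C in auto)
qed

lemma dominated_family_subset: "dominated_family \<delta> r k F F' \<Longrightarrow> \<delta>' \<le> \<delta> \<Longrightarrow> dominated_family \<delta>' r k F F'"
  unfolding dominated_family_def by (meson greaterThanLessThan_iff le_less_trans less_le_trans neg_le_iff_le order_trans)

lemma dominated_family_linear:
  assumes a: "continuous_on {r<..} a" "continuous_on {r<..} b" and \<delta>: "\<delta> \<le> 1"
    and C: "\<And>s. s > r \<Longrightarrow> cmod (a s) \<le> C * (max 1 s) powi k" "\<And>s. s > r \<Longrightarrow> cmod (b s) \<le> C * (max 1 s) powi k" "C \<ge> 0"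
  shows "dominated_family \<delta> r k (\<lambda>e s. a s + of_real e * b s) (\<lambda>e s. b s)"
proof (rule dominated_familyI[where C="C + C"])
  fix e s assume es: "e \<in> {-\<delta><..<\<delta>}" "s > r"
  have x: "0 \<le> C * (max 1 s) powi k" using C(3) by (auto intro!: mult_nonneg_nonneg zero_le_power_int)
  have "cmod (of_real e * b s) \<le> 1 * cmod (b s)"
    unfolding norm_mult using es \<delta> by (intro mult_right_mono) auto
  then show "cmod (a s + of_real e * b s) \<le> (C + C) * (max 1 s) powi k"
    using C(1,2)[OF es(2)] norm_triangle_ineq[of "a s" "of_real e * b s"] by (simp add: distrib_right)
  show "cmod (b s) \<le> (C + C) * (max 1 s) powi k" using C(2)[OF es(2)] x by (simp add: distrib_right)
  have "((\<lambda>e. complex_of_real e) has_vector_derivative of_real 1) (at e)"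
    by (intro has_vector_derivative_of_real) (rule DERIV_ident)
  from has_vector_derivative_add[OF has_vector_derivative_const[of "a s"] has_vector_derivative_mult[OF this has_vector_derivative_const[of "b s"]]]
  show "((\<lambda>e. a s + of_real e * b s) has_vector_derivative b s) (at e)" by simp
qed (use a C in \<open>auto intro!: continuous_on_add continuous_on_mult continuous_on_const\<close>)

lemma dominator_max: "(max 1 s) powi (-2) = dominator 1 s"
  by (simp add: dominator_def max_def)

lemma dominated_family_integral:
  assumes F: "dominated_family \<delta> r (-2) F F'" and \<delta>: "\<delta> > 0"
  shows "((\<lambda>e. LINT s:{r<..}|lborel. F e s) has_vector_derivative (LINT s:{r<..}|lborel. F' 0 s)) (at 0)"
    and "set_integrable lborel {r<..} (F' 0)"
proof -
  obtain C where C: "C \<ge> 0" "\<And>e s. e \<in> {-\<delta><..<\<delta>} \<Longrightarrow> s > r \<Longrightarrow> cmod (F e s) \<le> C * (max 1 s) powi (-2)"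
    "\<And>e s. e \<in> {-\<delta><..<\<delta>} \<Longrightarrow> s > r \<Longrightarrow> cmod (F' e s) \<le> C * (max 1 s) powi (-2)" using dominated_familyE[OF F] by blast
  have B: "set_integrable lborel {r<..} (\<lambda>s. C * dominator 1 s)" using set_integrable_dominator[of 1] by simp
  have int: "set_integrable lborel {r<..} H"
    if "continuous_on {r<..} H" "\<And>s. s > r \<Longrightarrow> cmod (H s) \<le> C * (max 1 s) powi (-2)" for H :: "real \<Rightarrow> complex"
  proof (rule set_integrable_bound[OF B])
    show "set_borel_measurable lborel {r<..} H"
      using set_measurable_continuous_on[OF _ that(1)] by (auto simp: set_borel_measurable_def)
    show "AE s in lborel. s \<in> {r<..} \<longrightarrow> cmod (H s) \<le> norm (C * dominator 1 s)"
      using that(2) by (intro AE_I2) (auto simp: dominator_max intro: order_trans[OF _ abs_ge_self])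
  qed
  have b: "ball (0::real) \<delta> = {-\<delta><..<\<delta>}" by (auto simp: dist_real_def)
  have 0: "0 \<in> {-\<delta><..<\<delta>}" using \<delta> by auto
  show i0: "set_integrable lborel {r<..} (F' 0)" by (rule int[OF dominated_familyD(2)[OF F 0] C(3)[OF 0]])
  have "((\<lambda>e. LINT s:{r<..}|lborel. F e s) has_derivative (\<lambda>v. LINT s:{r<..}|lborel. v *\<^sub>R F' 0 s)) (at 0)"
  proof (rule has_derivative_set_integral_dominated[OF \<delta>, where D="\<lambda>e s v. v *\<^sub>R F' e s" and B="\<lambda>s. C * dominator 1 s"])
    fix e s v assume "e \<in> ball (0::real) \<delta>" and s: "s \<in> {r<..}"
    then have e: "e \<in> {-\<delta><..<\<delta>}" using b by simp
    show "((\<lambda>e. F e s) has_derivative (\<lambda>v. v *\<^sub>R F' e s)) (at e)"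
      using dominated_familyD(3)[OF F e] s by (simp add: has_vector_derivative_def)
    show "cmod (v *\<^sub>R F' e s) \<le> C * dominator 1 s * norm v"
      using mult_left_mono[OF C(3)[OF e], of s "\<bar>v\<bar>"] s by (simp add: dominator_max mult.commute)
  next
    show "0 \<le> C * dominator 1 s" for s using C dominator_nonneg[of 1] by simp
  next
    fix e assume "e \<in> ball (0::real) \<delta>"
    then have e: "e \<in> {-\<delta><..<\<delta>}" using b by simp
    show "set_integrable lborel {r<..} (F e)" by (rule int[OF dominated_familyD(1)[OF F e] C(2)[OF e]])
  next
    show "set_borel_measurable lborel {r<..} (\<lambda>s. v *\<^sub>R F' 0 s)" for v
    proof -
      have "set_integrable lborel {r<..} (\<lambda>s. v *\<^sub>R F' 0 s)" using i0 by simp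
      then show ?thesis by (simp add: set_integrable_def set_borel_measurable_def)
    qed
  qed (use B C dominator_nonneg[of 1] in auto)
  then show "((\<lambda>e. LINT s:{r<..}|lborel. F e s) has_vector_derivative (LINT s:{r<..}|lborel. F' 0 s)) (at 0)"
    by (simp add: has_vector_derivative_def)
qed

context region
begin

text \<open>Extends a bound for large radii to the whole half line from r. Since r may be small or
  negative, \<open>max 1 s\<close> replaces s, and the quotient by its power is bounded by
  compactness up to \<open>R\<close>.\<close>

lemma pointwise_bound:
  assumes F: "bnd k F" and uz: "u \<in> I" "z \<in> \<Omega>" and c: "continuous_on {r0<..} (\<lambda>s. F u s z)" and r: "r > r0"
  obtains C where "C \<ge> 0" "\<And>s. s \<ge> r \<Longrightarrow> cmod (F u s z) \<le> C * (max 1 s) powi k"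
proof -
  have K: "compact {(u, z)}" "{(u, z)} \<subseteq> I \<times> \<Omega>" using uz by auto
  obtain C R where R: "C \<ge> 0" "R \<ge> 1" "\<And>s u' z'. s \<ge> R \<Longrightarrow> (u', z') \<in> {(u, z)} \<Longrightarrow> cmod (F u' s z') \<le> C * s powi k"
    using bndE[OF F K] by metis
  have x: "(max 1 s) powi k > 0" for s :: real by (intro zero_less_power_int) auto
  have sub: "continuous_on {r..R} (\<lambda>s. F u s z)" by (rule continuous_on_subset[OF c]) (use r in auto)
  have "continuous_on {r..R} (\<lambda>s. cmod (F u s z) / (max 1 s) powi k)"
    using x sub
    by (intro continuous_on_divide continuous_on_norm continuous_on_power_int continuous_on_max continuous_on_const continuous_on_id)
       (auto simp: less_imp_neq[symmetric])
  then have "compact ((\<lambda>s. cmod (F u s z) / (max 1 s) powi k) ` {r..R})"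
    by (intro compact_continuous_image) auto
  then obtain D where D: "\<forall>y\<in>(\<lambda>s. cmod (F u s z) / (max 1 s) powi k) ` {r..R}. norm y \<le> D"
    using compact_imp_bounded bounded_iff by metis
  show thesis
  proof (rule that[of "max C D"])
    fix s assume s: "s \<ge> r"
    show "cmod (F u s z) \<le> max C D * (max 1 s) powi k"
    proof (cases "s \<ge> R")
      case True
      then have "cmod (F u s z) \<le> C * (max 1 s) powi k" using R by (auto simp: max_def)
      also have "\<dots> \<le> max C D * (max 1 s) powi k" using x[of s] by (intro mult_right_mono) auto
      finally show ?thesis .
    next
      case False
      then have "cmod (F u s z) / (max 1 s) powi k \<le> D" using D s by force
      then have "cmod (F u s z) \<le> D * (max 1 s) powi k" using x[of s] by (simp add: pos_divide_le_eq)
      also have "\<dots> \<le> max C D * (max 1 s) powi k" using x[of s] by (intro mult_right_mono) auto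
      finally show ?thesis .
    qed
  qed (use R in auto)
qed

end

section \<open>The variation of the inverse metric\<close>

context nu_xi
begin

abbreviation "ge \<equiv> (\<lambda>e \<alpha> \<beta> u r z. g \<alpha> \<beta> u r z + of_real e * h \<alpha> \<beta> u r z)"

text \<open>The range of e must not shrink as s grows. Both the determinant and its e-derivative
  scale like s^4, so one \<delta> keeps the determinant bounded below by a multiple of s^4 at every
  radius.\<close>

lemma inverse_variation:
  assumes uz: "u \<in> I" "z \<in> \<Omega>" and r: "r > r0"
  obtains \<delta> N N' where "\<delta> > 0"
    "\<And>\<mu> B. \<mu> \<noteq> Cu \<Longrightarrow> dominated_family \<delta> r (-2) (N \<mu> B) (N' \<mu> B)"
    "\<And>e s. e \<in> {-\<delta><..<\<delta>} \<Longrightarrow> s > r \<Longrightarrow> nu_shape (ge e) u s z"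
    "\<And>e s \<mu> B. e \<in> {-\<delta><..<\<delta>} \<Longrightarrow> s > r \<Longrightarrow> \<mu> \<noteq> Cu \<Longrightarrow> metric_inv (ge e) \<mu> (Cx B) u s z = N \<mu> B e s"
proof -
  let ?x = "\<lambda>s. max 1 (s::real)"
  have cg: "continuous_on {r<..} (\<lambda>s. g \<mu> \<nu> u s z)" "continuous_on {r<..} (\<lambda>s. h \<mu> \<nu> u s z)" for \<mu> \<nu>
    using continuous_on_subset[OF sm_slice_r[OF sm_g uz], of "{r<..}"] continuous_on_subset[OF h_continuous[OF uz], of "{r<..}"] r by auto
  have "\<exists>C\<ge>0. \<forall>s\<ge>r. cmod (g (Cx A) (Cx B) u s z) \<le> C * ?x s powi 2" for A B
    using pointwise_bound[OF Ord_bnd[OF Ord_g] uz sm_slice_r[OF sm_g uz] r] by metis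
  then obtain c1 where c1: "\<And>A B. c1 A B \<ge> 0" "\<And>A B s. s \<ge> r \<Longrightarrow> cmod (g (Cx A) (Cx B) u s z) \<le> c1 A B * ?x s powi 2" by metis
  have "\<exists>C\<ge>0. \<forall>s\<ge>r. cmod (h (Cx A) (Cx B) u s z) \<le> C * ?x s powi 2" for A B
    using pointwise_bound[OF bnd_h_AB uz h_continuous[OF uz] r] by metis
  then obtain c2 where c2: "\<And>A B. c2 A B \<ge> 0" "\<And>A B s. s \<ge> r \<Longrightarrow> cmod (h (Cx A) (Cx B) u s z) \<le> c2 A B * ?x s powi 2" by metis
  have "\<exists>C\<ge>0. \<forall>s\<ge>r. cmod (g Cu (Cx B) u s z) \<le> C * ?x s powi 0" for B
    using pointwise_bound[OF Ord_bnd[OF Ord_guA] uz sm_slice_r[OF sm_g uz] r] by metis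
  then obtain c3 where c3: "\<And>B. c3 B \<ge> 0" "\<And>B s. s \<ge> r \<Longrightarrow> cmod (g Cu (Cx B) u s z) \<le> c3 B * ?x s powi 0" by metis
  have "\<exists>C\<ge>0. \<forall>s\<ge>r. cmod (h Cu (Cx B) u s z) \<le> C * ?x s powi 0" for B
    using pointwise_bound[OF bnd_h_uA uz h_continuous[OF uz] r] by metis
  then obtain c4 where c4: "\<And>B. c4 B \<ge> 0" "\<And>B s. s \<ge> r \<Longrightarrow> cmod (h Cu (Cx B) u s z) \<le> c4 B * ?x s powi 0" by metis
  obtain c5 where c5: "c5 \<ge> 0" "\<And>s. s \<ge> r \<Longrightarrow> cmod (inverse (det2 (gx u s z))) \<le> c5 * ?x s powi (-4)"
    using pointwise_bound[OF Ord_bnd[OF Ord_idet] uz sm_slice_r[OF sm_idet uz] r] by metis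
  have G: "dominated_family 1 r 2 (\<lambda>e s. ge e (Cx A) (Cx B) u s z) (\<lambda>e s. h (Cx A) (Cx B) u s z)" for A B
  proof (rule dominated_family_linear[where C="max (c1 A B) (c2 A B)"])
    fix s assume s: "s > r"
    have x: "0 \<le> ?x s powi 2" by simp
    show "cmod (g (Cx A) (Cx B) u s z) \<le> max (c1 A B) (c2 A B) * ?x s powi 2"
      using c1(2)[of s A B] s mult_right_mono[OF max.cobounded1 x] by (meson less_imp_le order_trans)
    show "cmod (h (Cx A) (Cx B) u s z) \<le> max (c1 A B) (c2 A B) * ?x s powi 2"
      using c2(2)[of s A B] s mult_right_mono[OF max.cobounded2 x] by (meson less_imp_le order_trans)
  qed (use cg c1 in \<open>auto simp: le_max_iff_disj\<close>)
  have p: "dominated_family 1 r 0 (\<lambda>e s. ge e Cu (Cx B) u s z) (\<lambda>e s. h Cu (Cx B) u s z)" for B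
  proof (rule dominated_family_linear[where C="max (c3 B) (c4 B)"])
    fix s assume s: "s > r"
    show "cmod (g Cu (Cx B) u s z) \<le> max (c3 B) (c4 B) * ?x s powi 0" using c3(2)[of s B] s by (simp add: le_max_iff_disj)
    show "cmod (h Cu (Cx B) u s z) \<le> max (c3 B) (c4 B) * ?x s powi 0" using c4(2)[of s B] s by (simp add: le_max_iff_disj)
  qed (use cg c3 in \<open>auto simp: le_max_iff_disj\<close>)
  let ?m = "\<lambda>e s A B. ge e (Cx A) (Cx B) u s z"
  obtain d' where D: "dominated_family 1 r 4 (\<lambda>e s. det2 (?m e s)) d'"
    using dominated_family_add[OF dominated_family_mult[OF G[of Zeta Zeta] G[of Zetabar Zetabar]] dominated_family_minus[OF dominated_family_mult[OF G[of Zeta Zetabar] G[of Zeta Zetabar]]]]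
    unfolding det2_def by simp
  obtain c6 where c6: "c6 \<ge> 0" "\<And>e s. e \<in> {-1<..<1} \<Longrightarrow> s > r \<Longrightarrow> cmod (d' e s) \<le> c6 * ?x s powi 4"
    using dominated_familyE[OF D] by metis
  \<comment> \<open>The unperturbed determinant is at least s^4 / (c5 + 1) and moves by at most c6
    \<delta> s^4, with \<open>max 1 s\<close> for s. This \<delta> makes the change at most half of
    the lower bound; the summands 1 keep the denominators positive.\<close>
  define \<delta> where "\<delta> = min 1 (1 / (2 * (c5 + 1) * (c6 + 1)))"
  have \<delta>: "\<delta> > 0" "\<delta> \<le> 1" "2 * (c5 + 1) * (c6 + 1) * \<delta> \<le> 1"
  proof -
    have pp: "2 * (c5 + 1) * (c6 + 1) > 0" using c5(1) c6(1) by (intro mult_pos_pos) auto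
    then show "\<delta> > 0" "\<delta> \<le> 1" by (auto simp: \<delta>_def)
    have "\<delta> \<le> 1 / (2 * (c5 + 1) * (c6 + 1))" by (simp add: \<delta>_def)
    then show "2 * (c5 + 1) * (c6 + 1) * \<delta> \<le> 1" unfolding pos_le_divide_eq[OF pp] by (simp only: mult.commute)
  qed
  have lower: "(1 / (2 * (c5 + 1))) * ?x s powi 4 \<le> cmod (det2 (?m e s))" if e: "e \<in> {-\<delta><..<\<delta>}" and s: "s > r" for e s
  proof -
    have x: "?x s powi 4 > 0" by (intro zero_less_power_int) auto
    have "cmod (det2 (?m e s) - det2 (?m 0 s)) \<le> (c6 * ?x s powi 4) * norm (e - 0)"
    proof (rule differentiable_bound[where S="{-\<delta><..<\<delta>}" and f'="\<lambda>e v. v *\<^sub>R d' e s"])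
      fix y assume y: "y \<in> {-\<delta><..<\<delta>}"
      then have y1: "y \<in> {-1<..<1}" using \<delta>(2) by auto
      show "((\<lambda>e. det2 (?m e s)) has_derivative (\<lambda>v. v *\<^sub>R d' y s)) (at y within {-\<delta><..<\<delta>})"
        using dominated_familyD(3)[OF D y1 s] unfolding has_vector_derivative_def by (rule has_derivative_at_withinI)
      show "onorm (\<lambda>v. v *\<^sub>R d' y s) \<le> c6 * ?x s powi 4"
        using c6(2)[OF y1 s] c6(1) x by (intro onorm_bound) (auto simp: mult.commute mult_left_mono)
    qed (use e \<delta> in auto)
    also have "\<dots> \<le> (c6 * ?x s powi 4) * \<delta>"
      using e c6 x by (intro mult_left_mono) auto
    finally have a: "cmod (det2 (?m e s) - det2 (?m 0 s)) \<le> c6 * \<delta> * ?x s powi 4" by (simp add: mult.assoc mult.commute)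
    have m0: "?m 0 s = gx u s z" by (simp add: fun_eq_iff)
    have dn: "cmod (det2 (gx u s z)) > 0" using det_nonzero[of u s z] uz s r by auto
    have "1 / cmod (det2 (gx u s z)) \<le> (c5 + 1) * inverse (?x s powi 4)"
    proof -
      have "1 / cmod (det2 (gx u s z)) \<le> c5 * inverse (?x s powi 4)"
        using c5(2)[of s] s by (simp add: norm_inverse power_int_minus divide_inverse)
      also have "\<dots> \<le> (c5 + 1) * inverse (?x s powi 4)" using x by (intro mult_right_mono) auto
      finally show ?thesis .
    qed
    then have "?x s powi 4 \<le> (c5 + 1) * cmod (det2 (gx u s z))"
      using dn x by (simp add: field_simps)
    then have b: "(1 / (c5 + 1)) * ?x s powi 4 \<le> cmod (det2 (gx u s z))" using c5(1) by (simp add: field_simps)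
    have "c6 * \<delta> \<le> 1 / (2 * (c5 + 1))"
    proof -
      have "(2 * (c5 + 1)) * (c6 * \<delta>) \<le> 2 * (c5 + 1) * (c6 + 1) * \<delta>"
        using c5(1) \<delta>(1) by (simp add: algebra_simps)
      then have "(2 * (c5 + 1)) * (c6 * \<delta>) \<le> 1" using \<delta>(3) by linarith
      then show ?thesis using c5(1) by (simp add: pos_le_divide_eq mult.commute)
    qed
    then have 1: "c6 * \<delta> * ?x s powi 4 \<le> (1 / (2 * (c5 + 1))) * ?x s powi 4" using x by (intro mult_right_mono) auto
    have 2: "(1 / (c5 + 1)) * ?x s powi 4 = (1 / (2 * (c5 + 1))) * ?x s powi 4 + (1 / (2 * (c5 + 1))) * ?x s powi 4"
    proof -
      have "1 / (2 * (c5 + 1)) = (1 / (c5 + 1)) / 2" by simp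
      then have "1 / (2 * (c5 + 1)) + 1 / (2 * (c5 + 1)) = 1 / (c5 + 1)" by (simp only: field_sum_of_halves)
      then show ?thesis by (metis distrib_right)
    qed
    have 3: "cmod (det2 (gx u s z)) \<le> cmod (det2 (?m e s)) + cmod (det2 (?m e s) - det2 (?m 0 s))"
      using norm_triangle_ineq4[of "det2 (?m e s)" "det2 (?m e s) - det2 (?m 0 s)"] m0 by simp
    have "m2 \<le> q" if "p \<le> m2" "m1 = m2 + m2" "d0 \<le> q + t" "t \<le> p" "m1 \<le> d0" for p m1 m2 d0 q t :: real
      using that by linarith
    from this[OF 1 2 3 a b] show ?thesis .
  qed
  have G': "dominated_family \<delta> r 2 (\<lambda>e s. ge e (Cx A) (Cx B) u s z) (\<lambda>e s. h (Cx A) (Cx B) u s z)" for A B by (rule dominated_family_subset[OF G \<delta>(2)])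
  have p': "dominated_family \<delta> r 0 (\<lambda>e s. ge e Cu (Cx B) u s z) (\<lambda>e s. h Cu (Cx B) u s z)" for B by (rule dominated_family_subset[OF p \<delta>(2)])
  have "0 < 1 / (2 * (c5 + 1))" using c5(1) by simp
  note iD = dominated_family_inverse[OF dominated_family_subset[OF D \<delta>(2)] this lower]
  have ex: "\<exists>N'. dominated_family \<delta> r (-2) (\<lambda>e s. inv2 (?m e s) A B) N'" for A B
    using dominated_family_mult[OF G'[of Zetabar Zetabar] iD] dominated_family_mult[OF G'[of Zeta Zeta] iD] dominated_family_mult[OF dominated_family_minus[OF G'[of Zeta Zetabar]] iD]
    by (cases A; cases B) (auto simp del: mult_minus_left)
  \<comment> \<open>Any e-derivative will do here: its value at 0 is identified afterwards in
    \<open>inverse_variation_value\<close>.\<close>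
  define i' where "i' = (\<lambda>A B. SOME N'. dominated_family \<delta> r (-2) (\<lambda>e s. inv2 (?m e s) A B) N')"
  have i': "dominated_family \<delta> r (-2) (\<lambda>e s. inv2 (?m e s) A B) (i' A B)" for A B
    unfolding i'_def by (rule someI_ex[OF ex])
  have rr: "\<exists>N'. dominated_family \<delta> r (-2) (\<lambda>e s. \<Sum>C\<in>UNIV. inv2 (?m e s) B C * ge e Cu (Cx C) u s z) N'" for B
    using dominated_family_add[OF dominated_family_mult[OF i'[of B Zeta] p'[of Zeta]] dominated_family_mult[OF i'[of B Zetabar] p'[of Zetabar]]]
    unfolding sum_ang by auto
  have ex': "\<exists>N'. dominated_family \<delta> r (-2) (\<lambda>e s. nu_inv (ge e Cu Cu u s z) (\<lambda>A. ge e Cu (Cx A) u s z) (?m e s) \<mu> (Cx B)) N'" if "\<mu> \<noteq> Cu" for \<mu> B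
    using that i' rr by (cases \<mu>) auto
  define N' where "N' = (\<lambda>\<mu> B. SOME N'. dominated_family \<delta> r (-2) (\<lambda>e s. nu_inv (ge e Cu Cu u s z) (\<lambda>A. ge e Cu (Cx A) u s z) (?m e s) \<mu> (Cx B)) N')"
  have N': "dominated_family \<delta> r (-2) (\<lambda>e s. nu_inv (ge e Cu Cu u s z) (\<lambda>A. ge e Cu (Cx A) u s z) (?m e s) \<mu> (Cx B)) (N' \<mu> B)"
    if "\<mu> \<noteq> Cu" for \<mu> B
    unfolding N'_def by (rule someI_ex[OF ex'[OF that]])
  have sh: "nu_shape (ge e) u s z" if "e \<in> {-\<delta><..<\<delta>}" "s > r" for e s
  proof -
    have q: "u \<in> I" "s > r0" "z \<in> \<Omega>" using uz that r by auto
    have "?x s powi 4 > 0" by (intro zero_less_power_int) auto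
    then have "0 < (1 / (2 * (c5 + 1))) * ?x s powi 4" using c5(1) by (intro mult_pos_pos) auto
    then have "det2 (?m e s) \<noteq> 0" using lower[OF that] by auto
    moreover have "h (Cx A) Cu u s z = h Cu (Cx A) u s z" "g (Cx A) Cu u s z = g Cu (Cx A) u s z"
      "h (Cx Zetabar) (Cx Zeta) u s z = h (Cx Zeta) (Cx Zetabar) u s z"
      "g (Cx Zetabar) (Cx Zeta) u s z = g (Cx Zeta) (Cx Zetabar) u s z" for A
      by (rule h_sym[OF q] g_sym[OF q])+
    ultimately show ?thesis
      unfolding nu_shape_def by (simp add: gr[OF q] h_r[OF q])
  qed
  show thesis
    by (rule that[OF \<delta>(1) N' sh]) (use metric_inv_nu(1)[OF sh] in auto)
qed

text \<open>The identity "inverse times metric" is differentiated instead of the explicit formula.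
  The u-entry \<open>c\<close> of the row is the same for all e, and the r-entry meets only
  vanishing components of g and h, so the unknown derivatives satisfy a linear system whose matrix
  is the angular block of g.\<close>

lemma inverse_variation_value:
  assumes p: "u \<in> I" "s > r0" "z \<in> \<Omega>" and \<delta>: "\<delta> > 0" and \<mu>: "\<mu> \<noteq> Cu"
    and sh: "\<And>e. e \<in> {-\<delta><..<\<delta>} \<Longrightarrow> nu_shape (ge e) u s z"
    and N: "\<And>B. ((\<lambda>e. metric_inv (ge e) \<mu> (Cx B) u s z) has_vector_derivative N' B) (at 0)"
  shows "N' B = lie_inv \<mu> (Cx B) u s z"
proof -
  let ?G = "\<lambda>\<mu> \<nu>. Gi \<mu> \<nu> u s z" and ?g = "\<lambda>\<mu> \<nu>. g \<mu> \<nu> u s z" and ?h = "\<lambda>\<mu> \<nu>. h \<mu> \<nu> u s z"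
  have g0: "ge 0 = g" by simp
  have lin: "((\<lambda>e. ?g \<alpha> \<beta> + of_real e * ?h \<alpha> \<beta>) has_vector_derivative ?h \<alpha> \<beta>) (at 0)" for \<alpha> \<beta>
  proof -
    have "((\<lambda>e. complex_of_real e) has_vector_derivative of_real 1) (at 0)"
      by (intro has_vector_derivative_of_real) (rule DERIV_ident)
    from has_vector_derivative_add[OF has_vector_derivative_const[of "?g \<alpha> \<beta>"] has_vector_derivative_mult[OF this has_vector_derivative_const[of "?h \<alpha> \<beta>"]]]
    show ?thesis by simp
  qed
  define c where "c = ?G \<mu> Cu"
  have eq: "(\<Sum>C\<in>UNIV. N' C * ?g (Cx C) (Cx D) + ?G \<mu> (Cx C) * ?h (Cx C) (Cx D)) + c * ?h Cu (Cx D) = 0" for D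
  proof -
    have id: "c * (?g Cu (Cx D) + of_real e * ?h Cu (Cx D))
       + (\<Sum>C\<in>UNIV. metric_inv (ge e) \<mu> (Cx C) u s z * (?g (Cx C) (Cx D) + of_real e * ?h (Cx C) (Cx D))) = (if \<mu> = Cx D then 1 else 0)"
      if e: "e \<in> {-\<delta><..<\<delta>}" for e
    proof -
      have "metric_inv (ge e) \<mu> Cu u s z = c"
        unfolding c_def using metric_inv_nu(1)[OF sh[OF e], of \<mu> Cu] Gi_eq(1)[OF p, of \<mu> Cu] \<mu> by (cases \<mu>) auto
      then show ?thesis
        using metric_inv_nu(2)[OF sh[OF e], of \<mu> "Cx D"] by (simp add: sum_coord sum_ang gr[OF p] h_r[OF p] add.assoc)
    qed
    have "((\<lambda>e. c * (?g Cu (Cx D) + of_real e * ?h Cu (Cx D))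
       + (\<Sum>C\<in>UNIV. metric_inv (ge e) \<mu> (Cx C) u s z * (?g (Cx C) (Cx D) + of_real e * ?h (Cx C) (Cx D))))
       has_vector_derivative (c * ?h Cu (Cx D) + 0 * (?g Cu (Cx D) + of_real 0 * ?h Cu (Cx D)))
       + (\<Sum>C\<in>UNIV. metric_inv (ge 0) \<mu> (Cx C) u s z * ?h (Cx C) (Cx D) + N' C * (?g (Cx C) (Cx D) + of_real 0 * ?h (Cx C) (Cx D)))) (at 0)"
      by (intro has_vector_derivative_add has_vector_derivative_mult has_vector_derivative_sum has_vector_derivative_const lin N)
    then have "((\<lambda>e. if \<mu> = Cx D then 1 else (0::complex)) has_vector_derivative (c * ?h Cu (Cx D) + 0 * (?g Cu (Cx D) + of_real 0 * ?h Cu (Cx D)))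
       + (\<Sum>C\<in>UNIV. metric_inv (ge 0) \<mu> (Cx C) u s z * ?h (Cx C) (Cx D) + N' C * (?g (Cx C) (Cx D) + of_real 0 * ?h (Cx C) (Cx D)))) (at 0)"
      by (rule has_vector_derivative_transform_within_open[where S="{-\<delta><..<\<delta>}"]) (use \<delta> id in auto)
    from vector_derivative_unique_at[OF this has_vector_derivative_const]
    show ?thesis unfolding g0 Gi_def[symmetric] by (simp add: sum_ang algebra_simps)
  qed
  have gG: "(\<Sum>D\<in>UNIV. ?g (Cx C) (Cx D) * ?G (Cx D) (Cx B)) = (if B = C then 1 else 0)" for C
    using g_Gi'[OF p, of "Cx C" "Cx B"] by (simp add: sum_coord sum_ang gr[OF p] Gi_eq(1)[OF p])
  have "0 = (\<Sum>D\<in>UNIV. ((\<Sum>C\<in>UNIV. N' C * ?g (Cx C) (Cx D) + ?G \<mu> (Cx C) * ?h (Cx C) (Cx D)) + c * ?h Cu (Cx D)) * ?G (Cx D) (Cx B))"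
    by (simp add: eq)
  also have "\<dots> = (\<Sum>C\<in>UNIV. N' C * (\<Sum>D\<in>UNIV. ?g (Cx C) (Cx D) * ?G (Cx D) (Cx B)))
      + (\<Sum>D\<in>UNIV. ((\<Sum>C\<in>UNIV. ?G \<mu> (Cx C) * ?h (Cx C) (Cx D)) + c * ?h Cu (Cx D)) * ?G (Cx D) (Cx B))"
    unfolding sum_ang by algebra
  also have "(\<Sum>C\<in>UNIV. N' C * (\<Sum>D\<in>UNIV. ?g (Cx C) (Cx D) * ?G (Cx D) (Cx B))) = N' B"
    unfolding gG by (cases B) (simp_all add: sum_ang)
  also have "(\<Sum>D\<in>UNIV. ((\<Sum>C\<in>UNIV. ?G \<mu> (Cx C) * ?h (Cx C) (Cx D)) + c * ?h Cu (Cx D)) * ?G (Cx D) (Cx B)) = - lie_inv \<mu> (Cx B) u s z"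
    unfolding lie_inv_h[OF p] c_def by (simp add: sum_coord sum_ang h_r[OF p] Gi_eq(1)[OF p, of Cu "Cx _"] algebra_simps)
  finally show ?thesis by (simp add: eq_neg_iff_add_eq_0)
qed

lemma integral_variation:
  assumes p: "u \<in> I" "r > r0" "z \<in> \<Omega>" and \<mu>: "\<mu> \<noteq> Cu"
  shows "((\<lambda>e. LBINT s=r..\<infinity>. metric_inv (ge e) \<mu> (Cx B) u s z) has_vector_derivative tail (lie_inv \<mu> (Cx B)) u r z) (at 0)"
    and "set_integrable lborel {r<..} (\<lambda>s. lie_inv \<mu> (Cx B) u s z)"
proof -
  obtain \<delta> N N' where \<delta>: "\<delta> > 0" and N: "\<And>\<mu> B. \<mu> \<noteq> Cu \<Longrightarrow> dominated_family \<delta> r (-2) (N \<mu> B) (N' \<mu> B)"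
    and sh: "\<And>e s. e \<in> {-\<delta><..<\<delta>} \<Longrightarrow> s > r \<Longrightarrow> nu_shape (ge e) u s z"
    and eq: "\<And>e s \<mu> B. e \<in> {-\<delta><..<\<delta>} \<Longrightarrow> s > r \<Longrightarrow> \<mu> \<noteq> Cu \<Longrightarrow> metric_inv (ge e) \<mu> (Cx B) u s z = N \<mu> B e s"
    using inverse_variation[OF p(1,3,2)] by blast
  have 0: "0 \<in> {-\<delta><..<\<delta>}" using \<delta> by auto
  have val: "N' \<mu> B 0 s = lie_inv \<mu> (Cx B) u s z" if s: "s > r" for s B
  proof (rule inverse_variation_value[OF p(1) _ p(3) \<delta> \<mu>])
    show "s > r0" using s p by simp
    show "nu_shape (ge e) u s z" if "e \<in> {-\<delta><..<\<delta>}" for e using sh[OF that s] .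
    show "((\<lambda>e. metric_inv (ge e) \<mu> (Cx B) u s z) has_vector_derivative N' \<mu> B 0 s) (at 0)" for B
      by (rule has_vector_derivative_transform_within_open[OF dominated_familyD(3)[OF N[OF \<mu>] 0 s], where S="{-\<delta><..<\<delta>}"])
         (use 0 eq[OF _ s \<mu>] in auto)
  qed
  note I = dominated_family_integral[OF N[OF \<mu>] \<delta>]
  have c: "(LINT s:{r<..}|lborel. N' \<mu> B 0 s) = tail (lie_inv \<mu> (Cx B)) u r z"
    unfolding tail_eq by (rule set_lebesgue_integral_cong) (use val in auto)
  show "((\<lambda>e. LBINT s=r..\<infinity>. metric_inv (ge e) \<mu> (Cx B) u s z) has_vector_derivative tail (lie_inv \<mu> (Cx B)) u r z) (at 0)"
  proof (rule has_vector_derivative_transform_within_open[OF I(1)[of B, unfolded c], where S="{-\<delta><..<\<delta>}"])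
    fix e assume e: "e \<in> {-\<delta><..<\<delta>}"
    show "(LINT s:{r<..}|lborel. N \<mu> B e s) = (LBINT s=r..\<infinity>. metric_inv (ge e) \<mu> (Cx B) u s z)"
      unfolding interval_integral_to_infinity_eq by (rule set_lebesgue_integral_cong) (use eq[OF e _ \<mu>] in auto)
  qed (use 0 in auto)
  show "set_integrable lborel {r<..} (\<lambda>s. lie_inv \<mu> (Cx B) u s z)"
    using I(2)[of B] val by (subst set_integrable_cong[where M'=lborel and A'="{r<..}" and f'="N' \<mu> B 0"]) auto
qed

end

section \<open>The variation of the conformal factor and of the vector fields\<close>

context nu_xi
begin

text \<open>By \<open>bnd_h_zz\<close> the perturbation multiplies the r^2 coefficient by 1 + 2 e
  \<omega>, and the O(r) remainders vanish after division by r^2. The logarithm makes the result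
  nonlinear in e, with derivative \<omega> at e = 0.\<close>

lemma conf_factor_variation:
  assumes p: "u \<in> I" "z \<in> \<Omega>" and pos: "1 + 2 * e * \<omega> u z > 0"
  shows "conf_factor (ge e) u z = \<phi> u z + ln (1 + 2 * e * \<omega> u z) / 2"
proof -
  let ?c = "exp (2 * \<phi> u z) / 2 * (1 + 2 * e * \<omega> u z)"
  let ?F = "\<lambda>u r z. (g (Cx Zeta) (Cx Zetabar) u r z - of_real (r^2) * gam' u r z)
     + of_real e * (h (Cx Zeta) (Cx Zetabar) u r z - of_real (r^2) * (gam' u r z * (2 * of_real (\<omega> u z))))"
  have "bnd 1 (\<lambda>u r z. of_real e * (h (Cx Zeta) (Cx Zetabar) u r z - of_real (r^2) * (gam' u r z * (2 * of_real (\<omega> u z)))))"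
    by (rule bnd_mult_le[OF bnd_indep bnd_h_zz]) (auto simp: case_prod_unfold)
  then have "bnd 1 ?F" by (intro bnd_add Ord_bnd[OF Ord_goff']) simp
  from bnd_tendsto[OF bnd_mult_le[OF this bnd_rpow[of "-2"], of "-1"] p]
  have "((\<lambda>r. ?F u r z * of_real (r powi (-2))) \<longlongrightarrow> 0) at_top" by simp
  then have "((\<lambda>r. ge e (Cx Zeta) (Cx Zetabar) u r z / of_real (r^2) - of_real ?c) \<longlongrightarrow> 0) at_top"
  proof (rule Lim_transform_eventually)
    show "\<forall>\<^sub>F r in at_top. ?F u r z * of_real (r powi (-2)) = ge e (Cx Zeta) (Cx Zetabar) u r z / of_real (r^2) - of_real ?c"
      using eventually_gt_at_top[of 0]
    proof eventually_elim
      case (elim r)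
      have gm: "gam' u r z = of_real (exp (2 * \<phi> u z) / 2)" by (simp add: gam'_def flip: exp_of_real)
      have ab: "complex_of_real (r^2) * of_real (r powi (-2)) = 1"
      proof -
        have "r^2 * r powi (-2) = 1" using elim by (simp add: power_int_minus)
        then show ?thesis by (metis of_real_1 of_real_mult)
      qed
      have dv: "x / complex_of_real (r^2) = x * of_real (r powi (-2))" for x
        by (simp add: power_int_minus divide_inverse)
      have c: "complex_of_real ?c = of_real (exp (2 * \<phi> u z) / 2) * (1 + 2 * of_real e * of_real (\<omega> u z))" by simp
      show ?case unfolding gm dv c using ab by algebra
    qed
  qed
  then have "((\<lambda>r. ge e (Cx Zeta) (Cx Zetabar) u r z / of_real (r^2)) \<longlongrightarrow> of_real ?c) at_top" by (simp only: LIM_zero_iff)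
  then have "Lim at_top (\<lambda>r. ge e (Cx Zeta) (Cx Zetabar) u r z / of_real (r^2)) = of_real ?c"
    by (intro tendsto_Lim) auto
  then have "conf_factor (ge e) u z = ln (2 * ?c) / 2" by (simp only: conf_factor_def Re_complex_of_real)
  also have "2 * ?c = exp (2 * \<phi> u z) * (1 + 2 * e * \<omega> u z)" by simp
  also have "ln \<dots> = 2 * \<phi> u z + ln (1 + 2 * e * \<omega> u z)" using pos by (subst ln_mult_pos) auto
  finally show ?thesis by simp
qed

text \<open>Since f at u integrates over all v between 0 and u, the logarithm must be defined for
  all these v, and for points near z, on one common interval of e. Compactness gives a bound
  \<open>M\<close> on \<omega> there.\<close>

lemma variation_box:
  assumes p: "u \<in> I" "z \<in> \<Omega>"
  obtains \<delta> J B where "\<delta> > 0" "open J" "is_interval J" "0 \<in> J" "u \<in> J" "J \<subseteq> I" "open B" "z \<in> B" "B \<subseteq> \<Omega>"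
    "\<And>e v w. e \<in> {-\<delta><..<\<delta>} \<Longrightarrow> v \<in> J \<Longrightarrow> w \<in> B \<Longrightarrow> 1 + 2 * e * \<omega> v w > 0"
proof -
  have m: "min 0 u \<in> I" "max 0 u \<in> I" using p(1) I by (auto simp: min_def max_def)
  obtain e1 where e1: "e1 > 0" "cball (min 0 u) e1 \<subseteq> I" using open_I m(1) open_contains_cball by metis
  obtain e2 where e2: "e2 > 0" "cball (max 0 u) e2 \<subseteq> I" using open_I m(2) open_contains_cball by metis
  obtain \<rho> where \<rho>: "\<rho> > 0" "cball z \<rho> \<subseteq> \<Omega>" using open_\<Omega> p(2) open_contains_cball by metis
  let ?l = "min 0 u - e1" and ?h = "max 0 u + e2"
  have "?l \<in> I" "?h \<in> I" using e1 e2 by (auto simp: dist_real_def subset_eq)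
  then have sub: "{?l..?h} \<subseteq> I" using interval_subsetI[OF I(1), of ?l ?h] e1(1) e2(1) by (simp add: min_def max_def split: if_splits)
  let ?K = "{?l..?h} \<times> cball z \<rho>"
  have "continuous_on ?K (\<lambda>(u, z). \<omega> u z)"
    by (rule continuous_on_subset[OF smooth_on_continuous[OF \<omega>]]) (use sub \<rho> in auto)
  then have "compact ((\<lambda>(u, z). \<omega> u z) ` ?K)"
    by (intro compact_continuous_image compact_Times) auto
  then obtain M where "\<forall>x\<in>(\<lambda>(u, z). \<omega> u z) ` ?K. norm x \<le> M"
    using compact_imp_bounded bounded_iff by metis
  then have M: "\<bar>\<omega> v w\<bar> \<le> M" if "v \<in> {?l..?h}" "w \<in> cball z \<rho>" for v w using that by force
  \<comment> \<open>This choice makes the product of e and \<omega> smaller than 1/2 in modulus,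
    also when \<open>M\<close> is 0.\<close>
  define \<delta> where "\<delta> = 1 / (2 * \<bar>M\<bar> + 2)"
  show thesis
  proof (rule that[of \<delta> "{?l<..<?h}" "ball z \<rho>"])
    fix e v w assume e: "e \<in> {-\<delta><..<\<delta>}" and vw: "v \<in> {?l<..<?h}" "w \<in> ball z \<rho>"
    have "\<bar>e * \<omega> v w\<bar> \<le> \<delta> * \<bar>M\<bar>"
      unfolding abs_mult using e M[of v w] vw by (intro mult_mono) auto
    also have "\<dots> < 1 / 2" by (simp add: \<delta>_def field_simps)
    finally show "1 + 2 * e * \<omega> v w > 0" by (simp add: abs_if split: if_splits)
  qed (use sub \<rho> e1 e2 in \<open>auto simp: \<delta>_def is_interval_1 intro!: divide_pos_pos\<close>)
qed

end

lemma has_vector_derivative_pd_r: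
  "pdiff F u e z \<Longrightarrow> ((\<lambda>e. F u e z) has_vector_derivative pd Cr F u e z) (at e)"
  by (simp add: pd_def pdiff_def vector_derivative_works)

text \<open>Agreement on the single slice with radial slot e is enough, because the derivative is
  not taken in that slot. It transfers identities known at parameter 0 only.\<close>

lemma pd_slot_cong:
  assumes "open J" "open B" "u \<in> J" "z \<in> B" "\<mu> \<noteq> Cr" "\<And>v w. v \<in> J \<Longrightarrow> w \<in> B \<Longrightarrow> F v e w = G v e w"
  shows "pd \<mu> F u e z = pd \<mu> G u e z"
proof (cases \<mu>)
  case Cu
  then show ?thesis
    using vector_derivative_cong_open[OF assms(1,3), of "\<lambda>v. F v e z" "\<lambda>v. G v e z"] assms(4,6) by (simp add: pd_def)
next
  case (Cx A)
  then show ?thesis using dang_cong[OF assms(2,4), of "F u e" "G u e" A] assms(3,6) by (simp add: pd_def)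
qed (use assms in auto)

section \<open>The variation of one vector field along another\<close>

locale nu_var = n1: nu_xi I \<Omega> r0 \<phi> g W V C Y1 T1 \<omega>1 + n2: nu_xi I \<Omega> r0 \<phi> g W V C Y2 T2 \<omega>2
  for I \<Omega> r0 \<phi> g W V C Y1 T1 \<omega>1 Y2 T2 \<omega>2
begin

definition DF :: scalar where "DF = dvar (lift2 \<omega>1) n1.\<Phi> Y2 T2 (lift2 \<omega>2)"

lemma sm_DF: "sm (I \<times> UNIV \<times> \<Omega>) DF"
  unfolding DF_def by (rule n2.pm.sm_dvar[OF n1.pm.sm_w])

lemma indep_DF: "n1.indep DF"
  unfolding DF_def n1.indep_def dvar_def dvarG_def fam_def famF_def famG_def psi_def int0_def pd_def by simp

text \<open>The product rule for the varied Laplacian: -2 \<omega>1 comes from the factor exp (-2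
  \<phi>), the rest from the variation of f.\<close>

definition dlap :: scalar where
  "dlap u r z = - 2 * of_real (\<omega>1 u z) * n2.lap u r z + 4 * exp (- 2 * n1.\<Phi> u r z) * pd (Cx Zeta) (pd (Cx Zetabar) DF) u r z"

definition dtail :: "coord \<Rightarrow> scalar" where
  "dtail \<mu> u r z = (\<Sum>B\<in>UNIV. pd (Cx B) DF u r z * tail (n1.Gi \<mu> (Cx B)) u r z + pd (Cx B) n2.f u r z * tail (n1.lie_inv \<mu> (Cx B)) u r z)"

text \<open>The variation of the second vector field along the first.\<close>

primrec dX :: "coord \<Rightarrow> scalar" where
  "dX Cu = DF"
| "dX Cr = (\<lambda>u r z. - of_real r * pd Cu DF u r z + dlap u r z / 2 - dtail Cr u r z)"
| "dX (Cx A) = (\<lambda>u r z. - dtail (Cx A) u r z)"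

lemma variation_xi:
  assumes p: "u \<in> I" "r > r0" "z \<in> \<Omega>"
  shows "variation (lie_metric (xi (Y1, T1, \<omega>1) g) g) (xi (Y2, T2, \<omega>2)) g \<mu> u r z = dX \<mu> u r z"
proof -
  obtain \<delta> J B where \<delta>: "\<delta> > 0" and J: "open J" "is_interval J" "0 \<in> J" "u \<in> J" "J \<subseteq> I" and B: "open B" "z \<in> B" "B \<subseteq> \<Omega>"
    and pos: "\<And>e v w. e \<in> {-\<delta><..<\<delta>} \<Longrightarrow> v \<in> J \<Longrightarrow> w \<in> B \<Longrightarrow> 1 + 2 * e * \<omega>1 v w > 0"
    using n1.variation_box[OF p(1,3)] by metis
  let ?R = "{-\<delta><..<\<delta>}"
  \<comment> \<open>The conformal factor of g + e h, with e in the radial slot; it is smooth on the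
    box by the choice of \<delta>.\<close>
  define \<sigma> :: scalar where "\<sigma> = (\<lambda>u e z. of_real (\<phi> u z + ln (1 + 2 * e * \<omega>1 u z) / 2))"
  have o: "open (J \<times> ?R \<times> B)" using J B by (auto intro!: open_Times)
  have sub: "J \<times> B \<subseteq> I \<times> \<Omega>" using J B by auto
  have smw: "smooth_on (J \<times> ?R \<times> B) (\<lambda>(u, e, z). \<omega>1 u z)"
    by (rule n1.sm_lift[OF smooth_on_subset[OF n1.\<omega> sub] J(1) B(1)]) auto
  have smp: "smooth_on (J \<times> ?R \<times> B) (\<lambda>(u, e, z). \<phi> u z)"
    by (rule n1.sm_lift[OF smooth_on_subset[OF n1.sm_\<phi> sub] J(1) B(1)]) auto
  have sme: "smooth_on (J \<times> ?R \<times> B) (\<lambda>x. fst (snd x))"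
    by (rule smooth_on_bounded_linear[OF bounded_linear_compose[OF bounded_linear_fst bounded_linear_snd] o])
  have s0: "smooth_on (J \<times> ?R \<times> B) (\<lambda>x. 1 + 2 * fst (snd x) * (\<lambda>(u, e, z). \<omega>1 u z) x)"
    by (intro smooth_on_add smooth_on_mult smooth_on_const o sme smw)
  have "smooth_on (J \<times> ?R \<times> B) (\<lambda>x. ln (1 + 2 * fst (snd x) * (\<lambda>(u, e, z). \<omega>1 u z) x))"
    by (rule smooth_on_ln[OF o _ s0]) (use pos in auto)
  then have "smooth_on (J \<times> ?R \<times> B) (\<lambda>x. (\<lambda>(u, e, z). \<phi> u z) x + ln (1 + 2 * fst (snd x) * (\<lambda>(u, e, z). \<omega>1 u z) x) * inverse 2)"
    by (intro smooth_on_add smooth_on_mult smooth_on_const o smp)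
  from smooth_on_bounded_linear_comp[OF bounded_linear_of_real o this]
  have sm\<sigma>': "smooth_on (J \<times> ?R \<times> B) (\<lambda>x. complex_of_real ((\<lambda>(u, e, z). \<phi> u z) x + ln (1 + 2 * fst (snd x) * (\<lambda>(u, e, z). \<omega>1 u z) x) * inverse 2))" .
  have "uncurried \<sigma> = (\<lambda>x. complex_of_real ((\<lambda>(u, e, z). \<phi> u z) x + ln (1 + 2 * fst (snd x) * (\<lambda>(u, e, z). \<omega>1 u z) x) * inverse 2))"
    by (rule ext) (simp add: \<sigma>_def split: prod.split)
  with sm\<sigma>' have sm\<sigma>: "sm (J \<times> ?R \<times> B) \<sigma>" by (simp only:)
  interpret bb: box_params J ?R B \<sigma> Y2 T2 "lift2 \<omega>2"
    by unfold_locales (use J B sm\<sigma> n2.params_box[OF J(1) _ B(1,3) J(5)] in auto)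
  have 0: "0 \<in> ?R" using \<delta> by auto
  have \<sigma>0: "\<sigma> v 0 w = n1.\<Phi> v 0 w" for v w by (simp add: \<sigma>_def)
  have \<sigma>0': "\<sigma> v 0 = (\<lambda>w. of_real (\<phi> v w))" for v by (simp add: \<sigma>_def fun_eq_iff)
  have pd\<sigma>: "pd Cr \<sigma> v 0 w = of_real (\<omega>1 v w)" if "v \<in> J" "w \<in> B" for v w
  proof -
    have "((\<lambda>e. \<phi> v w + ln (1 + 2 * e * \<omega>1 v w) / 2) has_real_derivative \<omega>1 v w) (at 0)"
      by (auto intro!: derivative_eq_intros)
    then have "((\<lambda>e. \<sigma> v e w) has_vector_derivative of_real (\<omega>1 v w)) (at 0)"
      unfolding \<sigma>_def by (intro has_vector_derivative_of_real)
    then show ?thesis by (simp add: pd_def vector_derivative_at)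
  qed
  define Fm where "Fm = fam \<sigma> Y2 T2 (lift2 \<omega>2)"
  have smF: "sm (J \<times> ?R \<times> B) Fm" unfolding Fm_def by (rule bb.sm_fam)
  have q: "(v, 0, w) \<in> J \<times> ?R \<times> B" if "v \<in> J" "w \<in> B" for v w using that 0 by auto
  have F0: "Fm v 0 w = n2.f v 0 w" for v w
    unfolding Fm_def n2.f_def fam_def famF_def famG_def psi_def int0_def pd_def by (simp add: \<sigma>0')
  have DFeq: "pd Cr Fm v 0 w = DF v 0 w" if "v \<in> J" "w \<in> B" for v w
  proof -
    have "pd Cr Fm v 0 w = dvar (lift2 \<omega>1) \<sigma> Y2 T2 (lift2 \<omega>2) v 0 w"
      unfolding Fm_def by (rule bb.pd_r_fam[OF q[OF that]]) (use pd\<sigma> in \<open>auto simp: pd_def\<close>)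
    also have "\<dots> = DF v 0 w"
      unfolding DF_def dvar_def dvarG_def fam_def famF_def famG_def psi_def int0_def pd_def by (simp add: \<sigma>0')
    finally show ?thesis .
  qed
  have D1: "pd Cr (pd \<mu> Fm) v 0 w = pd \<mu> DF v 0 w" if "v \<in> J" "w \<in> B" "\<mu> \<noteq> Cr" for v w \<mu>
    using pd_commute[OF o smF q[OF that(1,2)], of Cr \<mu>] pd_slot_cong[OF J(1) B(1) that, of "pd Cr Fm" 0 DF] DFeq by simp
  have D2: "pd Cr (pd (Cx Zeta) (pd (Cx Zetabar) Fm)) u 0 z = pd (Cx Zeta) (pd (Cx Zetabar) DF) u 0 z"
    using pd_commute[OF o sm_pd[OF o smF] q[OF J(4) B(2)], of Cr "Cx Zeta" "Cx Zetabar"]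
      pd_slot_cong[OF J(1) B(1) J(4) B(2), of "Cx Zeta" "pd Cr (pd (Cx Zetabar) Fm)" 0 "pd (Cx Zetabar) DF"] D1 by simp
  have P1: "pd \<mu> Fm v 0 w = pd \<mu> n2.f v 0 w" if "v \<in> J" "w \<in> B" "\<mu> \<noteq> Cr" for v w \<mu>
    by (rule pd_slot_cong[OF J(1) B(1) that]) (rule F0)
  have P2: "pd (Cx Zeta) (pd (Cx Zetabar) Fm) u 0 z = pd (Cx Zeta) (pd (Cx Zetabar) n2.f) u 0 z"
    by (rule pd_slot_cong[OF J(1) B(1) J(4) B(2)]) (use P1 in auto)
  have q0: "(u, 0, z) \<in> J \<times> ?R \<times> B" by (rule q[OF J(4) B(2)])
  have V0: "((\<lambda>e. Fm u e z) has_vector_derivative DF u 0 z) (at 0)"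
    using has_vector_derivative_pd_r[OF sm_pdiff[OF smF q0]] DFeq[OF J(4) B(2)] by simp
  have V1: "((\<lambda>e. pd \<mu> Fm u e z) has_vector_derivative pd \<mu> DF u 0 z) (at 0)" if "\<mu> \<noteq> Cr" for \<mu>
    using has_vector_derivative_pd_r[OF sm_pdiff[OF sm_pd[OF o smF, of \<mu>] q0]] D1[OF J(4) B(2) that] by simp
  have V2: "((\<lambda>e. pd (Cx Zeta) (pd (Cx Zetabar) Fm) u e z) has_vector_derivative pd (Cx Zeta) (pd (Cx Zetabar) DF) u 0 z) (at 0)"
    using has_vector_derivative_pd_r[OF sm_pdiff[OF sm_pd[OF o sm_pd[OF o smF, of "Cx Zetabar"], of "Cx Zeta"] q0]] D2 by simp
  have VE: "((\<lambda>e. exp (- 2 * \<sigma> u e z)) has_vector_derivative - 2 * of_real (\<omega>1 u z) * exp (- 2 * n1.\<Phi> u 0 z)) (at 0)"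
  proof -
    have s: "sm (J \<times> ?R \<times> B) (\<lambda>u e z. - 2 * \<sigma> u e z)" "sm (J \<times> ?R \<times> B) (\<lambda>u e z. exp (- 2 * \<sigma> u e z))"
      by (intro bb.sm_rules sm\<sigma>)+
    have "pd Cr (\<lambda>u e z. exp (- 2 * \<sigma> u e z)) u 0 z = - 2 * of_real (\<omega>1 u z) * exp (- 2 * n1.\<Phi> u 0 z)"
      unfolding pd_exp[OF sm_pdiff[OF s(1) q0]]
      using pd_mult[OF pdiff_const[of "-2"] sm_pdiff[OF sm\<sigma> q0], of Cr] pd\<sigma>[OF J(4) B(2)] by (simp add: pd_const \<sigma>0)
    then show ?thesis using has_vector_derivative_pd_r[OF sm_pdiff[OF s(2) q0]] by simp
  qed
  let ?fo = "\<lambda>e. f_of (conf_factor (n1.ge e)) (Y2, T2, \<omega>2)"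
  have cfe: "conf_factor (n1.ge e) v w = \<phi> v w + ln (1 + 2 * e * \<omega>1 v w) / 2" if "e \<in> ?R" "v \<in> J" "w \<in> B" for e v w
    using n1.conf_factor_variation[of v w e] pos[OF that] that J B by auto
  have fo: "?fo e v w = Fm v e w" if "e \<in> ?R" "v \<in> J" "w \<in> B" for e v w
    unfolding Fm_def by (rule f_of_fam[OF J(2,3) that(2) B(1) that(3)]) (use cfe that in \<open>auto simp: \<sigma>_def\<close>)
  have foA: "dang A (?fo e v) w = pd (Cx A) Fm v e w" if "e \<in> ?R" "v \<in> J" "w \<in> B" for e v w A
    unfolding pd_def using dang_cong[OF B(1) that(3), of "?fo e v" "Fm v e" A] fo[OF that(1,2)] by simp
  have fou: "vector_derivative (\<lambda>v. ?fo e v z) (at u) = pd Cu Fm u e z" if "e \<in> ?R" for e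
    unfolding pd_def using vector_derivative_cong_open[OF J(1,4), of "\<lambda>v. ?fo e v z" "\<lambda>v. Fm v e z"] fo[OF that _ B(2)] by simp
  have fol: "laplace_bar (conf_factor (n1.ge e)) (?fo e) u z = 4 * exp (- 2 * \<sigma> u e z) * pd (Cx Zeta) (pd (Cx Zetabar) Fm) u e z" if e: "e \<in> ?R" for e
  proof -
    have "dang Zeta (dang Zetabar (?fo e u)) z = dang Zeta (\<lambda>w. pd (Cx Zetabar) Fm u e w) z"
      by (rule dang_cong[OF B(1,2)]) (rule foA[OF e J(4)])
    moreover have "complex_of_real (4 * exp (- 2 * conf_factor (n1.ge e) u z)) = 4 * exp (- 2 * \<sigma> u e z)"
      unfolding cfe[OF e J(4) B(2)] \<sigma>_def by (simp flip: exp_of_real)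
    ultimately show ?thesis by (simp only: laplace_bar_def dang_Cx)
  qed
  let ?Int = "\<lambda>\<mu> B e. LBINT s=r..\<infinity>. metric_inv (n1.ge e) \<mu> (Cx B) u s z"
  have ge0: "n1.ge 0 = g" by simp
  have Int0: "?Int \<mu> B 0 = tail (n1.Gi \<mu> (Cx B)) u r z" for \<mu> B
    by (simp add: tail_def n1.Gi_def)
  have IntV: "(?Int \<mu> B has_vector_derivative tail (n1.lie_inv \<mu> (Cx B)) u r z) (at 0)" if "\<mu> \<noteq> Cu" for \<mu> B
    by (rule n1.integral_variation(1)[OF p that])
  have ind: "DF u 0 z = DF u r z" "pd \<mu> DF u 0 z = pd \<mu> DF u r z" "pd \<mu> n2.f u 0 z = pd \<mu> n2.f u r z" if "\<mu> \<noteq> Cr" for \<mu>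
    using n1.indep_pd[OF indep_DF that] n1.indep_pd[OF n2.indep_f that] indep_DF unfolding n1.indep_def by blast+
  have ind2: "pd (Cx Zeta) (pd (Cx Zetabar) DF) u 0 z = pd (Cx Zeta) (pd (Cx Zetabar) DF) u r z"
    "pd (Cx Zeta) (pd (Cx Zetabar) n2.f) u 0 z = pd (Cx Zeta) (pd (Cx Zetabar) n2.f) u r z"
    using n1.indep_pd[OF n1.indep_pd[OF indep_DF, of "Cx Zetabar"], of "Cx Zeta"]
      n1.indep_pd[OF n1.indep_pd[OF n2.indep_f, of "Cx Zetabar"], of "Cx Zeta"] unfolding n1.indep_def by blast+
  have prod: "((\<lambda>e. \<Sum>B\<in>UNIV. pd (Cx B) Fm u e z * ?Int \<mu> B e) has_vector_derivative dtail \<mu> u r z) (at 0)" if "\<mu> \<noteq> Cu" for \<mu>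
  proof -
    have "((\<lambda>e. \<Sum>B\<in>UNIV. pd (Cx B) Fm u e z * ?Int \<mu> B e) has_vector_derivative
       (\<Sum>B\<in>UNIV. pd (Cx B) Fm u 0 z * tail (n1.lie_inv \<mu> (Cx B)) u r z + pd (Cx B) DF u 0 z * ?Int \<mu> B 0)) (at 0)"
      by (intro has_vector_derivative_sum has_vector_derivative_mult V1 IntV[OF that]) auto
    then show ?thesis unfolding Int0 P1[OF J(4) B(2) coord.distinct(6)] dtail_def
      using ind by (simp add: add.commute)
  qed
  have var: "variation (lie_metric (xi (Y1, T1, \<omega>1) g) g) (xi (Y2, T2, \<omega>2)) g \<mu> u r z =
      vector_derivative (\<lambda>e. xi (Y2, T2, \<omega>2) (n1.ge e) \<mu> u r z) (at 0)"
    unfolding variation_def n1.h_def ..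
  have "((\<lambda>e. xi (Y2, T2, \<omega>2) (n1.ge e) \<mu> u r z) has_vector_derivative dX \<mu> u r z) (at 0)"
  proof (cases \<mu>)
    case Cu
    have "((\<lambda>e. xi (Y2, T2, \<omega>2) (n1.ge e) Cu u r z) has_vector_derivative DF u 0 z) (at 0)"
      by (rule has_vector_derivative_transform_within_open[OF V0, of ?R]) (use 0 fo[OF _ J(4) B(2)] in \<open>auto simp: xi_def\<close>)
    then show ?thesis using Cu ind(1)[of Cu] by simp
  next
    case (Cx A)
    have "((\<lambda>e. Y2 A z - (\<Sum>B\<in>UNIV. pd (Cx B) Fm u e z * ?Int (Cx A) B e)) has_vector_derivative 0 - dtail (Cx A) u r z) (at 0)"
      by (intro has_vector_derivative_diff has_vector_derivative_const prod) auto
    then have "((\<lambda>e. xi (Y2, T2, \<omega>2) (n1.ge e) (Cx A) u r z) has_vector_derivative 0 - dtail (Cx A) u r z) (at 0)"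
      by (rule has_vector_derivative_transform_within_open[where S="?R"]) (use 0 foA[OF _ J(4) B(2)] in \<open>auto simp: xi_def\<close>)
    then show ?thesis using Cx by simp
  next
    case Cr
    have a: "((\<lambda>e. - of_real r * pd Cu Fm u e z + 4 * exp (- 2 * \<sigma> u e z) * pd (Cx Zeta) (pd (Cx Zetabar) Fm) u e z * inverse 2
        - (\<Sum>B\<in>UNIV. pd (Cx B) Fm u e z * ?Int Cr B e)) has_vector_derivative
       (- of_real r * pd Cu DF u 0 z + 0 * pd Cu Fm u 0 z)
       + (4 * exp (- 2 * \<sigma> u 0 z) * pd (Cx Zeta) (pd (Cx Zetabar) Fm) u 0 z * 0
         + (4 * exp (- 2 * \<sigma> u 0 z) * pd (Cx Zeta) (pd (Cx Zetabar) DF) u 0 z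
           + (4 * (- 2 * of_real (\<omega>1 u z) * exp (- 2 * n1.\<Phi> u 0 z)) + 0 * exp (- 2 * \<sigma> u 0 z)) * pd (Cx Zeta) (pd (Cx Zetabar) Fm) u 0 z) * inverse 2)
       - dtail Cr u r z) (at 0)"
      by (intro has_vector_derivative_diff has_vector_derivative_add has_vector_derivative_mult has_vector_derivative_const prod V1 V2 VE) auto
    have b: "(- of_real r * pd Cu DF u 0 z + 0 * pd Cu Fm u 0 z)
       + (4 * exp (- 2 * \<sigma> u 0 z) * pd (Cx Zeta) (pd (Cx Zetabar) Fm) u 0 z * 0
         + (4 * exp (- 2 * \<sigma> u 0 z) * pd (Cx Zeta) (pd (Cx Zetabar) DF) u 0 z
           + (4 * (- 2 * of_real (\<omega>1 u z) * exp (- 2 * n1.\<Phi> u 0 z)) + 0 * exp (- 2 * \<sigma> u 0 z)) * pd (Cx Zeta) (pd (Cx Zetabar) Fm) u 0 z) * inverse 2)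
       - dtail Cr u r z = dX Cr u r z"
      unfolding P2 ind2 \<sigma>0 dX.simps dlap_def n2.lap_def ind(2)[of Cu, simplified] by (simp add: field_simps)
    have c: "((\<lambda>e. - of_real r * pd Cu Fm u e z + 4 * exp (- 2 * \<sigma> u e z) * pd (Cx Zeta) (pd (Cx Zetabar) Fm) u e z * inverse 2
        - (\<Sum>B\<in>UNIV. pd (Cx B) Fm u e z * ?Int Cr B e)) has_vector_derivative dX Cr u r z) (at 0)"
      using a by (subst (asm) b)
    have "((\<lambda>e. xi (Y2, T2, \<omega>2) (n1.ge e) Cr u r z) has_vector_derivative dX Cr u r z) (at 0)"
    proof (rule has_vector_derivative_transform_within_open[OF c, where S="?R"])
      fix e assume e: "e \<in> ?R"
      show "- of_real r * pd Cu Fm u e z + 4 * exp (- 2 * \<sigma> u e z) * pd (Cx Zeta) (pd (Cx Zetabar) Fm) u e z * inverse 2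
        - (\<Sum>B\<in>UNIV. pd (Cx B) Fm u e z * ?Int Cr B e) = xi (Y2, T2, \<omega>2) (n1.ge e) Cr u r z"
      proof -
        have sgn: "a * x / 2 = a * x * inverse 2" for a x :: complex by (rule divide_inverse)
        have "xi (Y2, T2, \<omega>2) (n1.ge e) Cr u r z = - of_real r * vector_derivative (\<lambda>v. ?fo e v z) (at u)
           + laplace_bar (conf_factor (n1.ge e)) (?fo e) u z / 2
           + (\<Sum>A\<in>UNIV. dang A (?fo e u) z * (LBINT s=r..\<infinity>. - metric_inv (n1.ge e) Cr (Cx A) u s z))"
          by (simp only: xi_def Let_def coord.case)
        also have "(\<Sum>A\<in>UNIV. dang A (?fo e u) z * (LBINT s=r..\<infinity>. - metric_inv (n1.ge e) Cr (Cx A) u s z)) =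
           - (\<Sum>B\<in>UNIV. pd (Cx B) Fm u e z * ?Int Cr B e)"
          by (simp only: foA[OF e J(4) B(2)] interval_lebesgue_integral_uminus mult_minus_right sum_negf)
        finally show ?thesis by (simp only: fol[OF e] fou[OF e] sgn diff_conv_add_uminus)
      qed
    qed (use 0 in auto)
    then show ?thesis using Cr by simp
  qed
  then show ?thesis unfolding var by (rule vector_derivative_at)
qed

text \<open>The inverse metric's u-row is fixed by the gauge, and h_r\<mu> = 0 says that the
  variation respects this.\<close>

lemma lie_inv_u:
  assumes p: "u \<in> I" "r > r0" "z \<in> \<Omega>"
  shows "n1.lie_inv \<mu> Cu u r z = 0" "n1.lie_inv Cu \<mu> u r z = 0"
  unfolding n1.lie_inv_h[OF p] by (simp_all add: sum_coord n1.h_r[OF p] n1.Gi_eq(1)[OF p, of _ Cu] n1.Gi_eq(1)[OF p, of Cu])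

lemma lie_inv_continuous:
  assumes uz: "u \<in> I" "z \<in> \<Omega>"
  shows "continuous_on {r0<..} (\<lambda>s. n1.lie_inv \<mu> \<nu> u s z)"
proof -
  have "continuous_on {r0<..} (\<lambda>s. - (\<Sum>\<alpha>\<in>UNIV. \<Sum>\<beta>\<in>UNIV. n1.Gi \<mu> \<alpha> u s z * n1.h \<alpha> \<beta> u s z * n1.Gi \<beta> \<nu> u s z))"
    by (intro continuous_on_minus continuous_on_sum continuous_on_mult n1.h_continuous uz n1.sm_slice_r n1.sm_Gi)
  then show ?thesis by (rule continuous_on_eq) (use n1.lie_inv_h uz in auto)
qed

lemma tail_lie_inv_radial:
  assumes p: "u \<in> I" "r > r0" "z \<in> \<Omega>" and \<mu>: "\<mu> \<noteq> Cu"
  shows "((\<lambda>r. tail (n1.lie_inv \<mu> (Cx B)) u r z) has_vector_derivative - n1.lie_inv \<mu> (Cx B) u r z) (at r)"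
  unfolding tail_eq
  by (rule tail_radial_derivative[OF lie_inv_continuous[OF p(1,3)] n1.integral_variation(2)[OF p(1) _ p(3) \<mu>] p(2)])

lemma tail_Gi_radial:
  assumes p: "u \<in> I" "r > r0" "z \<in> \<Omega>" and \<mu>: "\<mu> \<noteq> Cu"
  shows "((\<lambda>r. tail (n1.Gi \<mu> (Cx B)) u r z) has_vector_derivative - n1.Gi \<mu> (Cx B) u r z) (at r)"
  using n1.tail_has_vector_derivative[OF n1.sm_Gi _ p(1,3,2)] n1.Ord_Gi n1.Ord_Gi_rA \<mu> by (cases \<mu>) auto

text \<open>The radial equation after variation: the gradient of the varied f, plus the varied
  inverse metric applied to the gradient of f. It is read off from the closed form of
  \<open>dX\<close>, so no exchange of \<partial>_r with the derivative in e is needed.\<close>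

lemma dX_radial:
  assumes p: "u \<in> I" "r > r0" "z \<in> \<Omega>"
  shows "((\<lambda>r. dX \<mu> u r z) has_vector_derivative
    (\<Sum>\<rho>\<in>UNIV. n1.Gi \<mu> \<rho> u r z * pd \<rho> DF u r z) + (\<Sum>\<rho>\<in>UNIV. n1.lie_inv \<mu> \<rho> u r z * pd \<rho> n2.f u r z)) (at r)"
proof -
  have e: "DF u s z = DF u r z" "pd Cu DF u s z = pd Cu DF u r z" "pd (Cx B) DF u s z = pd (Cx B) DF u r z"
    "pd (Cx B) n2.f u s z = pd (Cx B) n2.f u r z" for s B
    using n1.indep_pd[OF indep_DF, of Cu] n1.indep_pd[OF indep_DF, of "Cx B"] n1.indep_pd[OF n2.indep_f, of "Cx B"] indep_DF
    unfolding n1.indep_def by blast+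
  have lap: "dlap u s z = dlap u r z" for s
  proof -
    have "n1.indep (pd (Cx Zeta) (pd (Cx Zetabar) DF))" by (intro n1.indep_pd indep_DF) auto
    then have 1: "pd (Cx Zeta) (pd (Cx Zetabar) DF) u s z = pd (Cx Zeta) (pd (Cx Zetabar) DF) u r z" unfolding n1.indep_def by blast
    have 2: "n2.lap u s z = n2.lap u r z" using n2.indep_lap unfolding n1.indep_def by blast
    show ?thesis unfolding dlap_def 1 2 ..
  qed
  have t: "((\<lambda>r. dtail \<mu> u r z) has_vector_derivative - (\<Sum>B\<in>UNIV. pd (Cx B) DF u r z * n1.Gi \<mu> (Cx B) u r z + pd (Cx B) n2.f u r z * n1.lie_inv \<mu> (Cx B) u r z)) (at r)"
    if "\<mu> \<noteq> Cu" for \<mu>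
  proof -
    have "((\<lambda>s. \<Sum>B\<in>UNIV. pd (Cx B) DF u r z * tail (n1.Gi \<mu> (Cx B)) u s z + pd (Cx B) n2.f u r z * tail (n1.lie_inv \<mu> (Cx B)) u s z)
      has_vector_derivative (\<Sum>B\<in>UNIV. (pd (Cx B) DF u r z * (- n1.Gi \<mu> (Cx B) u r z) + 0 * tail (n1.Gi \<mu> (Cx B)) u r z)
        + (pd (Cx B) n2.f u r z * (- n1.lie_inv \<mu> (Cx B) u r z) + 0 * tail (n1.lie_inv \<mu> (Cx B)) u r z))) (at r)"
      by (intro has_vector_derivative_sum has_vector_derivative_add has_vector_derivative_mult has_vector_derivative_const
          tail_Gi_radial tail_lie_inv_radial p that)
    moreover have "(\<lambda>s. \<Sum>B\<in>UNIV. pd (Cx B) DF u r z * tail (n1.Gi \<mu> (Cx B)) u s z + pd (Cx B) n2.f u r z * tail (n1.lie_inv \<mu> (Cx B)) u s z) = (\<lambda>s. dtail \<mu> u s z)"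
      unfolding dtail_def by (intro ext sum.cong refl) (metis e(3,4))
    ultimately show ?thesis by (simp add: sum_ang algebra_simps)
  qed
  have fr: "pd Cr n2.f u r z = 0" "pd Cr DF u r z = 0" using n1.indep_pd_r[OF n2.indep_f] n1.indep_pd_r[OF indep_DF] by auto
  show ?thesis
  proof (cases \<mu>)
    case Cu
    have "(\<lambda>s. DF u s z) = (\<lambda>s. DF u r z)" using e(1) by blast
    then have "((\<lambda>s. DF u s z) has_vector_derivative 0) (at r)" by (metis has_vector_derivative_const)
    then show ?thesis using Cu by (simp add: sum_coord lie_inv_u[OF p] n1.Gi_eq(1)[OF p, of Cu] fr)
  next
    case Cr
    have "((\<lambda>s. complex_of_real s) has_vector_derivative of_real 1) (at r)"
      by (intro has_vector_derivative_of_real) (rule DERIV_ident)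
    then have "((\<lambda>s. - of_real s * pd Cu DF u r z + dlap u r z / 2 - dtail Cr u s z) has_vector_derivative
        (- of_real r * 0 + (- of_real 1) * pd Cu DF u r z) + 0
        - - (\<Sum>B\<in>UNIV. pd (Cx B) DF u r z * n1.Gi Cr (Cx B) u r z + pd (Cx B) n2.f u r z * n1.lie_inv Cr (Cx B) u r z)) (at r)"
      by (intro has_vector_derivative_diff has_vector_derivative_add has_vector_derivative_mult has_vector_derivative_minus
          has_vector_derivative_const t) auto
    moreover have "(\<lambda>s. - of_real s * pd Cu DF u r z + dlap u r z / 2 - dtail Cr u s z) = (\<lambda>s. dX Cr u s z)"
      unfolding dX.simps by (intro ext) (metis e(2) lap)
    ultimately show ?thesis using Cr
      by (simp add: sum_coord sum_ang lie_inv_u[OF p] n1.Gi_eq(1)[OF p, of Cr Cu] fr algebra_simps)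
  next
    case (Cx A)
    have "((\<lambda>r. - dtail (Cx A) u r z) has_vector_derivative - (- (\<Sum>B\<in>UNIV. pd (Cx B) DF u r z * n1.Gi (Cx A) (Cx B) u r z + pd (Cx B) n2.f u r z * n1.lie_inv (Cx A) (Cx B) u r z))) (at r)"
      by (intro has_vector_derivative_minus t) auto
    then show ?thesis using Cx
      by (simp add: sum_coord sum_ang lie_inv_u[OF p] n1.Gi_eq(1)[OF p, of "Cx A" Cu] fr algebra_simps)
  qed
qed

end

section \<open>Limits at large radius\<close>

text \<open>Needed for \<open>lie_inv\<close>, for which only integrability is at hand and no rate
  of decay.\<close>

lemma tail_tendsto_0:
  assumes "set_integrable lborel {a<..} (\<lambda>s. F u s z)"
  shows "((\<lambda>r. tail F u r z) \<longlongrightarrow> 0) at_top"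
proof -
  let ?g = "\<lambda>s. indicat_real {a<..} s *\<^sub>R F u s z"
  have g: "integrable lborel ?g" using assms by (simp add: set_integrable_def)
  have "((\<lambda>r. \<integral>s. indicat_real {r<..} s *\<^sub>R ?g s \<partial>lborel) \<longlongrightarrow> (\<integral>s. 0 \<partial>(lborel :: real measure))) at_top"
  proof (rule integral_dominated_convergence_at_top[where w="\<lambda>s. norm (?g s)" and s="\<lambda>r s. indicat_real {r<..} s *\<^sub>R ?g s" and f="\<lambda>s. 0" and M=lborel])
    show "\<forall>\<^sub>F r in at_top. AE s in lborel. norm (indicat_real {r<..} s *\<^sub>R ?g s) \<le> norm (?g s)"
      by (intro always_eventually allI AE_I2) (auto simp: indicator_def)
    show "AE s in lborel. ((\<lambda>r. indicat_real {r<..} s *\<^sub>R ?g s) \<longlongrightarrow> 0) at_top"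
    proof (rule AE_I2)
      fix s :: real
      have "\<forall>\<^sub>F r in at_top. 0 = indicat_real {r<..} s *\<^sub>R ?g s"
        using eventually_ge_at_top[of s] by eventually_elim (auto simp: indicator_def)
      then show "((\<lambda>r. indicat_real {r<..} s *\<^sub>R ?g s) \<longlongrightarrow> 0) at_top"
        by (rule Lim_transform_eventually[OF tendsto_const])
    qed
    show "(\<lambda>s. indicat_real {r<..} s *\<^sub>R ?g s) \<in> borel_measurable lborel" for r
      by (rule borel_measurable_scaleR[OF _ borel_measurable_integrable[OF g]]) simp
    show "integrable lborel (\<lambda>s. norm (?g s))" by (rule integrable_norm[OF g])
  qed auto
  then have "((\<lambda>r. \<integral>s. indicat_real {r<..} s *\<^sub>R ?g s \<partial>lborel) \<longlongrightarrow> 0) at_top" by simp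
  then show ?thesis
  proof (rule Lim_transform_eventually)
    show "\<forall>\<^sub>F r in at_top. (\<integral>s. indicat_real {r<..} s *\<^sub>R ?g s \<partial>lborel) = tail F u r z"
      using eventually_ge_at_top[of a]
    proof eventually_elim
      case (elim r)
      then show ?case unfolding tail_eq set_lebesgue_integral_def
        by (intro Bochner_Integration.integral_cong) (auto simp: indicator_def)
    qed
  qed
qed

context nu_xi
begin

context
  fixes u z assumes uz: "u \<in> I" "z \<in> \<Omega>"
begin

lemma eventually_reg: "\<forall>\<^sub>F r in at_top. r > R1"
  by (rule eventually_gt_at_top)

lemma X_tendsto: "((\<lambda>r. X (Cx A) u r z) \<longlongrightarrow> Y A z) at_top"
  using bnd_tendsto[OF Ord_bnd[OF Ord_XY] uz] by (simp add: LIM_zero_iff)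

lemma pd_XY:
  assumes "r > R1"
  shows "pd \<mu> (X (Cx A)) u r z = pd \<mu> (\<lambda>u r z. X (Cx A) u r z - Y A z) u r z + pd \<mu> (\<lambda>u r z. Y A z) u r z"
proof -
  have p: "u \<in> I" "r > r0" "z \<in> \<Omega>" using uz assms R1_r0 by auto
  have "pdiff (\<lambda>u r z. Y A z) u r z" by (rule pdiff_ux[OF p pm.sm_Y])
  then show ?thesis using pd_diff[OF pdiff_X[OF p], of "\<lambda>u r z. Y A z" \<mu> "Cx A"] by simp
qed

lemma pd_X_tendsto: "((\<lambda>r. pd (Cx B) (X (Cx A)) u r z) \<longlongrightarrow> pd (Cx B) (\<lambda>u r z. Y A z) u 0 z) at_top"
proof -
  have "((\<lambda>r. pd (Cx B) (\<lambda>u r z. X (Cx A) u r z - Y A z) u r z + pd (Cx B) (\<lambda>u r z. Y A z) u 0 z) \<longlongrightarrow> 0 + pd (Cx B) (\<lambda>u r z. Y A z) u 0 z) at_top"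
    by (intro tendsto_add tendsto_const bnd_tendsto[OF Ord_pd_le[OF Ord_XY] uz])
  then have "((\<lambda>r. pd (Cx B) (\<lambda>u r z. X (Cx A) u r z - Y A z) u r z + pd (Cx B) (\<lambda>u r z. Y A z) u 0 z) \<longlongrightarrow> pd (Cx B) (\<lambda>u r z. Y A z) u 0 z) at_top"
    by simp
  then show ?thesis
  proof (rule Lim_transform_eventually)
    show "\<forall>\<^sub>F r in at_top. pd (Cx B) (\<lambda>u r z. X (Cx A) u r z - Y A z) u r z + pd (Cx B) (\<lambda>u r z. Y A z) u 0 z = pd (Cx B) (X (Cx A)) u r z"
      using eventually_reg by eventually_elim (simp add: pd_XY, simp add: pd_def)
  qed
qed

lemma pd_u_X_tendsto: "((\<lambda>r. pd Cu (X (Cx A)) u r z) \<longlongrightarrow> 0) at_top"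
  using bnd_tendsto[OF Ord_pd_le[OF Ord_XY] uz, of Cu A]
proof (rule Lim_transform_eventually)
  show "\<forall>\<^sub>F r in at_top. pd Cu (\<lambda>u r z. X (Cx A) u r z - Y A z) u r z = pd Cu (X (Cx A)) u r z"
    using eventually_reg by eventually_elim (simp add: pd_XY pm.pd_u_Y[of u 0 z] pd_def[of Cu "\<lambda>u r z. Y A z"])
qed

text \<open>The radial factor is a field \<open>X'\<close> of its own because in the bracket it
  belongs to the other triple; order 1 against order -2 leaves 1/r.\<close>

lemma Xr_pd_r_tendsto: "((\<lambda>r. X' Cr u r z * pd Cr (X (Cx A)) u r z) \<longlongrightarrow> 0) at_top"
  if "Ord 1 (X' Cr)" for X' :: "coord \<Rightarrow> scalar"
proof -
  have "bnd (-1) (\<lambda>u r z. X' Cr u r z * pd Cr (\<lambda>u r z. X (Cx A) u r z - Y A z) u r z)"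
    by (rule bnd_mult_le[OF Ord_bnd[OF that] Ord_pd[OF Ord_XY]]) simp
  from bnd_tendsto[OF this uz] show ?thesis
  proof (rule Lim_transform_eventually)
    show "\<forall>\<^sub>F r in at_top. X' Cr u r z * pd Cr (\<lambda>u r z. X (Cx A) u r z - Y A z) u r z = X' Cr u r z * pd Cr (X (Cx A)) u r z"
      using eventually_reg by eventually_elim (simp add: pd_XY pd_def[of Cr "\<lambda>u r z. Y A z"])
  qed
qed

lemma tail_Gi_tendsto: "\<mu> \<noteq> Cu \<Longrightarrow> ((\<lambda>r. tail (Gi \<mu> (Cx B)) u r z) \<longlongrightarrow> 0) at_top"
  using tail_tendsto_0[of "R1 + 1" "Gi \<mu> (Cx B)" u z] Gi_integrable[OF uz, of "R1 + 1" \<mu> B] R1_r0[of "R1 + 1"] by auto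

lemma tail_lie_inv_tendsto: "\<mu> \<noteq> Cu \<Longrightarrow> ((\<lambda>r. tail (lie_inv \<mu> (Cx B)) u r z) \<longlongrightarrow> 0) at_top"
  using tail_tendsto_0[of "R1 + 1" "lie_inv \<mu> (Cx B)" u z] integral_variation(2)[OF uz(1) _ uz(2), of "R1 + 1" \<mu> B] R1_r0[of "R1 + 1"] by auto

lemma Rr_tendsto: "((\<lambda>r. Rr u r z) \<longlongrightarrow> lap u 0 z / 2) at_top"
  and pd_Rr_tendsto: "\<mu> \<noteq> Cr \<Longrightarrow> ((\<lambda>r. pd \<mu> Rr u r z) \<longlongrightarrow> pd \<mu> lap u 0 z / 2) at_top"
proof -
  have l: "lap u r z = lap u 0 z" for r using indep_lap unfolding indep_def by blast
  have "((\<lambda>r. lap u 0 z / 2 - tail (P Cr) u r z) \<longlongrightarrow> lap u 0 z / 2 - 0) at_top"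
    by (intro tendsto_diff tendsto_const bnd_tendsto[OF Ord_bnd[OF Ord_tailP] uz])
  moreover have "(\<lambda>r. Rr u r z) = (\<lambda>r. lap u 0 z / 2 - tail (P Cr) u r z)"
    unfolding Rr_def by (rule ext) (metis l)
  ultimately show "((\<lambda>r. Rr u r z) \<longlongrightarrow> lap u 0 z / 2) at_top" by simp
  show "((\<lambda>r. pd \<mu> Rr u r z) \<longlongrightarrow> pd \<mu> lap u 0 z / 2) at_top" if \<mu>: "\<mu> \<noteq> Cr"
  proof -
    have "((\<lambda>r. pd \<mu> lap u 0 z / 2 - pd \<mu> (tail (P Cr)) u r z) \<longlongrightarrow> pd \<mu> lap u 0 z / 2 - 0) at_top"
      by (intro tendsto_diff tendsto_const bnd_tendsto[OF Ord_pd_le[OF Ord_tailP] uz])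
    then have "((\<lambda>r. pd \<mu> lap u 0 z / 2 - pd \<mu> (tail (P Cr)) u r z) \<longlongrightarrow> pd \<mu> lap u 0 z / 2) at_top" by simp
    then show ?thesis
    proof (rule Lim_transform_eventually)
      show "\<forall>\<^sub>F r in at_top. pd \<mu> lap u 0 z / 2 - pd \<mu> (tail (P Cr)) u r z = pd \<mu> Rr u r z"
        using eventually_reg
      proof eventually_elim
        case (elim r)
        have p: "u \<in> I" "r > r0" "z \<in> \<Omega>" using uz elim R1_r0 by auto
        have d: "pdiff lap u r z" using pdiff_ux[OF p sm_lap] .
        have "pdiff (\<lambda>u r z. lap u r z / 2) u r z" using pdiff_ux[OF p ux.sm_divide[OF sm_lap]] .
        then have "pd \<mu> Rr u r z = pd \<mu> (\<lambda>u r z. lap u r z / 2) u r z - pd \<mu> (tail (P Cr)) u r z"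
          unfolding Rr_def[abs_def] by (rule pd_diff[OF _ pdiff_tail[OF sm_P Ord_P p(1,3,2)]])
        also have "pd \<mu> (\<lambda>u r z. lap u r z / 2) u r z = pd \<mu> lap u r z / 2" by (rule pd_divide[OF d])
        also have "pd \<mu> lap u r z = pd \<mu> lap u 0 z" using indep_pd[OF indep_lap \<mu>] unfolding indep_def by blast
        finally show ?case by simp
      qed
    qed
  qed
qed

lemma rP_tendsto: "((\<lambda>r. of_real r * P Cr u r z) \<longlongrightarrow> 0) at_top"
  using bnd_tendsto[OF bnd_mult_le[OF Ord_bnd[OF Ord_r] Ord_bnd[OF Ord_P], of "-1" Cr] uz] by simp

lemma P_tendsto: "((\<lambda>r. P Cr u r z) \<longlongrightarrow> 0) at_top"
  using bnd_tendsto[OF bnd_mono[OF Ord_bnd[OF Ord_P], of "-1" Cr] uz] by simp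

text \<open>The subleading part of \<open>X\<^sup>A\<close>: \<open>X\<^sup>A = Y\<^sup>A - (Q\<^sup>A + eta\<^sup>A) / r\<close> for positive r.\<close>

definition eta :: "ang \<Rightarrow> real \<Rightarrow> complex" where
  "eta A r = of_real r * (tail (P (Cx A)) u r z - of_real (r powi (-1)) * Q A u r z)"

lemma eta_tendsto: "((\<lambda>r. eta A r) \<longlongrightarrow> 0) at_top"
  unfolding eta_def
  using bnd_tendsto[OF bnd_mult_le[OF Ord_bnd[OF Ord_r] Ord_bnd[OF Ord_tailQ], of "-1" A] uz] by simp

lemma X_eta: "r > 0 \<Longrightarrow> X (Cx A) u r z = Y A z - (Q A u 0 z + eta A r) * inverse (of_real r)"
proof -
  assume r: "r > 0"
  have Q0: "Q A u r z = Q A u 0 z" using indep_Q unfolding indep_def by blast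
  have "complex_of_real (r powi (-1)) = inverse (of_real r)" using r by (simp add: power_int_minus)
  then show ?thesis using r unfolding eta_def X_def Q0 by (simp add: field_simps)
qed

end

lemma pd_Xr:
  assumes p: "u \<in> I" "r > R1" "z \<in> \<Omega>" and \<mu>: "\<mu> \<noteq> Cr"
  shows "pd \<mu> (X Cr) u r z = - of_real r * pd \<mu> (pd Cu f) u r z + pd \<mu> Rr u r z"
proof -
  have q: "u \<in> I" "r > r0" "z \<in> \<Omega>" using p R1_r0 by auto
  have i: "pdiff (pd Cu f) u r z" using pdiff_ux[OF q ux.sm_PD[OF sm_f]] .
  have Rd: "pdiff Rr u r z" using Ord_Rr p unfolding Ord_def by blast
  have "pd \<mu> (X Cr) u r z = pd \<mu> (\<lambda>u r z. of_real (- r) * pd Cu f u r z + Rr u r z) u r z"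
    by (rule pd_cong[OF open_reg]) (use q Xr in auto)
  also have "\<dots> = pd \<mu> (\<lambda>u r z. of_real (- r) * pd Cu f u r z) u r z + pd \<mu> Rr u r z"
  proof (rule pd_add)
    have "pdiff (\<lambda>u r z. - (of_real r * pd Cu f u r z)) u r z"
      by (intro pdiff_minus pdiff_mult i pdiff_ux[OF q sm_r])
    then show "pdiff (\<lambda>u r z. of_real (- r) * pd Cu f u r z) u r z" by simp
  qed (rule Rd)
  finally show ?thesis using pd_mult_r[OF i \<mu>, of uminus] by simp
qed

lemma grad_Cr: "u \<in> I \<Longrightarrow> r > r0 \<Longrightarrow> z \<in> \<Omega> \<Longrightarrow> grad Cr u r z = - pd Cu f u r z + P Cr u r z"
  using indep_pd_r[OF indep_f] by (simp add: grad_def P_def sum_coord sum_ang Gi_eq(1)[of u r z Cr Cu] algebra_simps)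

lemma pd_grad:
  assumes p: "u \<in> I" "r > r0" "z \<in> \<Omega>"
  shows "pd \<nu> (grad \<mu>) u r z = (\<Sum>\<rho>\<in>UNIV. Gi \<mu> \<rho> u r z * pd \<rho> (pd \<nu> f) u r z + pd \<nu> (Gi \<mu> \<rho>) u r z * pd \<rho> f u r z)"
proof -
  have "pd \<nu> (pd \<rho> f) u r z = pd \<rho> (pd \<nu> f) u r z" for \<rho>
    using p by (intro pd_commute[OF ux.open_S sm_f]) auto
  moreover have "pdiff (Gi \<mu> \<rho>) u r z" "pdiff (pd \<rho> f) u r z" for \<rho>
    using pdiff_reg[OF p sm_Gi] pdiff_ux[OF p ux.sm_PD[OF sm_f]] by auto
  ultimately show ?thesis
    unfolding grad_def[abs_def] by (simp add: pd_sum pd_mult pdiff_mult)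
qed

lemma holY:
  assumes "(u, r, z) \<in> I \<times> UNIV \<times> \<Omega>"
  shows "pd (Cx Zetabar) (\<lambda>u r z. Y Zeta z) u r z = 0" "pd (Cx Zeta) (\<lambda>u r z. Y Zetabar z) u r z = 0"
proof -
  have z: "z \<in> \<Omega>" using assms by simp
  have Yh: "Y Zeta holomorphic_on \<Omega>" using Y by (simp add: conformal_killing_def)
  have D: "(Y Zeta has_derivative (\<lambda>h. deriv (Y Zeta) z * h)) (at z)"
    using holomorphic_derivI[OF Yh open_\<Omega> z] by (simp add: has_field_derivative_def)
  then have a: "dang Zetabar (Y Zeta) z = 0" by (subst dang_eqI[OF D]) (simp add: algebra_simps)
  then show "pd (Cx Zetabar) (\<lambda>u r z. Y Zeta z) u r z = 0" by (simp add: pd_def)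
  have "dang Zeta (Y Zetabar) z = dang Zeta (\<lambda>w. cnj (Y Zeta w)) z"
    by (rule dang_cong[OF open_\<Omega> z]) (use Y in \<open>simp add: conformal_killing_def\<close>)
  also have "\<dots> = cnj (dang Zetabar (Y Zeta) z)"
    using dang_cnj[of "Y Zeta" z Zetabar] differentiableI[OF D] by simp
  finally show "pd (Cx Zeta) (\<lambda>u r z. Y Zetabar z) u r z = 0" using a by (simp add: pd_def)
qed

lemma pd_lap:
  assumes p: "u \<in> I" "z \<in> \<Omega>"
  shows "pd \<mu> lap u r z = 4 * exp (- 2 * \<Phi> u r z) * (pd (Cx Zeta) (pd (Cx Zetabar) (pd \<mu> f)) u r z - 2 * pd \<mu> \<Phi> u r z * pd (Cx Zeta) (pd (Cx Zetabar) f) u r z)"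
proof -
  have q: "(u, r, z) \<in> I \<times> UNIV \<times> \<Omega>" using p by simp
  have c: "pd \<mu> (pd (Cx Zeta) (pd (Cx Zetabar) f)) u r z = pd (Cx Zeta) (pd (Cx Zetabar) (pd \<mu> f)) u r z"
  proof -
    have "pd \<mu> (pd (Cx Zeta) (pd (Cx Zetabar) f)) u r z = pd (Cx Zeta) (pd \<mu> (pd (Cx Zetabar) f)) u r z"
      by (rule pd_commute[OF ux.open_S ux.sm_PD[OF sm_f] q])
    also have "\<dots> = pd (Cx Zeta) (pd (Cx Zetabar) (pd \<mu> f)) u r z"
      by (rule pd_cong[OF ux.open_S q]) (rule pd_commute[OF ux.open_S sm_f])
    finally show ?thesis .
  qed
  have l: "lap = (\<lambda>u r z. 2 * igam' u r z * pd (Cx Zeta) (pd (Cx Zetabar) f) u r z)"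
    by (simp add: lap_def igam'_def fun_eq_iff)
  have d: "pdiff igam' u r z" "pdiff (pd (Cx Zeta) (pd (Cx Zetabar) f)) u r z"
    using sm_pdiff[OF sm_gam'(2) q] sm_pdiff[OF ux.sm_PD[OF ux.sm_PD[OF sm_f]] q] by auto
  show ?thesis
    unfolding l pd_mult[OF pdiff_mult[OF pdiff_const d(1)] d(2)] pd_mult[OF pdiff_const d(1)] pd_const pd_gam'(2)[OF p] c
    unfolding igam'_def by (simp add: algebra_simps)
qed

end

section \<open>The modified bracket of two vector fields\<close>

text \<open>Read G as the inverse metric, dG as the derivatives of its row \<mu>, x and D as the
  fields and their first derivatives, d and S as first and second derivatives of the f's, and e12,
  e21 as gradients of the varied f's. The terms x dG d and those with D \<nu> \<mu> in the bracket
  cancel against the variations; all others carry the factor G \<mu> \<rho>.\<close>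

lemma bracket_index_identity:
  fixes G S1 S2 D1 D2 :: "coord \<Rightarrow> coord \<Rightarrow> complex" and dG :: "coord \<Rightarrow> coord \<Rightarrow> complex"
    and x1 x2 d1 d2 e12 e21 :: "coord \<Rightarrow> complex"
  shows "(\<Sum>\<nu>\<in>UNIV. (x1 \<nu> * (\<Sum>\<rho>\<in>UNIV. G \<mu> \<rho> * S2 \<rho> \<nu> + dG \<nu> \<rho> * d2 \<rho>) + (\<Sum>\<rho>\<in>UNIV. G \<nu> \<rho> * d1 \<rho>) * D2 \<nu> \<mu>)
        - (x2 \<nu> * (\<Sum>\<rho>\<in>UNIV. G \<mu> \<rho> * S1 \<rho> \<nu> + dG \<nu> \<rho> * d1 \<rho>) + (\<Sum>\<rho>\<in>UNIV. G \<nu> \<rho> * d2 \<rho>) * D1 \<nu> \<mu>))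
      - ((\<Sum>\<rho>\<in>UNIV. G \<mu> \<rho> * e12 \<rho>) + (\<Sum>\<rho>\<in>UNIV. (\<Sum>\<sigma>\<in>UNIV. x1 \<sigma> * dG \<sigma> \<rho> - G \<sigma> \<rho> * D1 \<sigma> \<mu> - G \<mu> \<sigma> * D1 \<sigma> \<rho>) * d2 \<rho>))
      + ((\<Sum>\<rho>\<in>UNIV. G \<mu> \<rho> * e21 \<rho>) + (\<Sum>\<rho>\<in>UNIV. (\<Sum>\<sigma>\<in>UNIV. x2 \<sigma> * dG \<sigma> \<rho> - G \<sigma> \<rho> * D2 \<sigma> \<mu> - G \<mu> \<sigma> * D2 \<sigma> \<rho>) * d1 \<rho>))
    = (\<Sum>\<rho>\<in>UNIV. G \<mu> \<rho> * ((\<Sum>\<nu>\<in>UNIV. x1 \<nu> * S2 \<rho> \<nu> + D1 \<rho> \<nu> * d2 \<nu> - (x2 \<nu> * S1 \<rho> \<nu> + D2 \<rho> \<nu> * d1 \<nu>)) - e12 \<rho> + e21 \<rho>))"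
  unfolding sum_coord by algebra

text \<open>The second copy exchanges the triples and supplies the variation of the first field
  along the second.\<close>

locale nu_pair = v12: nu_var I \<Omega> r0 \<phi> g W V C Y1 T1 \<omega>1 Y2 T2 \<omega>2
    + v21: nu_var I \<Omega> r0 \<phi> g W V C Y2 T2 \<omega>2 Y1 T1 \<omega>1
  for I \<Omega> r0 \<phi> g W V C Y1 T1 \<omega>1 Y2 T2 \<omega>2
begin

abbreviation "f1 \<equiv> v12.n1.f"
abbreviation "f2 \<equiv> v12.n2.f"
abbreviation "X1 \<equiv> v12.n1.X"
abbreviation "X2 \<equiv> v12.n2.X"
abbreviation "Gi \<equiv> v12.n1.Gi"
abbreviation "DF12 \<equiv> v12.DF"
abbreviation "DF21 \<equiv> v21.DF"

sublocale tp: two_params I UNIV \<Omega> v12.n1.\<Phi> Y1 T1 "lift2 \<omega>1" Y2 T2 "lift2 \<omega>2"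
  by unfold_locales (use v12.n1.holY v12.n2.holY in auto)

abbreviation "fh \<equiv> tp.fhat"

lemma fh_eq: "fh u r z = f1 u r z * pd Cu f2 u r z - f2 u r z * pd Cu f1 u r z
    + (\<Sum>A\<in>UNIV. Y1 A z * pd (Cx A) f2 u r z - Y2 A z * pd (Cx A) f1 u r z) - DF12 u r z + DF21 u r z"
  unfolding tp.fhat_def v12.n1.f_def v12.n2.f_def v12.DF_def v21.DF_def ..

lemma indep_fh: "v12.n1.indep fh"
  unfolding tp.fhat_def[abs_def] v12.n1.indep_def
  unfolding dvar_def dvarG_def fam_def famF_def famG_def psi_def int0_def pd_def by simp

text \<open>Both sides contract the gradients of f1 and f2 with the integral of the symmetric g^AB.
  Hence the r-dependent parts of X^A drop out of the u-component of the bracket, which is why that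
  component does not depend on r.\<close>

lemma tail_P_sym:
  assumes p: "u \<in> I" "r > r0" "z \<in> \<Omega>"
  shows "(\<Sum>A\<in>UNIV. tail (v12.n1.P (Cx A)) u r z * pd (Cx A) f2 u r z) = (\<Sum>A\<in>UNIV. tail (v12.n2.P (Cx A)) u r z * pd (Cx A) f1 u r z)"
proof -
  have s: "tail (Gi (Cx Zetabar) (Cx Zeta)) u r z = tail (Gi (Cx Zeta) (Cx Zetabar)) u r z"
    unfolding tail_eq by (rule set_lebesgue_integral_cong) (use p v12.n1.Gi_sym in auto)
  show ?thesis
    unfolding sum_ang v12.n1.tail_P[OF p, of "Cx _", simplified] v12.n2.tail_P[OF p, of "Cx _", simplified] s by algebra
qed

lemma fh_reg:
  assumes p: "u \<in> I" "r > r0" "z \<in> \<Omega>"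
  shows "fh u r z = (\<Sum>\<nu>\<in>UNIV. X1 \<nu> u r z * pd \<nu> f2 u r z - X2 \<nu> u r z * pd \<nu> f1 u r z) - DF12 u r z + DF21 u r z"
proof -
  have "pd Cr f1 u r z = 0" "pd Cr f2 u r z = 0" using v12.n1.indep_pd_r[OF v12.n1.indep_f] v12.n1.indep_pd_r[OF v12.n2.indep_f] by auto
  note c = this
  have x: "X1 (Cx A) u r z = Y1 A z - tail (v12.n1.P (Cx A)) u r z" "X2 (Cx A) u r z = Y2 A z - tail (v12.n2.P (Cx A)) u r z" for A
    by (simp_all add: v12.n1.X_def v12.n2.X_def)
  show ?thesis
    unfolding fh_eq sum_coord sum_ang v12.n1.tail_P_u[OF p] v12.n2.tail_P_u[OF p] x c
    using tail_P_sym[OF p, unfolded sum_ang] by algebra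
qed

lemma pd_fh:
  assumes p: "u \<in> I" "r > r0" "z \<in> \<Omega>"
  shows "pd \<rho> fh u r z = (\<Sum>\<nu>\<in>UNIV. X1 \<nu> u r z * pd \<rho> (pd \<nu> f2) u r z + pd \<rho> (X1 \<nu>) u r z * pd \<nu> f2 u r z
      - (X2 \<nu> u r z * pd \<rho> (pd \<nu> f1) u r z + pd \<rho> (X2 \<nu>) u r z * pd \<nu> f1 u r z)) - pd \<rho> DF12 u r z + pd \<rho> DF21 u r z"
proof -
  have d: "pdiff (X1 \<nu>) u r z" "pdiff (X2 \<nu>) u r z" "pdiff (pd \<nu> f1) u r z" "pdiff (pd \<nu> f2) u r z" "pdiff DF12 u r z" "pdiff DF21 u r z" for \<nu>
    using v12.n1.pdiff_X[OF p] v12.n2.pdiff_X[OF p] v12.n1.pdiff_ux[OF p v12.n1.ux.sm_PD[OF v12.n1.sm_f]]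
      v12.n1.pdiff_ux[OF p v12.n1.ux.sm_PD[OF v12.n2.sm_f]] v12.n1.pdiff_ux[OF p v12.sm_DF] v12.n1.pdiff_ux[OF p v21.sm_DF] by auto
  have "pd \<rho> fh u r z = pd \<rho> (\<lambda>u r z. (\<Sum>\<nu>\<in>UNIV. X1 \<nu> u r z * pd \<nu> f2 u r z - X2 \<nu> u r z * pd \<nu> f1 u r z) - DF12 u r z + DF21 u r z) u r z"
    by (rule pd_cong[OF v12.n1.open_reg]) (use p fh_reg in auto)
  then show ?thesis
    by (simp add: pd_add pd_diff pd_sum pd_mult pdiff_add pdiff_diff pdiff_sum pdiff_mult d)
qed

definition M :: "coord \<Rightarrow> scalar" where
  "M \<mu> u r z = (\<Sum>\<nu>\<in>UNIV. X1 \<nu> u r z * pd \<nu> (X2 \<mu>) u r z - X2 \<nu> u r z * pd \<nu> (X1 \<mu>) u r z) - v12.dX \<mu> u r z + v21.dX \<mu> u r z"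

lemma mod_bracket_M:
  assumes p: "u \<in> I" "r > r0" "z \<in> \<Omega>"
  shows "mod_bracket (xi (Y1, T1, \<omega>1)) (xi (Y2, T2, \<omega>2)) g \<mu> u r z = M \<mu> u r z"
  unfolding mod_bracket_def M_def v12.variation_xi[OF p] v21.variation_xi[OF p] lie_bracket_def
    v12.n1.xi_eq[OF p] v12.n2.xi_eq[OF p] v12.n1.pd_xi[OF p] v12.n2.pd_xi[OF p] ..

lemma M_u:
  assumes p: "u \<in> I" "r > r0" "z \<in> \<Omega>"
  shows "M Cu u r z = fh u r z"
  unfolding M_def fh_reg[OF p] v12.n1.pd_X_u[OF p] v12.n2.pd_X_u[OF p] by simp

lemma M_radial:
  assumes p: "u \<in> I" "r > r0" "z \<in> \<Omega>"
  shows "((\<lambda>r. M \<mu> u r z) has_vector_derivative (\<Sum>\<rho>\<in>UNIV. Gi \<mu> \<rho> u r z * pd \<rho> fh u r z)) (at r)"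
proof -
  have "((\<lambda>r. M \<mu> u r z) has_vector_derivative
     (\<Sum>\<nu>\<in>UNIV. (X1 \<nu> u r z * pd \<nu> (v12.n2.grad \<mu>) u r z + v12.n1.grad \<nu> u r z * pd \<nu> (X2 \<mu>) u r z)
        - (X2 \<nu> u r z * pd \<nu> (v12.n1.grad \<mu>) u r z + v12.n2.grad \<nu> u r z * pd \<nu> (X1 \<mu>) u r z))
      - ((\<Sum>\<rho>\<in>UNIV. Gi \<mu> \<rho> u r z * pd \<rho> DF12 u r z) + (\<Sum>\<rho>\<in>UNIV. v12.n1.lie_inv \<mu> \<rho> u r z * pd \<rho> f2 u r z))
      + ((\<Sum>\<rho>\<in>UNIV. Gi \<mu> \<rho> u r z * pd \<rho> DF21 u r z) + (\<Sum>\<rho>\<in>UNIV. v12.n2.lie_inv \<mu> \<rho> u r z * pd \<rho> f1 u r z))) (at r)"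
    unfolding M_def
    by (intro has_vector_derivative_add has_vector_derivative_diff has_vector_derivative_sum has_vector_derivative_mult
        v12.n1.X_radial v12.n2.X_radial v12.n1.pd_X_radial v12.n2.pd_X_radial v12.dX_radial v21.dX_radial p)
  then show ?thesis
    unfolding v12.n1.pd_grad[OF p] v12.n2.pd_grad[OF p] v12.n1.lie_inv_def v12.n2.lie_inv_def pd_fh[OF p]
      v12.n1.grad_def v12.n2.grad_def
    by (rule has_vector_derivative_eq_rhs)
       (rule bracket_index_identity[where G="\<lambda>\<mu> \<nu>. Gi \<mu> \<nu> u r z" and ?S1.0="\<lambda>\<rho> \<nu>. pd \<rho> (pd \<nu> f1) u r z" and ?S2.0="\<lambda>\<rho> \<nu>. pd \<rho> (pd \<nu> f2) u r z"
         and ?D1.0="\<lambda>\<nu> \<mu>. pd \<nu> (X1 \<mu>) u r z" and ?D2.0="\<lambda>\<nu> \<mu>. pd \<nu> (X2 \<mu>) u r z" and dG="\<lambda>\<nu> \<rho>. pd \<nu> (Gi \<mu> \<rho>) u r z"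
         and ?x1.0="\<lambda>\<nu>. X1 \<nu> u r z" and ?x2.0="\<lambda>\<nu>. X2 \<nu> u r z" and ?d1.0="\<lambda>\<nu>. pd \<nu> f1 u r z" and ?d2.0="\<lambda>\<nu>. pd \<nu> f2 u r z"
         and ?e12.0="\<lambda>\<rho>. pd \<rho> DF12 u r z" and ?e21.0="\<lambda>\<rho>. pd \<rho> DF21 u r z"])
qed


text \<open>The statement at order r^0 behind the comparison of r-components. Mixed products of
  gradients form the Q terms, holomorphy removes the cross derivatives of Y, and the leftover
  multiples of the Laplacians of f1 and f2 vanish by the evolution equations \<open>f1u\<close> and
  \<open>f2u\<close>.\<close>

lemma lap_fh:
  assumes p: "u \<in> I" "z \<in> \<Omega>"
  shows "4 * exp (- 2 * v12.n1.\<Phi> u r z) * pd (Cx Zeta) (pd (Cx Zetabar) fh) u r z =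
    f1 u r z * pd Cu v12.n2.lap u r z - v12.n1.lap u r z * pd Cu f2 u r z
    - (f2 u r z * pd Cu v12.n1.lap u r z - v12.n2.lap u r z * pd Cu f1 u r z)
    + (\<Sum>A\<in>UNIV. Y1 A z * pd (Cx A) v12.n2.lap u r z + 2 * v12.n1.Q A u r z * pd (Cx A) (pd Cu f2) u r z
         - (Y2 A z * pd (Cx A) v12.n1.lap u r z + 2 * v12.n2.Q A u r z * pd (Cx A) (pd Cu f1) u r z))
    - v12.dlap u r z + v21.dlap u r z"
proof -
  have q: "(u, r, z) \<in> I \<times> UNIV \<times> \<Omega>" using p by simp
  note o = v12.n1.ux.open_S
  let ?z = "Cx Zeta" and ?b = "Cx Zetabar"
  note ss = v12.n1.sm_f v12.n2.sm_f v12.sm_DF v21.sm_DF v12.n1.pm.sm_Y v12.n2.pm.sm_Y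
  have comm: "pd \<mu> (pd \<nu> F) v s w = pd \<nu> (pd \<mu> F) v s w" if "sm (I \<times> UNIV \<times> \<Omega>) F" "(v, s, w) \<in> I \<times> UNIV \<times> \<Omega>" for \<mu> \<nu> F v s w
    by (rule pd_commute[OF o that])
  have b: "pd ?b fh v s w = (f1 v s w * pd ?b (pd Cu f2) v s w + pd ?b f1 v s w * pd Cu f2 v s w)
      - (f2 v s w * pd ?b (pd Cu f1) v s w + pd ?b f2 v s w * pd Cu f1 v s w)
      + (Y1 Zeta w * pd ?b (pd ?z f2) v s w - Y2 Zeta w * pd ?b (pd ?z f1) v s w
        + (Y1 Zetabar w * pd ?b (pd ?b f2) v s w + pd ?b (\<lambda>u r z. Y1 Zetabar z) v s w * pd ?b f2 v s w
        - (Y2 Zetabar w * pd ?b (pd ?b f1) v s w + pd ?b (\<lambda>u r z. Y2 Zetabar z) v s w * pd ?b f1 v s w)))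
      - pd ?b DF12 v s w + pd ?b DF21 v s w" if v: "(v, s, w) \<in> I \<times> UNIV \<times> \<Omega>" for v s w
  proof -
    have e: "fh = (\<lambda>u r z. f1 u r z * pd Cu f2 u r z - f2 u r z * pd Cu f1 u r z
      + (Y1 Zeta z * pd ?z f2 u r z - Y2 Zeta z * pd ?z f1 u r z + (Y1 Zetabar z * pd ?b f2 u r z - Y2 Zetabar z * pd ?b f1 u r z)) - DF12 u r z + DF21 u r z)"
      by (intro ext) (simp only: fh_eq sum_ang)
    show ?thesis unfolding e
      by (simp add: v12.n1.pm.pd_rules[OF v] v12.n1.ux.sm_rules ss tp.hol[OF v])
  qed
  have zb: "pd ?z (pd ?b fh) u r z =
      (f1 u r z * pd ?z (pd ?b (pd Cu f2)) u r z + pd ?z f1 u r z * pd ?b (pd Cu f2) u r z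
        + (pd ?b f1 u r z * pd ?z (pd Cu f2) u r z + pd ?z (pd ?b f1) u r z * pd Cu f2 u r z))
      - (f2 u r z * pd ?z (pd ?b (pd Cu f1)) u r z + pd ?z f2 u r z * pd ?b (pd Cu f1) u r z
        + (pd ?b f2 u r z * pd ?z (pd Cu f1) u r z + pd ?z (pd ?b f2) u r z * pd Cu f1 u r z))
      + ((Y1 Zeta z * pd ?z (pd ?b (pd ?z f2)) u r z + pd ?z (\<lambda>u r z. Y1 Zeta z) u r z * pd ?b (pd ?z f2) u r z)
        - (Y2 Zeta z * pd ?z (pd ?b (pd ?z f1)) u r z + pd ?z (\<lambda>u r z. Y2 Zeta z) u r z * pd ?b (pd ?z f1) u r z)
        + ((Y1 Zetabar z * pd ?z (pd ?b (pd ?b f2)) u r z + pd ?b (\<lambda>u r z. Y1 Zetabar z) u r z * pd ?z (pd ?b f2) u r z)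
        - (Y2 Zetabar z * pd ?z (pd ?b (pd ?b f1)) u r z + pd ?b (\<lambda>u r z. Y2 Zetabar z) u r z * pd ?z (pd ?b f1) u r z)))
      - pd ?z (pd ?b DF12) u r z + pd ?z (pd ?b DF21) u r z"
  proof -
    have e0: "pd ?z (pd ?b fh) u r z = pd ?z (\<lambda>v s w. (f1 v s w * pd ?b (pd Cu f2) v s w + pd ?b f1 v s w * pd Cu f2 v s w)
      - (f2 v s w * pd ?b (pd Cu f1) v s w + pd ?b f2 v s w * pd Cu f1 v s w)
      + (Y1 Zeta w * pd ?b (pd ?z f2) v s w - Y2 Zeta w * pd ?b (pd ?z f1) v s w
        + (Y1 Zetabar w * pd ?b (pd ?b f2) v s w + pd ?b (\<lambda>u r z. Y1 Zetabar z) v s w * pd ?b f2 v s w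
        - (Y2 Zetabar w * pd ?b (pd ?b f1) v s w + pd ?b (\<lambda>u r z. Y2 Zetabar z) v s w * pd ?b f1 v s w)))
      - pd ?b DF12 v s w + pd ?b DF21 v s w) u r z"
      by (rule pd_cong[OF o q]) (rule b)
    show ?thesis
      unfolding e0
      by (simp add: v12.n1.pm.pd_rules[OF q] v12.n1.ux.sm_rules ss tp.hol[OF q] tp.hol3[OF q])
  qed
  have c1: "pd ?b (pd ?z f1) u r z = pd ?z (pd ?b f1) u r z" "pd ?b (pd ?z f2) u r z = pd ?z (pd ?b f2) u r z"
    using comm[OF ss(1) q] comm[OF ss(2) q] by auto
  note fu = v12.n1.pd_u_f[OF p, of r] v12.n2.pd_u_f[OF p, of r]
  have f1u: "2 * pd Cu f1 u r z = 2 * f1 u r z * pd Cu v12.n1.\<Phi> u r z + (pd ?z (\<lambda>u r z. Y1 Zeta z) u r z + 2 * Y1 Zeta z * pd ?z v12.n1.\<Phi> u r z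
     + (pd ?b (\<lambda>u r z. Y1 Zetabar z) u r z + 2 * Y1 Zetabar z * pd ?b v12.n1.\<Phi> u r z) - 2 * of_real (\<omega>1 u z))"
    unfolding fu psi_def sum_ang by (simp add: field_simps)
  have f2u: "2 * pd Cu f2 u r z = 2 * f2 u r z * pd Cu v12.n1.\<Phi> u r z + (pd ?z (\<lambda>u r z. Y2 Zeta z) u r z + 2 * Y2 Zeta z * pd ?z v12.n1.\<Phi> u r z
     + (pd ?b (\<lambda>u r z. Y2 Zetabar z) u r z + 2 * Y2 Zetabar z * pd ?b v12.n1.\<Phi> u r z) - 2 * of_real (\<omega>2 u z))"
    unfolding fu psi_def sum_ang by (simp add: field_simps)
  define E where "E = exp (- 2 * v12.n1.\<Phi> u r z)"
  show ?thesis
    unfolding zb c1 v12.n1.pd_lap[OF p] v12.n2.pd_lap[OF p] v12.dlap_def v21.dlap_def v12.n1.lap_def v12.n2.lap_def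
      v12.n1.Q_def v12.n2.Q_def v12.n1.igam'_def sum_ang conj_ang.simps E_def[symmetric]
    using f1u f2u by algebra
qed

end

lemma constant_of_radial_derivative_zero:
  fixes E :: "real \<Rightarrow> complex"
  assumes D: "\<And>r. r > a \<Longrightarrow> (E has_vector_derivative 0) (at r)" and L: "(E \<longlongrightarrow> 0) at_top" and r: "r > a"
  shows "E r = 0"
proof -
  have "\<exists>c. \<forall>x\<in>{a<..}. E x = c"
  proof (rule has_derivative_zero_constant)
    fix x assume "x \<in> {a<..}"
    then show "(E has_derivative (\<lambda>h. 0)) (at x within {a<..})"
      using D[of x] by (auto simp: has_vector_derivative_def intro: has_derivative_at_withinI)
  qed simp
  then obtain c where c: "\<And>x. x > a \<Longrightarrow> E x = c" by auto
  have "(E \<longlongrightarrow> c) at_top"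
  proof (rule Lim_transform_eventually[OF tendsto_const])
    show "\<forall>\<^sub>F x in at_top. c = E x" using eventually_gt_at_top[of a] by eventually_elim (simp add: c)
  qed
  then have "c = 0" using L tendsto_unique trivial_limit_at_top_linorder by blast
  then show ?thesis using c r by simp
qed

context nu_var
begin

lemma dtail_tendsto:
  assumes uz: "u \<in> I" "z \<in> \<Omega>" and \<mu>: "\<mu> \<noteq> Cu"
  shows "((\<lambda>r. dtail \<mu> u r z) \<longlongrightarrow> 0) at_top"
proof -
  have e: "pd (Cx B) DF u r z = pd (Cx B) DF u 0 z" "pd (Cx B) n2.f u r z = pd (Cx B) n2.f u 0 z" for r B
    using n1.indep_pd[OF indep_DF, of "Cx B"] n1.indep_pd[OF n2.indep_f, of "Cx B"] unfolding n1.indep_def by blast+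
  have "((\<lambda>r. \<Sum>B\<in>UNIV. pd (Cx B) DF u 0 z * tail (n1.Gi \<mu> (Cx B)) u r z + pd (Cx B) n2.f u 0 z * tail (n1.lie_inv \<mu> (Cx B)) u r z)
     \<longlongrightarrow> (\<Sum>B\<in>UNIV. pd (Cx B) DF u 0 z * 0 + pd (Cx B) n2.f u 0 z * 0)) at_top"
    by (intro tendsto_sum tendsto_add tendsto_mult tendsto_const n1.tail_Gi_tendsto n1.tail_lie_inv_tendsto uz \<mu>)
  moreover have "(\<lambda>r. \<Sum>B\<in>UNIV. pd (Cx B) DF u 0 z * tail (n1.Gi \<mu> (Cx B)) u r z + pd (Cx B) n2.f u 0 z * tail (n1.lie_inv \<mu> (Cx B)) u r z) = (\<lambda>r. dtail \<mu> u r z)"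
    unfolding dtail_def by (intro ext sum.cong refl) (metis e)
  ultimately show ?thesis by simp
qed

end

section \<open>Comparison with the vector field of the bracket triple\<close>

context nu_pair
begin

definition lapfh :: scalar where
  "lapfh u r z = 4 * exp (- 2 * v12.n1.\<Phi> u r z) * pd (Cx Zeta) (pd (Cx Zetabar) fh) u r z"

definition tfh :: "coord \<Rightarrow> scalar" where
  "tfh \<mu> u r z = (\<Sum>B\<in>UNIV. pd (Cx B) fh u r z * tail (Gi \<mu> (Cx B)) u r z)"

text \<open>The formulas for \<xi> with \<open>fh\<close> as its f, so that the radial equation and
  the limits can be worked out in terms of \<open>fh\<close> itself.\<close>

primrec xi_hat :: "coord \<Rightarrow> scalar" where
  "xi_hat Cu = fh"
| "xi_hat Cr = (\<lambda>u r z. - of_real r * pd Cu fh u r z + lapfh u r z / 2 - tfh Cr u r z)"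
| "xi_hat (Cx A) = (\<lambda>u r z. bracket_Y Y1 Y2 A z - tfh (Cx A) u r z)"

lemma fh_slot: "\<mu> \<noteq> Cr \<Longrightarrow> pd \<mu> fh u r z = pd \<mu> fh u s z"
  using v12.n1.indep_pd[OF indep_fh] unfolding v12.n1.indep_def by blast

lemma lapfh_slot: "lapfh u r z = lapfh u s z"
proof -
  have "v12.n1.indep (pd (Cx Zeta) (pd (Cx Zetabar) fh))" by (intro v12.n1.indep_pd indep_fh) auto
  then have e: "pd (Cx Zeta) (pd (Cx Zetabar) fh) u r z = pd (Cx Zeta) (pd (Cx Zetabar) fh) u s z" unfolding v12.n1.indep_def by blast
  show ?thesis unfolding lapfh_def e ..
qed

text \<open>By \<open>fhat_eq\<close> the f built from the bracket triple is \<open>fh\<close>; the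
  derivatives and the Laplacian then agree because the equality holds on the whole open (u, \<zeta>)
  region.\<close>

lemma xi_bracket:
  assumes p: "u \<in> I" "r > r0" "z \<in> \<Omega>"
  shows "xi (ebms_bracket (Y1, T1, \<omega>1) (Y2, T2, \<omega>2)) g \<mu> u r z = xi_hat \<mu> u r z"
proof -
  let ?T = "\<lambda>z. Re (bracket_T Y1 T1 Y2 T2 z)"
  let ?f = "f_of (conf_factor g) (bracket_Y Y1 Y2, ?T, \<lambda>u z. 0)"
  have T: "of_real (?T z) = bracket_T Y1 T1 Y2 T2 z" if "z \<in> \<Omega>" for z
    by (rule bracket_T_real[OF v12.n1.open_\<Omega> that v12.n1.Y v12.n2.Y v12.n1.T v12.n2.T])
  have fo: "?f v w = fh v s w" if "v \<in> I" "w \<in> \<Omega>" for v s w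
  proof -
    have "?f v w = fam v12.n1.\<Phi> (bracket_Y Y1 Y2) ?T (lift2 (\<lambda>u z. 0)) v s w"
      by (rule f_of_fam[OF v12.n1.I that(1) v12.n1.open_\<Omega> that(2)]) (use v12.n1.cf in auto)
    also have "\<dots> = fh v s w"
      using tp.fhat_eq[of v s w ?T] that T by simp
    finally show ?thesis .
  qed
  have d: "dang A (?f u) w = pd (Cx A) fh u r w" if "w \<in> \<Omega>" for A w
    unfolding pd_def using dang_cong[OF v12.n1.open_\<Omega> that, of "?f u" "fh u r" A] fo[OF p(1)] by simp
  have du: "vector_derivative (\<lambda>v. ?f v z) (at u) = pd Cu fh u r z"
    unfolding pd_def using vector_derivative_cong_open[OF v12.n1.open_I p(1), of "\<lambda>v. ?f v z" "\<lambda>v. fh v r z"] fo[OF _ p(3)] by simp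
  have l: "laplace_bar (conf_factor g) ?f u z = lapfh u r z"
  proof -
    have "dang Zeta (dang Zetabar (?f u)) z = dang Zeta (\<lambda>w. pd (Cx Zetabar) fh u r w) z"
      by (rule dang_cong[OF v12.n1.open_\<Omega> p(3)]) (rule d)
    then show ?thesis by (simp add: laplace_bar_def lapfh_def v12.n1.cf[OF p(1,3)] dang_Cx flip: exp_of_real)
  qed
  have i: "(LBINT s=r..\<infinity>. metric_inv g \<mu> (Cx B) u s z) = tail (Gi \<mu> (Cx B)) u r z" for \<mu> B
    by (simp add: tail_def v12.n1.Gi_def)
  show ?thesis
  proof (cases \<mu>)
    case Cu then show ?thesis using fo[OF p(1,3)] by (simp add: xi_def)
  next
    case Cr
    then show ?thesis
      using d[OF p(3)] du l by (simp add: xi_def tfh_def interval_lebesgue_integral_uminus i sum_negf)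
  next
    case (Cx A)
    then show ?thesis using d[OF p(3)] by (simp add: xi_def tfh_def i)
  qed
qed

lemma xi_hat_radial:
  assumes p: "u \<in> I" "r > r0" "z \<in> \<Omega>" and \<mu>: "\<mu> \<noteq> Cu"
  shows "((\<lambda>r. xi_hat \<mu> u r z) has_vector_derivative (\<Sum>\<rho>\<in>UNIV. Gi \<mu> \<rho> u r z * pd \<rho> fh u r z)) (at r)"
proof -
  have t: "((\<lambda>s. tfh \<mu> u s z) has_vector_derivative - (\<Sum>B\<in>UNIV. pd (Cx B) fh u r z * Gi \<mu> (Cx B) u r z)) (at r)"
  proof -
    have "((\<lambda>s. \<Sum>B\<in>UNIV. pd (Cx B) fh u r z * tail (Gi \<mu> (Cx B)) u s z) has_vector_derivative
       (\<Sum>B\<in>UNIV. pd (Cx B) fh u r z * (- Gi \<mu> (Cx B) u r z) + 0 * tail (Gi \<mu> (Cx B)) u r z)) (at r)"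
      by (intro has_vector_derivative_sum has_vector_derivative_mult has_vector_derivative_const v12.tail_Gi_radial p \<mu>)
    moreover have "(\<lambda>s. \<Sum>B\<in>UNIV. pd (Cx B) fh u r z * tail (Gi \<mu> (Cx B)) u s z) = (\<lambda>s. tfh \<mu> u s z)"
      unfolding tfh_def by (intro ext sum.cong refl) (metis fh_slot coord.distinct(6))
    ultimately show ?thesis by (simp add: sum_ang)
  qed
  have fr: "pd Cr fh u r z = 0" by (rule v12.n1.indep_pd_r[OF indep_fh])
  show ?thesis
  proof (cases \<mu>)
    case Cr
    have id: "((\<lambda>s. complex_of_real s) has_vector_derivative of_real 1) (at r)"
      by (intro has_vector_derivative_of_real) (rule DERIV_ident)
    have "((\<lambda>s. - of_real s * pd Cu fh u r z + lapfh u r z / 2 - tfh \<mu> u s z) has_vector_derivative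
       (- of_real r * 0 + (- of_real 1) * pd Cu fh u r z) + 0 - - (\<Sum>B\<in>UNIV. pd (Cx B) fh u r z * Gi \<mu> (Cx B) u r z)) (at r)"
      by (intro has_vector_derivative_diff has_vector_derivative_add has_vector_derivative_mult has_vector_derivative_minus
          has_vector_derivative_const t id)
    moreover have "(\<lambda>s. - of_real s * pd Cu fh u r z + lapfh u r z / 2 - tfh \<mu> u s z) = (\<lambda>s. xi_hat \<mu> u s z)"
      unfolding Cr xi_hat.simps by (intro ext) (metis fh_slot lapfh_slot coord.distinct(1))
    ultimately show ?thesis using Cr
      by (simp add: sum_coord sum_ang v12.n1.Gi_eq(1)[OF p, of Cr Cu] fr algebra_simps)
  next
    case (Cx A)
    have "((\<lambda>s. bracket_Y Y1 Y2 A z - tfh \<mu> u s z) has_vector_derivative 0 - - (\<Sum>B\<in>UNIV. pd (Cx B) fh u r z * Gi \<mu> (Cx B) u r z)) (at r)"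
      by (intro has_vector_derivative_diff has_vector_derivative_const t)
    then show ?thesis using Cx
      by (simp add: sum_coord sum_ang v12.n1.Gi_eq(1)[OF p, of "Cx A" Cu] fr algebra_simps)
  qed (use \<mu> in simp)
qed

lemma tfh_tendsto:
  assumes uz: "u \<in> I" "z \<in> \<Omega>" and \<mu>: "\<mu> \<noteq> Cu"
  shows "((\<lambda>r. tfh \<mu> u r z) \<longlongrightarrow> 0) at_top"
proof -
  have "((\<lambda>r. \<Sum>B\<in>UNIV. pd (Cx B) fh u 0 z * tail (Gi \<mu> (Cx B)) u r z) \<longlongrightarrow> (\<Sum>B\<in>UNIV. pd (Cx B) fh u 0 z * 0)) at_top"
    by (intro tendsto_sum tendsto_mult tendsto_const v12.n1.tail_Gi_tendsto uz \<mu>)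
  moreover have "(\<lambda>r. \<Sum>B\<in>UNIV. pd (Cx B) fh u 0 z * tail (Gi \<mu> (Cx B)) u r z) = (\<lambda>r. tfh \<mu> u r z)"
    unfolding tfh_def by (intro ext sum.cong refl) (metis fh_slot coord.distinct(6))
  ultimately show ?thesis by simp
qed

text \<open>Leading orders suffice here: X^A and its angular derivatives tend to those of Y^A,
  \<partial>_u X^A tends to 0, X^r \<partial>_r X^A decays like 1/r, and all tails vanish. What is
  left is the bracket of Y1 and Y2.\<close>

lemma angular_limit:
  assumes uz: "u \<in> I" "z \<in> \<Omega>"
  shows "((\<lambda>r. M (Cx A) u r z - xi_hat (Cx A) u r z) \<longlongrightarrow> 0) at_top"
proof -
  let ?A = "Cx A"
  have f0: "f1 u r z = f1 u 0 z" "f2 u r z = f2 u 0 z" for r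
    using v12.n1.indep_f v12.n2.indep_f unfolding v12.n1.indep_def by blast+
  have L: "((\<lambda>r. (f1 u 0 z * pd Cu (X2 ?A) u r z - f2 u 0 z * pd Cu (X1 ?A) u r z)
      + (X1 Cr u r z * pd Cr (X2 ?A) u r z - X2 Cr u r z * pd Cr (X1 ?A) u r z)
      + (\<Sum>B\<in>UNIV. X1 (Cx B) u r z * pd (Cx B) (X2 ?A) u r z - X2 (Cx B) u r z * pd (Cx B) (X1 ?A) u r z)
      + v12.dtail ?A u r z - v21.dtail ?A u r z - bracket_Y Y1 Y2 A z + tfh ?A u r z) \<longlongrightarrow>
      (f1 u 0 z * 0 - f2 u 0 z * 0) + (0 - 0)
      + (\<Sum>B\<in>UNIV. Y1 B z * pd (Cx B) (\<lambda>u r z. Y2 A z) u 0 z - Y2 B z * pd (Cx B) (\<lambda>u r z. Y1 A z) u 0 z)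
      + 0 - 0 - bracket_Y Y1 Y2 A z + 0) at_top"
    by (intro tendsto_add tendsto_diff tendsto_sum tendsto_mult tendsto_const v12.n1.pd_u_X_tendsto v12.n2.pd_u_X_tendsto
        v12.n1.X_tendsto v12.n2.X_tendsto v12.n1.pd_X_tendsto v12.n2.pd_X_tendsto
        v12.n1.Xr_pd_r_tendsto[where X'=X2] v12.n2.Xr_pd_r_tendsto[where X'=X1]
        v12.n1.Ord_Xr v12.n2.Ord_Xr v12.dtail_tendsto v21.dtail_tendsto tfh_tendsto uz) auto
  have "(\<Sum>B\<in>UNIV. Y1 B z * pd (Cx B) (\<lambda>u r z. Y2 A z) u 0 z - Y2 B z * pd (Cx B) (\<lambda>u r z. Y1 A z) u 0 z) = bracket_Y Y1 Y2 A z"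
    by (simp add: bracket_Y_def pd_def)
  with L have "((\<lambda>r. (f1 u 0 z * pd Cu (X2 ?A) u r z - f2 u 0 z * pd Cu (X1 ?A) u r z)
      + (X1 Cr u r z * pd Cr (X2 ?A) u r z - X2 Cr u r z * pd Cr (X1 ?A) u r z)
      + (\<Sum>B\<in>UNIV. X1 (Cx B) u r z * pd (Cx B) (X2 ?A) u r z - X2 (Cx B) u r z * pd (Cx B) (X1 ?A) u r z)
      + v12.dtail ?A u r z - v21.dtail ?A u r z - bracket_Y Y1 Y2 A z + tfh ?A u r z) \<longlongrightarrow> 0) at_top" by simp
  then show ?thesis
  proof (rule Lim_transform_eventually)
    show "\<forall>\<^sub>F r in at_top. (f1 u 0 z * pd Cu (X2 ?A) u r z - f2 u 0 z * pd Cu (X1 ?A) u r z)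
      + (X1 Cr u r z * pd Cr (X2 ?A) u r z - X2 Cr u r z * pd Cr (X1 ?A) u r z)
      + (\<Sum>B\<in>UNIV. X1 (Cx B) u r z * pd (Cx B) (X2 ?A) u r z - X2 (Cx B) u r z * pd (Cx B) (X1 ?A) u r z)
      + v12.dtail ?A u r z - v21.dtail ?A u r z - bracket_Y Y1 Y2 A z + tfh ?A u r z = M ?A u r z - xi_hat ?A u r z"
      using v12.n1.eventually_reg[OF uz]
    proof eventually_elim
      case (elim r)
      have p: "u \<in> I" "r > r0" "z \<in> \<Omega>" using uz elim v12.n1.R1_r0 by auto
      have x: "X1 Cu u r z = f1 u 0 z" "X2 Cu u r z = f2 u 0 z"
        using v12.n1.tail_P_u[OF p] v12.n2.tail_P_u[OF p] f0[of r] by simp_all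
      show ?case unfolding M_def v12.dX.simps v21.dX.simps xi_hat.simps sum_coord sum_ang x by algebra
    qed
  qed
qed

lemma pd_u_fh:
  assumes p: "u \<in> I" "z \<in> \<Omega>"
  shows "pd Cu fh u r z = f1 u r z * pd Cu (pd Cu f2) u r z - f2 u r z * pd Cu (pd Cu f1) u r z
    + (\<Sum>A\<in>UNIV. Y1 A z * pd (Cx A) (pd Cu f2) u r z - Y2 A z * pd (Cx A) (pd Cu f1) u r z)
    - pd Cu DF12 u r z + pd Cu DF21 u r z"
proof -
  have q: "(u, r, z) \<in> I \<times> UNIV \<times> \<Omega>" using p by simp
  note ss = v12.n1.sm_f v12.n2.sm_f v12.sm_DF v21.sm_DF v12.n1.pm.sm_Y v12.n2.pm.sm_Y
  have c: "pd Cu (pd (Cx A) f1) u r z = pd (Cx A) (pd Cu f1) u r z" "pd Cu (pd (Cx A) f2) u r z = pd (Cx A) (pd Cu f2) u r z" for A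
    using pd_commute[OF v12.n1.ux.open_S ss(1) q] pd_commute[OF v12.n1.ux.open_S ss(2) q] by auto
  have e: "fh = (\<lambda>u r z. f1 u r z * pd Cu f2 u r z - f2 u r z * pd Cu f1 u r z
    + (\<Sum>A\<in>UNIV. Y1 A z * pd (Cx A) f2 u r z - Y2 A z * pd (Cx A) f1 u r z) - DF12 u r z + DF21 u r z)"
    by (intro ext) (rule fh_eq)
  show ?thesis unfolding e
    by (simp add: v12.n1.pm.pd_rules[OF q] v12.n1.ux.sm_rules ss c v12.n1.pm.pd_u_Y[OF q] v12.n2.pm.pd_u_Y[OF q])
qed

text \<open>The parts linear in r cancel exactly, by \<open>pd_u_fh\<close>. Since \<partial>_A X^r
  grows like r, the 1/r correction of X^A contributes a finite Q term; the resulting constant is the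
  identity \<open>lap_fh\<close>.\<close>

lemma radial_limit:
  assumes uz: "u \<in> I" "z \<in> \<Omega>"
  shows "((\<lambda>r. M Cr u r z - xi_hat Cr u r z) \<longlongrightarrow> 0) at_top"
proof -
  let ?\<eta>1 = "v12.n1.eta u z" and ?\<eta>2 = "v12.n2.eta u z"
  let ?R1 = "\<lambda>r. v12.n1.Rr u r z" and ?R2 = "\<lambda>r. v12.n2.Rr u r z"
  let ?dR1 = "\<lambda>\<mu> r. pd \<mu> v12.n1.Rr u r z" and ?dR2 = "\<lambda>\<mu> r. pd \<mu> v12.n2.Rr u r z"
  let ?P1 = "\<lambda>r. v12.n1.P Cr u r z" and ?P2 = "\<lambda>r. v12.n2.P Cr u r z"
  let ?l1 = "v12.n1.lap" and ?l2 = "v12.n2.lap"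
  let ?f1u = "pd Cu f1 u 0 z" and ?f2u = "pd Cu f2 u 0 z"
  let ?f1A = "\<lambda>A. pd (Cx A) (pd Cu f1) u 0 z" and ?f2A = "\<lambda>A. pd (Cx A) (pd Cu f2) u 0 z"
  let ?Q1 = "\<lambda>A. v12.n1.Q A u 0 z" and ?Q2 = "\<lambda>A. v12.n2.Q A u 0 z"
  let ?i = "\<lambda>r. inverse (complex_of_real r)"
  \<comment> \<open>The difference regrouped, for r > 0, so that no factor r is left except in r P,
    which tends to 0; every summand now has a limit of its own.\<close>
  let ?F = "\<lambda>r. (f1 u 0 z * ?dR2 Cu r - ?f1u * (of_real r * ?P2 r) - ?R1 r * ?f2u + ?R1 r * ?P2 r)
     - (f2 u 0 z * ?dR1 Cu r - ?f2u * (of_real r * ?P1 r) - ?R2 r * ?f1u + ?R2 r * ?P1 r)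
     + (\<Sum>A\<in>UNIV. (Y1 A z * ?dR2 (Cx A) r + (?Q1 A + ?\<eta>1 A r) * ?f2A A - (?Q1 A + ?\<eta>1 A r) * ?i r * ?dR2 (Cx A) r)
         - (Y2 A z * ?dR1 (Cx A) r + (?Q2 A + ?\<eta>2 A r) * ?f1A A - (?Q2 A + ?\<eta>2 A r) * ?i r * ?dR1 (Cx A) r))
     - (v12.dlap u 0 z / 2 - v12.dtail Cr u r z) + (v21.dlap u 0 z / 2 - v21.dtail Cr u r z)
     - (lapfh u 0 z / 2 - tfh Cr u r z)"
  let ?L = "(f1 u 0 z * (pd Cu ?l2 u 0 z / 2) - ?f1u * 0 - (?l1 u 0 z / 2) * ?f2u + (?l1 u 0 z / 2) * 0)
     - (f2 u 0 z * (pd Cu ?l1 u 0 z / 2) - ?f2u * 0 - (?l2 u 0 z / 2) * ?f1u + (?l2 u 0 z / 2) * 0)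
     + (\<Sum>A\<in>UNIV. (Y1 A z * (pd (Cx A) ?l2 u 0 z / 2) + (?Q1 A + 0) * ?f2A A - (?Q1 A + 0) * 0 * (pd (Cx A) ?l2 u 0 z / 2))
         - (Y2 A z * (pd (Cx A) ?l1 u 0 z / 2) + (?Q2 A + 0) * ?f1A A - (?Q2 A + 0) * 0 * (pd (Cx A) ?l1 u 0 z / 2)))
     - (v12.dlap u 0 z / 2 - 0) + (v21.dlap u 0 z / 2 - 0)
     - (lapfh u 0 z / 2 - 0)"
  have ev: "?F r = M Cr u r z - xi_hat Cr u r z" if elim: "r > v12.n1.R1" for r
  proof -
    have p: "u \<in> I" "r > r0" "z \<in> \<Omega>" using uz v12.n1.R1_r0[OF elim] by simp_all
    have r0: "r > 0" using elim by (simp add: v12.n1.R1_def)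
    have s: "f1 u r z = f1 u 0 z" "f2 u r z = f2 u 0 z" "v12.dlap u r z = v12.dlap u 0 z" "v21.dlap u r z = v21.dlap u 0 z"
    proof -
      show "f1 u r z = f1 u 0 z" "f2 u r z = f2 u 0 z"
        using v12.n1.indep_f v12.n2.indep_f unfolding v12.n1.indep_def by blast+
      have "v12.n1.indep (pd (Cx Zeta) (pd (Cx Zetabar) DF12))" "v12.n1.indep (pd (Cx Zeta) (pd (Cx Zetabar) DF21))"
        by (intro v12.n1.indep_pd v12.indep_DF v21.indep_DF; simp)+
      then have d: "pd (Cx Zeta) (pd (Cx Zetabar) DF12) u r z = pd (Cx Zeta) (pd (Cx Zetabar) DF12) u 0 z"
         "pd (Cx Zeta) (pd (Cx Zetabar) DF21) u r z = pd (Cx Zeta) (pd (Cx Zetabar) DF21) u 0 z"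
        unfolding v12.n1.indep_def by blast+
      have l: "?l1 u r z = ?l1 u 0 z" "?l2 u r z = ?l2 u 0 z"
        using v12.n1.indep_lap v12.n2.indep_lap unfolding v12.n1.indep_def by blast+
      show "v12.dlap u r z = v12.dlap u 0 z" "v21.dlap u r z = v21.dlap u 0 z"
        unfolding v12.dlap_def v21.dlap_def d l by simp_all
    qed
    have sl: "F u r z = F u 0 z" if "v12.n1.indep F" for F using that unfolding v12.n1.indep_def by blast
    have i1: "v12.n1.indep (pd Cu f1)" "v12.n1.indep (pd Cu f2)" "v12.n1.indep (pd Cu DF12)" "v12.n1.indep (pd Cu DF21)"
      by (intro v12.n1.indep_pd v12.n1.indep_f v12.n2.indep_f v12.indep_DF v21.indep_DF; simp)+
    have i2: "v12.n1.indep (pd \<mu> (pd Cu f1))" "v12.n1.indep (pd \<mu> (pd Cu f2))" if "\<mu> \<noteq> Cr" for \<mu>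
      by (intro v12.n1.indep_pd i1 that)+
    note sl' = sl[OF i1(1)] sl[OF i1(2)] sl[OF i1(3)] sl[OF i1(4)] sl[OF i2(1)[of Cu]] sl[OF i2(2)[of Cu]]
       sl[OF i2(1)[of "Cx _"]] sl[OF i2(2)[of "Cx _"]]
    have x: "X1 Cu u r z = f1 u 0 z" "X2 Cu u r z = f2 u 0 z"
      using v12.n1.tail_P_u[OF p] v12.n2.tail_P_u[OF p] s by simp_all
    have dx: "pd Cr (X1 Cr) u r z = - ?f1u + ?P1 r" "pd Cr (X2 Cr) u r z = - ?f2u + ?P2 r"
      unfolding v12.n1.pd_r_X[OF p] v12.n2.pd_r_X[OF p] v12.n1.grad_Cr[OF p] v12.n2.grad_Cr[OF p] using sl' by simp_all
    have dxu: "pd Cu (X1 Cr) u r z = - of_real r * pd Cu (pd Cu f1) u 0 z + ?dR1 Cu r"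
      "pd Cu (X2 Cr) u r z = - of_real r * pd Cu (pd Cu f2) u 0 z + ?dR2 Cu r"
      using v12.n1.pd_Xr[OF uz(1) elim uz(2), of Cu] v12.n2.pd_Xr[OF uz(1) elim uz(2), of Cu] sl' by simp_all
    have dxA: "pd (Cx A) (X1 Cr) u r z = - of_real r * ?f1A A + ?dR1 (Cx A) r"
      "pd (Cx A) (X2 Cr) u r z = - of_real r * ?f2A A + ?dR2 (Cx A) r" for A
      using v12.n1.pd_Xr[OF uz(1) elim uz(2), of "Cx A"] v12.n2.pd_Xr[OF uz(1) elim uz(2), of "Cx A"] sl' by simp_all
    have xr: "X1 Cr u r z = - of_real r * ?f1u + ?R1 r" "X2 Cr u r z = - of_real r * ?f2u + ?R2 r"
      unfolding v12.n1.Xr v12.n2.Xr using sl' by simp_all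
    have fhu: "pd Cu fh u r z = f1 u 0 z * pd Cu (pd Cu f2) u 0 z - f2 u 0 z * pd Cu (pd Cu f1) u 0 z
      + (Y1 Zeta z * ?f2A Zeta - Y2 Zeta z * ?f1A Zeta + (Y1 Zetabar z * ?f2A Zetabar - Y2 Zetabar z * ?f1A Zetabar))
      - pd Cu DF12 u 0 z + pd Cu DF21 u 0 z"
      unfolding pd_u_fh[OF uz] sum_ang using sl' s by simp
    have du: "pd Cu DF12 u r z = pd Cu DF12 u 0 z" "pd Cu DF21 u r z = pd Cu DF21 u 0 z" using sl' by simp_all
    have lf: "lapfh u r z = lapfh u 0 z" by (rule lapfh_slot)
    have ri: "complex_of_real r * (?i r * x) = x" for x using r0 by simp
    show ?thesis
      unfolding M_def v12.dX.simps v21.dX.simps xi_hat.simps sum_coord sum_ang x dx dxu dxA xr fhu s du lf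
        v12.n1.X_eta[OF uz r0] v12.n2.X_eta[OF uz r0]
      by (simp add: algebra_simps ri)
  qed
  have i0: "(?i \<longlongrightarrow> 0) at_top"
    using tendsto_of_real[OF tendsto_inverse_0_at_top[OF filterlim_ident], where 'a=complex] by simp
  have "(?F \<longlongrightarrow> ?L) at_top"
    by (intro tendsto_add tendsto_diff tendsto_sum tendsto_mult tendsto_const i0
        v12.n1.pd_Rr_tendsto v12.n2.pd_Rr_tendsto v12.n1.Rr_tendsto v12.n2.Rr_tendsto
        v12.n1.rP_tendsto v12.n2.rP_tendsto v12.n1.P_tendsto v12.n2.P_tendsto
        v12.n1.eta_tendsto v12.n2.eta_tendsto v12.dtail_tendsto v21.dtail_tendsto tfh_tendsto uz) auto
  \<comment> \<open>Half of the identity \<open>lap_fh\<close>.\<close>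
  moreover have "?L = 0"
  proof -
    have e: "x * (y / 2) = (x * y) / 2" "(x / 2) * y = (x * y) / 2" for x y :: complex by simp_all
    show ?thesis
      unfolding lapfh_def lap_fh[OF uz] sum_ang e
      by (simp add: add_divide_distrib diff_divide_distrib algebra_simps)
  qed
  ultimately have "(?F \<longlongrightarrow> 0) at_top" by (simp only:)
  then show ?thesis
    by (rule Lim_transform_eventually) (rule eventually_mono[OF v12.n1.eventually_reg[OF uz] ev])
qed

lemma M_eq_xi_hat:
  assumes p: "u \<in> I" "r > r0" "z \<in> \<Omega>"
  shows "M \<mu> u r z = xi_hat \<mu> u r z"
proof (cases "\<mu> = Cu")
  case True
  then show ?thesis using M_u[OF p] by simp
next
  case False
  have "M \<mu> u r z - xi_hat \<mu> u r z = 0"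
  proof (rule constant_of_radial_derivative_zero[of r0 "\<lambda>r. M \<mu> u r z - xi_hat \<mu> u r z", OF _ _ p(2)])
    show "((\<lambda>r. M \<mu> u r z - xi_hat \<mu> u r z) has_vector_derivative 0) (at s)" if "s > r0" for s
      using has_vector_derivative_diff[OF M_radial[OF p(1) that p(3), of \<mu>] xi_hat_radial[OF p(1) that p(3) False]] by simp
    show "((\<lambda>r. M \<mu> u r z - xi_hat \<mu> u r z) \<longlongrightarrow> 0) at_top"
      using False angular_limit[OF p(1,3)] radial_limit[OF p(1,3)] by (cases \<mu>) auto
  qed
  then show ?thesis by simp
qed

end

theorem theorem3p1:
  fixes I :: "real set" and r0 :: real and \<Omega> :: "complex set"
    and \<phi> :: "real \<Rightarrow> complex \<Rightarrow> real" and g :: metric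
    and Y1 Y2 :: "ang \<Rightarrow> complex \<Rightarrow> complex" and T1 T2 :: "complex \<Rightarrow> real"
    and \<omega>1 \<omega>2 :: "real \<Rightarrow> complex \<Rightarrow> real"
  assumes "open I" and "is_interval I" and "0 \<in> I" and "open \<Omega>"
    and "newman_unti I r0 \<Omega> \<phi> g"
    and "conformal_killing \<Omega> Y1" and "conformal_killing \<Omega> Y2"
    and "smooth_on \<Omega> T1" and "smooth_on \<Omega> T2"
    and "smooth_on (I \<times> \<Omega>) (\<lambda>(u, z). \<omega>1 u z)" and "smooth_on (I \<times> \<Omega>) (\<lambda>(u, z). \<omega>2 u z)"
  shows "\<forall>u\<in>I. \<forall>r>r0. \<forall>z\<in>\<Omega>. \<forall>\<mu>.
    mod_bracket (xi (Y1, T1, \<omega>1)) (xi (Y2, T2, \<omega>2)) g \<mu> u r z =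
    xi (ebms_bracket (Y1, T1, \<omega>1) (Y2, T2, \<omega>2)) g \<mu> u r z"
proof -
  have cf: "conf_factor g u z = \<phi> u z" if "u \<in> I" "z \<in> \<Omega>" for u z
    by (rule newman_unti_conf_factor[OF assms(5) that])
  show ?thesis
    using assms(5)[unfolded newman_unti_def]
  proof (elim exE conjE, goal_cases)
    case (1 W V C)
    have m: "nu_metric I \<Omega> r0 \<phi> g W V C"
      by unfold_locales (use assms(1-4) 1 in \<open>blast+\<close>)
    have "nu_xi I \<Omega> r0 \<phi> g W V C Y1 T1 \<omega>1" "nu_xi I \<Omega> r0 \<phi> g W V C Y2 T2 \<omega>2"
      using m cf assms(6-11) by (simp_all add: nu_xi_def nu_xi_axioms_def)
    then interpret nu_pair I \<Omega> r0 \<phi> g W V C Y1 T1 \<omega>1 Y2 T2 \<omega>2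
      by (simp add: nu_pair_def nu_var_def)
    show ?case
      using mod_bracket_M M_eq_xi_hat xi_bracket by simp
  qed
qed

end
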